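(* Let $T^\ast\in(0,+\infty]$, $D\subset\mathbb{R}^d$ be an open set, $u_M:D\to\mathbb{R}$ a Lebesgue measurable function, and $F\in L^2(D;\mathbb{R}^d)$. Let $(u_1,\mu_1)$ and $(u_2,\mu_2)$ be respectively a Dirichlet enthalpy subsolution and a Dirichlet enthalpy supersolution in $D_{T^\ast}$ with melting temperature $u_M$ and heat source $F$. Assume that $$(u_2-u_1)^-\in H^1_{0,P}(D_{T^\ast})\quad\text{and}\quad\mu_1(x,0)\le\mu_2(x,0)\ \text{ for almost every }x\in D.$$ Then, for all $T\in(0,T^\ast)$, $$u_1(x,T)\le u_2(x,T)\quad\text{and}\quad\mu_1(x,T)\le\mu_2(x,T)\quad\text{for almost every }x\in D.$$
   Context: For $D\subset\mathbb{R}^d$ open and $t\in(0,+\infty]$, $D_t:=D\times[0,t)$; $\nabla$ is the gradient in $x$ only. $w^-:=\min\{w,0\}$ is the (nonpositive) negative part. $H^1_{0,P}(D_t)$ is the closure in $H^1(D_t)$ of (the restrictions to $D_t$ of) $C^\infty_c(D\times(0,+\infty))$, i.e. functions vanishing on the parabolic boundary $(D\times\{0\})\cup(\partial D\times(0,t))$. A Dirichlet enthalpy subsolution (resp. supersolution) in $D_{T^\ast}$ with melting temperature $u_M$ and heat source $F$ is a pair of measurable functions $(u,\mu)$ on $D_{T^\ast}$ such that: (i) $u\in L^2_{loc}([0,T^\ast);H^1(D))$ and $\partial_tu\in L^2_{loc}([0,T^\ast);L^2(D))$ (so $u(\cdot,t)$ is understood as the representative continuous in $t$ with values in $L^2(D)$);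 (ii) $\mu:[0,T^\ast)\to L^\infty(D)$ is continuous for the weak-$\ast$ topology of $L^\infty(D)=(L^1(D))^*$; (iii) for all $t\in[0,T^\ast)$ and a.e. $x\in D$: $|\mu(x,t)|\le1$, $\mu(x,t)=1$ if $u(x,t)>u_M(x)$, and $\mu(x,t)=-1$ if $u(x,t)<u_M(x)$; (iv) for all $0\le t_1\le t_2<T^\ast$ and all nonnegative $\eta\in C^\infty_c(D\times\mathbb{R})$, $$\int_D(u+\mu)\eta\,dx\Big|_{t=t_1}^{t_2}\le\int_{t_1}^{t_2}\int_D\big[(u+\mu)\partial_t\eta-\nabla u\cdot\nabla\eta-F\cdot\nabla\eta\big]\,dx\,dt\qquad(\text{resp. }\ge).$$ *)

theory Defs
  imports "HOL-Analysis.Analysis"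
begin

section \<open>Test functions\<close>

primrec C_k :: "nat \<Rightarrow> ('a::euclidean_space \<Rightarrow> real) \<Rightarrow> bool" where
  "C_k 0 f \<longleftrightarrow> continuous_on UNIV f"
| "C_k (Suc k) f \<longleftrightarrow> (\<forall>x. f differentiable (at x)) \<and>
     (\<forall>b\<in>Basis. C_k k (\<lambda>x. frechet_derivative f (at x) b))"

definition test_functions :: "'a::euclidean_space set \<Rightarrow> ('a \<Rightarrow> real) set" where
  "test_functions U = {\<phi>. (\<forall>k. C_k k \<phi>) \<and> compact (closure {x. \<phi> x \<noteq> 0}) \<and> closure {x. \<phi> x \<noteq> 0} \<subseteq> U}"

definition grad :: "('a::euclidean_space \<Rightarrow> real) \<Rightarrow> 'a \<Rightarrow> 'a" where
  "grad f x = (\<Sum>b\<in>Basis. frechet_derivative f (at x) b *\<^sub>R b)"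

section \<open>Lebesgue and Sobolev spaces\<close>

text \<open>Elements of the function spaces are represented by functions; values outside \<open>\<Omega>\<close>
  are irrelevant.\<close>

definition L2 :: "'a::euclidean_space set \<Rightarrow> ('a \<Rightarrow> 'b::euclidean_space) set" where
  "L2 \<Omega> = {f \<in> borel_measurable (lebesgue_on \<Omega>). integrable (lebesgue_on \<Omega>) (\<lambda>x. (norm (f x))\<^sup>2)}"

definition Linf :: "'a::euclidean_space set \<Rightarrow> ('a \<Rightarrow> real) set" where
  "Linf \<Omega> = {f \<in> borel_measurable (lebesgue_on \<Omega>). \<exists>C. AE x in lebesgue_on \<Omega>. \<bar>f x\<bar> \<le> C}"

text \<open>\<open>w\<close> is in \<open>H\<^sup>1(\<Omega>)\<close> with weak gradient \<open>g\<close>. The test functions live on the interior because this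
  is also used for \<open>\<Omega> = D \<times> [0,t)\<close>, which differs from its interior by a null set only.\<close>

definition has_H1_gradient ::
  "'a::euclidean_space set \<Rightarrow> ('a \<Rightarrow> real) \<Rightarrow> ('a \<Rightarrow> 'a) \<Rightarrow> bool" where
  "has_H1_gradient \<Omega> w g \<longleftrightarrow> w \<in> L2 \<Omega> \<and> g \<in> L2 \<Omega> \<and>
     (\<forall>\<phi>\<in>test_functions (interior \<Omega>). \<forall>b\<in>Basis.
        (\<integral>x. w x * (grad \<phi> x \<bullet> b) \<partial>lebesgue_on \<Omega>) = - (\<integral>x. (g x \<bullet> b) * \<phi> x \<partial>lebesgue_on \<Omega>))"

section \<open>Space-time cylinders\<close>

definition time_interval :: "ereal \<Rightarrow> real set" where
  "time_interval T = {t. 0 \<le> t \<and> ereal t < T}"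

definition cyl :: "'a::euclidean_space set \<Rightarrow> ereal \<Rightarrow> ('a \<times> real) set" where
  "cyl D T = D \<times> time_interval T"

text \<open>The closure in \<open>H\<^sup>1(D\<^sub>T)\<close> of the (restrictions of) test functions on \<open>D \<times> (0,\<infinity>)\<close>. The gradient
  here is the full space-time gradient \<open>(\<nabla>w, \<partial>\<^sub>tw)\<close>; the sum of integrals is the square of the
  \<open>H\<^sup>1(D\<^sub>T)\<close>-distance of \<open>w\<close> and \<open>\<phi>\<close>.\<close>

definition H1_0P :: "'a::euclidean_space set \<Rightarrow> ereal \<Rightarrow> ('a \<times> real \<Rightarrow> real) set" where
  "H1_0P D T = {w. \<exists>g. has_H1_gradient (cyl D T) w g \<and>
     (\<forall>\<epsilon>>0. \<exists>\<phi>\<in>test_functions (D \<times> {0<..}).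
        (\<integral>z. (w z - \<phi> z)\<^sup>2 \<partial>lebesgue_on (cyl D T))
        + (\<integral>z. (norm (g z - grad \<phi> z))\<^sup>2 \<partial>lebesgue_on (cyl D T)) < \<epsilon>\<^sup>2)}"

text \<open>\<open>L\<^sup>2\<^sub>l\<^sub>o\<^sub>c([0,T);L\<^sup>2(D))\<close>, with Bochner classes represented by jointly measurable functions.\<close>

definition L2loc_L2 ::
  "'a::euclidean_space set \<Rightarrow> ereal \<Rightarrow> ('a \<times> real \<Rightarrow> 'b::euclidean_space) set" where
  "L2loc_L2 D T = {f \<in> borel_measurable (lebesgue_on (cyl D T)). \<forall>S\<in>time_interval T. f \<in> L2 (cyl D (ereal S))}"

text \<open>\<open>u \<in> L\<^sup>2\<^sub>l\<^sub>o\<^sub>c([0,T);H\<^sup>1(D))\<close> with spatial gradient \<open>G\<close>: \<open>G(\<sqdot>,t)\<close> is the weak gradient of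
  \<open>u(\<sqdot>,t) \<in> H\<^sup>1(D)\<close> for almost every \<open>t\<close>, and the \<open>H\<^sup>1(D)\<close>-norm of \<open>u(\<sqdot>,t)\<close> is locally square
  integrable in time. Joint measurability of \<open>(u,G)\<close> expresses Bochner measurability
  of \<open>t \<mapsto> u(\<sqdot>,t)\<close>.\<close>

definition has_L2loc_H1_gradient ::
  "'a::euclidean_space set \<Rightarrow> ereal \<Rightarrow> ('a \<times> real \<Rightarrow> real) \<Rightarrow> ('a \<times> real \<Rightarrow> 'a) \<Rightarrow> bool" where
  "has_L2loc_H1_gradient D T u G \<longleftrightarrow> u \<in> L2loc_L2 D T \<and> G \<in> L2loc_L2 D T \<and>
     (AE t in lebesgue_on (time_interval T). has_H1_gradient D (\<lambda>x. u (x, t)) (\<lambda>x. G (x, t)))"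

definition has_weak_time_derivative ::
  "'a::euclidean_space set \<Rightarrow> ereal \<Rightarrow> ('a \<times> real \<Rightarrow> real) \<Rightarrow> ('a \<times> real \<Rightarrow> real) \<Rightarrow> bool" where
  "has_weak_time_derivative D T u v \<longleftrightarrow>
     (\<forall>\<phi>\<in>test_functions (D \<times> {t. 0 < t \<and> ereal t < T}).
        (\<integral>(x, t). u (x, t) * deriv (\<lambda>s. \<phi> (x, s)) t \<partial>lebesgue_on (cyl D T))
        = - (\<integral>z. v z * \<phi> z \<partial>lebesgue_on (cyl D T)))"

definition L2_continuous ::
  "'a::euclidean_space set \<Rightarrow> ereal \<Rightarrow> ('a \<times> real \<Rightarrow> real) \<Rightarrow> bool" where
  "L2_continuous D T u \<longleftrightarrow> (\<forall>t\<in>time_interval T. (\<lambda>x. u (x, t)) \<in> L2 D) \<and>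
     (\<forall>t\<in>time_interval T. ((\<lambda>s. \<integral>x. (u (x, s) - u (x, t))\<^sup>2 \<partial>lebesgue_on D) \<longlongrightarrow> 0) (at t within time_interval T))"

definition Linf_weak_star_continuous ::
  "'a::euclidean_space set \<Rightarrow> ereal \<Rightarrow> ('a \<times> real \<Rightarrow> real) \<Rightarrow> bool" where
  "Linf_weak_star_continuous D T \<mu> \<longleftrightarrow> (\<forall>t\<in>time_interval T. (\<lambda>x. \<mu> (x, t)) \<in> Linf D) \<and>
     (\<forall>f. integrable (lebesgue_on D) f \<longrightarrow>
        continuous_on (time_interval T) (\<lambda>t. \<integral>x. \<mu> (x, t) * f x \<partial>lebesgue_on D))"

section \<open>Enthalpy sub- and supersolutions\<close>

text \<open>The conditions shared by sub- and supersolutions; \<open>G\<close> is the spatial gradient \<open>\<nabla>u\<close>.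
  The representative of \<open>u\<close> is the one continuous in time with values in \<open>L\<^sup>2(D)\<close>.\<close>

definition enthalpy_pair ::
  "'a::euclidean_space set \<Rightarrow> ereal \<Rightarrow> ('a \<Rightarrow> real) \<Rightarrow>
   ('a \<times> real \<Rightarrow> real) \<Rightarrow> ('a \<times> real \<Rightarrow> real) \<Rightarrow> ('a \<times> real \<Rightarrow> 'a) \<Rightarrow> bool" where
  "enthalpy_pair D T uM u \<mu> G \<longleftrightarrow>
     u \<in> borel_measurable (lebesgue_on (cyl D T)) \<and>
     \<mu> \<in> borel_measurable (lebesgue_on (cyl D T)) \<and>
     has_L2loc_H1_gradient D T u G \<and>
     (\<exists>v\<in>L2loc_L2 D T. has_weak_time_derivative D T u v) \<and>
     L2_continuous D T u \<and>
     Linf_weak_star_continuous D T \<mu> \<and>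
     (\<forall>t\<in>time_interval T. AE x in lebesgue_on D.
        \<bar>\<mu> (x, t)\<bar> \<le> 1 \<and> (u (x, t) > uM x \<longrightarrow> \<mu> (x, t) = 1) \<and> (u (x, t) < uM x \<longrightarrow> \<mu> (x, t) = - 1))"

definition enthalpy_increment ::
  "'a::euclidean_space set \<Rightarrow> ('a \<times> real \<Rightarrow> real) \<Rightarrow> ('a \<times> real \<Rightarrow> real) \<Rightarrow>
   ('a \<times> real \<Rightarrow> real) \<Rightarrow> real \<Rightarrow> real \<Rightarrow> real" where
  "enthalpy_increment D u \<mu> \<eta> t1 t2 =
     (\<integral>x. (u (x, t2) + \<mu> (x, t2)) * \<eta> (x, t2) \<partial>lebesgue_on D)
     - (\<integral>x. (u (x, t1) + \<mu> (x, t1)) * \<eta> (x, t1) \<partial>lebesgue_on D)"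

definition enthalpy_flux ::
  "'a::euclidean_space set \<Rightarrow> ('a \<Rightarrow> 'a) \<Rightarrow> ('a \<times> real \<Rightarrow> real) \<Rightarrow> ('a \<times> real \<Rightarrow> real) \<Rightarrow>
   ('a \<times> real \<Rightarrow> 'a) \<Rightarrow> ('a \<times> real \<Rightarrow> real) \<Rightarrow> real \<Rightarrow> real \<Rightarrow> real" where
  "enthalpy_flux D F u \<mu> G \<eta> t1 t2 =
     (\<integral>t. (\<integral>x. (u (x, t) + \<mu> (x, t)) * deriv (\<lambda>s. \<eta> (x, s)) t
               - G (x, t) \<bullet> grad (\<lambda>y. \<eta> (y, t)) x
               - F x \<bullet> grad (\<lambda>y. \<eta> (y, t)) x \<partial>lebesgue_on D) \<partial>lebesgue_on {t1..t2})"

definition dirichlet_enthalpy_subsolution ::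
  "'a::euclidean_space set \<Rightarrow> ereal \<Rightarrow> ('a \<Rightarrow> real) \<Rightarrow> ('a \<Rightarrow> 'a) \<Rightarrow>
   ('a \<times> real \<Rightarrow> real) \<Rightarrow> ('a \<times> real \<Rightarrow> real) \<Rightarrow> bool" where
  "dirichlet_enthalpy_subsolution D T uM F u \<mu> \<longleftrightarrow>
     (\<exists>G. enthalpy_pair D T uM u \<mu> G \<and>
       (\<forall>t1 t2 \<eta>. 0 \<le> t1 \<and> t1 \<le> t2 \<and> ereal t2 < T \<and> \<eta> \<in> test_functions (D \<times> UNIV) \<and> (\<forall>z. 0 \<le> \<eta> z) \<longrightarrow>
          enthalpy_increment D u \<mu> \<eta> t1 t2 \<le> enthalpy_flux D F u \<mu> G \<eta> t1 t2))"

definition dirichlet_enthalpy_supersolution ::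
  "'a::euclidean_space set \<Rightarrow> ereal \<Rightarrow> ('a \<Rightarrow> real) \<Rightarrow> ('a \<Rightarrow> 'a) \<Rightarrow>
   ('a \<times> real \<Rightarrow> real) \<Rightarrow> ('a \<times> real \<Rightarrow> real) \<Rightarrow> bool" where
  "dirichlet_enthalpy_supersolution D T uM F u \<mu> \<longleftrightarrow>
     (\<exists>G. enthalpy_pair D T uM u \<mu> G \<and>
       (\<forall>t1 t2 \<eta>. 0 \<le> t1 \<and> t1 \<le> t2 \<and> ereal t2 < T \<and> \<eta> \<in> test_functions (D \<times> UNIV) \<and> (\<forall>z. 0 \<le> \<eta> z) \<longrightarrow>
          enthalpy_increment D u \<mu> \<eta> t1 t2 \<ge> enthalpy_flux D F u \<mu> G \<eta> t1 t2))"

end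

theory Submission
  imports Defs "HOL-Real_Asymp.Real_Asymp"
begin

text \<open>The proof is by duality. Put \<open>w = u1 - u2\<close> and \<open>m = \<mu>1 - \<mu>2\<close>. By monotonicity of the enthalpy
  graph, \<open>w\<close> and \<open>m\<close> never have opposite signs, so \<open>w = a (w + m)\<close> with \<open>0 \<le> a \<le> 1\<close>, and
  \<open>w + m \<le> 0\<close> already implies \<open>w \<le> 0\<close> and \<open>m \<le> 0\<close>. Subtracting the two inequalities (the heat source
  cancels), \<open>w + m\<close> satisfies \<open>\<partial>\<^sub>t (w + m) \<le> \<Delta> (a (w + m))\<close> weakly. To show
  \<open>\<integral> (w + m)(T) f \<le> 0\<close> for a test function \<open>f \<ge> 0\<close>, one pairs this with a solution of the backward
  problem \<open>\<partial>\<^sub>t\<eta> + (a + \<delta>) \<Delta>\<eta> = 0\<close>, \<open>\<eta> \<ge> 0\<close>, \<open>\<eta>(T) = f\<close>.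

  The backward problem is discretised in time by the implicit Euler scheme, and every step is replaced by
  approximately minimising a quadratic energy over the cone of nonnegative test functions. Thus
  neither existence nor regularity of solutions is needed, and all competitors are admissible in the enthalpy
  inequality. No boundary regularity of \<open>w\<close> is available; instead the time average of \<open>w\<close> is written as
  \<open>P - Z\<close>, where \<open>P\<close> lies in the \<open>H\<^sup>1\<close>-closure of the cone because of the boundary condition on
  \<open>w\<^sup>+ = - (u2 - u1)\<^sup>-\<close>, and \<open>Z \<ge> 0\<close> has a weak gradient in \<open>L\<^sup>2(D)\<close>. The energy estimate for
  the scheme makes the errors vanish when first the time step, then \<open>\<delta>\<close> and finally the gradient of a
  spatial cutoff tend to \<open>0\<close>.\<close>

section \<open>Smooth functions\<close>

text \<open>Duality moves all derivatives to \<eta>, but the operator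
  \<open>(a + \<delta>) \<Delta>\<close> is in nondivergence form with a merely measurable
  coefficient. Dividing one Euler step by the coefficient makes it the Euler-Lagrange equation of a
  quadratic energy, and the coefficient is evaluated only at grid times. The constraint \<eta> \<ge>
  0 costs half of the variations: upward ones are free, downward ones are allowed only where \<eta>
  > 0. The lost half is harmless for the pairing with \<open>- Z\<close>, because where \<eta>
  vanishes the residual \<open>\<zeta> \<eta>\<close> is nonnegative. So the step delivers
  \<open>\<integral> \<zeta> \<eta> * (P - Z) \<le> h \<integral> \<nabla>\<eta> \<bullet>
  \<nabla>(P - Z)\<close> up to a tolerance, the one direction that the argument uses. The
  regularisation error vanishes with \<delta> because the energy bounds the sum over all steps of
  the norms of \<open>\<zeta> \<eta>\<close> by a multiple of \<open>\<delta>^(-1/2)\<close>, and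
  this sum is multiplied by \<delta>.\<close>

abbreviation pderiv_at :: "'a::euclidean_space \<Rightarrow> ('a \<Rightarrow> real) \<Rightarrow> 'a \<Rightarrow> real" where
  "pderiv_at b f \<equiv> (\<lambda>x. frechet_derivative f (at x) b)"

definition smooth :: "('a::euclidean_space \<Rightarrow> real) \<Rightarrow> bool" where
  "smooth f \<longleftrightarrow> (\<forall>k. C_k k f)"

lemma C_k_continuous: "C_k k f \<Longrightarrow> continuous_on UNIV f"
  by (cases k) (auto simp: continuous_on_eq_continuous_at differentiable_imp_continuous_within)

lemma C_k_Suc_imp: "C_k (Suc k) f \<Longrightarrow> C_k k f"
proof (induction k arbitrary: f)
  case 0 then show ?case using C_k_continuous[of "Suc 0" f] by simp
next
  case (Suc k)
  from Suc.prems have "\<forall>x. f differentiable (at x)" "\<forall>b\<in>Basis. C_k (Suc k) (pderiv_at b f)"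
    unfolding C_k.simps(2)[of "Suc k"] by blast+
  with Suc.IH show ?case unfolding C_k.simps(2)[of k] by blast
qed

lemma smooth_continuous: "smooth f \<Longrightarrow> continuous_on UNIV f"
  unfolding smooth_def using C_k_continuous by blast

lemma smooth_differentiable: "smooth f \<Longrightarrow> f differentiable (at x)"
  unfolding smooth_def using C_k.simps(2) by blast

lemma smooth_pderiv: "smooth f \<Longrightarrow> b \<in> Basis \<Longrightarrow> smooth (pderiv_at b f)"
  unfolding smooth_def using C_k.simps(2) by blast

lemma frechet_eq_grad:
  assumes "f differentiable (at x)"
  shows "frechet_derivative f (at x) h = grad f x \<bullet> h"
proof -
  interpret linear "frechet_derivative f (at x)"
    using assms by (rule linear_frechet_derivative)
  have "frechet_derivative f (at x) h = frechet_derivative f (at x) (\<Sum>b\<in>Basis. (h \<bullet> b) *\<^sub>R b)"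
    by (simp add: euclidean_representation)
  also have "\<dots> = grad f x \<bullet> h"
    by (simp add: sum scale grad_def inner_sum_right inner_commute mult.commute)
  finally show ?thesis .
qed

lemma grad_has_derivative:
  assumes "f differentiable (at x)"
  shows "(f has_derivative (\<lambda>h. grad f x \<bullet> h)) (at x)"
  using frechet_derivative_works[THEN iffD1, OF assms] frechet_eq_grad[OF assms]
  by (metis (no_types, lifting) ext)

lemmas smooth_grad = grad_has_derivative[OF smooth_differentiable]

lemma grad_eqI:
  assumes "(f has_derivative (\<lambda>h. g \<bullet> h)) (at x)"
  shows "grad f x = g"
proof -
  have "frechet_derivative f (at x) = (\<lambda>h. g \<bullet> h)"
    using frechet_derivative_at[OF assms] by simp
  then show ?thesis
    unfolding grad_def by (simp add: euclidean_representation)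
qed

lemma pderiv_eqI:
  assumes "(f has_derivative f') (at x)"
  shows "pderiv_at b f x = f' b"
  using frechet_derivative_at[OF assms] by simp

lemma C_k_const [simp]: "C_k k (\<lambda>x. c)"
  by (induction k arbitrary: c) (simp_all add: frechet_derivative_const)

lemma C_k_add: "C_k k f \<Longrightarrow> C_k k g \<Longrightarrow> C_k k (\<lambda>x. f x + g x)"
proof (induction k arbitrary: f g)
  case 0 then show ?case by (auto intro: continuous_intros)
next
  case (Suc k)
  have "pderiv_at b (\<lambda>x. f x + g x) = (\<lambda>x. pderiv_at b f x + pderiv_at b g x)" for b
    using Suc.prems
    by (intro ext pderiv_eqI) (auto intro!: has_derivative_add simp: frechet_derivative_works[symmetric])
  with Suc show ?case by auto
qed

lemma C_k_mult: "C_k k f \<Longrightarrow> C_k k g \<Longrightarrow> C_k k (\<lambda>x. f x * g x)"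
proof (induction k arbitrary: f g)
  case 0 then show ?case by (auto intro: continuous_intros)
next
  case (Suc k)
  have "pderiv_at b (\<lambda>x. f x * g x) = (\<lambda>x. f x * pderiv_at b g x + pderiv_at b f x * g x)" for b
    using Suc.prems
    by (intro ext pderiv_eqI) (auto intro!: has_derivative_mult simp: frechet_derivative_works[symmetric])
  moreover have "C_k k f" "C_k k g" using Suc.prems C_k_Suc_imp by auto
  ultimately show ?case using Suc by (auto intro!: C_k_add)
qed

lemma C_k_sum: "(\<And>i. i \<in> I \<Longrightarrow> C_k k (f i)) \<Longrightarrow> C_k k (\<lambda>x. \<Sum>i\<in>I. f i x)"
  by (induction I rule: infinite_finite_induct) (auto intro: C_k_add)

lemma C_k_linear:
  assumes "bounded_linear f" shows "C_k k f"
proof (cases k)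
  case 0 then show ?thesis using assms by (simp add: linear_continuous_on)
next
  case (Suc n)
  have d: "(f has_derivative f) (at x)" for x
    using assms by (rule bounded_linear_imp_has_derivative)
  have "pderiv_at b f = (\<lambda>x. f b)" for b
    using d by (intro ext pderiv_eqI)
  then show ?thesis using d by (auto simp: Suc differentiable_def)
qed

lemma C_k_compose:
  fixes f :: "'a::euclidean_space \<Rightarrow> real" and g :: "real \<Rightarrow> real"
  shows "C_k k f \<Longrightarrow> C_k k g \<Longrightarrow> C_k k (\<lambda>x. g (f x))"
proof (induction k arbitrary: f g)
  case 0 then show ?case
    using continuous_on_compose2[of UNIV g UNIV f] by auto
next
  case (Suc k)
  have "((\<lambda>x. g (f x)) has_derivative (\<lambda>h. frechet_derivative g (at (f x)) (frechet_derivative f (at x) h))) (at x)" for x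
    using Suc.prems
    by (intro has_derivative_compose[of f _ x UNIV g, simplified]) (auto simp: frechet_derivative_works[symmetric])
  moreover have "(\<lambda>h. frechet_derivative g (at y) (frechet_derivative f (at x) h))
      = (\<lambda>h. frechet_derivative f (at x) h * pderiv_at 1 g y)" for x y
  proof
    fix h
    have "linear (frechet_derivative g (at y))"
      using Suc.prems by (intro linear_frechet_derivative) auto
    from linear_scale[OF this, of "frechet_derivative f (at x) h" 1]
    show "frechet_derivative g (at y) (frechet_derivative f (at x) h)
      = frechet_derivative f (at x) h * pderiv_at 1 g y"
      by (simp only: real_scaleR_def mult_1_right)
  qed
  ultimately have *: "((\<lambda>x. g (f x)) has_derivative (\<lambda>h. frechet_derivative f (at x) h * pderiv_at 1 g (f x))) (at x)" for x
    by (simp only:)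
  then have "pderiv_at b (\<lambda>x. g (f x)) = (\<lambda>x. pderiv_at b f x * pderiv_at 1 g (f x))" for b
    by (intro ext pderiv_eqI)
  moreover have "C_k k f" "C_k k (pderiv_at 1 g)" using Suc.prems C_k_Suc_imp by auto
  moreover from this have "C_k k (\<lambda>x. pderiv_at b f x * pderiv_at 1 g (f x))" if "b \<in> Basis" for b
    using C_k_mult[OF _ Suc.IH[of f "pderiv_at 1 g"]] Suc.prems that by auto
  ultimately show ?case using * by (auto simp: differentiable_def)
qed

text \<open>One derivative \<open>L'\<close> serves every base point, so \<open>L\<close> is affine:
  the partial derivatives of \<open>f (L x)\<close> are combinations, with constant coefficients, of
  partial derivatives of \<open>f\<close> composed with \<open>L\<close>, and the induction
  hypothesis for general \<open>f\<close> applies to each.\<close>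

lemma C_k_inner_compose:
  fixes f :: "'b::euclidean_space \<Rightarrow> real" and L :: "'a::euclidean_space \<Rightarrow> 'b"
  assumes "\<And>x. (L has_derivative L') (at x)"
  shows "C_k k f \<Longrightarrow> C_k k (\<lambda>x. f (L x))"
proof (induction k arbitrary: f)
  case 0
  have "continuous_on UNIV L"
    using assms by (meson has_derivative_continuous_on has_derivative_at_withinI)
  then show ?case using continuous_on_compose2[of UNIV f UNIV L] 0 by auto
next
  case (Suc k)
  have *: "((\<lambda>x. f (L x)) has_derivative (\<lambda>h. grad f (L x) \<bullet> L' h)) (at x)" for x
    using Suc.prems
    by (intro has_derivative_compose[OF assms] grad_has_derivative) auto
  have "pderiv_at b (\<lambda>x. f (L x)) = (\<lambda>x. \<Sum>c\<in>Basis. pderiv_at c f (L x) * (c \<bullet> L' b))" for b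
    by (rule ext, subst pderiv_eqI[OF *]) (simp add: grad_def inner_sum_left)
  moreover have "C_k k (\<lambda>x. pderiv_at c f (L x))" if "c \<in> Basis" for c
    using Suc.IH[of "pderiv_at c f"] Suc.prems that by auto
  ultimately show ?case using * 
    by (auto intro!: C_k_sum C_k_mult simp: differentiable_def)
qed

lemma C_k_inverse:
  fixes f :: "'a::euclidean_space \<Rightarrow> real"
  assumes "\<And>x. f x \<noteq> 0"
  shows "C_k k f \<Longrightarrow> C_k k (\<lambda>x. inverse (f x))"
proof (induction k)
  case 0 then show ?case using assms by (auto intro!: continuous_intros)
next
  case (Suc k)
  have *: "((\<lambda>x. inverse (f x)) has_derivative (\<lambda>h. - (inverse (f x) * frechet_derivative f (at x) h * inverse (f x)))) (at x)" for x
    using Suc.prems assms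
    by (intro Deriv.has_derivative_inverse) (auto simp: frechet_derivative_works[symmetric])
  then have "pderiv_at b (\<lambda>x. inverse (f x)) = (\<lambda>x. (-1) * (inverse (f x) * pderiv_at b f x * inverse (f x)))" for b
    by (intro ext) (subst pderiv_eqI, assumption, simp only: mult_minus1)
  moreover have "C_k k f" using Suc.prems C_k_Suc_imp by auto
  moreover from this have "C_k k (\<lambda>x. (-1) * (inverse (f x) * pderiv_at b f x * inverse (f x)))"
    if "b \<in> Basis" for b
    using that Suc by (intro C_k_mult C_k_const) auto
  ultimately show ?case using * by (auto simp: differentiable_def)
qed

lemma smooth_const [simp, intro]: "smooth (\<lambda>x. c)" by (simp add: smooth_def)
lemma smooth_add [intro]: "smooth f \<Longrightarrow> smooth g \<Longrightarrow> smooth (\<lambda>x. f x + g x)"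
  by (simp add: smooth_def C_k_add)
lemma smooth_mult [intro]: "smooth f \<Longrightarrow> smooth g \<Longrightarrow> smooth (\<lambda>x. f x * g x)"
  by (simp add: smooth_def C_k_mult)
lemma smooth_diff [intro]: "smooth f \<Longrightarrow> smooth g \<Longrightarrow> smooth (\<lambda>x. f x - g x)"
  using smooth_add[of f "\<lambda>x. (-1) * g x"] smooth_mult[of "\<lambda>x. -1" g] by simp
lemma smooth_sum [intro]: "(\<And>i. i \<in> I \<Longrightarrow> smooth (f i)) \<Longrightarrow> smooth (\<lambda>x. \<Sum>i\<in>I. f i x)"
  by (simp add: smooth_def C_k_sum)
lemma smooth_compose: "smooth g \<Longrightarrow> smooth f \<Longrightarrow> smooth (\<lambda>x. g (f x))" for g :: "real \<Rightarrow> real"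
  by (simp add: smooth_def C_k_compose)
lemma smooth_inner_compose:
  "(\<And>x. (L has_derivative L') (at x)) \<Longrightarrow> smooth f \<Longrightarrow> smooth (\<lambda>x. f (L x))"
  unfolding smooth_def using C_k_inner_compose by blast
lemma smooth_divide [intro]:
  "smooth f \<Longrightarrow> smooth g \<Longrightarrow> (\<And>x. g x \<noteq> 0) \<Longrightarrow> smooth (\<lambda>x. f x / g x)"
  unfolding divide_inverse by (simp add: smooth_def C_k_mult C_k_inverse)
lemma smooth_linear: "bounded_linear f \<Longrightarrow> smooth f"
  by (simp add: smooth_def C_k_linear)
lemma smooth_inner_left [intro]: "smooth (\<lambda>x. x \<bullet> c)"
  by (intro smooth_linear bounded_linear_inner_left)
lemma smooth_id [intro]: "smooth (\<lambda>x::real. x)"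
  by (intro smooth_linear bounded_linear_ident)
lemma smooth_norm_sq [intro]: "smooth (\<lambda>x. x \<bullet> x)"
proof -
  have "(\<lambda>x::'a. x \<bullet> x) = (\<lambda>x. \<Sum>b\<in>Basis. (x \<bullet> b) * (x \<bullet> b))"
    by (rule ext) (rule euclidean_inner)
  then show ?thesis by (auto intro!: smooth_sum smooth_mult)
qed

text \<open>A coinduction principle: it suffices to exhibit a class that contains \<open>f\<close>
  and is closed under partial derivatives. It handles functions whose higher derivatives have no
  convenient closed form, namely \<open>flat_exp\<close> and integrals depending on a
  parameter.\<close>

lemma smooth_induct:
  assumes "X f"
    and "\<And>f. X f \<Longrightarrow> (\<forall>x. f differentiable (at x)) \<and> (\<forall>b\<in>Basis. X (pderiv_at b f))"
  shows "smooth f"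
proof -
  have "C_k k f" if "X f" for k f
    using that
  proof (induction k arbitrary: f)
    case 0 then show ?case using assms(2)
      by (auto simp: continuous_on_eq_continuous_at differentiable_imp_continuous_within)
  next
    case (Suc k) then show ?case using assms(2) by auto
  qed
  then show ?thesis using assms(1) by (auto simp: smooth_def)
qed

section \<open>A flat function and a smooth step\<close>

definition flat_exp :: "real \<Rightarrow> real" where
  "flat_exp x = (if x > 0 then exp (- 1 / x) else 0)"

lemma poly_exp_decay: "((\<lambda>y. poly p y * exp (- y)) \<longlongrightarrow> 0) at_top" for p :: "real poly"
proof -
  have "((\<lambda>y. \<Sum>i\<le>degree p. coeff p i * (y ^ i / exp y)) \<longlongrightarrow> (\<Sum>i\<le>degree p. coeff p i * 0)) at_top"
    by (intro tendsto_sum tendsto_mult tendsto_const tendsto_power_div_exp_0)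
  then show ?thesis
    by (simp add: poly_altdef sum_distrib_right exp_minus divide_inverse mult.assoc)
qed

text \<open>With \<open>y = 1 / x\<close> the chain rule produces the factor
  \<open>(p y - p' y) * y^2\<close>, which is \<open>q\<close>; so the functions
  \<open>p (1 / x) exp (- 1 / x)\<close>, extended by 0, are closed under differentiation. At 0 the
  difference quotient from the right is \<open>y * p y * exp (- y)\<close> with \<open>y\<close>
  tending to infinity.\<close>

lemma poly_flat_exp_deriv:
  fixes p :: "real poly"
  defines "q \<equiv> (p - pderiv p) * [:0, 0, 1:]"
  shows "((\<lambda>x. if x > 0 then poly p (1/x) * exp (-1/x) else 0) has_real_derivative
      (if x > 0 then poly q (1/x) * exp (-1/x) else 0)) (at x)"
proof -
  let ?f = "\<lambda>x::real. if x > 0 then poly p (1/x) * exp (-1/x) else 0"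
  consider "x > 0" | "x < 0" | "x = 0" by linarith
  then show ?thesis
  proof cases
    case 1
    have "((\<lambda>x. poly p (1/x) * exp (-1/x)) has_real_derivative
        (poly q (1/x) * exp (-1/x))) (at x)"
      using 1 unfolding q_def
      by (auto intro!: derivative_eq_intros DERIV_chain2[of "poly p"] poly_DERIV
          simp: field_simps power2_eq_square)
    then have "(?f has_real_derivative (poly q (1/x) * exp (-1/x))) (at x)"
      using 1 by (elim has_field_derivative_transform_within_open[of _ _ _ "{0<..}"]) auto
    then show ?thesis using 1 by simp
  next
    case 2
    have "(?f has_real_derivative 0) (at x)"
      by (rule has_field_derivative_transform_within_open[of "\<lambda>_. 0" _ _ "{..<0}"]) (use 2 in auto)
    then show ?thesis using 2 by simp
  next
    case 3
    have "((\<lambda>y. (poly p (1/y) * exp (-1/y)) / y) \<longlongrightarrow> 0) (at_right 0)"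
    proof -
      have "((\<lambda>y. poly (p * [:0,1:]) (inverse y) * exp (- (inverse y))) \<longlongrightarrow> 0) (at_right 0)"
        by (rule filterlim_compose[OF poly_exp_decay filterlim_inverse_at_top_right])
      then show ?thesis by (simp add: field_simps inverse_eq_divide)
    qed
    then have "((\<lambda>y. (?f y - ?f 0) / (y - 0)) \<longlongrightarrow> 0) (at_right 0)"
      by (rule Lim_transform_eventually) (auto simp: eventually_at_right_field intro!: exI[of _ 1])
    moreover have "((\<lambda>y. (?f y - ?f 0) / (y - 0)) \<longlongrightarrow> 0) (at_left 0)"
      by (rule Lim_transform_eventually[OF tendsto_const]) (auto simp: eventually_at_left_field intro!: exI[of _ "-1"])
    ultimately have "((\<lambda>y. (?f y - ?f 0) / (y - 0)) \<longlongrightarrow> 0) (at 0)"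
      by (simp add: filterlim_at_split)
    then show ?thesis using 3 by (simp add: has_field_derivative_iff)
  qed
qed

lemma smooth_flat_exp [intro]: "smooth flat_exp"
proof (rule smooth_induct[of "\<lambda>f. \<exists>p. f = (\<lambda>x. if x > 0 then poly p (1/x) * exp (-1/x) else 0)"])
  show "\<exists>p. flat_exp = (\<lambda>x. if x > 0 then poly p (1/x) * exp (-1/x) else 0)"
    by (rule exI[of _ 1]) (auto simp: flat_exp_def fun_eq_iff)
next
  fix f :: "real \<Rightarrow> real"
  assume "\<exists>p. f = (\<lambda>x. if x > 0 then poly p (1/x) * exp (-1/x) else 0)"
  then obtain p where f: "f = (\<lambda>x. if x > 0 then poly p (1/x) * exp (-1/x) else 0)" by blast
  let ?q = "(p - pderiv p) * [:0, 0, 1:]"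
  have d: "(f has_derivative (\<lambda>h. (if x > 0 then poly ?q (1/x) * exp (-1/x) else 0) * h)) (at x)" for x
    unfolding f using poly_flat_exp_deriv has_field_derivative_imp_has_derivative by blast
  have "pderiv_at b f = (\<lambda>x. if x > 0 then poly ?q (1/x) * exp (-1/x) else 0)" if "b \<in> Basis" for b
    using that by (intro ext) (subst pderiv_eqI[OF d], simp)
  then show "(\<forall>x. f differentiable (at x)) \<and> (\<forall>b\<in>Basis. \<exists>p. pderiv_at b f = (\<lambda>x. if x > 0 then poly p (1/x) * exp (-1/x) else 0))"
    using d by (blast intro: differentiableI)
qed

lemma flat_exp_pos: "x > 0 \<Longrightarrow> flat_exp x > 0" and flat_exp_nonneg: "flat_exp x \<ge> 0"
  and flat_exp_zero: "x \<le> 0 \<Longrightarrow> flat_exp x = 0"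
  by (auto simp: flat_exp_def)

definition smooth_step :: "real \<Rightarrow> real" where
  "smooth_step x = flat_exp x / (flat_exp x + flat_exp (1 - x))"

lemma smooth_step_denom: "flat_exp x + flat_exp (1 - x) > 0"
proof (cases "x > 0")
  case True
  then show ?thesis by (intro add_pos_nonneg flat_exp_pos flat_exp_nonneg)
next
  case False
  then show ?thesis by (intro add_nonneg_pos flat_exp_pos flat_exp_nonneg) simp
qed

lemma smooth_smooth_step [intro]: "smooth smooth_step"
proof -
  have "smooth (\<lambda>x. flat_exp (1 - x))"
    by (rule smooth_compose[OF smooth_flat_exp smooth_diff[OF smooth_const smooth_id]])
  then have "smooth (\<lambda>x. flat_exp x / (flat_exp x + flat_exp (1 - x)))"
    using smooth_step_denom by (intro smooth_divide[OF smooth_flat_exp smooth_add[OF smooth_flat_exp]]) (auto simp: less_le)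
  then show ?thesis unfolding smooth_step_def[abs_def] .
qed

lemma smooth_step_bounds: "0 \<le> smooth_step x" "smooth_step x \<le> 1"
  using smooth_step_denom[of x] flat_exp_nonneg[of x] flat_exp_nonneg[of "1-x"]
  by (simp_all add: smooth_step_def pos_divide_le_eq)

lemma smooth_step_eq: "x \<le> 0 \<Longrightarrow> smooth_step x = 0" "x \<ge> 1 \<Longrightarrow> smooth_step x = 1"
  using smooth_step_denom[of x] by (auto simp: smooth_step_def flat_exp_zero)

section \<open>Calculus of test functions and cutoffs\<close>

lemma test_functions_smooth: "\<phi> \<in> test_functions U \<Longrightarrow> smooth \<phi>"
  by (simp add: test_functions_def smooth_def)

lemma test_functionsI:
  assumes "smooth \<phi>" "compact C" "C \<subseteq> U" "\<And>x. x \<notin> C \<Longrightarrow> \<phi> x = 0"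
  shows "\<phi> \<in> test_functions U"
proof -
  have "closure {x. \<phi> x \<noteq> 0} \<subseteq> C"
    by (rule closure_minimal) (use assms in \<open>auto simp: compact_imp_closed\<close>)
  moreover from this have "compact (closure {x. \<phi> x \<noteq> 0})"
    using assms(2) by (meson closed_closure compact_Int_closed compact_closure bounded_subset compact_imp_bounded closure_subset order_trans)
  ultimately show ?thesis using assms unfolding test_functions_def smooth_def by auto
qed

lemma test_functionsE:
  assumes "\<phi> \<in> test_functions U"
  obtains C where "compact C" "C \<subseteq> U" "\<And>x. x \<notin> C \<Longrightarrow> \<phi> x = 0" "\<And>x. x \<notin> C \<Longrightarrow> grad \<phi> x = 0"
proof -
  let ?C = "closure {x. \<phi> x \<noteq> 0}"
  have 1: "\<phi> x = 0" if "x \<notin> ?C" for x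
    using that closure_subset[of "{x. \<phi> x \<noteq> 0}"] by blast
  have 2: "grad \<phi> x = 0" if "x \<notin> ?C" for x
  proof (rule grad_eqI)
    have "((\<lambda>_. 0) has_derivative (\<lambda>h. 0 \<bullet> h)) (at x)" by simp
    then show "(\<phi> has_derivative (\<lambda>h. 0 \<bullet> h)) (at x)"
    proof (rule has_derivative_transform_within_open)
      show "open (- ?C)" by (intro open_Compl closed_closure)
      show "x \<in> - ?C" using that by blast
      show "0 = \<phi> y" if "y \<in> - ?C" for y using 1[of y] that by simp
    qed
  qed
  have "compact ?C" "?C \<subseteq> U" using assms unfolding test_functions_def by blast+
  from this 1 2 show thesis by (rule that)
qed

lemma test_functions_mono: "\<phi> \<in> test_functions U \<Longrightarrow> U \<subseteq> V \<Longrightarrow> \<phi> \<in> test_functions V"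
  by (auto simp: test_functions_def)

lemma pderiv_test_function:
  assumes "\<phi> \<in> test_functions U" "b \<in> Basis"
  shows "pderiv_at b \<phi> \<in> test_functions U"
proof -
  obtain C where C: "compact C" "C \<subseteq> U" "\<And>x. x \<notin> C \<Longrightarrow> \<phi> x = 0" "\<And>x. x \<notin> C \<Longrightarrow> grad \<phi> x = 0"
    using test_functionsE[OF assms(1)] by metis
  have s: "smooth \<phi>" using assms test_functions_smooth by blast
  show ?thesis
    using C by (intro test_functionsI[of _ C] smooth_pderiv s assms)
      (simp_all add: frechet_eq_grad[OF smooth_differentiable[OF s]])
qed

lemma smooth_grad_inner: "smooth f \<Longrightarrow> b \<in> Basis \<Longrightarrow> smooth (\<lambda>x. grad f x \<bullet> b)"
  using smooth_pderiv[of f b] by (simp add: frechet_eq_grad[OF smooth_differentiable])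

lemma grad_test_function_inner:
  assumes "\<phi> \<in> test_functions U" "b \<in> Basis"
  shows "(\<lambda>x. grad \<phi> x \<bullet> b) \<in> test_functions U"
  using pderiv_test_function[OF assms] test_functions_smooth[OF assms(1)]
  by (simp add: frechet_eq_grad[OF smooth_differentiable])

lemma smooth_grad_continuous: "smooth f \<Longrightarrow> continuous_on UNIV (grad f)"
  unfolding grad_def[abs_def]
  by (intro continuous_intros smooth_continuous smooth_pderiv)

lemma test_function_mult:
  assumes "\<phi> \<in> test_functions U" "smooth g"
  shows "(\<lambda>x. g x * \<phi> x) \<in> test_functions U"
proof -
  obtain C where "compact C" "C \<subseteq> U" "\<And>x. x \<notin> C \<Longrightarrow> \<phi> x = 0"
    using test_functionsE[OF assms(1)] by metis
  then show ?thesis using smooth_mult[OF assms(2) test_functions_smooth[OF assms(1)]]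
    by (intro test_functionsI[of _ C]) auto
qed

lemma test_function_add:
  assumes "\<phi> \<in> test_functions U" "\<psi> \<in> test_functions U"
  shows "(\<lambda>x. \<phi> x + \<psi> x) \<in> test_functions U"
proof -
  obtain C where "compact C" "C \<subseteq> U" "\<And>x. x \<notin> C \<Longrightarrow> \<phi> x = 0"
    using test_functionsE[OF assms(1)] by metis
  moreover obtain C' where "compact C'" "C' \<subseteq> U" "\<And>x. x \<notin> C' \<Longrightarrow> \<psi> x = 0"
    using test_functionsE[OF assms(2)] by metis
  ultimately show ?thesis
    using smooth_add[OF assms[THEN test_functions_smooth]]
    by (intro test_functionsI[of _ "C \<union> C'"]) auto
qed

lemma grad_mult: "smooth f \<Longrightarrow> smooth g \<Longrightarrow> grad (\<lambda>x. f x * g x) x = f x *\<^sub>R grad g x + g x *\<^sub>R grad f x"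
  by (rule grad_eqI) (auto intro!: derivative_eq_intros smooth_grad simp: inner_add_left)

lemma grad_add: "smooth f \<Longrightarrow> smooth g \<Longrightarrow> grad (\<lambda>x. f x + g x) x = grad f x + grad g x"
  by (rule grad_eqI) (auto intro!: derivative_eq_intros smooth_grad simp: inner_add_left)

lemma grad_cmult: "smooth f \<Longrightarrow> grad (\<lambda>x. c * f x) x = c *\<^sub>R grad f x"
  by (rule grad_eqI) (auto intro!: derivative_eq_intros smooth_grad)

lemma grad_compose:
  assumes "smooth f" "(g has_real_derivative g') (at (f x))"
  shows "grad (\<lambda>x. g (f x)) x = g' *\<^sub>R grad f x"
  by (rule grad_eqI)
    (auto intro!: derivative_eq_intros has_derivative_compose[OF smooth_grad[OF assms(1)] assms(2)[THEN has_field_derivative_imp_has_derivative]])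

text \<open>The squared norm keeps the function smooth at the origin. It equals 1 up to radius
  \<open>R\<close> and vanishes beyond \<open>2 * R\<close> (in fact already beyond
  \<open>sqrt 2 * R\<close>).\<close>

definition cutoff :: "real \<Rightarrow> 'a::euclidean_space \<Rightarrow> real" where
  "cutoff R x = smooth_step (2 - (x \<bullet> x) / R\<^sup>2)"

lemma smooth_cutoff: "smooth (cutoff R)"
  unfolding cutoff_def[abs_def] divide_inverse
  by (rule smooth_compose[OF smooth_smooth_step smooth_diff[OF smooth_const smooth_mult[OF smooth_norm_sq smooth_const]]])

lemma cutoff_bounds: "0 \<le> cutoff R x" "cutoff R x \<le> 1"
  by (simp_all add: cutoff_def smooth_step_bounds)

lemma cutoff_eq_1: "R > 0 \<Longrightarrow> norm x \<le> R \<Longrightarrow> cutoff R x = 1"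
  unfolding cutoff_def
  by (intro smooth_step_eq) (simp add: field_simps power_mono flip: power2_norm_eq_inner)

lemma cutoff_eq_0:
  assumes "R > 0" "norm x \<ge> 2 * R" shows "cutoff R x = 0"
proof -
  have "(2 * R)\<^sup>2 \<le> (norm x)\<^sup>2" using assms by (intro power_mono) auto
  then have "4 * R\<^sup>2 \<le> x \<bullet> x"
    by (simp add: power_mult_distrib power2_norm_eq_inner)
  then have "4 \<le> (x \<bullet> x) / R\<^sup>2" using assms by (simp add: pos_le_divide_eq)
  then show ?thesis unfolding cutoff_def
    by (intro smooth_step_eq) simp
qed

lemma cutoff_test_function: "R > 0 \<Longrightarrow> cutoff R \<in> test_functions UNIV"
  by (rule test_functionsI[of _ "cball 0 (2*R)"]) (auto simp: smooth_cutoff cutoff_eq_0 dist_norm)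

section \<open>Square integrable functions\<close>

text \<open>If the square is not integrable the Bochner integral is 0, and so is this value; the
  estimates below therefore carry membership in \<open>L2\<close> as a hypothesis.\<close>

definition l2norm :: "'a::euclidean_space set \<Rightarrow> ('a \<Rightarrow> 'b::euclidean_space) \<Rightarrow> real" where
  "l2norm \<Omega> f = sqrt (\<integral>x. (norm (f x))\<^sup>2 \<partial>lebesgue_on \<Omega>)"

lemma l2norm_nonneg [simp]: "0 \<le> l2norm \<Omega> f"
  by (simp add: l2norm_def)

lemma l2norm_sq: "(l2norm \<Omega> f)\<^sup>2 = (\<integral>x. (norm (f x))\<^sup>2 \<partial>lebesgue_on \<Omega>)"
  by (simp add: l2norm_def)

lemma L2_measurable: "f \<in> L2 \<Omega> \<Longrightarrow> f \<in> borel_measurable (lebesgue_on \<Omega>)"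
  and L2_integrable_sq: "f \<in> L2 \<Omega> \<Longrightarrow> integrable (lebesgue_on \<Omega>) (\<lambda>x. (norm (f x))\<^sup>2)"
  by (simp_all add: L2_def)

lemma inner_le_sq: "norm (a \<bullet> b) \<le> norm ((norm a)\<^sup>2 + (norm b)\<^sup>2)" for a b :: "'b::real_inner"
proof -
  have "norm (a \<bullet> b) \<le> norm a * norm b" by (simp add: Cauchy_Schwarz_ineq2)
  also have "\<dots> \<le> (norm a)\<^sup>2 + (norm b)\<^sup>2"
    using sum_squares_bound[of "norm a" "norm b"] mult_nonneg_nonneg[OF norm_ge_zero norm_ge_zero, of a b] by linarith
  finally show ?thesis by simp
qed

lemma L2_inner_integrable:
  assumes "f \<in> L2 \<Omega>" "g \<in> L2 \<Omega>"
  shows "integrable (lebesgue_on \<Omega>) (\<lambda>x. f x \<bullet> g x)"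
  using assms[THEN L2_measurable] inner_le_sq
  by (intro Bochner_Integration.integrable_bound[OF Bochner_Integration.integrable_add[OF assms[THEN L2_integrable_sq]]]
      borel_measurable_inner AE_I2) auto

lemma L2_mult_integrable:
  fixes f g :: "'a::euclidean_space \<Rightarrow> real"
  assumes "f \<in> L2 \<Omega>" "g \<in> L2 \<Omega>"
  shows "integrable (lebesgue_on \<Omega>) (\<lambda>x. f x * g x)"
  using L2_inner_integrable[OF assms] by simp

lemma L2_bound:
  assumes "g \<in> L2 \<Omega>" "f \<in> borel_measurable (lebesgue_on \<Omega>)"
    "AE x in lebesgue_on \<Omega>. norm (f x) \<le> norm (g x)"
  shows "f \<in> L2 \<Omega>"
proof -
  have "integrable (lebesgue_on \<Omega>) (\<lambda>x. (norm (f x))\<^sup>2)"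
  proof (rule Bochner_Integration.integrable_bound[OF L2_integrable_sq[OF assms(1)]])
    show "AE x in lebesgue_on \<Omega>. norm ((norm (f x))\<^sup>2) \<le> norm ((norm (g x))\<^sup>2)"
      using assms(3) by eventually_elim (auto intro: power_mono)
  qed (use assms(2) in measurable)
  then show ?thesis using assms(2) by (simp add: L2_def)
qed

lemma l2norm_mono:
  assumes "g \<in> L2 \<Omega>" "f \<in> borel_measurable (lebesgue_on \<Omega>)"
    "AE x in lebesgue_on \<Omega>. norm (f x) \<le> norm (g x)"
  shows "l2norm \<Omega> f \<le> l2norm \<Omega> g"
  unfolding l2norm_def
proof (intro real_sqrt_le_mono integral_mono_AE L2_integrable_sq assms(1) L2_bound[OF assms])
  show "AE x in lebesgue_on \<Omega>. (norm (f x))\<^sup>2 \<le> (norm (g x))\<^sup>2"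
    using assms(3) by eventually_elim (auto intro: power_mono)
qed

lemma L2_add: 
  assumes "f \<in> L2 \<Omega>" "g \<in> L2 \<Omega>" shows "(\<lambda>x. f x + g x) \<in> L2 \<Omega>"
proof -
  have *: "(norm (f x + g x))\<^sup>2 = (norm (f x))\<^sup>2 + 2 * (f x \<bullet> g x) + (norm (g x))\<^sup>2" for x
    by (simp add: power2_norm_eq_inner algebra_simps inner_commute)
  show ?thesis unfolding L2_def mem_Collect_eq *
    using assms[THEN L2_measurable]
    by (intro conjI Bochner_Integration.integrable_add integrable_mult_right L2_inner_integrable assms
        assms[THEN L2_integrable_sq]) auto
qed

lemma L2_scaleR: 
  assumes "f \<in> L2 \<Omega>" shows "(\<lambda>x. c *\<^sub>R f x) \<in> L2 \<Omega>"
  using L2_measurable[OF assms] L2_integrable_sq[OF assms] unfolding L2_def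
  by (simp add: power_mult_distrib)

lemma L2_cmult: "f \<in> L2 \<Omega> \<Longrightarrow> (\<lambda>x. c * f x) \<in> L2 \<Omega>" for f :: "_ \<Rightarrow> real"
  using L2_scaleR[of f \<Omega> c] by simp

lemma L2_uminus: "f \<in> L2 \<Omega> \<Longrightarrow> (\<lambda>x. - f x) \<in> L2 \<Omega>"
  using L2_scaleR[of f \<Omega> "-1"] by simp

lemma L2_diff: "f \<in> L2 \<Omega> \<Longrightarrow> g \<in> L2 \<Omega> \<Longrightarrow> (\<lambda>x. f x - g x) \<in> L2 \<Omega>"
  using L2_add[OF _ L2_uminus, of f \<Omega> g] by simp

lemma L2_zero [simp]: "(\<lambda>x. 0) \<in> L2 \<Omega>"
  by (simp add: L2_def)

lemma L2_norm: "f \<in> L2 \<Omega> \<Longrightarrow> (\<lambda>x. norm (f x)) \<in> L2 \<Omega>"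
  by (auto simp: L2_def)

lemma L2_component:
  assumes "f \<in> L2 \<Omega>" shows "(\<lambda>x. f x \<bullet> b) \<in> L2 \<Omega>"
proof (rule L2_bound[OF L2_scaleR[OF L2_norm[OF assms], of "norm b"]])
  show "AE x in lebesgue_on \<Omega>. norm (f x \<bullet> b) \<le> norm (norm b *\<^sub>R norm (f x))"
  proof (intro AE_I2)
    fix x show "norm (f x \<bullet> b) \<le> norm (norm b *\<^sub>R norm (f x))"
      using Cauchy_Schwarz_ineq2[of "f x" b] by (simp add: mult.commute)
  qed
qed (use L2_measurable[OF assms] in measurable)

lemma L2_mult_bounded:
  assumes "f \<in> L2 \<Omega>" "a \<in> borel_measurable (lebesgue_on \<Omega>)" "AE x in lebesgue_on \<Omega>. \<bar>a x\<bar> \<le> c"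
  shows "(\<lambda>x. a x *\<^sub>R f x) \<in> L2 \<Omega>" "l2norm \<Omega> (\<lambda>x. a x *\<^sub>R f x) \<le> l2norm \<Omega> (\<lambda>x. c *\<^sub>R f x)"
proof -
  have m: "(\<lambda>x. a x *\<^sub>R f x) \<in> borel_measurable (lebesgue_on \<Omega>)"
    using assms(2) L2_measurable[OF assms(1)] by measurable
  have b: "AE x in lebesgue_on \<Omega>. norm (a x *\<^sub>R f x) \<le> norm (c *\<^sub>R f x)"
    using assms(3) by eventually_elim (auto intro: mult_right_mono)
  show "(\<lambda>x. a x *\<^sub>R f x) \<in> L2 \<Omega>" "l2norm \<Omega> (\<lambda>x. a x *\<^sub>R f x) \<le> l2norm \<Omega> (\<lambda>x. c *\<^sub>R f x)"
    using L2_bound[OF L2_scaleR[OF assms(1)] m b] l2norm_mono[OF L2_scaleR[OF assms(1)] m b] by auto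
qed

lemma l2norm_scaleR: "l2norm \<Omega> (\<lambda>x. c *\<^sub>R f x) = \<bar>c\<bar> * l2norm \<Omega> f"
  unfolding l2norm_def by (simp add: power_mult_distrib real_sqrt_mult)

lemma l2norm_minus_commute: "l2norm \<Omega> (\<lambda>x. f x - g x) = l2norm \<Omega> (\<lambda>x. g x - f x)"
  unfolding l2norm_def by (simp add: norm_minus_commute)

lemma l2norm_norm: "l2norm \<Omega> (\<lambda>x. norm (f x)) = l2norm \<Omega> f"
  by (simp add: l2norm_def)

lemma l2norm_eq_0:
  assumes "f \<in> L2 \<Omega>" "l2norm \<Omega> f = 0" shows "AE x in lebesgue_on \<Omega>. f x = 0"
proof -
  have "(\<integral>x. (norm (f x))\<^sup>2 \<partial>lebesgue_on \<Omega>) = 0"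
    using assms(2) l2norm_sq[of \<Omega> f] by simp
  then have "AE x in lebesgue_on \<Omega>. (norm (f x))\<^sup>2 = 0"
    using integral_nonneg_eq_0_iff_AE[OF L2_integrable_sq[OF assms(1)]] by simp
  then show ?thesis by eventually_elim simp
qed

text \<open>Young's inequality with the weights \<open>B / A\<close> and \<open>A / B\<close>,
  integrated, gives exactly \<open>A * B\<close>. The case of a vanishing norm is separate because
  the weights divide by the norms.\<close>

lemma L2_Cauchy_Schwarz:
  assumes f: "f \<in> L2 \<Omega>" and g: "g \<in> L2 \<Omega>"
  shows "(\<integral>x. norm (f x) * norm (g x) \<partial>lebesgue_on \<Omega>) \<le> l2norm \<Omega> f * l2norm \<Omega> g"
proof (cases "l2norm \<Omega> f = 0 \<or> l2norm \<Omega> g = 0")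
  case True
  then have "AE x in lebesgue_on \<Omega>. norm (f x) * norm (g x) = 0"
  proof
    assume "l2norm \<Omega> f = 0" from l2norm_eq_0[OF f this] show ?thesis by eventually_elim simp
  next
    assume "l2norm \<Omega> g = 0" from l2norm_eq_0[OF g this] show ?thesis by eventually_elim simp
  qed
  then have "(\<integral>x. norm (f x) * norm (g x) \<partial>lebesgue_on \<Omega>) = 0"
    by (rule integral_eq_zero_AE)
  then show ?thesis by simp
next
  case False
  define A B where "A = l2norm \<Omega> f" and "B = l2norm \<Omega> g"
  have AB: "A > 0" "B > 0" using False by (simp_all add: A_def B_def less_le)
  have "norm (f x) * norm (g x) \<le> (B / A / 2) * (norm (f x))\<^sup>2 + (A / B / 2) * (norm (g x))\<^sup>2" for x
  proof -
    have "0 \<le> (B * norm (f x) - A * norm (g x))\<^sup>2" by simp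
    then have "2 * (A * B) * (norm (f x) * norm (g x)) \<le> B\<^sup>2 * (norm (f x))\<^sup>2 + A\<^sup>2 * (norm (g x))\<^sup>2"
      by (simp add: power2_eq_square algebra_simps)
    also have "\<dots> = 2 * (A * B) * ((B / A / 2) * (norm (f x))\<^sup>2 + (A / B / 2) * (norm (g x))\<^sup>2)"
      using AB by (simp add: field_simps power2_eq_square)
    finally show ?thesis using AB by (subst (asm) mult_le_cancel_left_pos) auto
  qed
  then have "(\<integral>x. norm (f x) * norm (g x) \<partial>lebesgue_on \<Omega>)
      \<le> (\<integral>x. (B / A / 2) * (norm (f x))\<^sup>2 + (A / B / 2) * (norm (g x))\<^sup>2 \<partial>lebesgue_on \<Omega>)"
    using L2_mult_integrable[OF L2_norm[OF f] L2_norm[OF g]]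
    by (intro integral_mono) (auto intro!: Bochner_Integration.integrable_add integrable_mult_right L2_integrable_sq f g)
  also have "\<dots> = (B / A / 2) * A\<^sup>2 + (A / B / 2) * B\<^sup>2"
    using L2_integrable_sq[OF f] L2_integrable_sq[OF g] by (simp add: A_def B_def l2norm_sq)
  also have "\<dots> = A * B" using AB by (simp add: power2_eq_square)
  finally show ?thesis by (simp add: A_def B_def)
qed

lemma L2_inner_le:
  assumes f: "f \<in> L2 \<Omega>" and g: "g \<in> L2 \<Omega>"
  shows "\<bar>\<integral>x. f x \<bullet> g x \<partial>lebesgue_on \<Omega>\<bar> \<le> l2norm \<Omega> f * l2norm \<Omega> g"
proof -
  have "\<bar>\<integral>x. f x \<bullet> g x \<partial>lebesgue_on \<Omega>\<bar> \<le> (\<integral>x. norm (f x) * norm (g x) \<partial>lebesgue_on \<Omega>)"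
    by (rule order_trans[OF integral_abs_bound
          integral_mono[OF integrable_abs[OF L2_inner_integrable[OF f g]] L2_mult_integrable[OF L2_norm[OF f] L2_norm[OF g]]]])
      (rule Cauchy_Schwarz_ineq2)
  with L2_Cauchy_Schwarz[OF f g] show ?thesis by linarith
qed

lemma L2_mult_le:
  fixes f g :: "'a::euclidean_space \<Rightarrow> real"
  assumes f: "f \<in> L2 \<Omega>" and g: "g \<in> L2 \<Omega>"
  shows "\<bar>\<integral>x. f x * g x \<partial>lebesgue_on \<Omega>\<bar> \<le> l2norm \<Omega> f * l2norm \<Omega> g"
  using L2_inner_le[OF f g] by simp

lemma l2norm_triangle:
  assumes f: "f \<in> L2 \<Omega>" and g: "g \<in> L2 \<Omega>"
  shows "l2norm \<Omega> (\<lambda>x. f x + g x) \<le> l2norm \<Omega> f + l2norm \<Omega> g"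
proof (rule power2_le_imp_le)
  have "(norm (f x + g x))\<^sup>2 = (norm (f x))\<^sup>2 + 2 * (f x \<bullet> g x) + (norm (g x))\<^sup>2" for x
    by (simp add: power2_norm_eq_inner algebra_simps inner_commute)
  then have "(l2norm \<Omega> (\<lambda>x. f x + g x))\<^sup>2 = (l2norm \<Omega> f)\<^sup>2 + 2 * (\<integral>x. f x \<bullet> g x \<partial>lebesgue_on \<Omega>) + (l2norm \<Omega> g)\<^sup>2"
    using L2_integrable_sq[OF f] L2_integrable_sq[OF g] L2_inner_integrable[OF f g] by (simp add: l2norm_sq)
  also have "\<dots> \<le> (l2norm \<Omega> f + l2norm \<Omega> g)\<^sup>2"
    using L2_inner_le[OF f g] by (simp add: power2_sum)
  finally show "(l2norm \<Omega> (\<lambda>x. f x + g x))\<^sup>2 \<le> (l2norm \<Omega> f + l2norm \<Omega> g)\<^sup>2" .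
qed simp

lemma l2norm_triangle_diff:
  assumes f: "f \<in> L2 \<Omega>" and g: "g \<in> L2 \<Omega>" and h: "h \<in> L2 \<Omega>"
  shows "l2norm \<Omega> (\<lambda>x. f x - h x) \<le> l2norm \<Omega> (\<lambda>x. f x - g x) + l2norm \<Omega> (\<lambda>x. g x - h x)"
  using l2norm_triangle[OF L2_diff[OF f g] L2_diff[OF g h]] by simp

lemma l2norm_le_diff:
  assumes f: "f \<in> L2 \<Omega>" and g: "g \<in> L2 \<Omega>"
  shows "l2norm \<Omega> f \<le> l2norm \<Omega> (\<lambda>x. f x - g x) + l2norm \<Omega> g"
  using l2norm_triangle[OF L2_diff[OF f g] g] by simp

lemma l2norm_sum:
  "finite I \<Longrightarrow> (\<And>i. i \<in> I \<Longrightarrow> f i \<in> L2 \<Omega>) \<Longrightarrow>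
    (\<lambda>x. \<Sum>i\<in>I. f i x) \<in> L2 \<Omega> \<and> l2norm \<Omega> (\<lambda>x. \<Sum>i\<in>I. f i x) \<le> (\<Sum>i\<in>I. l2norm \<Omega> (f i))"
proof (induction I rule: finite_induct)
  case (insert i I)
  then have "(\<lambda>x. \<Sum>i\<in>I. f i x) \<in> L2 \<Omega>" "l2norm \<Omega> (\<lambda>x. \<Sum>i\<in>I. f i x) \<le> (\<Sum>i\<in>I. l2norm \<Omega> (f i))" "f i \<in> L2 \<Omega>"
    by auto
  then show ?case using insert.hyps l2norm_triangle[of "f i" \<Omega> "\<lambda>x. \<Sum>i\<in>I. f i x"]
    by (auto simp: L2_add)
qed (auto simp: l2norm_def)

lemma l2norm_components:
  assumes "f \<in> L2 \<Omega>"
  shows "l2norm \<Omega> f \<le> (\<Sum>b\<in>Basis. l2norm \<Omega> (\<lambda>x. f x \<bullet> b))"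
proof -
  have "l2norm \<Omega> (\<lambda>x. \<Sum>b\<in>Basis. (f x \<bullet> b) *\<^sub>R b) \<le> (\<Sum>b\<in>Basis. l2norm \<Omega> (\<lambda>x. (f x \<bullet> b) *\<^sub>R b))"
  proof (rule conjunct2[OF l2norm_sum])
    fix b :: 'b assume "b \<in> Basis"
    show "(\<lambda>x. (f x \<bullet> b) *\<^sub>R b) \<in> L2 \<Omega>"
    proof (rule L2_bound[OF L2_scaleR[OF L2_component[OF assms, of b], of "norm b"]])
      show "(\<lambda>x. (f x \<bullet> b) *\<^sub>R b) \<in> borel_measurable (lebesgue_on \<Omega>)"
        using L2_measurable[OF assms] by measurable
    qed (simp add: mult.commute)
  qed simp
  also have "\<dots> = (\<Sum>b\<in>Basis. l2norm \<Omega> (\<lambda>x. f x \<bullet> b))"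
    by (intro sum.cong refl) (simp add: l2norm_def)
  finally show ?thesis by (simp add: euclidean_representation)
qed

text \<open>The majorant bounds the differences \<open>F n - f\<close> rather than
  \<open>F n\<close>, so that for truncations the limit \<open>f\<close> itself can serve as
  majorant.\<close>

lemma L2_dominated:
  fixes f :: "'a::euclidean_space \<Rightarrow> 'b::euclidean_space"
  assumes g: "g \<in> L2 \<Omega>" and m: "\<And>n. F n \<in> borel_measurable (lebesgue_on \<Omega>)" "f \<in> borel_measurable (lebesgue_on \<Omega>)"
    and lim: "AE x in lebesgue_on \<Omega>. (\<lambda>n. F n x) \<longlonglongrightarrow> f x"
    and bd: "\<And>n. AE x in lebesgue_on \<Omega>. norm (F n x - f x) \<le> norm (g x)"
  shows "(\<lambda>n. l2norm \<Omega> (\<lambda>x. F n x - f x)) \<longlonglongrightarrow> 0"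
proof -
  have "(\<lambda>n. \<integral>x. (norm (F n x - f x))\<^sup>2 \<partial>lebesgue_on \<Omega>) \<longlonglongrightarrow> (\<integral>x. 0 \<partial>lebesgue_on \<Omega>)"
  proof (rule integral_dominated_convergence[where w="\<lambda>x. (norm (g x))\<^sup>2"])
    show "AE x in lebesgue_on \<Omega>. (\<lambda>n. (norm (F n x - f x))\<^sup>2) \<longlonglongrightarrow> 0"
      using lim
    proof eventually_elim
      case (elim x)
      then have "(\<lambda>n. F n x - f x) \<longlonglongrightarrow> 0" by (simp add: LIM_zero)
      then show ?case using tendsto_power[OF tendsto_norm_zero, of "\<lambda>n. F n x - f x" sequentially 2] by simp
    qed
    show "AE x in lebesgue_on \<Omega>. norm ((norm (F n x - f x))\<^sup>2) \<le> (norm (g x))\<^sup>2" for n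
      using bd[of n] by eventually_elim (auto intro: power_mono)
  qed (use m L2_integrable_sq[OF g] in auto)
  then show ?thesis unfolding l2norm_def
    using tendsto_real_sqrt[of _ 0 sequentially] by simp
qed

lemma L2_subset:
  assumes "f \<in> L2 \<Omega>" "\<Omega>' \<subseteq> \<Omega>" "\<Omega> \<in> sets lebesgue" "\<Omega>' \<in> sets lebesgue"
  shows "f \<in> L2 \<Omega>'" "l2norm \<Omega>' f \<le> l2norm \<Omega> f"
proof -
  have m: "f \<in> borel_measurable (lebesgue_on \<Omega>')"
    using L2_measurable[OF assms(1)] assms(2) measurable_restrict_mono by blast
  have s: "set_integrable lebesgue \<Omega> (\<lambda>x. (norm (f x))\<^sup>2)"
    using L2_integrable_sq[OF assms(1)] assms(3) by (simp add: set_integrable_def integrable_restrict_space)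
  then have s': "set_integrable lebesgue \<Omega>' (\<lambda>x. (norm (f x))\<^sup>2)"
    using assms set_integrable_subset by blast
  then have "integrable (lebesgue_on \<Omega>') (\<lambda>x. (norm (f x))\<^sup>2)"
    using assms(4) by (simp add: set_integrable_def integrable_restrict_space)
  then show "f \<in> L2 \<Omega>'" using m by (simp add: L2_def)
  have "(LINT x:\<Omega>'|lebesgue. (norm (f x))\<^sup>2) \<le> (LINT x:\<Omega>|lebesgue. (norm (f x))\<^sup>2)"
    using s s' assms(2) unfolding set_integrable_def set_lebesgue_integral_def
    by (intro integral_mono) (auto simp: indicator_def)
  then show "l2norm \<Omega>' f \<le> l2norm \<Omega> f"
    using assms(3,4) unfolding l2norm_def set_lebesgue_integral_def
    by (auto simp: integral_restrict_space intro!: real_sqrt_le_mono)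
qed

section \<open>Continuous functions with compact support\<close>

lemma continuous_compact_support_integrable:
  fixes f :: "'a::euclidean_space \<Rightarrow> 'b::euclidean_space"
  assumes "continuous_on UNIV f" "compact C" "\<And>x. x \<notin> C \<Longrightarrow> f x = 0"
  shows "integrable lebesgue f"
proof -
  have "integrable lborel (\<lambda>x. indicator C x *\<^sub>R f x)"
    by (intro borel_integrable_compact continuous_on_subset[OF assms(1)] assms(2)) auto
  then have "integrable lebesgue (\<lambda>x. indicator C x *\<^sub>R f x)"
    by (subst integrable_completion) (auto intro: borel_measurable_integrable)
  moreover have "(\<lambda>x. indicator C x *\<^sub>R f x) = f" using assms(3) by (auto simp: indicator_def)
  ultimately show ?thesis by simp
qed

lemma continuous_compact_support_L2:
  fixes f :: "'a::euclidean_space \<Rightarrow> 'b::euclidean_space"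
  assumes "continuous_on UNIV f" "compact C" "\<And>x. x \<notin> C \<Longrightarrow> f x = 0" "\<Omega> \<in> sets lebesgue"
  shows "f \<in> L2 \<Omega>"
proof -
  have "integrable lebesgue (\<lambda>x. (norm (f x))\<^sup>2)"
    using assms by (intro continuous_compact_support_integrable[of _ C] continuous_intros) auto
  then have "f \<in> L2 UNIV" unfolding L2_def
    using assms(1) by (auto simp: integrable_restrict_space continuous_imp_measurable_on_sets_lebesgue)
  then show ?thesis using L2_subset[OF _ subset_UNIV] assms(4) by auto
qed

lemma test_function_integrable:
  assumes "\<phi> \<in> test_functions U" shows "integrable lebesgue \<phi>"
proof -
  obtain C where "compact C" "\<And>x. x \<notin> C \<Longrightarrow> \<phi> x = 0"
    using test_functionsE[OF assms] by metis
  then show ?thesis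
    by (intro continuous_compact_support_integrable[of _ C] smooth_continuous test_functions_smooth[OF assms])
qed

lemma test_function_L2:
  assumes "\<phi> \<in> test_functions U" "\<Omega> \<in> sets lebesgue"
  shows "\<phi> \<in> L2 \<Omega>" "grad \<phi> \<in> L2 \<Omega>"
proof -
  obtain C where C: "compact C" "\<And>x. x \<notin> C \<Longrightarrow> \<phi> x = 0" "\<And>x. x \<notin> C \<Longrightarrow> grad \<phi> x = 0"
    using test_functionsE[OF assms(1)] by metis
  show "\<phi> \<in> L2 \<Omega>" "grad \<phi> \<in> L2 \<Omega>"
    using C assms(2)
    by (auto intro!: continuous_compact_support_L2[of _ C] smooth_continuous smooth_grad_continuous
        test_functions_smooth[OF assms(1)])
qed

lemma compact_support_uniformly_continuous:
  fixes f :: "'a::euclidean_space \<Rightarrow> 'b::euclidean_space"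
  assumes "continuous_on UNIV f" "compact C" "\<And>x. x \<notin> C \<Longrightarrow> f x = 0"
  shows "uniformly_continuous_on UNIV f"
  unfolding uniformly_continuous_on_def
proof (intro allI impI)
  fix e :: real assume "e > 0"
  \<comment> \<open>The unit neighbourhood of \<open>C\<close>: if two points have distance below 1
    and one lies in \<open>C\<close>, both lie in this compact set.\<close>
  define K where "K = {x + y | x y. x \<in> C \<and> y \<in> cball 0 1}"
  have "compact K" unfolding K_def using assms(2) by (intro compact_sums) auto
  then have "uniformly_continuous_on K f"
    by (intro compact_uniformly_continuous continuous_on_subset[OF assms(1)] subset_UNIV)
  then obtain d where d: "d > 0" "\<And>x y. x \<in> K \<Longrightarrow> y \<in> K \<Longrightarrow> dist y x < d \<Longrightarrow> dist (f y) (f x) < e"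
    using \<open>e > 0\<close> unfolding uniformly_continuous_on_def by blast
  have in_C: "y \<in> K" if "x \<in> C" "dist y x < 1" for x y
    unfolding K_def mem_Collect_eq using that
    by (intro exI[of _ x] exI[of _ "y - x"]) (auto simp: dist_norm norm_minus_commute)
  have "dist (f y) (f x) < e" if xy: "dist y x < min d 1" for x y
  proof (cases "x \<in> C \<or> y \<in> C")
    case True
    then have "x \<in> K" "y \<in> K"
      using in_C[of x y] in_C[of y x] in_C[of x x] in_C[of y y] xy by (auto simp: dist_commute)
    then show ?thesis using d xy by auto
  next
    case False
    then show ?thesis using assms(3) \<open>e > 0\<close> by simp
  qed
  then show "\<exists>d>0. \<forall>x\<in>UNIV. \<forall>x'\<in>UNIV. dist x' x < d \<longrightarrow> dist (f x') (f x) < e"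
    using d(1) by (intro exI[of _ "min d 1"]) auto
qed

lemma test_function_bounded:
  assumes "\<phi> \<in> test_functions U"
  obtains B where "B > 0" "\<And>x. \<bar>\<phi> x\<bar> \<le> B" "\<And>x. norm (grad \<phi> x) \<le> B"
proof -
  obtain C where C: "compact C" "\<And>x. x \<notin> C \<Longrightarrow> \<phi> x = 0" "\<And>x. x \<notin> C \<Longrightarrow> grad \<phi> x = 0"
    using test_functionsE[OF assms] by metis
  have s: "smooth \<phi>" by (rule test_functions_smooth[OF assms])
  have "bounded (\<phi> ` C)" "bounded (grad \<phi> ` C)"
    by (intro compact_imp_bounded compact_continuous_image C(1)
        continuous_on_subset[OF smooth_continuous[OF s]] continuous_on_subset[OF smooth_grad_continuous[OF s]] subset_UNIV)+
  then obtain a b where "\<And>x. x \<in> C \<Longrightarrow> \<bar>\<phi> x\<bar> \<le> a" "\<And>x. x \<in> C \<Longrightarrow> norm (grad \<phi> x) \<le> b"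
    unfolding bounded_iff by (metis imageI real_norm_def)
  note ab = this
  show thesis
  proof (rule that[of "max 1 (max a b)"])
    show "\<bar>\<phi> x\<bar> \<le> max 1 (max a b)" for x
      using ab(1)[of x] C(2)[of x] by (cases "x \<in> C") auto
    show "norm (grad \<phi> x) \<le> max 1 (max a b)" for x
      using ab(2)[of x] C(3)[of x] by (cases "x \<in> C") auto
  qed simp
qed

section \<open>Parametric integrals of test functions\<close>

lemma parametric_integrable:
  fixes \<Phi> :: "'a::euclidean_space \<times> 'c::euclidean_space \<Rightarrow> real"
  assumes "\<Phi> \<in> test_functions UNIV" "integrable lebesgue z"
  shows "integrable lebesgue (\<lambda>y. \<Phi> (x, y) * z y)"
proof -
  obtain B where B: "\<And>x. \<bar>\<Phi> x\<bar> \<le> B" "B > 0" using test_function_bounded[OF assms(1)] by metis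
  have "continuous_on UNIV (\<lambda>y. \<Phi> (x, y))"
    by (rule continuous_on_compose2[OF smooth_continuous[OF test_functions_smooth[OF assms(1)]]])
      (auto intro!: continuous_intros)
  then have "(\<lambda>y. \<Phi> (x, y)) \<in> borel_measurable lebesgue"
    using continuous_imp_measurable_on_sets_lebesgue[of UNIV] by (simp add: lebesgue_on_UNIV_eq)
  moreover have "norm (\<Phi> (x, y) * z y) \<le> norm (B * z y)" for y
    using B(1)[of "(x, y)"] B(2) by (simp add: abs_mult mult_right_mono)
  ultimately show ?thesis
    using assms(2) by (intro Bochner_Integration.integrable_bound[OF integrable_mult_right[OF assms(2), of B]])
      (auto intro!: borel_measurable_times borel_measurable_integrable)
qed

text \<open>Because \<open>grad \<Phi>\<close> is uniformly continuous, the linearisation error of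
  \<open>\<Phi> (x, c)\<close> in \<open>x\<close> is at most \<open>e / I\<close> times the
  increment, uniformly in \<open>c\<close>. Integrated against the absolute value of
  \<open>z\<close>, whose integral is below \<open>I\<close>, it becomes at most \<open>e\<close>
  times the increment. The summand 1 in \<open>I\<close> keeps it positive when \<open>z\<close>
  vanishes.\<close>

lemma parametric_integral_has_derivative:
  fixes \<Phi> :: "'a::euclidean_space \<times> 'c::euclidean_space \<Rightarrow> real"
  assumes \<Phi>: "\<Phi> \<in> test_functions UNIV" and z: "integrable lebesgue z"
  shows "((\<lambda>x. \<integral>y. \<Phi> (x, y) * z y \<partial>lebesgue) has_derivative
     (\<lambda>h. \<Sum>b\<in>Basis. (h \<bullet> b) * (\<integral>y. (grad \<Phi> (x, y) \<bullet> (b, 0)) * z y \<partial>lebesgue))) (at x)"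
  unfolding has_derivative_at_alt
proof (intro conjI allI impI)
  show "bounded_linear (\<lambda>h. \<Sum>b\<in>Basis. (h \<bullet> b) * (\<integral>y. (grad \<Phi> (x, y) \<bullet> (b, 0)) * z y \<partial>lebesgue))"
    by (intro bounded_linear_sum bounded_linear_mult_left[THEN bounded_linear_compose] bounded_linear_inner_left)
  have s: "smooth \<Phi>" using \<Phi> by (rule test_functions_smooth)
  have int_b: "integrable lebesgue (\<lambda>y. (grad \<Phi> (x, y) \<bullet> (b, 0)) * z y)" if "b \<in> Basis" for b x
  proof -
    have "(b, 0::'c) \<in> Basis" using that by (auto simp: Basis_prod_def)
    from parametric_integrable[OF grad_test_function_inner[OF \<Phi> this] z] show ?thesis .
  qed
  fix e :: real assume "e > 0"
  define I where "I = (\<integral>y. \<bar>z y\<bar> \<partial>lebesgue) + 1"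
  have I: "I > 0" unfolding I_def by (intro add_nonneg_pos integral_nonneg_AE) auto
  obtain C where C: "compact C" "\<And>x. x \<notin> C \<Longrightarrow> grad \<Phi> x = 0"
    using test_functionsE[OF \<Phi>] by metis
  have "uniformly_continuous_on UNIV (grad \<Phi>)"
    using C by (intro compact_support_uniformly_continuous[of _ C] smooth_grad_continuous[OF s])
  then obtain d where d: "d > 0" "\<And>x y. dist y x < d \<Longrightarrow> dist (grad \<Phi> y) (grad \<Phi> x) < e / I"
    using \<open>e > 0\<close> I unfolding uniformly_continuous_on_def by (metis UNIV_I divide_pos_pos)
  show "\<exists>d>0. \<forall>y. norm (y - x) < d \<longrightarrow>
     norm ((\<integral>c. \<Phi> (y, c) * z c \<partial>lebesgue) - (\<integral>c. \<Phi> (x, c) * z c \<partial>lebesgue)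
       - (\<Sum>b\<in>Basis. ((y - x) \<bullet> b) * (\<integral>c. (grad \<Phi> (x, c) \<bullet> (b, 0)) * z c \<partial>lebesgue))) \<le> e * norm (y - x)"
  proof (intro exI[of _ d] conjI allI impI d(1))
    fix x' assume x': "norm (x' - x) < d"
    have sum_eq: "(\<Sum>b\<in>Basis. ((x' - x) \<bullet> b) * (grad \<Phi> (x, c) \<bullet> (b, 0))) = grad \<Phi> (x, c) \<bullet> (x' - x, 0)" for c
    proof -
      have "(\<Sum>b\<in>Basis. ((x' - x) \<bullet> b) * (grad \<Phi> (x, c) \<bullet> (b, 0))) = fst (grad \<Phi> (x, c)) \<bullet> (\<Sum>b\<in>Basis. ((x' - x) \<bullet> b) *\<^sub>R b)"
        by (simp add: inner_sum_right inner_prod_def)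
      also have "\<dots> = grad \<Phi> (x, c) \<bullet> (x' - x, 0)"
        by (simp only: euclidean_representation) (simp add: inner_prod_def)
      finally show ?thesis .
    qed
    have lin: "\<bar>\<Phi> (x', c) - \<Phi> (x, c) - grad \<Phi> (x, c) \<bullet> (x' - x, 0)\<bar> \<le> norm (x' - x) * (e / I)" for c
    proof -
      let ?S = "ball (x, c) d"
      have "norm (\<Phi> (x', c) - \<Phi> (x, c) - grad \<Phi> (x, c) \<bullet> ((x', c) - (x, c))) \<le> norm ((x', c) - (x, c)) * (e / I)"
      proof (rule differentiable_bound_linearization[where S = ?S and f' = "\<lambda>u h. grad \<Phi> u \<bullet> h"])
        show "(\<Phi> has_derivative (\<lambda>h. grad \<Phi> u \<bullet> h)) (at u within ?S)" for u
          using smooth_grad[OF s] has_derivative_at_withinI by blast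
        show "(x, c) \<in> ?S" using d by simp
        show "(x, c) + t *\<^sub>R ((x', c) - (x, c)) \<in> ?S" if "t \<in> {0..1}" for t
        proof -
          have "norm (t *\<^sub>R (x' - x)) \<le> norm (x' - x)" using that by (simp add: mult_left_le_one_le)
          then show ?thesis using x' by (simp add: dist_norm norm_Pair)
        qed
        show "onorm ((\<lambda>h. grad \<Phi> u \<bullet> h) - (\<lambda>h. grad \<Phi> (x, c) \<bullet> h)) \<le> e / I" if "u \<in> ?S" for u
          unfolding fun_diff_def
        proof (rule onorm_bound)
          show "0 \<le> e / I" using \<open>e > 0\<close> I by simp
          fix h
          have "norm (grad \<Phi> u \<bullet> h - grad \<Phi> (x, c) \<bullet> h) = norm ((grad \<Phi> u - grad \<Phi> (x, c)) \<bullet> h)"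
            by (simp add: inner_diff_left)
          also have "\<dots> \<le> norm (grad \<Phi> u - grad \<Phi> (x, c)) * norm h"
            using Cauchy_Schwarz_ineq2 by auto
          also have "\<dots> \<le> e / I * norm h"
            using d(2)[of u "(x, c)"] that
            by (intro mult_right_mono) (auto simp: dist_norm norm_minus_commute intro: less_imp_le)
          finally show "norm (grad \<Phi> u \<bullet> h - grad \<Phi> (x, c) \<bullet> h) \<le> e / I * norm h" .
        qed
      qed
      then show ?thesis by (simp add: norm_Pair)
    qed
    have "(\<Sum>b\<in>Basis. ((x' - x) \<bullet> b) * (\<integral>c. (grad \<Phi> (x, c) \<bullet> (b, 0)) * z c \<partial>lebesgue))
        = (\<integral>c. (\<Sum>b\<in>Basis. ((x' - x) \<bullet> b) * ((grad \<Phi> (x, c) \<bullet> (b, 0)) * z c)) \<partial>lebesgue)"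
      using int_b by (simp add: integral_sum)
    also have "\<dots> = (\<integral>c. (grad \<Phi> (x, c) \<bullet> (x' - x, 0)) * z c \<partial>lebesgue)"
      by (simp add: sum_eq[symmetric] sum_distrib_right mult.assoc)
    finally have 1: "(\<Sum>b\<in>Basis. ((x' - x) \<bullet> b) * (\<integral>c. (grad \<Phi> (x, c) \<bullet> (b, 0)) * z c \<partial>lebesgue))
        = (\<integral>c. (grad \<Phi> (x, c) \<bullet> (x' - x, 0)) * z c \<partial>lebesgue)" .
    have int_x: "integrable lebesgue (\<lambda>c. (grad \<Phi> (x, c) \<bullet> (x' - x, 0)) * z c)"
      using int_b by (simp add: sum_eq[symmetric] sum_distrib_right mult.assoc)
    note ints = parametric_integrable[OF \<Phi> z] int_x
    have "(\<integral>c. \<Phi> (x', c) * z c \<partial>lebesgue) - (\<integral>c. \<Phi> (x, c) * z c \<partial>lebesgue)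
        - (\<integral>c. (grad \<Phi> (x, c) \<bullet> (x' - x, 0)) * z c \<partial>lebesgue)
        = (\<integral>c. (\<Phi> (x', c) - \<Phi> (x, c) - grad \<Phi> (x, c) \<bullet> (x' - x, 0)) * z c \<partial>lebesgue)"
      using ints by (simp add: left_diff_distrib)
    also have "\<bar>\<dots>\<bar> \<le> (\<integral>c. (norm (x' - x) * (e / I)) * \<bar>z c\<bar> \<partial>lebesgue)"
    proof (rule order_trans[OF integral_abs_bound integral_mono])
      show "integrable lebesgue (\<lambda>c. \<bar>(\<Phi> (x', c) - \<Phi> (x, c) - grad \<Phi> (x, c) \<bullet> (x' - x, 0)) * z c\<bar>)"
        using ints by (simp add: left_diff_distrib)
      show "integrable lebesgue (\<lambda>c. (norm (x' - x) * (e / I)) * \<bar>z c\<bar>)" using z by simp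
      show "\<bar>(\<Phi> (x', c) - \<Phi> (x, c) - grad \<Phi> (x, c) \<bullet> (x' - x, 0)) * z c\<bar> \<le> (norm (x' - x) * (e / I)) * \<bar>z c\<bar>" for c
        unfolding abs_mult by (intro mult_right_mono lin) simp
    qed
    also have "\<dots> = norm (x' - x) * (e / I) * (\<integral>c. \<bar>z c\<bar> \<partial>lebesgue)" by simp
    also have "\<dots> \<le> norm (x' - x) * (e / I) * I"
      using \<open>e > 0\<close> I by (intro mult_left_mono) (auto simp: I_def)
    also have "\<dots> = e * norm (x' - x)" using I by simp
    finally show "norm ((\<integral>c. \<Phi> (x', c) * z c \<partial>lebesgue) - (\<integral>c. \<Phi> (x, c) * z c \<partial>lebesgue)
       - (\<Sum>b\<in>Basis. ((x' - x) \<bullet> b) * (\<integral>c. (grad \<Phi> (x, c) \<bullet> (b, 0)) * z c \<partial>lebesgue))) \<le> e * norm (x' - x)"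
      unfolding 1 real_norm_def .
  qed
qed

text \<open>A partial derivative of such an integral is an integral of the same kind, with a partial
  derivative of \<Phi> in place of \<Phi>; so the class is closed and \<open>smooth_induct\<close>
  applies.\<close>

lemma parametric_integral_test_function:
  fixes \<Phi> :: "'a::euclidean_space \<times> 'c::euclidean_space \<Rightarrow> real"
  assumes \<Phi>: "\<Phi> \<in> test_functions UNIV" and z: "integrable lebesgue z"
  shows "smooth (\<lambda>x. \<integral>y. \<Phi> (x, y) * z y \<partial>lebesgue)"
    and "b \<in> Basis \<Longrightarrow> grad (\<lambda>x. \<integral>y. \<Phi> (x, y) * z y \<partial>lebesgue) x \<bullet> b = (\<integral>y. (grad \<Phi> (x, y) \<bullet> (b, 0)) * z y \<partial>lebesgue)"
proof -
  have pd: "pderiv_at b (\<lambda>x. \<integral>y. \<Phi> (x, y) * z y \<partial>lebesgue) = (\<lambda>x. \<integral>y. (grad \<Phi> (x, y) \<bullet> (b, 0)) * z y \<partial>lebesgue)"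
    if "b \<in> Basis" "\<Phi> \<in> test_functions UNIV" for b and \<Phi> :: "'a \<times> 'c \<Rightarrow> real"
  proof
    fix x
    show "pderiv_at b (\<lambda>x. \<integral>y. \<Phi> (x, y) * z y \<partial>lebesgue) x = (\<integral>y. (grad \<Phi> (x, y) \<bullet> (b, 0)) * z y \<partial>lebesgue)"
      using that(1) by (subst pderiv_eqI[OF parametric_integral_has_derivative[OF that(2) z]]) (simp add: inner_Basis if_distrib[where f="\<lambda>t. t * _"] cong: if_cong)
  qed
  show 1: "smooth (\<lambda>x. \<integral>y. \<Phi> (x, y) * z y \<partial>lebesgue)"
  proof (rule smooth_induct[of "\<lambda>g. \<exists>\<Phi>\<in>test_functions UNIV. g = (\<lambda>x. \<integral>y. \<Phi> (x, y) * z y \<partial>lebesgue)"])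
    show "\<exists>\<Phi>'\<in>test_functions UNIV. (\<lambda>x. \<integral>y. \<Phi> (x, y) * z y \<partial>lebesgue) = (\<lambda>x. \<integral>y. \<Phi>' (x, y) * z y \<partial>lebesgue)"
      using \<Phi> by blast
  next
    fix g :: "'a \<Rightarrow> real" assume "\<exists>\<Phi>\<in>test_functions UNIV. g = (\<lambda>x. \<integral>y. \<Phi> (x, y) * z y \<partial>lebesgue)"
    then obtain \<Psi> where \<Psi>: "\<Psi> \<in> test_functions UNIV" "g = (\<lambda>x. \<integral>y. \<Psi> (x, y) * z y \<partial>lebesgue)" by blast
    have "g differentiable (at x)" for x
      unfolding \<Psi>(2) using parametric_integral_has_derivative[OF \<Psi>(1) z] by (rule differentiableI)
    moreover have "\<exists>\<Phi>\<in>test_functions UNIV. pderiv_at b g = (\<lambda>x. \<integral>y. \<Phi> (x, y) * z y \<partial>lebesgue)" if b: "b \<in> Basis" for b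
    proof (rule bexI)
      show "pderiv_at b g = (\<lambda>x. \<integral>y. (\<lambda>u. grad \<Psi> u \<bullet> (b, 0)) (x, y) * z y \<partial>lebesgue)"
        unfolding \<Psi>(2) using pd[OF b \<Psi>(1)] by simp
      show "(\<lambda>u. grad \<Psi> u \<bullet> (b, 0)) \<in> test_functions UNIV"
        using b by (intro grad_test_function_inner[OF \<Psi>(1)]) (auto simp: Basis_prod_def)
    qed
    ultimately show "(\<forall>x. g differentiable (at x)) \<and> (\<forall>b\<in>Basis. \<exists>\<Phi>\<in>test_functions UNIV. pderiv_at b g = (\<lambda>x. \<integral>y. \<Phi> (x, y) * z y \<partial>lebesgue))"
      by blast
  qed
  show "grad (\<lambda>x. \<integral>y. \<Phi> (x, y) * z y \<partial>lebesgue) x \<bullet> b = (\<integral>y. (grad \<Phi> (x, y) \<bullet> (b, 0)) * z y \<partial>lebesgue)" if "b \<in> Basis"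
    by (rule trans[OF sym[OF frechet_eq_grad[OF smooth_differentiable[OF 1]]] fun_cong[OF pd[OF that \<Phi>]]])
qed

section \<open>Mollification\<close>

text \<open>The cutoff with parameter \<open>r / 2\<close> vanishes beyond radius \<open>r\<close>,
  so the kernel lives on the ball of radius \<open>r\<close>; the denominator gives it mass
  1.\<close>

definition mollifier :: "real \<Rightarrow> 'a::euclidean_space \<Rightarrow> real" where
  "mollifier r x = cutoff (r / 2) x / (\<integral>y. cutoff (r / 2) y \<partial>(lebesgue :: 'a measure))"

definition mollify :: "real \<Rightarrow> ('a::euclidean_space \<Rightarrow> real) \<Rightarrow> 'a \<Rightarrow> real" where
  "mollify r f x = (\<integral>y. mollifier r (x - y) * f y \<partial>lebesgue)"

lemma integral_cutoff_pos: "R > 0 \<Longrightarrow> 0 < (\<integral>y. cutoff R y \<partial>(lebesgue :: 'a::euclidean_space measure))"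
proof -
  assume R: "R > 0"
  have "0 < measure lebesgue (cball (0::'a) R)"
    using R content_cball_pos[of R] by simp
  also have "\<dots> = (\<integral>y. indicator (cball (0::'a) R) y \<partial>lebesgue)" by simp
  also have "\<dots> \<le> (\<integral>y. cutoff R y \<partial>(lebesgue :: 'a measure))"
  proof (rule integral_mono[of lebesgue "indicat_real (cball (0::'a) R)" "cutoff R"])
    show "integrable lebesgue (indicat_real (cball (0::'a) R))"
      using lmeasurable_cball lmeasurable_iff_integrable by blast
    show "integrable lebesgue (cutoff R :: 'a \<Rightarrow> real)"
      by (rule test_function_integrable[OF cutoff_test_function[OF R]])
    show "indicat_real (cball 0 R) x \<le> cutoff R x" for x :: 'a
      using cutoff_bounds[of R x] cutoff_eq_1[OF R, of x] by (auto simp: indicator_def)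
  qed
  finally show ?thesis .
qed

lemma mollifier_nonneg: "r > 0 \<Longrightarrow> 0 \<le> mollifier r x"
  unfolding mollifier_def using integral_cutoff_pos[of "r/2", where 'a='a] cutoff_bounds[of "r/2" x] by (intro divide_nonneg_pos) auto

lemma mollifier_eq_0: "r > 0 \<Longrightarrow> norm x \<ge> r \<Longrightarrow> mollifier r x = 0"
  unfolding mollifier_def by (simp add: cutoff_eq_0)

lemma mollifier_test_function:
  assumes "r > 0" shows "mollifier r \<in> test_functions UNIV"
  unfolding mollifier_def[abs_def] divide_inverse mult.commute[of "cutoff _ _"]
  using assms by (intro test_function_mult[OF cutoff_test_function] smooth_const) auto

lemma mollifier_minus: "mollifier r (x - y) = mollifier r (y - x)"
proof -
  have "(x - y) \<bullet> (x - y) = (y - x) \<bullet> (y - x)"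
    by (simp add: norm_minus_commute flip: power2_norm_eq_inner)
  then show ?thesis by (simp add: mollifier_def cutoff_def)
qed

lemma mollifier_integral:
  assumes "r > 0" shows "(\<integral>y. mollifier r y \<partial>(lebesgue :: 'a::euclidean_space measure)) = 1"
  unfolding mollifier_def using integral_cutoff_pos[of "r/2", where 'a='a] assms by simp

lemma l2norm_UNIV: "l2norm UNIV f = sqrt (\<integral>x. (norm (f x))\<^sup>2 \<partial>lebesgue)"
  by (simp add: l2norm_def lebesgue_on_UNIV_eq)

lemma L2_UNIV_iff: "f \<in> L2 UNIV \<longleftrightarrow> f \<in> borel_measurable lebesgue \<and> integrable lebesgue (\<lambda>x. (norm (f x))\<^sup>2)"
  by (simp add: L2_def lebesgue_on_UNIV_eq)

lemma mollifier_borel [measurable]: "r > 0 \<Longrightarrow> mollifier r \<in> borel_measurable borel"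
  by (intro borel_measurable_continuous_onI smooth_continuous test_functions_smooth[OF mollifier_test_function])

lemma mollifier_translate_test_function:
  "r > 0 \<Longrightarrow> (\<lambda>y. mollifier r (x - y)) \<in> test_functions (cball x r)"
proof (rule test_functionsI[of _ "cball x r"])
  assume r: "r > 0"
  have "((\<lambda>y. x - y) has_derivative (\<lambda>h. - h)) (at y)" for y :: 'a
    by (auto intro!: derivative_eq_intros)
  from smooth_inner_compose[OF this test_functions_smooth[OF mollifier_test_function[OF r]]]
  show "smooth (\<lambda>y. mollifier r (x - y))" .
  show "mollifier r (x - y) = 0" if "y \<notin> cball x r" for y
    using that r by (intro mollifier_eq_0) (auto simp: dist_norm)
qed auto

lemma mollifier_translate_integral:
  fixes x :: "'a::euclidean_space"
  assumes r: "r > 0"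
  shows "integrable lborel (\<lambda>y. mollifier r (x - y))" "(\<integral>y. mollifier r (x - y) \<partial>lborel) = 1"
    "(\<integral>\<^sup>+y. ennreal (mollifier r (y - x)) \<partial>lborel) = 1"
proof -
  have m: "(\<lambda>y. mollifier r (y - x)) \<in> borel_measurable lborel" "mollifier r \<in> borel_measurable (borel :: 'a measure)"
    using r by measurable
  have i: "integrable lborel (mollifier r :: 'a \<Rightarrow> real)"
    using test_function_integrable[OF mollifier_test_function[OF r]] r by (subst (asm) integrable_completion) measurable
  have one: "(\<integral>y. mollifier r y \<partial>(lborel :: 'a measure)) = 1"
    using mollifier_integral[OF r, where 'a='a] r by (subst (asm) integral_completion) measurable
  have "(\<integral>\<^sup>+y. ennreal (mollifier r (y - x)) \<partial>lborel) = (\<integral>\<^sup>+y. ennreal (mollifier r (y - x)) \<partial>distr lborel borel ((+) x))"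
    by (simp add: lborel_distr_plus)
  also have "\<dots> = (\<integral>\<^sup>+y. ennreal (mollifier r y) \<partial>(lborel :: 'a measure))"
    using r by (subst nn_integral_distr) auto
  also have "\<dots> = ennreal 1"
    using i one by (subst nn_integral_eq_integral) (auto simp: mollifier_nonneg r)
  finally show 1: "(\<integral>\<^sup>+y. ennreal (mollifier r (y - x)) \<partial>lborel) = 1" by simp
  then show 2: "integrable lborel (\<lambda>y. mollifier r (x - y))"
    unfolding mollifier_minus[of r x] using m
    by (intro integrableI_nonneg) (auto simp: mollifier_nonneg r)
  show "(\<integral>y. mollifier r (x - y) \<partial>lborel) = 1"
    using 1 2 unfolding mollifier_minus[of r x]
    by (subst (asm) nn_integral_eq_integral) (auto simp: mollifier_nonneg r)
qed

text \<open>The weights have mass 1, so the square of the average is at most the average of the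
  squares; this follows from nonnegativity of the variance around the mean \<open>c\<close>. Tonelli
  and translation invariance then give the norm bound. Borel measurability of \<open>f\<close> is
  what makes the integrand measurable on the product.\<close>

lemma mollify_borel:
  fixes f :: "'a::euclidean_space \<Rightarrow> real"
  assumes r: "r > 0" and [measurable]: "f \<in> borel_measurable borel" and f2: "integrable lborel (\<lambda>x. (f x)\<^sup>2)"
  shows "integrable lborel (\<lambda>y. mollifier r (x - y) * f y)"
    and "(\<integral>\<^sup>+x. ennreal ((\<integral>y. mollifier r (x - y) * f y \<partial>lborel)\<^sup>2) \<partial>lborel) \<le> (\<integral>\<^sup>+x. ennreal ((f x)\<^sup>2) \<partial>lborel)"
proof -
  have [measurable]: "mollifier r \<in> borel_measurable (borel :: 'a measure)" using r by measurable
  obtain B where B: "B > 0" "\<And>x::'a. \<bar>mollifier r x\<bar> \<le> B"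
    using test_function_bounded[OF mollifier_test_function[OF r]] by metis
  note k_int = mollifier_translate_integral(1)[OF r]
  have kf2: "integrable lborel (\<lambda>y. mollifier r (x - y) * (f y)\<^sup>2)" for x
  proof (rule Bochner_Integration.integrable_bound[OF integrable_mult_right[OF f2, of B]])
    show "AE y in lborel. norm (mollifier r (x - y) * (f y)\<^sup>2) \<le> norm (B * (f y)\<^sup>2)"
      using B by (auto simp: abs_mult intro!: mult_right_mono)
  qed measurable
  show kf: "integrable lborel (\<lambda>y. mollifier r (x - y) * f y)" for x
  proof (rule Bochner_Integration.integrable_bound[OF Bochner_Integration.integrable_add[OF k_int[of x] kf2[of x]]])
    have "\<bar>f y\<bar> \<le> 1 + (f y)\<^sup>2" for y
      using sum_squares_bound[of "\<bar>f y\<bar>" 1] by simp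
    then have "mollifier r (x - y) * \<bar>f y\<bar> \<le> mollifier r (x - y) * (1 + (f y)\<^sup>2)" for y
      by (intro mult_left_mono mollifier_nonneg r)
    then show "AE y in lborel. norm (mollifier r (x - y) * f y) \<le> norm (mollifier r (x - y) + mollifier r (x - y) * (f y)\<^sup>2)"
      using mollifier_nonneg[OF r, where 'a='a] by (auto simp: abs_mult algebra_simps)
  qed measurable
  have jensen: "(\<integral>y. mollifier r (x - y) * f y \<partial>lborel)\<^sup>2 \<le> (\<integral>y. mollifier r (x - y) * (f y)\<^sup>2 \<partial>lborel)" for x
  proof -
    define c where "c = (\<integral>y. mollifier r (x - y) * f y \<partial>lborel)"
    have eq: "mollifier r (x - y) * (f y - c)\<^sup>2 = mollifier r (x - y) * (f y)\<^sup>2 - 2 * c * (mollifier r (x - y) * f y) + c\<^sup>2 * mollifier r (x - y)" for y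
      by (simp add: power2_eq_square algebra_simps)
    have "0 \<le> (\<integral>y. mollifier r (x - y) * (f y - c)\<^sup>2 \<partial>lborel)"
      by (intro integral_nonneg_AE AE_I2 mult_nonneg_nonneg mollifier_nonneg r) simp
    also have "\<dots> = (\<integral>y. mollifier r (x - y) * (f y)\<^sup>2 \<partial>lborel) - 2 * c * c + c\<^sup>2"
      unfolding eq using kf2[of x] kf[of x] k_int[of x] mollifier_translate_integral(2)[OF r, of x]
      by (simp add: c_def)
    finally show ?thesis unfolding c_def[symmetric] by (simp add: power2_eq_square)
  qed
  have "(\<integral>\<^sup>+x. ennreal ((\<integral>y. mollifier r (x - y) * f y \<partial>lborel)\<^sup>2) \<partial>lborel)
      \<le> (\<integral>\<^sup>+x. ennreal (\<integral>y. mollifier r (x - y) * (f y)\<^sup>2 \<partial>lborel) \<partial>lborel)"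
    by (intro nn_integral_mono ennreal_leI jensen)
  also have "\<dots> = (\<integral>\<^sup>+x. (\<integral>\<^sup>+y. ennreal (mollifier r (x - y) * (f y)\<^sup>2) \<partial>lborel) \<partial>lborel)"
    using kf2 by (subst nn_integral_eq_integral) (auto simp: mollifier_nonneg r)
  also have "\<dots> = (\<integral>\<^sup>+y. (\<integral>\<^sup>+x. ennreal (mollifier r (x - y) * (f y)\<^sup>2) \<partial>lborel) \<partial>lborel)"
    by (rule lborel_pair.Fubini'[symmetric]) measurable
  also have "\<dots> = (\<integral>\<^sup>+y. ennreal ((f y)\<^sup>2) * (\<integral>\<^sup>+x. ennreal (mollifier r (x - y)) \<partial>lborel) \<partial>lborel)"
    by (subst nn_integral_cmult[symmetric])
       (auto intro!: nn_integral_cong simp: ennreal_mult' mollifier_nonneg r mult.commute)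
  also have "\<dots> = (\<integral>\<^sup>+y. ennreal ((f y)\<^sup>2) \<partial>lborel)"
    by (simp add: mollifier_translate_integral(3)[OF r])
  finally show "(\<integral>\<^sup>+x. ennreal ((\<integral>y. mollifier r (x - y) * f y \<partial>lborel)\<^sup>2) \<partial>lborel) \<le> (\<integral>\<^sup>+x. ennreal ((f x)\<^sup>2) \<partial>lborel)" .
qed

text \<open>Tonelli is applied on the product of the Borel versions of Lebesgue measure, where the
  integrand built from a Lebesgue measurable \<open>f\<close> need not be measurable. Replacing
  \<open>f\<close> by a Borel function equal to it almost everywhere leaves every value of the
  convolution unchanged.\<close>

lemma mollify_L2:
  fixes f :: "'a::euclidean_space \<Rightarrow> real"
  assumes r: "r > 0" and f: "f \<in> L2 UNIV"
  shows "integrable lebesgue (\<lambda>y. mollifier r (x - y) * f y)"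
    and "mollify r f \<in> L2 UNIV" "l2norm UNIV (mollify r f) \<le> l2norm UNIV f"
proof -
  have fm: "f \<in> borel_measurable lebesgue" and f2: "integrable lebesgue (\<lambda>x. (f x)\<^sup>2)"
    using f by (auto simp: L2_UNIV_iff)
  obtain g where g[measurable]: "g \<in> borel_measurable borel" and fg: "AE x in lborel. f x = g x"
    using completion_ex_borel_measurable_real[OF fm] by auto
  have fg': "AE x in lebesgue. f x = g x" using fg by (rule AE_completion)
  have gm: "g \<in> borel_measurable lebesgue" by (rule measurable_completion) simp
  have [measurable]: "mollifier r \<in> borel_measurable (borel :: 'a measure)" using r by measurable
  have k[measurable]: "(\<lambda>y. mollifier r (x - y)) \<in> borel_measurable lebesgue" for x
    by (rule measurable_completion[OF borel_measurable_integrable[OF mollifier_translate_integral(1)[OF r]]])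
  have "integrable lebesgue (\<lambda>x. (g x)\<^sup>2)"
    by (rule integrable_cong_AE_imp[OF f2]) (use fg' gm in \<open>auto elim: eventually_mono\<close>)
  then have g2: "integrable lborel (\<lambda>x. (g x)\<^sup>2)" by (subst (asm) integrable_completion) auto
  have kg: "integrable lebesgue (\<lambda>y. mollifier r (x - y) * g y)" for x
    using mollify_borel(1)[OF r g g2] by (subst integrable_completion) auto
  show kf: "integrable lebesgue (\<lambda>y. mollifier r (x - y) * f y)" for x
    by (rule integrable_cong_AE_imp[OF kg[of x]]) (use fg' fm k in \<open>auto elim: eventually_mono\<close>)
  have meq: "mollify r f x = (\<integral>y. mollifier r (x - y) * g y \<partial>lborel)" for x
  proof -
    have "mollify r f x = (\<integral>y. mollifier r (x - y) * g y \<partial>lebesgue)"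
      unfolding mollify_def by (rule integral_cong_AE) (use fg' fm gm k in \<open>auto elim: eventually_mono\<close>)
    then show ?thesis by (subst (asm) integral_completion) auto
  qed
  have mm: "mollify r f \<in> borel_measurable borel"
    unfolding meq[abs_def] by measurable
  have bd: "(\<integral>\<^sup>+x. ennreal ((mollify r f x)\<^sup>2) \<partial>lborel) \<le> (\<integral>\<^sup>+x. ennreal ((g x)\<^sup>2) \<partial>lborel)"
    unfolding meq by (rule mollify_borel(2)[OF r g g2])
  also have e: "\<dots> = ennreal (\<integral>x. (g x)\<^sup>2 \<partial>lborel)"
    using g2 by (rule nn_integral_eq_integral) auto
  finally have bd': "(\<integral>\<^sup>+x. ennreal ((mollify r f x)\<^sup>2) \<partial>lborel) \<le> ennreal (\<integral>x. (g x)\<^sup>2 \<partial>lborel)" .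
  have m2: "integrable lborel (\<lambda>x. (mollify r f x)\<^sup>2)"
    using mm bd' by (intro integrableI_nonneg) (auto simp: le_less_trans)
  have "ennreal (\<integral>x. (mollify r f x)\<^sup>2 \<partial>lborel) \<le> ennreal (\<integral>x. (g x)\<^sup>2 \<partial>lborel)"
    using bd' nn_integral_eq_integral[OF m2] by simp
  then have le: "(\<integral>x. (mollify r f x)\<^sup>2 \<partial>lborel) \<le> (\<integral>x. (g x)\<^sup>2 \<partial>lborel)"
    by (subst (asm) ennreal_le_iff) auto
  show "mollify r f \<in> L2 UNIV"
    using m2 mm by (auto simp: L2_UNIV_iff integrable_completion intro: measurable_completion)
  have "(\<integral>x. (mollify r f x)\<^sup>2 \<partial>lebesgue) \<le> (\<integral>x. (f x)\<^sup>2 \<partial>lebesgue)"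
  proof -
    have "(\<integral>x. (f x)\<^sup>2 \<partial>lebesgue) = (\<integral>x. (g x)\<^sup>2 \<partial>lebesgue)"
      by (rule integral_cong_AE) (use fg' fm gm in \<open>auto elim: eventually_mono\<close>)
    also have "\<dots> = (\<integral>x. (g x)\<^sup>2 \<partial>lborel)" by (rule integral_completion) auto
    moreover have "(\<integral>x. (mollify r f x)\<^sup>2 \<partial>lebesgue) = (\<integral>x. (mollify r f x)\<^sup>2 \<partial>lborel)"
      using mm by (intro integral_completion) auto
    ultimately show ?thesis using le by simp
  qed
  then show "l2norm UNIV (mollify r f) \<le> l2norm UNIV f"
    unfolding l2norm_UNIV by simp
qed

lemma mollify_outside:
  fixes f :: "'a::euclidean_space \<Rightarrow> real"
  assumes "r > 0" "\<And>y. y \<in> ball x r \<Longrightarrow> f y = 0"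
  shows "mollify r f x = 0"
proof -
  have "(\<lambda>y. mollifier r (x - y) * f y) = (\<lambda>y. 0)"
  proof
    fix y show "mollifier r (x - y) * f y = 0"
      using assms mollifier_eq_0[OF assms(1), of "x - y"] by (cases "y \<in> ball x r") (auto simp: dist_norm)
  qed
  then show ?thesis by (simp add: mollify_def)
qed

text \<open>An average stays in any interval that contains the averaged values. Centre
  \<open>c\<close> and radius \<open>e\<close> are kept general for two uses: closeness of
  \<open>mollify r g x\<close> to \<open>g x\<close> for continuous \<open>g\<close>, and, with
  \<open>c = e = M / 2\<close>, preservation of the bounds 0 and \<open>M\<close>.\<close>

lemma mollify_bounds:
  assumes "r > 0" "f \<in> L2 UNIV" "\<And>y. y \<in> ball x r \<Longrightarrow> \<bar>f y - c\<bar> \<le> e"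
  shows "\<bar>mollify r f x - c\<bar> \<le> e"
proof -
  let ?k = "\<lambda>y. mollifier r (x - y)"
  have [measurable]: "mollifier r \<in> borel_measurable (borel :: 'a measure)" using assms by measurable
  have m: "?k \<in> borel_measurable lborel" by measurable
  have k: "integrable lebesgue ?k" "(\<integral>y. ?k y \<partial>lebesgue) = 1"
    using mollifier_translate_integral[OF assms(1), of x] m
    by (simp_all add: integrable_completion integral_completion)
  have "mollify r f x - c = (\<integral>y. ?k y * f y \<partial>lebesgue) - (\<integral>y. c * ?k y \<partial>lebesgue)"
    using k by (simp add: mollify_def)
  also have "\<dots> = (\<integral>y. ?k y * f y - c * ?k y \<partial>lebesgue)"
    using k mollify_L2(1)[OF assms(1,2)] by (intro Bochner_Integration.integral_diff[symmetric]) auto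
  also have "\<bar>\<dots>\<bar> \<le> (\<integral>y. e * ?k y \<partial>lebesgue)"
  proof (rule order_trans[OF integral_abs_bound integral_mono])
    show "integrable lebesgue (\<lambda>y. \<bar>?k y * f y - c * ?k y\<bar>)"
      using k mollify_L2(1)[OF assms(1,2)] by (intro integrable_abs Bochner_Integration.integrable_diff) auto
    show "integrable lebesgue (\<lambda>y. e * ?k y)" using k by simp
    show "\<bar>?k y * f y - c * ?k y\<bar> \<le> e * ?k y" for y
    proof (cases "y \<in> ball x r")
      case True
      have "\<bar>?k y * f y - c * ?k y\<bar> = ?k y * \<bar>f y - c\<bar>"
        unfolding mult.commute[of c] right_diff_distrib[symmetric] abs_mult
        using mollifier_nonneg[OF assms(1), of "x - y"] by simp
      also have "\<dots> \<le> ?k y * e" by (intro mult_left_mono assms(3) True mollifier_nonneg assms(1))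
      finally show ?thesis by (simp add: mult.commute)
    next
      case False
      then have "?k y = 0" using mollifier_eq_0[OF assms(1), of "x - y"] by (auto simp: dist_norm)
      then show ?thesis by simp
    qed
  qed
  also have "\<dots> = e" using k by simp
  finally show ?thesis .
qed

text \<open>The kernel \<open>mollifier r (x - y)\<close> is not compactly supported in the pair of
  variables. A cutoff in \<open>y\<close> that equals 1 wherever \<open>f\<close> may be nonzero
  changes no integral and turns the kernel into a test function \<Phi>, to which the results on
  parametric integrals apply.\<close>

lemma mollify_smooth:
  fixes f :: "'a::euclidean_space \<Rightarrow> real"
  assumes r: "r > 0" and R: "R > 0" and f: "integrable lebesgue f" "\<And>x. norm x \<ge> R \<Longrightarrow> f x = 0"
  shows "smooth (mollify r f)"
    and "b \<in> Basis \<Longrightarrow> grad (mollify r f) x \<bullet> b = (\<integral>y. (grad (mollifier r) (x - y) \<bullet> b) * f y \<partial>lebesgue)"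
proof -
  define \<Phi> where "\<Phi> = (\<lambda>(x::'a, y). cutoff R y * mollifier r (x - y) :: real)"
  have sm: "smooth (mollifier r :: 'a \<Rightarrow> real)"
    by (rule test_functions_smooth[OF mollifier_test_function[OF r]])
  have d1: "((\<lambda>u::'a \<times> 'a. fst u - snd u) has_derivative (\<lambda>h. fst h - snd h)) (at u)" for u
    by (auto intro!: derivative_eq_intros)
  have d2: "((\<lambda>u::'a \<times> 'a. snd u) has_derivative snd) (at u)" for u
    by (rule bounded_linear_imp_has_derivative[OF bounded_linear_snd])
  have s1: "smooth (\<lambda>u::'a \<times> 'a. mollifier r (fst u - snd u))" and s2: "smooth (\<lambda>u::'a \<times> 'a. cutoff R (snd u))"
    using smooth_inner_compose[OF d1 sm] smooth_inner_compose[OF d2 smooth_cutoff[of R]] by auto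
  have \<Phi>s: "\<Phi> = (\<lambda>u. cutoff R (snd u) * mollifier r (fst u - snd u))"
    by (auto simp: \<Phi>_def)
  have \<Phi>: "\<Phi> \<in> test_functions UNIV"
  proof (rule test_functionsI[of _ "cball 0 (2 * R + r) \<times> cball 0 (2 * R)"])
    show "smooth \<Phi>" unfolding \<Phi>s by (rule smooth_mult[OF s2 s1])
    show "compact (cball (0::'a) (2 * R + r) \<times> cball (0::'a) (2 * R))" by (intro compact_Times compact_cball)
    show "\<Phi> u = 0" if "u \<notin> cball 0 (2 * R + r) \<times> cball 0 (2 * R)" for u
    proof (cases "norm (snd u) \<le> 2 * R")
      case True
      then have "norm (fst u) > 2 * R + r" using that by (cases u) auto
      then have "norm (fst u - snd u) \<ge> r" using True norm_triangle_ineq2[of "fst u" "snd u"] by linarith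
      then show ?thesis using mollifier_eq_0[OF r, of "fst u - snd u"] by (simp add: \<Phi>s)
    next
      case False then show ?thesis using cutoff_eq_0[OF R, of "snd u"] by (simp add: \<Phi>s)
    qed
  qed simp
  have eq: "mollify r f = (\<lambda>x. \<integral>y. \<Phi> (x, y) * f y \<partial>lebesgue)"
  proof
    fix x show "mollify r f x = (\<integral>y. \<Phi> (x, y) * f y \<partial>lebesgue)"
      unfolding mollify_def
    proof (rule Bochner_Integration.integral_cong)
      fix y show "mollifier r (x - y) * f y = \<Phi> (x, y) * f y"
        using f(2)[of y] cutoff_eq_1[OF R, of y] by (cases "norm y \<ge> R") (auto simp: \<Phi>_def)
    qed simp
  qed
  show "smooth (mollify r f)" unfolding eq by (rule parametric_integral_test_function(1)[OF \<Phi> f(1)])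
  assume b: "b \<in> Basis"
  have "grad (mollify r f) x \<bullet> b = (\<integral>y. (grad \<Phi> (x, y) \<bullet> (b, 0)) * f y \<partial>lebesgue)"
    unfolding eq by (rule parametric_integral_test_function(2)[OF \<Phi> f(1) b])
  also have "\<dots> = (\<integral>y. (grad (mollifier r) (x - y) \<bullet> b) * f y \<partial>lebesgue)"
  proof (rule Bochner_Integration.integral_cong)
    fix y show "(grad \<Phi> (x, y) \<bullet> (b, 0)) * f y = (grad (mollifier r) (x - y) \<bullet> b) * f y"
    proof (cases "norm y \<ge> R")
      case False
      have dd: "(\<Phi> has_derivative (\<lambda>h. cutoff R y * (grad (mollifier r) (x - y) \<bullet> (fst h - snd h)) + (grad (cutoff R) y \<bullet> snd h) * mollifier r (x - y))) (at (x, y))"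
        unfolding \<Phi>s
        using has_derivative_mult[OF has_derivative_compose[OF d2 smooth_grad[OF smooth_cutoff[of R]]] has_derivative_compose[OF d1 smooth_grad[OF sm]], of "(x, y)"]
        by simp
      have "grad \<Phi> (x, y) \<bullet> (b, 0) = frechet_derivative \<Phi> (at (x, y)) (b, 0)"
        by (rule frechet_eq_grad[OF differentiableI[OF dd], symmetric])
      also have "\<dots> = cutoff R y * (grad (mollifier r) (x - y) \<bullet> b)"
        by (subst pderiv_eqI[OF dd]) simp
      finally show ?thesis using cutoff_eq_1[OF R, of y] False by simp
    qed (simp add: f(2))
  qed simp
  finally show "grad (mollify r f) x \<bullet> b = (\<integral>y. (grad (mollifier r) (x - y) \<bullet> b) * f y \<partial>lebesgue)" .
qed

text \<open>Truncating \<open>f\<close> in value and in space costs half of \<open>e\<close>. The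
  truncation is an almost everywhere limit of continuous functions; clipping these to the same range
  and cutting them off in space provides a majorant, so the convergence also holds in
  \<open>L2\<close>.\<close>

lemma L2_continuous_dense:
  fixes f :: "'a::euclidean_space \<Rightarrow> real"
  assumes f: "f \<in> L2 UNIV" and e: "e > 0"
  obtains g C where "continuous_on UNIV g" "compact C" "\<And>x. x \<notin> C \<Longrightarrow> g x = 0" "l2norm UNIV (\<lambda>x. f x - g x) < e"
proof -
  have fm[measurable]: "f \<in> borel_measurable lebesgue" using f by (auto simp: L2_UNIV_iff)
  define T where "T n x = (if norm x \<le> real n then max (- real n) (min (real n) (f x)) else 0)" for n x
  have T_m[measurable]: "T n \<in> borel_measurable lebesgue" for n
  proof -
    have [measurable]: "norm \<in> borel_measurable (lebesgue :: 'a measure)"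
      by (rule measurable_completion) measurable
    show ?thesis unfolding T_def by measurable
  qed
  have T_le: "\<bar>T n x\<bar> \<le> real n" "\<bar>T n x - f x\<bar> \<le> \<bar>f x\<bar>" for n x
    unfolding T_def by (auto simp: max_def min_def)
  have "(\<lambda>n. l2norm UNIV (\<lambda>x. T n x - f x)) \<longlonglongrightarrow> 0"
  proof (rule L2_dominated[OF f])
    show "AE x in lebesgue_on UNIV. (\<lambda>n. T n x) \<longlonglongrightarrow> f x"
    proof (intro AE_I2)
      fix x
      obtain N where N: "real N \<ge> max (norm x) \<bar>f x\<bar>" using real_arch_simple by blast
      have "T n x = f x" if "n \<ge> N" for n
      proof -
        have "real n \<ge> max (norm x) \<bar>f x\<bar>" using N that by (meson of_nat_le_iff order_trans)
        then have "norm x \<le> real n" "\<bar>f x\<bar> \<le> real n" by simp_all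
        then show ?thesis unfolding T_def by (simp add: max_def min_def) linarith
      qed
      then show "(\<lambda>n. T n x) \<longlonglongrightarrow> f x"
        by (intro tendsto_eventually eventually_sequentiallyI[of N])
    qed
  qed (use T_le(2) in \<open>auto simp: lebesgue_on_UNIV_eq\<close>)
  then have "\<forall>\<^sub>F n in sequentially. l2norm UNIV (\<lambda>x. T n x - f x) < e / 2"
    using e by (intro order_tendstoD) auto
  then obtain n where n: "l2norm UNIV (\<lambda>x. T n x - f x) < e / 2"
    by (auto simp: eventually_sequentially)
  have "T n measurable_on UNIV"
    by (rule lebesgue_measurable_imp_measurable_on_real) simp_all
  then obtain N g where N: "negligible N" and g: "\<And>k. continuous_on UNIV (g k)"
      "\<And>x. x \<notin> N \<Longrightarrow> (\<lambda>k. g k x) \<longlonglongrightarrow> T n x"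
    unfolding measurable_on_def by auto
  define R where "R = real n + 1"
  have R: "R > 0" by (simp add: R_def)
  define h where "h k x = cutoff R x * max (- real n) (min (real n) (g k x))" for k x
  have hc: "continuous_on UNIV (h k)" for k
    unfolding h_def by (intro continuous_intros smooth_continuous[OF smooth_cutoff] g)
  have hz: "h k x = 0" if "x \<notin> cball 0 (2 * R)" for k x
    using that R by (auto simp: h_def cutoff_eq_0)
  have Tz: "T n x = 0" if "x \<notin> cball 0 (2 * R)" for x
    using that by (auto simp: T_def R_def)
  have hb: "\<bar>h k x\<bar> \<le> real n" for k x
    unfolding h_def abs_mult using mult_mono[of "\<bar>cutoff R x\<bar>" 1 "\<bar>max (- real n) (min (real n) (g k x))\<bar>" "real n"] cutoff_bounds[of R x] by auto
  have "(\<lambda>k. l2norm UNIV (\<lambda>x. h k x - T n x)) \<longlonglongrightarrow> 0"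
  proof (rule L2_dominated[of "\<lambda>x. (2 * real n) * cutoff (2 * R) x"])
    show "(\<lambda>x. (2 * real n) * cutoff (2 * R) x) \<in> L2 (UNIV :: 'a set)"
      using R by (intro L2_cmult test_function_L2(1)[OF cutoff_test_function]) auto
    show "h k \<in> borel_measurable (lebesgue_on UNIV)" for k
      by (intro continuous_imp_measurable_on_sets_lebesgue hc) simp
    show "T n \<in> borel_measurable (lebesgue_on UNIV)" by (simp add: lebesgue_on_UNIV_eq)
    have "AE x in lebesgue. x \<notin> N" using N by (simp add: negligible_iff_null_sets AE_not_in)
    then show "AE x in lebesgue_on UNIV. (\<lambda>k. h k x) \<longlonglongrightarrow> T n x"
      unfolding lebesgue_on_UNIV_eq
    proof eventually_elim
      case (elim x)
      have "(\<lambda>k. h k x) \<longlonglongrightarrow> cutoff R x * max (- real n) (min (real n) (T n x))"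
        unfolding h_def by (intro tendsto_intros g(2) elim)
      also have "cutoff R x * max (- real n) (min (real n) (T n x)) = T n x"
      proof (cases "norm x \<le> real n")
        case True
        then have "cutoff R x = 1" by (intro cutoff_eq_1[OF R]) (simp add: R_def)
        then show ?thesis using T_le(1)[of n x] by (auto simp: max_def min_def)
      qed (simp add: T_def)
      finally show ?case .
    qed
    show "AE x in lebesgue_on UNIV. norm (h k x - T n x) \<le> norm (2 * real n * cutoff (2 * R) x)" for k
    proof (intro AE_I2)
      fix x :: 'a
      show "norm (h k x - T n x) \<le> norm (2 * real n * cutoff (2 * R) x)"
      proof (cases "x \<in> cball 0 (2 * R)")
        case True
        then have "cutoff (2 * R) x = 1" using R by (intro cutoff_eq_1) auto
        then show ?thesis using hb[of k x] T_le(1)[of n x] by simp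
      qed (use hz Tz in auto)
    qed
  qed
  then have "\<forall>\<^sub>F k in sequentially. l2norm UNIV (\<lambda>x. h k x - T n x) < e / 2"
    using e by (intro order_tendstoD) auto
  then obtain k where k: "l2norm UNIV (\<lambda>x. h k x - T n x) < e / 2"
    by (auto simp: eventually_sequentially)
  have hL: "h k \<in> L2 UNIV"
    by (rule continuous_compact_support_L2[OF hc compact_cball[of 0 "2 * R"] hz]) auto
  have TL: "T n \<in> L2 UNIV"
  proof (rule L2_bound[OF f])
    show "AE x in lebesgue_on UNIV. norm (T n x) \<le> norm (f x)"
      by (rule AE_I2) (auto simp: T_def max_def min_def)
  qed (simp add: lebesgue_on_UNIV_eq)
  have "l2norm UNIV (\<lambda>x. f x - h k x) < e"
    using l2norm_triangle_diff[OF f TL hL] n k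
      l2norm_minus_commute[of UNIV f "T n"] l2norm_minus_commute[of UNIV "h k" "T n"] by simp
  with hc hz show thesis by (intro that[of "h k" "cball 0 (2 * R)"]) auto
qed

lemma mollify_diff:
  assumes "r > 0" "f \<in> L2 UNIV" "g \<in> L2 UNIV"
  shows "mollify r (\<lambda>x. f x - g x) x = mollify r f x - mollify r g x"
  unfolding mollify_def right_diff_distrib
  by (rule Bochner_Integration.integral_diff[OF mollify_L2(1)[OF assms(1,2)] mollify_L2(1)[OF assms(1,3)]])

lemma mollify_converges:
  fixes f :: "'a::euclidean_space \<Rightarrow> real"
  assumes f: "f \<in> L2 UNIV" and e: "e > 0"
  obtains d where "d > 0" "\<And>r. 0 < r \<Longrightarrow> r < d \<Longrightarrow> l2norm UNIV (\<lambda>x. mollify r f x - f x) < e"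
proof -
  obtain g C where g: "continuous_on UNIV g" "compact C" "\<And>x. x \<notin> C \<Longrightarrow> g x = 0"
      and fg: "l2norm UNIV (\<lambda>x. f x - g x) < e / 3"
    using L2_continuous_dense[OF f, of "e / 3"] e by auto
  have gL: "g \<in> L2 UNIV" by (rule continuous_compact_support_L2[OF g]) auto
  obtain R where R: "R > 0" "C \<subseteq> cball 0 R"
    using bounded_subset_ballD[OF compact_imp_bounded[OF g(2)], of 0] ball_subset_cball by blast
  \<comment> \<open>A multiple of this cutoff dominates the mollification error of \<open>g\<close>:
    both \<open>g\<close> and its mollification at a scale below 1 vanish beyond radius
    \<open>R + 1\<close>.\<close>
  have cL: "cutoff (R + 1) \<in> L2 (UNIV :: 'a set)"
    using R by (intro test_function_L2(1)[OF cutoff_test_function]) auto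
  define K where "K = l2norm UNIV (cutoff (R + 1) :: 'a \<Rightarrow> real) + 1"
  have K: "K > 0" unfolding K_def by (intro add_nonneg_pos) auto
  have "uniformly_continuous_on UNIV g"
    by (rule compact_support_uniformly_continuous[OF g])
  then obtain d where d: "d > 0" "\<And>x y. dist y x < d \<Longrightarrow> dist (g y) (g x) < e / 3 / K"
    using e K unfolding uniformly_continuous_on_def by (metis UNIV_I divide_pos_pos zero_less_numeral)
  show thesis
  proof (rule that[of "min d 1"])
    show "min d 1 > 0" using d(1) by simp
    fix r :: real assume r: "0 < r" "r < min d 1"
    note mg = mollify_L2[OF r(1) gL] and mf = mollify_L2[OF r(1) f]
    have close: "\<bar>mollify r g x - g x\<bar> \<le> (e / 3 / K) * cutoff (R + 1) x" for x
    proof (cases "norm x \<le> R + 1")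
      case True
      have "\<bar>mollify r g x - g x\<bar> \<le> e / 3 / K"
      proof (rule mollify_bounds[OF r(1) gL])
        fix y assume "y \<in> ball x r"
        then have "dist y x < d" using r by (simp add: dist_commute)
        from d(2)[OF this] show "\<bar>g y - g x\<bar> \<le> e / 3 / K" by (simp add: dist_real_def)
      qed
      then show ?thesis using cutoff_eq_1[of "R + 1" x] True R by simp
    next
      case False
      have z: "g y = 0" if "y \<in> ball x 1" for y
      proof (rule g(3))
        have "norm x \<le> norm y + dist x y" using norm_triangle_sub[of x y] by (simp add: dist_norm)
        then have "norm y > R" using that False by auto
        then show "y \<notin> C" using R(2) by auto
      qed
      then have "mollify r g x = 0" using r by (intro mollify_outside) auto
      moreover have "g x = 0" using z[of x] by simp
      ultimately show ?thesis using e K cutoff_bounds[of "R + 1" x] by simp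
    qed
    have "l2norm UNIV (\<lambda>x. mollify r g x - g x) \<le> l2norm UNIV (\<lambda>x::'a. (e / 3 / K) * cutoff (R + 1) x)"
    proof (rule l2norm_mono[OF L2_cmult[OF cL]])
      show "(\<lambda>x. mollify r g x - g x) \<in> borel_measurable (lebesgue_on UNIV)"
        by (rule L2_measurable[OF L2_diff[OF mg(2) gL]])
      show "AE x in lebesgue_on UNIV. norm (mollify r g x - g x) \<le> norm (e / 3 / K * cutoff (R + 1) x)"
        using close e K by (intro AE_I2) (simp add: abs_mult abs_of_nonneg[OF cutoff_bounds(1)])
    qed
    also have "\<dots> = (e / 3 / K) * l2norm UNIV (cutoff (R + 1) :: 'a \<Rightarrow> real)"
      using l2norm_scaleR[of UNIV "e / 3 / K" "cutoff (R + 1) :: 'a \<Rightarrow> real"] e K by simp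
    also have "\<dots> \<le> (e / 3 / K) * K" using e K by (intro mult_left_mono) (auto simp: K_def)
    also have "\<dots> = e / 3" using K by simp
    finally have 2: "l2norm UNIV (\<lambda>x. mollify r g x - g x) \<le> e / 3" .
    have 1: "l2norm UNIV (\<lambda>x. mollify r f x - mollify r g x) < e / 3"
      using mollify_L2(3)[OF r(1) L2_diff[OF f gL]] fg by (simp add: mollify_diff[OF r(1) f gL, abs_def])
    have "l2norm UNIV (\<lambda>x. mollify r f x - f x) \<le> l2norm UNIV (\<lambda>x. mollify r f x - mollify r g x)
        + (l2norm UNIV (\<lambda>x. mollify r g x - g x) + l2norm UNIV (\<lambda>x. g x - f x))"
      using l2norm_triangle_diff[OF mf(2) mg(2) f] l2norm_triangle_diff[OF mg(2) gL f] by linarith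
    also have "\<dots> < e" using 1 2 fg l2norm_minus_commute[of UNIV f g] by linarith
    finally show "l2norm UNIV (\<lambda>x. mollify r f x - f x) < e" .
  qed
qed

lemma L2_extend:
  assumes "f \<in> L2 S" "S \<in> sets lebesgue"
  shows "(\<lambda>x. indicator S x *\<^sub>R f x) \<in> L2 UNIV" "l2norm UNIV (\<lambda>x. indicator S x *\<^sub>R f x) = l2norm S f"
proof -
  have sq: "(norm (indicator S x *\<^sub>R f x))\<^sup>2 = indicator S x *\<^sub>R (norm (f x))\<^sup>2" for x
    by (simp add: indicator_def)
  show "(\<lambda>x. indicator S x *\<^sub>R f x) \<in> L2 UNIV"
    using assms(1) assms(2) unfolding L2_UNIV_iff sq
    by (auto simp: L2_def integrable_restrict_space borel_measurable_restrict_space_iff)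
  show "l2norm UNIV (\<lambda>x. indicator S x *\<^sub>R f x) = l2norm S f"
    unfolding l2norm_UNIV sq using assms(2) by (simp add: l2norm_def integral_restrict_space)
qed

lemma L2_indicator_restrict:
  assumes "f \<in> L2 S" "A \<in> sets lebesgue" "S \<in> sets lebesgue"
  shows "(\<lambda>x. indicator A x *\<^sub>R f x) \<in> L2 S"
  by (rule L2_mult_bounded(1)[OF assms(1), where c=1]) (use assms in \<open>auto simp: measurable_restrict_space1\<close>)

text \<open>The last property quantifies the distance of \<open>K n\<close> to the complement of
  \<open>D\<close>: it tells how small a mollification radius has to be for supports to stay inside
  \<open>D\<close>.\<close>

lemma open_compact_exhaustion:
  fixes D :: "'a::euclidean_space set"
  assumes "open D"
  obtains K where "\<And>n::nat. compact (K n)" "\<And>n. K n \<subseteq> D" "\<And>x. x \<in> D \<Longrightarrow> \<exists>N. \<forall>n\<ge>N. x \<in> K n"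
    "\<And>n x. x \<in> K n \<Longrightarrow> ball x (1 / real (Suc n)) \<subseteq> D"
proof (rule that)
  define K where "K n = cball 0 (real n) - (\<Union>y\<in>-D. ball y (1 / real (Suc n)))" for n
  show "compact (K n)" for n
    unfolding K_def by (intro compact_diff compact_cball open_UN ballI open_ball)
  show sub: "ball x (1 / real (Suc n)) \<subseteq> D" if "x \<in> K n" for n x
    using that by (fastforce simp: K_def dist_commute)
  show "K n \<subseteq> D" for n
    using sub[of _ n] centre_in_ball[of _ "1 / real (Suc n)"] by (meson of_nat_0_less_iff subset_iff zero_less_Suc zero_less_divide_1_iff)
  show "\<exists>N. \<forall>n\<ge>N. x \<in> K n" if xD: "x \<in> D" for x
  proof -
    obtain e where e: "e > 0" "ball x e \<subseteq> D" using openE[OF \<open>open D\<close> xD] by metis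
    obtain N where N: "real N \<ge> max (norm x) (1 / e)" using real_arch_simple by blast
    show ?thesis
    proof (intro exI[of _ N] allI impI)
      fix n assume "n \<ge> N"
      then have n: "real n \<ge> norm x" "real n \<ge> 1 / e" using N by (meson max.bounded_iff of_nat_le_iff order_trans)+
      have "1 / real (Suc n) \<le> e" using n(2) e(1) by (simp add: field_simps)
      then have "y \<in> D" if "dist y x < 1 / real (Suc n)" for y
        using that e(2) by (auto simp: dist_commute)
      then show "x \<in> K n"
        unfolding K_def using n(1) by (auto simp del: of_nat_Suc)
    qed
  qed
qed

lemma L2_integrable_compact_support:
  fixes f :: "'a::euclidean_space \<Rightarrow> real"
  assumes f: "f \<in> L2 UNIV" and R: "R > 0" "\<And>x. norm x \<ge> R \<Longrightarrow> f x = 0"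
  shows "integrable lebesgue f"
proof -
  have "cutoff R \<in> L2 (UNIV :: 'a set)"
    using R by (intro test_function_L2(1)[OF cutoff_test_function]) auto
  from L2_mult_integrable[OF this f] have "integrable lebesgue (\<lambda>x. cutoff R x * f x)"
    by (simp add: lebesgue_on_UNIV_eq)
  moreover have "(\<lambda>x. cutoff R x * f x) = f"
  proof
    fix x show "cutoff R x * f x = f x"
      using cutoff_eq_1[OF R(1), of x] R(2)[of x] by (cases "norm x \<ge> R") auto
  qed
  ultimately show ?thesis by simp
qed

text \<open>Restrict \<open>g\<close> to a compact subset of \<open>D\<close>, then mollify below
  its distance to the complement. The kernel is nonnegative, so the sign of \<open>g\<close> is
  inherited; this is what permits approximation inside the cone of nonnegative test
  functions.\<close>

lemma L2_test_functions_dense: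
  fixes g :: "'a::euclidean_space \<Rightarrow> real"
  assumes D: "open D" and g: "g \<in> L2 D" and e: "e > 0"
  obtains \<psi> where "\<psi> \<in> test_functions D" "l2norm D (\<lambda>x. g x - \<psi> x) < e"
    "(\<And>x. x \<in> D \<Longrightarrow> 0 \<le> g x) \<Longrightarrow> (\<And>x. 0 \<le> \<psi> x)"
proof -
  have Dm: "D \<in> sets lebesgue" using D by simp
  obtain K where K: "\<And>n::nat. compact (K n)" "\<And>n. K n \<subseteq> D" "\<And>x. x \<in> D \<Longrightarrow> \<exists>N. \<forall>n\<ge>N. x \<in> K n"
    "\<And>n x. x \<in> K n \<Longrightarrow> ball x (1 / real (Suc n)) \<subseteq> D"
    using open_compact_exhaustion[OF D] by metis
  have Km[measurable]: "K n \<in> sets lebesgue" for n using K(1) by (simp add: lmeasurable_compact fmeasurableD)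
  have gK: "(\<lambda>x. indicator (K n) x *\<^sub>R g x) \<in> L2 D" for n
    by (rule L2_indicator_restrict[OF g Km Dm])
  have "(\<lambda>n. l2norm D (\<lambda>x. indicator (K n) x *\<^sub>R g x - g x)) \<longlonglongrightarrow> 0"
  proof (rule L2_dominated[OF g L2_measurable[OF gK] L2_measurable[OF g]])
    show "AE x in lebesgue_on D. (\<lambda>n. indicator (K n) x *\<^sub>R g x) \<longlonglongrightarrow> g x"
    proof (intro AE_I2)
      fix x assume "x \<in> space (lebesgue_on D)"
      then obtain N where "\<forall>n\<ge>N. x \<in> K n" using K(3)[of x] by auto
      then show "(\<lambda>n. indicator (K n) x *\<^sub>R g x) \<longlonglongrightarrow> g x"
        by (intro tendsto_eventually eventually_sequentiallyI[of N]) auto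
    qed
    show "AE x in lebesgue_on D. norm (indicator (K n) x *\<^sub>R g x - g x) \<le> norm (g x)" for n
      by (intro AE_I2) (auto simp: indicator_def)
  qed
  then have "\<forall>\<^sub>F n in sequentially. l2norm D (\<lambda>x. indicator (K n) x *\<^sub>R g x - g x) < e / 2"
    using e by (intro order_tendstoD) auto
  then obtain n where n: "l2norm D (\<lambda>x. indicator (K n) x *\<^sub>R g x - g x) < e / 2"
    by (auto simp: eventually_sequentially)
  define f where "f x = indicator (K n) x * g x" for x
  have "(\<lambda>x. indicator D x *\<^sub>R (indicator (K n) x *\<^sub>R g x)) \<in> L2 UNIV"
    by (rule L2_extend(1)[OF gK Dm])
  moreover have "(\<lambda>x. indicator D x *\<^sub>R (indicator (K n) x *\<^sub>R g x)) = f"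
    using K(2)[of n] by (auto simp: f_def indicator_def fun_eq_iff)
  ultimately have f: "f \<in> L2 UNIV" by simp
  obtain d where d: "d > 0" "\<And>r. 0 < r \<Longrightarrow> r < d \<Longrightarrow> l2norm UNIV (\<lambda>x. mollify r f x - f x) < e / 2"
    using mollify_converges[OF f, of "e / 2"] e by auto
  define r where "r = min (d / 2) (1 / real (Suc n) / 2)"
  have r: "r > 0" "r < d" "r < 1 / real (Suc n)" using d(1) by (auto simp: r_def min_def field_simps)
  obtain R where R: "R > 0" "K n \<subseteq> ball 0 R"
    using bounded_subset_ballD[OF compact_imp_bounded[OF K(1)[of n]], of 0] by blast
  have fi: "integrable lebesgue f"
    by (rule L2_integrable_compact_support[OF f R(1)]) (use R(2) in \<open>auto simp: f_def indicator_def\<close>)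
  have "smooth (mollify r f)"
    by (rule mollify_smooth(1)[OF r(1) R(1) fi]) (use R(2) in \<open>auto simp: f_def indicator_def\<close>)
  then have test: "mollify r f \<in> test_functions D"
  proof (rule test_functionsI)
    let ?C = "{x + y | x y. x \<in> K n \<and> y \<in> cball 0 r}"
    show "compact ?C" by (intro compact_sums K compact_cball)
    show "?C \<subseteq> D"
      using K(4)[of _ n] r(3) by (force simp: dist_norm subset_iff)
    show "mollify r f x = 0" if "x \<notin> ?C" for x
    proof (rule mollify_outside[OF r(1)])
      fix y assume y: "y \<in> ball x r"
      have "y \<notin> K n"
      proof
        assume "y \<in> K n"
        then have "x \<in> ?C" unfolding mem_Collect_eq using y
          by (intro exI[of _ y] exI[of _ "x - y"]) (auto simp: dist_norm norm_minus_commute)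
        with that show False by blast
      qed
      then show "f y = 0" by (simp add: f_def)
    qed
  qed
  have mL: "mollify r f \<in> L2 UNIV" by (rule mollify_L2(2)[OF r(1) f])
  have fD: "f \<in> L2 D" "mollify r f \<in> L2 D" using L2_subset(1)[OF _ subset_UNIV] f mL Dm by auto
  have "l2norm D (\<lambda>x. g x - mollify r f x) \<le> l2norm D (\<lambda>x. g x - f x) + l2norm D (\<lambda>x. f x - mollify r f x)"
    by (rule l2norm_triangle_diff[OF g fD])
  also have "\<dots> < e"
  proof -
    have "l2norm D (\<lambda>x. mollify r f x - f x) \<le> l2norm UNIV (\<lambda>x. mollify r f x - f x)"
      by (rule L2_subset(2)[OF L2_diff[OF mL f] subset_UNIV _ Dm]) simp
    then show ?thesis
      using n d(2)[OF r(1,2)] l2norm_minus_commute[of D g f] l2norm_minus_commute[of D f "mollify r f"]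
      by (simp add: f_def)
  qed
  finally show thesis
  proof (rule that[OF test])
    show "0 \<le> mollify r f x" if "\<And>x. x \<in> D \<Longrightarrow> 0 \<le> g x" for x
      unfolding mollify_def using K(2)[of n] that
      by (intro integral_nonneg_AE AE_I2 mult_nonneg_nonneg mollifier_nonneg r) (auto simp: f_def indicator_def)
  qed
qed

section \<open>Weak gradients\<close>

lemma integral_translate:
  fixes f :: "'a::euclidean_space \<Rightarrow> real"
  assumes "continuous_on UNIV f"
  shows "(\<integral>x. f (x + c) \<partial>lebesgue) = (\<integral>x. f x \<partial>lebesgue)"
proof -
  have [measurable]: "f \<in> borel_measurable borel" using assms by (rule borel_measurable_continuous_onI)
  have "(\<integral>x. f x \<partial>lborel) = (\<integral>x. f x \<partial>distr lborel borel ((+) c))"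
    by (simp add: lborel_distr_plus)
  also have "\<dots> = (\<integral>x. f (c + x) \<partial>lborel)"
    by (subst integral_distr) auto
  finally show ?thesis by (simp add: integral_completion add.commute)
qed

text \<open>The integral of \<open>\<phi> (x + s b)\<close> over \<open>x\<close> does not depend on
  \<open>s\<close>, and its derivative at \<open>s = 0\<close> is the integral in question. The
  factor \<open>cutoff 1\<close> in \<open>s\<close> and the density \<open>cutoff R\<close> only
  bring the translate into the form of a parametric integral of a test function; both equal 1 where
  it matters.\<close>

lemma integral_grad_test_function:
  fixes \<phi> :: "'a::euclidean_space \<Rightarrow> real"
  assumes \<phi>: "\<phi> \<in> test_functions U" and b: "b \<in> Basis"
  shows "(\<integral>x. grad \<phi> x \<bullet> b \<partial>lebesgue) = 0"
proof -
  obtain C where C: "compact C" "\<And>x. x \<notin> C \<Longrightarrow> \<phi> x = 0" "\<And>x. x \<notin> C \<Longrightarrow> grad \<phi> x = 0"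
    using test_functionsE[OF \<phi>] by metis
  obtain R0 where R0: "R0 > 0" "C \<subseteq> ball 0 R0"
    using bounded_subset_ballD[OF compact_imp_bounded[OF C(1)], of 0] by blast
  have sm: "smooth \<phi>" by (rule test_functions_smooth[OF \<phi>])
  \<comment> \<open>Supports are shifted by at most 2, the range of \<open>s\<close> on which
    \<open>cutoff 1\<close> may be nonzero.\<close>
  define R where "R = R0 + 2"
  have R: "R > 0" using R0 by (simp add: R_def)
  define \<Phi> where "\<Phi> = (\<lambda>u::real \<times> 'a. cutoff 1 (fst u) * \<phi> (snd u + fst u *\<^sub>R b))"
  have d1: "((\<lambda>u::real \<times> 'a. snd u + fst u *\<^sub>R b) has_derivative (\<lambda>h. snd h + fst h *\<^sub>R b)) (at u)" for u
    by (auto intro!: derivative_eq_intros)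
  have d2: "((\<lambda>u::real \<times> 'a. fst u) has_derivative fst) (at u)" for u
    by (rule bounded_linear_imp_has_derivative[OF bounded_linear_fst])
  have out: "\<phi> (x + s *\<^sub>R b) = 0" if "norm s \<le> 2" "norm x \<ge> R" for s x
  proof -
    have "norm x \<le> norm (x + s *\<^sub>R b) + norm (s *\<^sub>R b)"
      using norm_triangle_ineq4[of "x + s *\<^sub>R b" "s *\<^sub>R b"] by simp
    then have "norm (x + s *\<^sub>R b) \<ge> R0" using that b by (simp add: R_def)
    then have "x + s *\<^sub>R b \<notin> C" using R0(2) by auto
    then show ?thesis by (rule C(2))
  qed
  have \<Phi>: "\<Phi> \<in> test_functions UNIV"
  proof (rule test_functionsI[of _ "cball 0 2 \<times> cball 0 R"])
    show "smooth \<Phi>" unfolding \<Phi>_def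
      by (rule smooth_mult[OF smooth_inner_compose[OF d2 smooth_cutoff] smooth_inner_compose[OF d1 sm]])
    show "compact (cball (0::real) 2 \<times> cball (0::'a) R)" by (intro compact_Times compact_cball)
    show "\<Phi> u = 0" if "u \<notin> cball 0 2 \<times> cball 0 R" for u
      using that out[of "fst u" "snd u"] cutoff_eq_0[of 1 "fst u"]
      by (cases u; cases "norm (fst u) \<le> 2") (auto simp: \<Phi>_def)
  qed simp
  have z: "integrable lebesgue (cutoff R :: 'a \<Rightarrow> real)"
    by (rule test_function_integrable[OF cutoff_test_function[OF R]])
  let ?g = "\<lambda>s. \<integral>x. \<Phi> (s, x) * cutoff R x \<partial>lebesgue"
  have g: "?g s = (\<integral>x. \<phi> x \<partial>lebesgue)" if "s \<in> ball 0 1" for s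
  proof -
    have "\<Phi> (s, x) * cutoff R x = \<phi> (x + s *\<^sub>R b)" for x
      using that out[of s x] cutoff_eq_1[of R x] R cutoff_eq_1[of 1 s]
      by (cases "norm x \<ge> R") (auto simp: \<Phi>_def)
    then have "?g s = (\<integral>x. \<phi> (x + s *\<^sub>R b) \<partial>lebesgue)" by simp
    also have "\<dots> = (\<integral>x. \<phi> x \<partial>lebesgue)" by (rule integral_translate[OF smooth_continuous[OF sm]])
    finally show ?thesis .
  qed
  have "(?g has_derivative (\<lambda>h. \<Sum>b\<in>Basis. (h \<bullet> b) * (\<integral>y. (grad \<Phi> (0, y) \<bullet> (b, 0)) * cutoff R y \<partial>lebesgue))) (at 0)"
    by (rule parametric_integral_has_derivative[OF \<Phi> z])
  moreover have "(?g has_derivative (\<lambda>h. 0)) (at 0)"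
    by (rule has_derivative_transform_within_open[of "\<lambda>s. \<integral>x. \<phi> x \<partial>lebesgue" _ _ _ "ball 0 1"]) (use g in auto)
  ultimately have "(\<lambda>h. \<Sum>b\<in>Basis. (h \<bullet> b) * (\<integral>y. (grad \<Phi> (0, y) \<bullet> (b, 0)) * cutoff R y \<partial>lebesgue)) = (\<lambda>h. 0)"
    by (rule has_derivative_unique)
  from fun_cong[OF this, of 1] have 0: "(\<integral>y. (grad \<Phi> (0, y) \<bullet> (1, 0)) * cutoff R y \<partial>lebesgue) = 0"
    by simp
  have "(grad \<Phi> (0, y) \<bullet> (1, 0)) * cutoff R y = grad \<phi> y \<bullet> b" for y
  proof -
    have dd: "(\<Phi> has_derivative (\<lambda>h. cutoff 1 (0::real) * (grad \<phi> y \<bullet> (snd h + fst h *\<^sub>R b)) + (grad (cutoff 1) 0 \<bullet> fst h) * \<phi> y)) (at (0, y))"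
      unfolding \<Phi>_def
      using has_derivative_mult[OF has_derivative_compose[OF d2 smooth_grad[OF smooth_cutoff[of 1]]] has_derivative_compose[OF d1 smooth_grad[OF sm]], of "(0, y)"]
      by simp
    have gc: "grad (cutoff 1) (0::real) = 0"
    proof (rule grad_eqI)
      have "((\<lambda>_. 1) has_derivative (\<lambda>h. 0 \<bullet> h)) (at (0::real))" by simp
      then show "(cutoff 1 has_derivative (\<lambda>h. 0 \<bullet> h)) (at (0::real))"
        by (rule has_derivative_transform_within_open[of _ _ _ _ "ball 0 1"]) (auto simp: cutoff_eq_1)
    qed
    have "grad \<Phi> (0, y) \<bullet> (1, 0) = frechet_derivative \<Phi> (at (0, y)) (1, 0)"
      by (rule frechet_eq_grad[OF differentiableI[OF dd], symmetric])
    also have "\<dots> = grad \<phi> y \<bullet> b"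
      by (subst pderiv_eqI[OF dd]) (simp add: gc cutoff_eq_1)
    finally have "grad \<Phi> (0, y) \<bullet> (1, 0) = grad \<phi> y \<bullet> b" .
    moreover have "cutoff R y = 1 \<or> grad \<phi> y = 0"
    proof (cases "norm y \<le> R")
      case False
      then have "y \<notin> C" using R0(2) by (auto simp: R_def)
      then show ?thesis using C(3) by simp
    qed (use R in \<open>simp add: cutoff_eq_1\<close>)
    ultimately show ?thesis by auto
  qed
  then show ?thesis using 0 by simp
qed

lemma integral_restrict_supported:
  fixes f :: "'a::euclidean_space \<Rightarrow> real"
  assumes "S \<in> sets lebesgue" "\<And>x. x \<notin> S \<Longrightarrow> f x = 0"
  shows "(\<integral>x. f x \<partial>lebesgue_on S) = (\<integral>x. f x \<partial>lebesgue)"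
proof -
  have "(\<lambda>x. indicator S x *\<^sub>R f x) = f" using assms(2) by (auto simp: indicator_def fun_eq_iff)
  then show ?thesis using assms(1) by (simp add: integral_restrict_space)
qed

lemma test_function_outside:
  assumes "\<phi> \<in> test_functions U" "x \<notin> U"
  shows "\<phi> x = 0" "grad \<phi> x = 0"
  using test_functionsE[OF assms(1)] assms(2) by (metis subset_iff)+

lemma smooth_integration_by_parts:
  fixes \<phi> f :: "'a::euclidean_space \<Rightarrow> real"
  assumes D: "D \<in> sets lebesgue" and \<phi>: "\<phi> \<in> test_functions D" and f: "smooth f" and b: "b \<in> Basis"
  shows "(\<integral>x. f x * (grad \<phi> x \<bullet> b) \<partial>lebesgue_on D) = - (\<integral>x. (grad f x \<bullet> b) * \<phi> x \<partial>lebesgue_on D)"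
proof -
  have sm: "smooth \<phi>" by (rule test_functions_smooth[OF \<phi>])
  have "(\<integral>x. grad (\<lambda>x. f x * \<phi> x) x \<bullet> b \<partial>lebesgue) = 0"
    by (rule integral_grad_test_function[OF test_function_mult[OF \<phi> f] b])
  moreover have "grad (\<lambda>x. f x * \<phi> x) x \<bullet> b = f x * (grad \<phi> x \<bullet> b) + (grad f x \<bullet> b) * \<phi> x" for x
    by (simp only: grad_mult[OF f sm] inner_add_left inner_scaleR_left mult.commute[of "\<phi> x"])
  moreover have "integrable lebesgue (\<lambda>x. f x * (grad \<phi> x \<bullet> b))" "integrable lebesgue (\<lambda>x. (grad f x \<bullet> b) * \<phi> x)"
    by (rule test_function_integrable[OF test_function_mult[OF grad_test_function_inner[OF \<phi> b] f]]
        test_function_integrable[OF test_function_mult[OF \<phi> smooth_grad_inner[OF f b]]])+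
  ultimately have "(\<integral>x. f x * (grad \<phi> x \<bullet> b) \<partial>lebesgue) = - (\<integral>x. (grad f x \<bullet> b) * \<phi> x \<partial>lebesgue)"
    by simp
  then show ?thesis
    using test_function_outside[OF \<phi>] by (subst (1 2) integral_restrict_supported[OF D]) auto
qed

text \<open>When the closed ball around \<open>x\<close> lies in \<open>D\<close>, the translated
  kernel is itself a test function of \<open>D\<close>, so the weak gradient may be moved across it.
  Closer to the boundary this argument breaks down, hence the pointwise hypothesis.\<close>

lemma mollify_H1_gradient:
  assumes D: "open D" and Z: "has_H1_gradient D Z GZ" and r: "r > 0" and R: "R > 0" "\<And>x. norm x \<ge> R \<Longrightarrow> Z x = 0"
    and x: "cball x r \<subseteq> D" and b: "b \<in> Basis"
  shows "grad (mollify r (\<lambda>x. indicator D x * Z x)) x \<bullet> b = mollify r (\<lambda>x. indicator D x * (GZ x \<bullet> b)) x"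
proof -
  have Dm: "D \<in> sets lebesgue" using D by simp
  let ?f = "\<lambda>x. indicator D x * Z x"
  have f: "?f \<in> L2 UNIV"
    using L2_extend(1)[OF _ Dm, of Z] Z by (simp add: has_H1_gradient_def)
  have fi: "integrable lebesgue ?f"
    by (rule L2_integrable_compact_support[OF f R(1)]) (simp add: R(2))
  have k: "(\<lambda>y. mollifier r (x - y)) \<in> test_functions D"
    by (rule test_functions_mono[OF mollifier_translate_test_function[OF r] x])
  have gk: "grad (\<lambda>y. mollifier r (x - y)) y = - grad (mollifier r) (x - y)" for y
  proof (rule grad_eqI)
    have "((\<lambda>y. x - y) has_derivative (\<lambda>h. - h)) (at y)"
      by (auto intro!: derivative_eq_intros)
    from has_derivative_compose[OF this smooth_grad[OF test_functions_smooth[OF mollifier_test_function[OF r]]]]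
    show "((\<lambda>y. mollifier r (x - y)) has_derivative (\<lambda>h. - grad (mollifier r) (x - y) \<bullet> h)) (at y)"
      by simp
  qed
  have "grad (mollify r ?f) x \<bullet> b = (\<integral>y. (grad (mollifier r) (x - y) \<bullet> b) * ?f y \<partial>lebesgue)"
    by (rule mollify_smooth(2)[OF r R(1) fi _ b]) (simp add: R(2))
  also have "\<dots> = (\<integral>y. indicator D y *\<^sub>R (- (Z y * (grad (\<lambda>y. mollifier r (x - y)) y \<bullet> b))) \<partial>lebesgue)"
    by (intro Bochner_Integration.integral_cong) (simp_all add: gk)
  also have "\<dots> = - (\<integral>y. Z y * (grad (\<lambda>y. mollifier r (x - y)) y \<bullet> b) \<partial>lebesgue_on D)"
    using Dm by (simp add: integral_restrict_space)
  also have "\<dots> = (\<integral>y. (GZ y \<bullet> b) * mollifier r (x - y) \<partial>lebesgue_on D)"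
    using Z k b interior_open[OF D] unfolding has_H1_gradient_def by auto
  also have "\<dots> = mollify r (\<lambda>x. indicator D x * (GZ x \<bullet> b)) x"
    unfolding mollify_def using Dm by (simp add: integral_restrict_space mult.commute mult.left_commute)
  finally show ?thesis .
qed

text \<open>Gradients are approximated only on a compact \<open>C\<close> because \<open>Z\<close>
  may have no extension across the boundary of \<open>D\<close>. The bound by \<open>M\<close> holds
  for every \<open>M\<close> at once: mollification averages \<open>Z\<close> extended by 0, and the
  value 0 of the extension explains the condition \<open>0 \<le> M\<close>.\<close>

lemma H1_local_approx:
  fixes D :: "'a::euclidean_space set"
  assumes D: "open D" and Z: "has_H1_gradient D Z GZ" and Z0: "\<And>x. x \<in> D \<Longrightarrow> 0 \<le> Z x"
    and R: "R > 0" "\<And>x. norm x \<ge> R \<Longrightarrow> Z x = 0"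
    and C: "compact C" "C \<subseteq> D" and e: "e > 0"
  obtains v where "v \<in> test_functions UNIV" "\<And>x. 0 \<le> v x" "\<And>M. 0 \<le> M \<Longrightarrow> (\<And>x. x \<in> D \<Longrightarrow> Z x \<le> M) \<Longrightarrow> (\<And>x. v x \<le> M)"
    "l2norm D (\<lambda>x. v x - Z x) < e" "l2norm D (\<lambda>x. indicator C x *\<^sub>R (grad v x - GZ x)) < e"
proof -
  have Dm: "D \<in> sets lebesgue" using D by simp
  have Cm: "C \<in> sets lebesgue" using C(1) by (simp add: lmeasurable_compact fmeasurableD)
  have ZL: "Z \<in> L2 D" "GZ \<in> L2 D" using Z by (auto simp: has_H1_gradient_def)
  define f where "f = (\<lambda>x. indicator D x * Z x)"
  define G where "G b = (\<lambda>x. indicator D x * (GZ x \<bullet> b))" for b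
  have f: "f \<in> L2 UNIV" using L2_extend(1)[OF ZL(1) Dm] by (simp add: f_def)
  have G: "G b \<in> L2 UNIV" for b using L2_extend(1)[OF L2_component[OF ZL(2)] Dm] by (simp add: G_def)
  have fi: "integrable lebesgue f"
    by (rule L2_integrable_compact_support[OF f R(1)]) (simp add: R(2) f_def)
  \<comment> \<open>One more than the number of components, so that the sum of the component errors
    stays strictly below \<open>e\<close>.\<close>
  define e' where "e' = e / real (DIM('a) + 1)"
  have e': "e' > 0" "e' \<le> e" using e by (auto simp: e'_def field_simps)
  obtain d0 where d0: "d0 > 0" "\<And>r. 0 < r \<Longrightarrow> r < d0 \<Longrightarrow> l2norm UNIV (\<lambda>x. mollify r f x - f x) < e'"
    using mollify_converges[OF f e'(1)] by metis
  have "\<exists>d>0. \<forall>r. 0 < r \<longrightarrow> r < d \<longrightarrow> l2norm UNIV (\<lambda>x. mollify r (G b) x - G b x) < e'" for b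
    using mollify_converges[OF G[of b] e'(1)] by metis
  then obtain d where d: "\<And>b. d b > 0" "\<And>b r. 0 < r \<Longrightarrow> r < d b \<Longrightarrow> l2norm UNIV (\<lambda>x. mollify r (G b) x - G b x) < e'"
    by metis
  obtain \<rho> where \<rho>: "\<rho> > 0" "(\<Union>x\<in>C. ball x \<rho>) \<subseteq> D"
    using compact_subset_open_imp_ball_epsilon_subset[OF C(1) D C(2)] by metis
  have bne: "Basis \<noteq> ({} :: 'a set)" by simp
  define r where "r = min (d0 / 2) (min (\<rho> / 2) (Min (d ` (Basis :: 'a set)) / 2))"
  have Md: "Min (d ` (Basis :: 'a set)) > 0" using d(1) by (subst Min_gr_iff) auto
  have "r > 0" using d0(1) \<rho>(1) Md by (simp add: r_def)
  moreover have "r \<le> d0 / 2" "r \<le> \<rho> / 2" by (simp_all add: r_def)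
  ultimately have r: "r > 0" "r < d0" "r < \<rho>" using d0(1) \<rho>(1) by linarith+
  have rd: "r < d b" if "b \<in> Basis" for b :: 'a
  proof -
    have "r \<le> Min (d ` (Basis :: 'a set)) / 2"
      unfolding r_def by (rule min.coboundedI2, rule min.coboundedI2, rule order_refl)
    also have "\<dots> < Min (d ` (Basis :: 'a set))" using Md by simp
    also have "\<dots> \<le> d b" using that by (intro Min_le) auto
    finally show ?thesis .
  qed
  define v where "v = mollify r f"
  have f0: "norm x \<ge> R \<Longrightarrow> f x = 0" for x by (simp add: f_def R(2))
  have sv: "smooth v" unfolding v_def by (rule mollify_smooth(1)[OF r(1) R(1) fi f0])
  have vt: "v \<in> test_functions UNIV"
  proof (rule test_functionsI[OF sv compact_cball[of "0::'a" "R + r"]])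
    fix x :: 'a assume x: "x \<notin> cball 0 (R + r)"
    show "v x = 0" unfolding v_def
    proof (rule mollify_outside[OF r(1)])
      fix y assume "y \<in> ball x r"
      then have "norm y \<ge> R" using x norm_triangle_sub[of x y] by (simp add: dist_norm)
      then show "f y = 0" by (rule f0)
    qed
  qed simp
  have vL: "v \<in> L2 UNIV" "v \<in> L2 D" "grad v \<in> L2 D" using test_function_L2[OF vt] Dm by auto
  have fL: "f \<in> L2 D" using L2_subset(1)[OF f subset_UNIV _ Dm] by simp
  have "l2norm D (\<lambda>x. v x - Z x) = l2norm D (\<lambda>x. v x - f x)"
    unfolding l2norm_def by (intro arg_cong[where f=sqrt] Bochner_Integration.integral_cong) (auto simp: f_def)
  also have "\<dots> \<le> l2norm UNIV (\<lambda>x. v x - f x)"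
    by (rule L2_subset(2)[OF L2_diff[OF vL(1) f] subset_UNIV _ Dm]) simp
  also have "\<dots> < e" using d0(2)[OF r(1,2)] e'(2) by (simp add: v_def)
  finally have c1: "l2norm D (\<lambda>x. v x - Z x) < e" .
  have gv: "grad v x \<bullet> b = mollify r (G b) x" if "x \<in> C" "b \<in> Basis" for x b
  proof -
    have "cball x r \<subseteq> ball x \<rho>" using r(3) by auto
    then have "cball x r \<subseteq> D" using \<rho>(2) that(1) by blast
    from mollify_H1_gradient[OF D Z r(1) R this that(2)]
    show ?thesis by (simp add: v_def f_def G_def)
  qed
  have iL: "(\<lambda>x. indicator C x *\<^sub>R (grad v x - GZ x)) \<in> L2 D"
    by (rule L2_indicator_restrict[OF L2_diff[OF vL(3) ZL(2)] Cm Dm])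
  have "l2norm D (\<lambda>x. indicator C x *\<^sub>R (grad v x - GZ x)) \<le> (\<Sum>b\<in>Basis. l2norm D (\<lambda>x. (indicator C x *\<^sub>R (grad v x - GZ x)) \<bullet> b))"
    by (rule l2norm_components[OF iL])
  also have "\<dots> \<le> (\<Sum>b\<in>(Basis :: 'a set). e')"
  proof (rule sum_mono)
    fix b :: 'a assume b: "b \<in> Basis"
    have mL: "mollify r (G b) \<in> L2 UNIV" by (rule mollify_L2(2)[OF r(1) G])
    have mD: "(\<lambda>x. mollify r (G b) x - G b x) \<in> L2 D"
      by (rule L2_subset(1)[OF L2_diff[OF mL G] subset_UNIV _ Dm]) simp
    have "l2norm D (\<lambda>x. (indicator C x *\<^sub>R (grad v x - GZ x)) \<bullet> b) \<le> l2norm D (\<lambda>x. mollify r (G b) x - G b x)"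
    proof (rule l2norm_mono[OF mD L2_measurable[OF L2_component[OF iL]]])
      show "AE x in lebesgue_on D. norm (indicator C x *\<^sub>R (grad v x - GZ x) \<bullet> b) \<le> norm (mollify r (G b) x - G b x)"
        by (intro AE_I2) (auto simp: indicator_def inner_diff_left gv[OF _ b] G_def)
    qed
    also have "\<dots> \<le> l2norm UNIV (\<lambda>x. mollify r (G b) x - G b x)"
      by (rule L2_subset(2)[OF L2_diff[OF mL G] subset_UNIV _ Dm]) simp
    also have "\<dots> < e'" by (rule d(2)[OF r(1) rd[OF b]])
    finally show "l2norm D (\<lambda>x. (indicator C x *\<^sub>R (grad v x - GZ x)) \<bullet> b) \<le> e'" by simp
  qed
  also have "\<dots> < e" using e by (simp add: e'_def field_simps)
  finally have c2: "l2norm D (\<lambda>x. indicator C x *\<^sub>R (grad v x - GZ x)) < e" .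
  have v0: "0 \<le> v x" for x
    unfolding v_def mollify_def
    by (intro integral_nonneg_AE AE_I2 mult_nonneg_nonneg mollifier_nonneg r) (auto simp: f_def indicator_def Z0)
  have vM: "v x \<le> M" if M: "0 \<le> M" "\<And>x. x \<in> D \<Longrightarrow> Z x \<le> M" for M x
  proof -
    have "\<bar>f y - M / 2\<bar> \<le> M / 2" for y
      using M Z0[of y] M(2)[of y] by (cases "y \<in> D") (auto simp: f_def abs_if)
    then have "\<bar>v x - M / 2\<bar> \<le> M / 2" unfolding v_def by (intro mollify_bounds[OF r(1) f])
    then show ?thesis by linarith
  qed
  show thesis by (rule that[OF vt v0 vM c1 c2])
qed


text \<open>The truncation \<open>s \<mapsto> M * s / (M + s)\<close> is bounded by \<open>M\<close>
  and 1-Lipschitz on nonnegative reals and, unlike \<open>min s M\<close>, has a Lipschitz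
  derivative. Hence the chain rule passes to the limit from smooth approximations, although their
  gradients converge only on the support of the test function.\<close>

lemma H1_rational_truncation:
  fixes D :: "'a::euclidean_space set"
  assumes D: "open D" and Z: "has_H1_gradient D Z GZ" and Z0: "\<And>x. x \<in> D \<Longrightarrow> 0 \<le> Z x"
    and R: "R > 0" "\<And>x. norm x \<ge> R \<Longrightarrow> Z x = 0" and M: "M > 0"
  shows "has_H1_gradient D (\<lambda>x. M * Z x / (M + Z x)) (\<lambda>x. (M / (M + Z x))\<^sup>2 *\<^sub>R GZ x)"
proof -
  define \<theta> where "\<theta> s = M * s / (M + s)" for s
  define \<theta>' where "\<theta>' s = (M / (M + s))\<^sup>2" for s
  have Dm: "D \<in> sets lebesgue" using D by simp
  have ZL: "Z \<in> L2 D" "GZ \<in> L2 D" using Z by (auto simp: has_H1_gradient_def)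
  note [measurable] = L2_measurable[OF ZL(1)] L2_measurable[OF ZL(2)]
  have \<theta>0: "0 \<le> \<theta> s" "\<theta> s \<le> s" "0 \<le> \<theta>' s" "\<theta>' s \<le> 1" if "0 \<le> s" for s
    using that M by (auto simp: \<theta>_def \<theta>'_def divide_simps power_le_one_iff algebra_simps)
  have \<theta>_lip: "\<bar>\<theta> s - \<theta> t\<bar> \<le> \<bar>s - t\<bar>" if "0 \<le> s" "0 \<le> t" for s t
  proof -
    have "\<theta> s - \<theta> t = (s - t) * ((M / (M + s)) * (M / (M + t)))"
      using that M by (simp add: \<theta>_def field_simps)
    then have "\<bar>\<theta> s - \<theta> t\<bar> = \<bar>s - t\<bar> * ((M / (M + s)) * (M / (M + t)))"
      using that M by (simp add: abs_mult)
    also have "\<dots> \<le> \<bar>s - t\<bar> * 1"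
      using that M by (intro mult_left_mono mult_le_one) auto
    finally show ?thesis by simp
  qed
  have \<theta>'_lip: "\<bar>\<theta>' s - \<theta>' t\<bar> \<le> (2 / M) * \<bar>s - t\<bar>" if "0 \<le> s" "0 \<le> t" for s t
  proof -
    define a b where "a = M / (M + s)" and "b = M / (M + t)"
    have ab: "0 \<le> a" "a \<le> 1" "0 \<le> b" "b \<le> 1" using that M by (auto simp: a_def b_def)
    have "M + s \<noteq> 0" "M + t \<noteq> 0" using that M by linarith+
    then have "a - b = (t - s) * (a * b) / M" using M
      by (simp add: a_def b_def divide_simps) (simp add: algebra_simps)
    then have "\<bar>a - b\<bar> = \<bar>s - t\<bar> / M * (a * b)" using ab M by (simp add: abs_mult abs_minus_commute)
    also have "\<dots> \<le> \<bar>s - t\<bar> / M * 1" using ab M by (intro mult_left_mono mult_le_one) auto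
    finally have 1: "\<bar>a - b\<bar> \<le> \<bar>s - t\<bar> / M" by simp
    have "\<theta>' s - \<theta>' t = (a - b) * (a + b)" by (simp add: \<theta>'_def a_def b_def power2_eq_square algebra_simps)
    then have "\<bar>\<theta>' s - \<theta>' t\<bar> = \<bar>a - b\<bar> * (a + b)" using ab by (simp add: abs_mult)
    also have "\<dots> \<le> (\<bar>s - t\<bar> / M) * 2" using ab 1 M by (intro mult_mono) auto
    finally show ?thesis by (simp add: mult.commute)
  qed
  have L: "(\<lambda>x. \<theta> (Z x)) \<in> L2 D"
  proof (rule L2_bound[OF ZL(1)])
    show "(\<lambda>x. \<theta> (Z x)) \<in> borel_measurable (lebesgue_on D)" unfolding \<theta>_def by measurable
    show "AE x in lebesgue_on D. norm (\<theta> (Z x)) \<le> norm (Z x)" using \<theta>0 Z0 by (intro AE_I2) auto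
  qed
  have \<theta>'m: "(\<lambda>x. \<theta>' (Z x)) \<in> borel_measurable (lebesgue_on D)"
    unfolding \<theta>'_def by measurable
  have GL: "(\<lambda>x. \<theta>' (Z x) *\<^sub>R GZ x) \<in> L2 D"
    by (rule L2_mult_bounded(1)[OF ZL(2) \<theta>'m, of 1]) (use \<theta>0 Z0 in auto)
  have "(\<integral>x. \<theta> (Z x) * (grad \<phi> x \<bullet> b) \<partial>lebesgue_on D) = - (\<integral>x. (\<theta>' (Z x) *\<^sub>R GZ x \<bullet> b) * \<phi> x \<partial>lebesgue_on D)"
    (is "?l = - ?r") if \<phi>: "\<phi> \<in> test_functions D" and b: "b \<in> Basis" for \<phi> b
  proof -
    obtain C where C: "compact C" "C \<subseteq> D" "\<And>x. x \<notin> C \<Longrightarrow> \<phi> x = 0"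
      using test_functionsE[OF \<phi>] by metis
    obtain B where B: "B > 0" "\<And>x. \<bar>\<phi> x\<bar> \<le> B" using test_function_bounded[OF \<phi>] by metis
    have gL: "(\<lambda>x. grad \<phi> x \<bullet> b) \<in> L2 D" "\<phi> \<in> L2 D"
      using test_function_L2[OF \<phi> Dm] L2_component by auto
    define K where "K = l2norm D (\<lambda>x. grad \<phi> x \<bullet> b) + l2norm D \<phi> + B * (2 / M) * l2norm D (\<lambda>x. GZ x \<bullet> b)"
    have K0: "K \<ge> 0" using B(1) M by (auto simp: K_def intro!: add_nonneg_nonneg mult_nonneg_nonneg)
    have "\<bar>?l + ?r\<bar> \<le> e * K" if e: "e > 0" for e
    proof -
      obtain v where v: "v \<in> test_functions UNIV" "\<And>x. 0 \<le> v x"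
        "l2norm D (\<lambda>x. v x - Z x) < e" "l2norm D (\<lambda>x. indicator C x *\<^sub>R (grad v x - GZ x)) < e"
        using H1_local_approx[OF D Z Z0 R C(1,2) e] by metis
      have sv: "smooth v" by (rule test_functions_smooth[OF v(1)])
      have vL: "v \<in> L2 D" "grad v \<in> L2 D" using test_function_L2[OF v(1) Dm] by auto
      note [measurable] = L2_measurable[OF vL(1)] L2_measurable[OF vL(2)]
      have Cm: "C \<in> sets lebesgue" using C(1) by (simp add: lmeasurable_compact fmeasurableD)
      have nz: "M + v x \<noteq> 0" for x using v(2)[of x] M by linarith
      have s\<theta>: "smooth (\<lambda>x. \<theta> (v x))"
        unfolding \<theta>_def by (intro smooth_divide smooth_mult smooth_add smooth_const sv nz)
      have g\<theta>: "grad (\<lambda>x. \<theta> (v x)) x = \<theta>' (v x) *\<^sub>R grad v x" for x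
      proof (rule grad_compose[OF sv])
        show "(\<theta> has_real_derivative \<theta>' (v x)) (at (v x))"
          unfolding \<theta>_def[abs_def] \<theta>'_def using nz[of x]
          by (auto intro!: derivative_eq_intros simp: field_simps power2_eq_square)
      qed
      have ibp: "(\<integral>x. \<theta> (v x) * (grad \<phi> x \<bullet> b) \<partial>lebesgue_on D) = - (\<integral>x. (\<theta>' (v x) *\<^sub>R grad v x \<bullet> b) * \<phi> x \<partial>lebesgue_on D)"
        using smooth_integration_by_parts[OF Dm \<phi> s\<theta> b] by (simp add: g\<theta>)
      have \<theta>v: "(\<lambda>x. \<theta> (v x)) \<in> L2 D"
      proof (rule L2_bound[OF vL(1)])
        show "(\<lambda>x. \<theta> (v x)) \<in> borel_measurable (lebesgue_on D)" unfolding \<theta>_def by measurable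
        show "AE x in lebesgue_on D. norm (\<theta> (v x)) \<le> norm (v x)" using \<theta>0 v(2) by (intro AE_I2) auto
      qed
      have \<theta>'vm: "(\<lambda>x. \<theta>' (v x)) \<in> borel_measurable (lebesgue_on D)"
        unfolding \<theta>'_def by measurable
      have G\<theta>v: "(\<lambda>x. \<theta>' (v x) *\<^sub>R grad v x) \<in> L2 D"
        by (rule L2_mult_bounded(1)[OF vL(2) \<theta>'vm, of 1]) (use \<theta>0 v(2) in auto)
      have d\<theta>: "l2norm D (\<lambda>x. \<theta> (Z x) - \<theta> (v x)) \<le> l2norm D (\<lambda>x. v x - Z x)"
        using \<theta>_lip Z0 v(2) L2_measurable[OF L2_diff[OF L \<theta>v]]
        by (intro l2norm_mono[OF L2_diff[OF vL(1) ZL(1)]] AE_I2) (auto simp: abs_minus_commute[of "v _"])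
      have 1: "\<bar>?l - (\<integral>x. \<theta> (v x) * (grad \<phi> x \<bullet> b) \<partial>lebesgue_on D)\<bar> \<le> e * l2norm D (\<lambda>x. grad \<phi> x \<bullet> b)"
      proof -
        have "?l - (\<integral>x. \<theta> (v x) * (grad \<phi> x \<bullet> b) \<partial>lebesgue_on D) = (\<integral>x. (\<theta> (Z x) - \<theta> (v x)) * (grad \<phi> x \<bullet> b) \<partial>lebesgue_on D)"
          using L2_mult_integrable[OF L gL(1)] L2_mult_integrable[OF \<theta>v gL(1)] by (simp add: left_diff_distrib)
        also have "\<bar>\<dots>\<bar> \<le> l2norm D (\<lambda>x. \<theta> (Z x) - \<theta> (v x)) * l2norm D (\<lambda>x. grad \<phi> x \<bullet> b)"
          by (rule L2_mult_le[OF L2_diff[OF L \<theta>v] gL(1)])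
        also have "\<dots> \<le> e * l2norm D (\<lambda>x. grad \<phi> x \<bullet> b)"
          using d\<theta> v(3) by (intro mult_right_mono) auto
        finally show ?thesis .
      qed
      have 2: "\<bar>(\<integral>x. (\<theta>' (v x) *\<^sub>R grad v x \<bullet> b) * \<phi> x \<partial>lebesgue_on D) - ?r\<bar> \<le> e * l2norm D \<phi> + e * (B * (2 / M) * l2norm D (\<lambda>x. GZ x \<bullet> b))"
      proof -
        let ?A = "\<lambda>x. (\<theta>' (v x) *\<^sub>R (indicator C x *\<^sub>R (grad v x - GZ x))) \<bullet> b"
        let ?B = "\<lambda>x. (\<theta>' (v x) - \<theta>' (Z x)) * \<phi> x"
        have iL: "(\<lambda>x. indicator C x *\<^sub>R (grad v x - GZ x)) \<in> L2 D"
          by (rule L2_indicator_restrict[OF L2_diff[OF vL(2) ZL(2)] Cm Dm])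
        have tiL: "(\<lambda>x. \<theta>' (v x) *\<^sub>R (indicator C x *\<^sub>R (grad v x - GZ x))) \<in> L2 D"
            and tin: "l2norm D (\<lambda>x. \<theta>' (v x) *\<^sub>R (indicator C x *\<^sub>R (grad v x - GZ x))) \<le> l2norm D (\<lambda>x. 1 *\<^sub>R indicator C x *\<^sub>R (grad v x - GZ x))"
          using L2_mult_bounded[OF iL \<theta>'vm, of 1] \<theta>0 v(2) by auto
        have AL: "?A \<in> L2 D" by (rule L2_component[OF tiL])
        have An: "l2norm D ?A \<le> e"
        proof -
          have "l2norm D ?A \<le> l2norm D (\<lambda>x. \<theta>' (v x) *\<^sub>R (indicator C x *\<^sub>R (grad v x - GZ x)))"
            unfolding real_norm_def[symmetric]
            by (intro l2norm_mono[OF tiL L2_measurable[OF AL]] AE_I2) (unfold real_norm_def, rule Basis_le_norm[OF b])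
          then show ?thesis using tin v(4) by simp
        qed
        have Bb: "\<bar>?B x\<bar> \<le> \<bar>(B * (2 / M)) * (v x - Z x)\<bar>" if "x \<in> D" for x
        proof -
          have "\<bar>?B x\<bar> \<le> ((2 / M) * \<bar>v x - Z x\<bar>) * B"
            unfolding abs_mult using \<theta>'_lip[of "v x" "Z x"] v(2)[of x] Z0[OF that] B(2)[of x] B(1) M
            by (intro mult_mono) auto
          moreover have "\<bar>(B * (2 / M)) * (v x - Z x)\<bar> = ((2 / M) * \<bar>v x - Z x\<bar>) * B"
            unfolding abs_mult[of "B * (2 / M)"] using B(1) M by simp
          ultimately show ?thesis by (simp only:)
        qed
        have BL: "?B \<in> L2 D"
        proof (rule L2_bound[OF L2_cmult[OF L2_diff[OF vL(1) ZL(1)], of "B * (2 / M)"]])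
          show "?B \<in> borel_measurable (lebesgue_on D)" using \<theta>'m \<theta>'vm L2_measurable[OF gL(2)] by measurable
          show "AE x in lebesgue_on D. norm (?B x) \<le> norm (B * (2 / M) * (v x - Z x))"
            using Bb by (intro AE_I2) (simp only: space_restrict_space real_norm_def, blast)
        qed
        have Bn: "l2norm D ?B \<le> (B * (2 / M)) * e"
        proof -
          have "l2norm D ?B \<le> l2norm D (\<lambda>x. (B * (2 / M)) * (v x - Z x))"
            using Bb by (intro l2norm_mono[OF L2_cmult[OF L2_diff[OF vL(1) ZL(1)]] L2_measurable[OF BL]] AE_I2)
              (simp only: space_restrict_space real_norm_def, blast)
          also have "\<dots> = (B * (2 / M)) * l2norm D (\<lambda>x. v x - Z x)"
            using l2norm_scaleR[of D "B * (2 / M)" "\<lambda>x. v x - Z x"] B(1) M by simp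
          also have "\<dots> \<le> (B * (2 / M)) * e" using v(3) B(1) M by (intro mult_left_mono) auto
          finally show ?thesis .
        qed
        \<comment> \<open>The difference is the sum of \<theta>'(v) (grad v - GZ) and (\<theta>'(v)
          - \<theta>'(Z)) GZ, each multiplied by \<phi>. Inserting the indicator of \<open>C\<close>
          is free since \<phi> vanishes off \<open>C\<close>; in the second part \<phi> is grouped
          with the small difference, since that product and \<open>GZ\<close> are both in
          \<open>L2\<close>.\<close>
        have "(\<theta>' (v x) *\<^sub>R grad v x \<bullet> b) * \<phi> x - (\<theta>' (Z x) *\<^sub>R GZ x \<bullet> b) * \<phi> x = ?A x * \<phi> x + ?B x * (GZ x \<bullet> b)" for x
          using C(3)[of x] by (cases "x \<in> C") (auto simp: inner_diff_left algebra_simps)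
        then have "(\<integral>x. (\<theta>' (v x) *\<^sub>R grad v x \<bullet> b) * \<phi> x \<partial>lebesgue_on D) - ?r = (\<integral>x. ?A x * \<phi> x + ?B x * (GZ x \<bullet> b) \<partial>lebesgue_on D)"
          using L2_mult_integrable[OF L2_component[OF G\<theta>v] gL(2)] L2_mult_integrable[OF L2_component[OF GL] gL(2)]
          by (subst Bochner_Integration.integral_diff[symmetric]) auto
        also have "\<dots> = (\<integral>x. ?A x * \<phi> x \<partial>lebesgue_on D) + (\<integral>x. ?B x * (GZ x \<bullet> b) \<partial>lebesgue_on D)"
          by (rule Bochner_Integration.integral_add[OF L2_mult_integrable[OF AL gL(2)] L2_mult_integrable[OF BL L2_component[OF ZL(2)]]])
        finally have "\<bar>(\<integral>x. (\<theta>' (v x) *\<^sub>R grad v x \<bullet> b) * \<phi> x \<partial>lebesgue_on D) - ?r\<bar>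
            \<le> l2norm D ?A * l2norm D \<phi> + l2norm D ?B * l2norm D (\<lambda>x. GZ x \<bullet> b)"
          using L2_mult_le[OF AL gL(2)] L2_mult_le[OF BL L2_component[OF ZL(2), of b]] by linarith
        also have "\<dots> \<le> e * l2norm D \<phi> + (B * (2 / M)) * e * l2norm D (\<lambda>x. GZ x \<bullet> b)"
          using An Bn by (intro add_mono mult_right_mono) auto
        finally show ?thesis by (simp add: mult_ac)
      qed
      have "\<bar>?l + ?r\<bar> \<le> e * l2norm D (\<lambda>x. grad \<phi> x \<bullet> b) + (e * l2norm D \<phi> + e * (B * (2 / M) * l2norm D (\<lambda>x. GZ x \<bullet> b)))"
        using 1 2 ibp by linarith
      then show ?thesis by (simp add: K_def algebra_simps)
    qed
    then have le: "\<bar>?l + ?r\<bar> \<le> e * K" if "e > 0" for e using that by blast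
    have "\<bar>?l + ?r\<bar> \<le> 0 + d" if "d > 0" for d
    proof -
      have "\<bar>?l + ?r\<bar> \<le> d / (K + 1) * K" using K0 that by (intro le) auto
      also have "\<dots> \<le> d" using K0 that by (simp add: field_simps)
      finally show ?thesis by simp
    qed
    then have "\<bar>?l + ?r\<bar> \<le> 0" by (rule field_le_epsilon)
    then show ?thesis by linarith
  qed
  then have "has_H1_gradient D (\<lambda>x. \<theta> (Z x)) (\<lambda>x. \<theta>' (Z x) *\<^sub>R GZ x)"
    using L GL interior_open[OF D] by (auto simp: has_H1_gradient_def)
  then show ?thesis unfolding \<theta>_def \<theta>'_def .
qed

text \<open>Rational truncations at levels tending to infinity: the factors
  \<open>M / (M + Z)\<close> lie in [0, 1] and tend to 1, so \<open>Z\<close> and \<open>GZ\<close>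
  themselves dominate the errors.\<close>

lemma H1_bounded_approx:
  fixes D :: "'a::euclidean_space set"
  assumes D: "open D" and Z: "has_H1_gradient D Z GZ" and Z0: "\<And>x. x \<in> D \<Longrightarrow> 0 \<le> Z x"
    and R: "R > 0" "\<And>x. norm x \<ge> R \<Longrightarrow> Z x = 0" and e: "e > 0"
  obtains M Z' GZ' where "M > 0" "has_H1_gradient D Z' GZ'" "\<And>x. x \<in> D \<Longrightarrow> 0 \<le> Z' x" "\<And>x. x \<in> D \<Longrightarrow> Z' x \<le> M"
    "\<And>x. norm x \<ge> R \<Longrightarrow> Z' x = 0" "l2norm D (\<lambda>x. Z' x - Z x) < e" "l2norm D (\<lambda>x. GZ' x - GZ x) < e"
proof -
  have ZL: "Z \<in> L2 D" "GZ \<in> L2 D" using Z by (auto simp: has_H1_gradient_def)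
  define M where "M n = real (Suc n)" for n
  have M: "M n > 0" for n by (simp add: M_def)
  let ?Z = "\<lambda>n x. M n * Z x / (M n + Z x)" and ?G = "\<lambda>n x. (M n / (M n + Z x))\<^sup>2 *\<^sub>R GZ x"
  have H: "has_H1_gradient D (?Z n) (?G n)" for n
    by (rule H1_rational_truncation[OF D Z Z0 R M])
  have HL: "?Z n \<in> L2 D" "?G n \<in> L2 D" for n using H[of n] by (auto simp: has_H1_gradient_def)
  have lim1: "(\<lambda>n. M n / (M n + s)) \<longlonglongrightarrow> 1" for s
    unfolding M_def by real_asymp
  have "(\<lambda>n. l2norm D (\<lambda>x. ?Z n x - Z x)) \<longlonglongrightarrow> 0"
  proof (rule L2_dominated[OF ZL(1) L2_measurable[OF HL(1)] L2_measurable[OF ZL(1)]])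
    show "AE x in lebesgue_on D. (\<lambda>n. ?Z n x) \<longlonglongrightarrow> Z x"
    proof (intro AE_I2)
      fix x show "(\<lambda>n. ?Z n x) \<longlonglongrightarrow> Z x"
        using tendsto_mult[OF lim1[of "Z x"] tendsto_const[of "Z x"]] by simp
    qed
    show "AE x in lebesgue_on D. norm (?Z n x - Z x) \<le> norm (Z x)" for n
    proof (intro AE_I2)
      fix x assume "x \<in> space (lebesgue_on D)"
      then have z: "0 \<le> Z x" using Z0 by simp
      have "0 \<le> ?Z n x" "?Z n x \<le> Z x" using z M[of n] by (auto simp: divide_simps algebra_simps)
      then show "norm (?Z n x - Z x) \<le> norm (Z x)" using z by simp
    qed
  qed
  then have "\<forall>\<^sub>F n in sequentially. l2norm D (\<lambda>x. ?Z n x - Z x) < e"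
    using e by (intro order_tendstoD) auto
  moreover have "(\<lambda>n. l2norm D (\<lambda>x. ?G n x - GZ x)) \<longlonglongrightarrow> 0"
  proof (rule L2_dominated[OF ZL(2) L2_measurable[OF HL(2)] L2_measurable[OF ZL(2)]])
    show "AE x in lebesgue_on D. (\<lambda>n. ?G n x) \<longlonglongrightarrow> GZ x"
    proof (intro AE_I2)
      fix x show "(\<lambda>n. ?G n x) \<longlonglongrightarrow> GZ x"
        using tendsto_scaleR[OF tendsto_power[OF lim1[of "Z x"], of 2] tendsto_const[of "GZ x"]] by simp
    qed
    show "AE x in lebesgue_on D. norm (?G n x - GZ x) \<le> norm (GZ x)" for n
    proof (intro AE_I2)
      fix x assume "x \<in> space (lebesgue_on D)"
      then have z: "0 \<le> Z x" using Z0 by simp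
      define t where "t = (M n / (M n + Z x))\<^sup>2"
      have t: "0 \<le> t" "t \<le> 1" using z M[of n] by (auto simp: t_def power_le_one_iff)
      have "t *\<^sub>R GZ x - GZ x = (t - 1) *\<^sub>R GZ x" by (simp add: scaleR_left_diff_distrib)
      then have "norm (t *\<^sub>R GZ x - GZ x) = (1 - t) * norm (GZ x)" using t by simp
      also have "\<dots> \<le> 1 * norm (GZ x)" using t by (intro mult_right_mono) auto
      finally show "norm (?G n x - GZ x) \<le> norm (GZ x)" by (simp add: t_def)
    qed
  qed
  then have "\<forall>\<^sub>F n in sequentially. l2norm D (\<lambda>x. ?G n x - GZ x) < e"
    using e by (intro order_tendstoD) auto
  ultimately have "\<forall>\<^sub>F n in sequentially. l2norm D (\<lambda>x. ?Z n x - Z x) < e \<and> l2norm D (\<lambda>x. ?G n x - GZ x) < e"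
    by (rule eventually_conj)
  then obtain n where n: "l2norm D (\<lambda>x. ?Z n x - Z x) < e" "l2norm D (\<lambda>x. ?G n x - GZ x) < e"
    by (auto simp: eventually_sequentially)
  show thesis
  proof (rule that[OF M H _ _ _ n])
    show "0 \<le> ?Z n x" "?Z n x \<le> M n" if "x \<in> D" for x
      using Z0[OF that] M[of n] by (auto simp: divide_simps algebra_simps)
  qed (simp add: R(2))
qed

section \<open>One step of the dual problem\<close>

definition pos_tests :: "'a::euclidean_space set \<Rightarrow> ('a \<Rightarrow> real) set" where
  "pos_tests D = {\<phi> \<in> test_functions D. \<forall>x. 0 \<le> \<phi> x}"

lemma pos_tests_test: "\<phi> \<in> pos_tests D \<Longrightarrow> \<phi> \<in> test_functions D"
  and pos_tests_nonneg: "\<phi> \<in> pos_tests D \<Longrightarrow> 0 \<le> \<phi> x"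
  by (auto simp: pos_tests_def)

lemma l2norm_component_le:
  assumes "f \<in> L2 \<Omega>" "b \<in> Basis" shows "l2norm \<Omega> (\<lambda>x. f x \<bullet> b) \<le> l2norm \<Omega> f"
  by (intro l2norm_mono[OF assms(1) L2_measurable[OF L2_component[OF assms(1)]]] AE_I2)
    (unfold real_norm_def, rule Basis_le_norm[OF assms(2)])

lemma L2_component_integrable:
  "f \<in> L2 \<Omega> \<Longrightarrow> g \<in> L2 \<Omega> \<Longrightarrow> integrable (lebesgue_on \<Omega>) (\<lambda>x. (f x \<bullet> b) * (g x \<bullet> b))"
  by (intro L2_mult_integrable L2_component)

text \<open>Gradients bounded in \<open>L2\<close>, of functions that are uniformly small, are
  weakly close to 0: replace the components of \<open>G\<close> by test functions and integrate by
  parts, so that only the size of \<open>L\<close> counts. It serves to discard the part of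
  \<nabla>\<eta> that lives where \<eta> is small.\<close>

lemma grad_pairing_small:
  fixes D :: "'a::euclidean_space set"
  assumes D: "open D" and G: "G \<in> L2 D" and K: "K \<ge> 0" and e: "e > 0"
  obtains \<epsilon> where "\<epsilon> > 0"
    "\<And>L. L \<in> test_functions D \<Longrightarrow> (\<And>x. \<bar>L x\<bar> \<le> \<epsilon>) \<Longrightarrow> l2norm D (grad L) \<le> K
      \<Longrightarrow> \<bar>\<integral>x. grad L x \<bullet> G x \<partial>lebesgue_on D\<bar> \<le> e"
proof -
  have Dm: "D \<in> sets lebesgue" using D by simp
  \<comment> \<open>Half of \<open>e\<close> pays for replacing \<open>G\<close> by test functions,
    half for the terms after integration by parts; the dimension enters because the components are
    treated separately.\<close>
  define \<rho> where "\<rho> = e / (2 * (K + 1) * real DIM('a))"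
  have \<rho>: "\<rho> > 0" using e K by (simp add: \<rho>_def)
  have "\<exists>\<psi>. \<psi> \<in> test_functions D \<and> l2norm D (\<lambda>x. G x \<bullet> b - \<psi> x) < \<rho>" for b
    using L2_test_functions_dense[OF D L2_component[OF G, of b] \<rho>] by metis
  then obtain \<Psi> where \<Psi>: "\<And>b. \<Psi> b \<in> test_functions D" "\<And>b. l2norm D (\<lambda>x. G x \<bullet> b - \<Psi> b x) < \<rho>"
    by metis
  define A where "A = (\<Sum>b\<in>Basis. \<integral>x. \<bar>grad (\<Psi> b) x \<bullet> b\<bar> \<partial>lebesgue_on D) + 1"
  have A: "A > 0" unfolding A_def by (intro add_nonneg_pos sum_nonneg integral_nonneg_AE) auto
  define \<epsilon> where "\<epsilon> = e / (2 * A)"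
  have \<epsilon>: "\<epsilon> > 0" using e A by (simp add: \<epsilon>_def)
  show thesis
  proof (rule that[OF \<epsilon>])
    fix L assume L: "L \<in> test_functions D" "\<And>x. \<bar>L x\<bar> \<le> \<epsilon>" "l2norm D (grad L) \<le> K"
    have sL: "smooth L" by (rule test_functions_smooth[OF L(1)])
    have gL: "grad L \<in> L2 D" "L \<in> L2 D" using test_function_L2[OF L(1) Dm] by auto
    have "(\<integral>x. grad L x \<bullet> G x \<partial>lebesgue_on D) = (\<integral>x. (\<Sum>b\<in>Basis. (grad L x \<bullet> b) * (G x \<bullet> b)) \<partial>lebesgue_on D)"
      by (simp add: euclidean_inner[symmetric])
    also have "\<dots> = (\<Sum>b\<in>Basis. \<integral>x. (grad L x \<bullet> b) * (G x \<bullet> b) \<partial>lebesgue_on D)"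
      by (rule Bochner_Integration.integral_sum) (rule L2_component_integrable[OF gL(1) G])
    finally have "\<bar>\<integral>x. grad L x \<bullet> G x \<partial>lebesgue_on D\<bar> \<le> (\<Sum>b\<in>Basis. \<bar>\<integral>x. (grad L x \<bullet> b) * (G x \<bullet> b) \<partial>lebesgue_on D\<bar>)"
      by simp
    also have "\<dots> \<le> (\<Sum>b\<in>Basis. K * \<rho> + \<epsilon> * (\<integral>x. \<bar>grad (\<Psi> b) x \<bullet> b\<bar> \<partial>lebesgue_on D))"
    proof (rule sum_mono)
      fix b :: 'a assume b: "b \<in> Basis"
      have \<Psi>L: "\<Psi> b \<in> L2 D" "grad (\<Psi> b) \<in> L2 D" using test_function_L2[OF \<Psi>(1) Dm] by auto
      have gb: "(\<lambda>x. grad L x \<bullet> b) \<in> L2 D" by (rule L2_component[OF gL(1)])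
      have Gb: "(\<lambda>x. G x \<bullet> b) \<in> L2 D" by (rule L2_component[OF G])
      have i1: "\<bar>\<integral>x. (grad L x \<bullet> b) * (G x \<bullet> b - \<Psi> b x) \<partial>lebesgue_on D\<bar> \<le> K * \<rho>"
      proof -
        have "\<bar>\<integral>x. (grad L x \<bullet> b) * (G x \<bullet> b - \<Psi> b x) \<partial>lebesgue_on D\<bar> \<le> l2norm D (\<lambda>x. grad L x \<bullet> b) * l2norm D (\<lambda>x. G x \<bullet> b - \<Psi> b x)"
          by (rule L2_mult_le[OF gb L2_diff[OF Gb \<Psi>L(1)]])
        also have "\<dots> \<le> K * \<rho>"
          using l2norm_component_le[OF gL(1) b] L(3) \<Psi>(2)[of b] K by (intro mult_mono) auto
        finally show ?thesis .
      qed
      have "(\<integral>x. (grad L x \<bullet> b) * \<Psi> b x \<partial>lebesgue_on D) = - (\<integral>x. L x * (grad (\<Psi> b) x \<bullet> b) \<partial>lebesgue_on D)"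
        using smooth_integration_by_parts[OF Dm \<Psi>(1) sL b] by simp
      also have "\<bar>\<dots>\<bar> \<le> (\<integral>x. \<epsilon> * \<bar>grad (\<Psi> b) x \<bullet> b\<bar> \<partial>lebesgue_on D)"
        unfolding abs_minus_cancel
      proof (rule order_trans[OF integral_abs_bound integral_mono])
        show "integrable (lebesgue_on D) (\<lambda>x. \<bar>L x * (grad (\<Psi> b) x \<bullet> b)\<bar>)"
          by (intro integrable_abs L2_mult_integrable gL L2_component \<Psi>L)
        have "integrable lebesgue (\<lambda>x. grad (\<Psi> b) x \<bullet> b)"
          by (rule test_function_integrable[OF grad_test_function_inner[OF \<Psi>(1) b]])
        then have "integrable (lebesgue_on D) (\<lambda>x. grad (\<Psi> b) x \<bullet> b)"
          using Dm integrable_restrict_space[of D lebesgue] integrable_mult_indicator by auto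
        then show "integrable (lebesgue_on D) (\<lambda>x. \<epsilon> * \<bar>grad (\<Psi> b) x \<bullet> b\<bar>)" by simp
        show "\<bar>L x * (grad (\<Psi> b) x \<bullet> b)\<bar> \<le> \<epsilon> * \<bar>grad (\<Psi> b) x \<bullet> b\<bar>" for x
          unfolding abs_mult by (intro mult_right_mono L) simp
      qed
      finally have i2: "\<bar>\<integral>x. (grad L x \<bullet> b) * \<Psi> b x \<partial>lebesgue_on D\<bar> \<le> \<epsilon> * (\<integral>x. \<bar>grad (\<Psi> b) x \<bullet> b\<bar> \<partial>lebesgue_on D)"
        by simp
      have "(\<integral>x. (grad L x \<bullet> b) * (G x \<bullet> b) \<partial>lebesgue_on D)
          = (\<integral>x. (grad L x \<bullet> b) * (G x \<bullet> b - \<Psi> b x) \<partial>lebesgue_on D) + (\<integral>x. (grad L x \<bullet> b) * \<Psi> b x \<partial>lebesgue_on D)"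
        using L2_mult_integrable[OF gb Gb] L2_mult_integrable[OF gb \<Psi>L(1)] by (simp add: right_diff_distrib)
      then show "\<bar>\<integral>x. (grad L x \<bullet> b) * (G x \<bullet> b) \<partial>lebesgue_on D\<bar> \<le> K * \<rho> + \<epsilon> * (\<integral>x. \<bar>grad (\<Psi> b) x \<bullet> b\<bar> \<partial>lebesgue_on D)"
        using i1 i2 by linarith
    qed
    also have "\<dots> = real DIM('a) * (K * \<rho>) + \<epsilon> * (A - 1)"
      by (simp add: sum.distrib sum_distrib_left A_def)
    also have "\<dots> \<le> e / 2 + e / 2"
    proof (rule add_mono)
      have "real DIM('a) * (K * \<rho>) = (K / (K + 1)) * (e / 2)" using K unfolding \<rho>_def by (simp add: divide_simps)
      also have "\<dots> \<le> 1 * (e / 2)" using K e by (intro mult_right_mono) auto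
      finally show "real DIM('a) * (K * \<rho>) \<le> e / 2" by simp
      have "\<epsilon> * (A - 1) \<le> \<epsilon> * A" using \<epsilon> by simp
      also have "\<dots> = e / 2" using A by (simp add: \<epsilon>_def)
      finally show "\<epsilon> * (A - 1) \<le> e / 2" .
    qed
    finally show "\<bar>\<integral>x. grad L x \<bullet> G x \<partial>lebesgue_on D\<bar> \<le> e" by simp
  qed
qed

text \<open>One backward time step: \<open>f\<close> is the datum from the later time, \<alpha> the
  regularised coefficient of the step. Its lower bound holds at every point, so that no exceptional
  set has to be carried through the weighted integrals.\<close>

locale parabolic_step =
  fixes D :: "'a::euclidean_space set" and \<alpha> f :: "'a \<Rightarrow> real" and \<delta> h :: real
  assumes D: "open D" and \<alpha>m: "\<alpha> \<in> borel_measurable (lebesgue_on D)"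
    and \<delta>: "\<delta> > 0" and \<alpha>\<delta>: "\<And>x. \<delta> \<le> \<alpha> x" and h: "h > 0" and f: "f \<in> pos_tests D"
begin

lemma Dm: "D \<in> sets lebesgue" using D by simp

text \<open>A minimiser \<open>\<eta>\<close> of the energy solves the implicit Euler step
  \<open>\<eta> - f = h \<alpha> \<Delta>\<eta>\<close>, that is \<open>\<zeta> \<eta> = - h \<Delta>\<eta>\<close>, of the dual problem.\<close>

definition \<zeta> :: "('a \<Rightarrow> real) \<Rightarrow> 'a \<Rightarrow> real" where
  "\<zeta> \<eta> x = (f x - \<eta> x) / \<alpha> x"

text \<open>The weight \<open>1 / \<alpha>\<close> makes the step variational: multiplication by
  \<alpha> destroys the symmetry of the Laplacian in \<open>L2\<close>, and the weight restores
  it.\<close>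

definition energy :: "('a \<Rightarrow> real) \<Rightarrow> real" where
  "energy \<eta> = (\<integral>x. (f x - \<eta> x)\<^sup>2 / \<alpha> x \<partial>lebesgue_on D) + h * (l2norm D (grad \<eta>))\<^sup>2"

definition quad :: "('a \<Rightarrow> real) \<Rightarrow> real" where
  "quad \<phi> = (\<integral>x. (\<phi> x)\<^sup>2 / \<alpha> x \<partial>lebesgue_on D) + h * (l2norm D (grad \<phi>))\<^sup>2"

lemma L2_over_\<alpha>:
  assumes "g \<in> L2 D" shows "(\<lambda>x. g x / \<alpha> x) \<in> L2 D"
proof -
  have "(\<lambda>x. (1 / \<alpha> x) *\<^sub>R g x) \<in> L2 D"
  proof (rule L2_mult_bounded(1)[OF assms])
    show "(\<lambda>x. 1 / \<alpha> x) \<in> borel_measurable (lebesgue_on D)" using \<alpha>m by measurable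
    show "AE x in lebesgue_on D. \<bar>1 / \<alpha> x\<bar> \<le> 1 / \<delta>"
    proof (intro AE_I2)
      fix x show "\<bar>1 / \<alpha> x\<bar> \<le> 1 / \<delta>" using \<alpha>\<delta>[of x] \<delta> by (simp add: frac_le)
    qed
  qed
  then show ?thesis by simp
qed

lemma f_test: "f \<in> test_functions D" and f_L2: "f \<in> L2 D" "grad f \<in> L2 D"
  using f test_function_L2[OF _ Dm] by (auto simp: pos_tests_def)

lemma \<zeta>_L2: "\<eta> \<in> L2 D \<Longrightarrow> \<zeta> \<eta> \<in> L2 D"
  unfolding \<zeta>_def[abs_def] by (intro L2_over_\<alpha> L2_diff f_L2)

lemma \<zeta>_bound:
  assumes "\<eta> \<in> L2 D"
  shows "\<delta> * (l2norm D (\<zeta> \<eta>))\<^sup>2 \<le> (\<integral>x. (f x - \<eta> x)\<^sup>2 / \<alpha> x \<partial>lebesgue_on D)"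
proof -
  have d: "(\<lambda>x. f x - \<eta> x) \<in> L2 D" by (intro L2_diff f_L2 assms)
  have "\<delta> * (l2norm D (\<zeta> \<eta>))\<^sup>2 = (\<integral>x. \<delta> * (\<zeta> \<eta> x)\<^sup>2 \<partial>lebesgue_on D)"
    by (simp add: l2norm_sq)
  also have "\<dots> \<le> (\<integral>x. (f x - \<eta> x) * ((f x - \<eta> x) / \<alpha> x) \<partial>lebesgue_on D)"
  proof (rule integral_mono)
    show "integrable (lebesgue_on D) (\<lambda>x. \<delta> * (\<zeta> \<eta> x)\<^sup>2)"
      using L2_integrable_sq[OF \<zeta>_L2[OF assms]] by simp
    show "integrable (lebesgue_on D) (\<lambda>x. (f x - \<eta> x) * ((f x - \<eta> x) / \<alpha> x))"
      by (rule L2_mult_integrable[OF d L2_over_\<alpha>[OF d]])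
    show "\<delta> * (\<zeta> \<eta> x)\<^sup>2 \<le> (f x - \<eta> x) * ((f x - \<eta> x) / \<alpha> x)" for x
    proof -
      have "\<alpha> x > 0" using \<alpha>\<delta>[of x] \<delta> by linarith
      then have "(f x - \<eta> x) * ((f x - \<eta> x) / \<alpha> x) = \<alpha> x * (\<zeta> \<eta> x)\<^sup>2"
        by (simp add: \<zeta>_def power2_eq_square field_simps)
      then show ?thesis using \<alpha>\<delta>[of x] by (simp add: mult_right_mono)
    qed
  qed
  finally show ?thesis by (simp add: power2_eq_square)
qed

lemma quad_integral_nonneg: "0 \<le> (\<integral>x. (g x)\<^sup>2 / \<alpha> x \<partial>lebesgue_on D)"
proof (intro integral_nonneg_AE AE_I2)
  fix x show "0 \<le> (g x)\<^sup>2 / \<alpha> x" using \<alpha>\<delta>[of x] \<delta> by (intro divide_nonneg_nonneg) auto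
qed

lemma energy_nonneg: "0 \<le> energy \<eta>"
  unfolding energy_def using h by (intro add_nonneg_nonneg quad_integral_nonneg) auto

lemma energy_f: "energy f = h * (l2norm D (grad f))\<^sup>2"
  by (simp add: energy_def)

lemma energy_expand:
  assumes \<eta>: "\<eta> \<in> test_functions D" and \<phi>: "\<phi> \<in> test_functions D"
  shows "energy (\<lambda>x. \<eta> x + s * \<phi> x) = energy \<eta>
    + 2 * s * (h * (\<integral>x. grad \<eta> x \<bullet> grad \<phi> x \<partial>lebesgue_on D) - (\<integral>x. \<zeta> \<eta> x * \<phi> x \<partial>lebesgue_on D)) + s\<^sup>2 * quad \<phi>"
proof -
  have L: "\<eta> \<in> L2 D" "grad \<eta> \<in> L2 D" "\<phi> \<in> L2 D" "grad \<phi> \<in> L2 D"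
    using test_function_L2[OF \<eta> Dm] test_function_L2[OF \<phi> Dm] by auto
  have d: "(\<lambda>x. f x - \<eta> x) \<in> L2 D" by (intro L2_diff f_L2 L)
  have i1: "integrable (lebesgue_on D) (\<lambda>x. (f x - \<eta> x)\<^sup>2 / \<alpha> x)"
    using L2_mult_integrable[OF d L2_over_\<alpha>[OF d]] by (simp add: power2_eq_square)
  have i2: "integrable (lebesgue_on D) (\<lambda>x. \<zeta> \<eta> x * \<phi> x)"
    by (rule L2_mult_integrable[OF \<zeta>_L2[OF L(1)] L(3)])
  have i3: "integrable (lebesgue_on D) (\<lambda>x. (\<phi> x)\<^sup>2 / \<alpha> x)"
    using L2_mult_integrable[OF L(3) L2_over_\<alpha>[OF L(3)]] by (simp add: power2_eq_square)
  have "(f x - (\<eta> x + s * \<phi> x))\<^sup>2 / \<alpha> x = (f x - \<eta> x)\<^sup>2 / \<alpha> x - 2 * s * (\<zeta> \<eta> x * \<phi> x) + s\<^sup>2 * ((\<phi> x)\<^sup>2 / \<alpha> x)" for x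
    by (simp add: \<zeta>_def power2_eq_square algebra_simps add_divide_distrib diff_divide_distrib)
  then have 1: "(\<integral>x. (f x - (\<eta> x + s * \<phi> x))\<^sup>2 / \<alpha> x \<partial>lebesgue_on D)
      = (\<integral>x. (f x - \<eta> x)\<^sup>2 / \<alpha> x \<partial>lebesgue_on D) - 2 * s * (\<integral>x. \<zeta> \<eta> x * \<phi> x \<partial>lebesgue_on D)
        + s\<^sup>2 * (\<integral>x. (\<phi> x)\<^sup>2 / \<alpha> x \<partial>lebesgue_on D)"
    using i1 i2 i3 by (simp del: times_divide_eq_right)
  have sm: "smooth \<eta>" "smooth \<phi>" using \<eta> \<phi> test_functions_smooth by auto
  have "grad (\<lambda>x. \<eta> x + s * \<phi> x) x = grad \<eta> x + s *\<^sub>R grad \<phi> x" for x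
    using grad_add[OF sm(1) smooth_mult[OF smooth_const sm(2)], of s x] grad_cmult[OF sm(2), of s x] by simp
  then have "(norm (grad (\<lambda>x. \<eta> x + s * \<phi> x) x))\<^sup>2 = (norm (grad \<eta> x))\<^sup>2 + 2 * s * (grad \<eta> x \<bullet> grad \<phi> x) + s\<^sup>2 * (norm (grad \<phi> x))\<^sup>2" for x
    by (simp only: power2_norm_eq_inner) (simp add: inner_add_left inner_add_right inner_commute power2_eq_square algebra_simps)
  then have 2: "(l2norm D (grad (\<lambda>x. \<eta> x + s * \<phi> x)))\<^sup>2
      = (l2norm D (grad \<eta>))\<^sup>2 + 2 * s * (\<integral>x. grad \<eta> x \<bullet> grad \<phi> x \<partial>lebesgue_on D) + s\<^sup>2 * (l2norm D (grad \<phi>))\<^sup>2"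
    unfolding l2norm_sq using L2_integrable_sq[OF L(2)] L2_integrable_sq[OF L(4)] L2_inner_integrable[OF L(2) L(4)] by simp
  show ?thesis unfolding energy_def quad_def 1 2 by (simp add: algebra_simps)
qed

lemma approx_minimizer:
  assumes "\<kappa> > 0"
  obtains \<eta> where "\<eta> \<in> pos_tests D" "\<And>\<phi>. \<phi> \<in> pos_tests D \<Longrightarrow> energy \<eta> \<le> energy \<phi> + \<kappa>"
proof -
  let ?S = "energy ` pos_tests D"
  have ne: "?S \<noteq> {}" using f by auto
  have bd: "bdd_below ?S" using energy_nonneg by (auto intro!: bdd_belowI[of _ 0])
  have "Inf ?S < Inf ?S + \<kappa>" using assms by simp
  then obtain \<eta> where \<eta>: "\<eta> \<in> pos_tests D" "energy \<eta> < Inf ?S + \<kappa>"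
    using cInf_lessD[OF ne] by blast
  have "energy \<eta> \<le> energy \<phi> + \<kappa>" if "\<phi> \<in> pos_tests D" for \<phi>
    using \<eta>(2) cInf_lower[OF imageI[OF that, of energy] bd] by linarith
  with \<eta>(1) show thesis by (rule that)
qed

text \<open>Comparing \<eta> with \<open>\<eta> + s \<psi>\<close> bounds the first variation from
  one side, the side being the sign of \<open>s\<close>. Division by twice the modulus of
  \<open>s\<close> leaves two errors: the quadratic term, small once \<open>s\<close> is small, and
  \<kappa>, which must be small compared with \<open>s\<close>; hence \<open>s\<close> is fixed
  before \<kappa>.\<close>

lemma variation_le:
  assumes \<eta>: "\<eta> \<in> pos_tests D" "\<And>\<phi>. \<phi> \<in> pos_tests D \<Longrightarrow> energy \<eta> \<le> energy \<phi> + \<kappa>"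
    and \<psi>: "\<psi> \<in> test_functions D" "\<And>x. 0 \<le> \<eta> x + s * \<psi> x" and s: "s \<noteq> 0" "\<bar>s\<bar> * quad \<psi> \<le> e" "\<kappa> \<le> \<bar>s\<bar> * e"
  shows "0 \<le> sgn s * (h * (\<integral>x. grad \<eta> x \<bullet> grad \<psi> x \<partial>lebesgue_on D) - (\<integral>x. \<zeta> \<eta> x * \<psi> x \<partial>lebesgue_on D)) + e"
proof -
  let ?I = "h * (\<integral>x. grad \<eta> x \<bullet> grad \<psi> x \<partial>lebesgue_on D) - (\<integral>x. \<zeta> \<eta> x * \<psi> x \<partial>lebesgue_on D)"
  have \<eta>t: "\<eta> \<in> test_functions D" using \<eta>(1) by (rule pos_tests_test)
  have "(\<lambda>x. \<eta> x + s * \<psi> x) \<in> pos_tests D"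
    unfolding pos_tests_def using test_function_add[OF \<eta>t test_function_mult[OF \<psi>(1) smooth_const[of s]]] \<psi>(2) by simp
  from \<eta>(2)[OF this] have "0 \<le> 2 * s * ?I + s\<^sup>2 * quad \<psi> + \<kappa>"
    unfolding energy_expand[OF \<eta>t \<psi>(1)] by linarith
  also have "\<dots> \<le> 2 * s * ?I + \<bar>s\<bar> * e + \<bar>s\<bar> * e"
  proof -
    have "s\<^sup>2 * quad \<psi> = \<bar>s\<bar> * (\<bar>s\<bar> * quad \<psi>)" by (simp add: power2_eq_square)
    also have "\<dots> \<le> \<bar>s\<bar> * e" by (intro mult_left_mono s) simp
    finally show ?thesis using s(3) by linarith
  qed
  also have "\<dots> = 2 * \<bar>s\<bar> * (sgn s * ?I + e)"
  proof -
    have "2 * (\<bar>s\<bar> * sgn s) * ?I + \<bar>s\<bar> * e + \<bar>s\<bar> * e = 2 * \<bar>s\<bar> * (sgn s * ?I + e)"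
      by (simp only: distrib_left mult.assoc)
    then show ?thesis unfolding abs_mult_sgn .
  qed
  finally show ?thesis using s(1) by (simp add: zero_le_mult_iff)
qed

text \<open>The second estimate combines two variations of an almost minimiser: adding a multiple of \<open>b\<close>, and
  subtracting a multiple of \<open>\<psi> = v q\<close>, where \<open>v\<close> is a smooth approximation of \<open>Z\<close> and
  \<open>q = 1 - \<epsilon>\<^sup>2 / (\<epsilon> + \<eta>)\<^sup>2 \<le> 2 \<eta> / \<epsilon>\<close>, so that \<open>\<eta>\<close> stays nonnegative. The factor \<open>q\<close> is harmless
  because \<open>(1 - q) \<nabla>\<eta> = \<nabla>L\<close> with \<open>0 \<le> L = \<epsilon> \<eta> / (\<epsilon> + \<eta>) \<le> \<epsilon>\<close>.\<close>

lemma minimizer_exists_bounded: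
  assumes b: "b \<in> pos_tests D" and Z: "has_H1_gradient D Z GZ"
    and Z0: "\<And>x. x \<in> D \<Longrightarrow> 0 \<le> Z x" and ZM: "\<And>x. x \<in> D \<Longrightarrow> Z x \<le> M" and M: "M > 0"
    and R: "R > 0" "\<And>x. norm x \<ge> R \<Longrightarrow> Z x = 0" and e: "e > 0"
  obtains \<eta> where "\<eta> \<in> pos_tests D" "energy \<eta> \<le> h * (l2norm D (grad f))\<^sup>2 + e"
    "(\<integral>x. \<zeta> \<eta> x * (b x - Z x) \<partial>lebesgue_on D) \<le> h * (\<integral>x. grad \<eta> x \<bullet> (grad b x - GZ x) \<partial>lebesgue_on D) + e"
proof -
  have ZL: "Z \<in> L2 D" "GZ \<in> L2 D" using Z by (auto simp: has_H1_gradient_def)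
  have bt: "b \<in> test_functions D" by (rule pos_tests_test[OF b])
  have bL: "b \<in> L2 D" "grad b \<in> L2 D" using test_function_L2[OF bt Dm] by auto
  \<comment> \<open>Five errors of size \<open>e1\<close> are collected: one from the variation by
    \<open>b\<close>, four in \<open>Zfin\<close>.\<close>
  define e1 where "e1 = e / 6"
  have e1: "e1 > 0" using e by (simp add: e1_def)
  \<comment> \<open>Bounds the gradient norm of every \<eta> whose energy exceeds that of
    \<open>f\<close> by at most \<open>e\<close>. It is available before \<eta> is chosen, and so
    are \<epsilon>, \<open>Q0\<close>, \<open>s\<close> and \<kappa>.\<close>
  define C0 where "C0 = sqrt ((l2norm D (grad f))\<^sup>2 + e / h)"
  have C0: "C0 \<ge> 0" using e h by (simp add: C0_def)
  obtain \<epsilon>0 where \<epsilon>0: "\<epsilon>0 > 0"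
    "\<And>L. L \<in> test_functions D \<Longrightarrow> (\<And>x. \<bar>L x\<bar> \<le> \<epsilon>0) \<Longrightarrow> l2norm D (grad L) \<le> C0
      \<Longrightarrow> \<bar>\<integral>x. grad L x \<bullet> GZ x \<partial>lebesgue_on D\<bar> \<le> e1 / h"
    using grad_pairing_small[OF D ZL(2) C0, of "e1 / h"] e1 h by (metis divide_pos_pos)
  have Zi: "integrable (lebesgue_on D) Z"
  proof -
    have "(\<lambda>x. indicator D x *\<^sub>R Z x) \<in> L2 UNIV" by (rule L2_extend(1)[OF ZL(1) Dm])
    then have "integrable lebesgue (\<lambda>x. indicator D x *\<^sub>R Z x)"
      by (rule L2_integrable_compact_support[OF _ R(1)]) (simp add: R(2))
    then show ?thesis using Dm by (simp add: integrable_restrict_space)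
  qed
  define IZ where "IZ = (\<integral>x. Z x \<partial>lebesgue_on D)"
  have IZ: "IZ \<ge> 0" unfolding IZ_def using Z0 by (intro integral_nonneg_AE AE_I2) auto
  \<comment> \<open>The second bound is for \<open>I4\<close>, where replacing \<open>q * Z\<close>
    by \<open>Z\<close> costs \<open>\<epsilon> / \<delta>\<close> times the integral of
    \<open>Z\<close>.\<close>
  define \<epsilon> where "\<epsilon> = min \<epsilon>0 (e1 * \<delta> / (IZ + 1))"
  have \<epsilon>: "\<epsilon> > 0" "\<epsilon> \<le> \<epsilon>0" using \<epsilon>0(1) e1 \<delta> IZ by (auto simp: \<epsilon>_def)
  have \<epsilon>IZ: "\<epsilon> / \<delta> * IZ \<le> e1"
  proof -
    have "\<epsilon> / \<delta> * IZ \<le> (e1 * \<delta> / (IZ + 1)) / \<delta> * IZ"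
      using IZ \<delta> by (intro mult_right_mono divide_right_mono) (auto simp: \<epsilon>_def)
    also have "\<dots> = e1 * (IZ / (IZ + 1))" using \<delta> by simp
    also have "\<dots> \<le> e1 * 1" using e1 IZ by (intro mult_left_mono) auto
    finally show ?thesis by simp
  qed
  \<comment> \<open>An a priori bound for \<open>quad \<psi>\<close>: the approximation
    \<open>v\<close> is within 1 of \<open>Z\<close> and at most \<open>M\<close>, and the gradient
    of \<open>q\<close> is at most \<open>2 / \<epsilon>\<close> times that of \<eta>.\<close>
  define Q0 where "Q0 = (l2norm D Z + 1)\<^sup>2 / \<delta> + h * (1 + l2norm D GZ + (2 * M / \<epsilon>) * C0)\<^sup>2"
  have Q0: "Q0 \<ge> 0" using \<delta> h by (simp add: Q0_def)
  have qb: "quad b \<ge> 0" unfolding quad_def using h by (intro add_nonneg_nonneg quad_integral_nonneg) auto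
  \<comment> \<open>The first bound keeps \<open>\<eta> - s \<psi>\<close> nonnegative, since
    \<open>\<psi> \<le> M * (2 * \<eta> / \<epsilon>)\<close>; the second controls the quadratic
    terms of both variations.\<close>
  define s where "s = min (\<epsilon> / (2 * M)) (e1 / (Q0 + quad b + 1))"
  have s: "s > 0" "s \<le> \<epsilon> / (2 * M)" using \<epsilon> M e1 Q0 qb by (auto simp: s_def)
  have sQ: "s * Q \<le> e1" if "Q \<le> Q0 + quad b" for Q
  proof -
    have "s * Q \<le> s * (Q0 + quad b + 1)" using that s(1) by (intro mult_left_mono) auto
    also have "\<dots> \<le> (e1 / (Q0 + quad b + 1)) * (Q0 + quad b + 1)"
      using Q0 qb by (intro mult_right_mono) (auto simp: s_def)
    also have "\<dots> = e1" using Q0 qb by simp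
    finally show ?thesis .
  qed
  define \<kappa> where "\<kappa> = min e (s * e1)"
  have \<kappa>: "\<kappa> > 0" "\<kappa> \<le> e" "\<kappa> \<le> s * e1" using e e1 s by (auto simp: \<kappa>_def)
  obtain \<eta> where \<eta>: "\<eta> \<in> pos_tests D" "\<And>\<phi>. \<phi> \<in> pos_tests D \<Longrightarrow> energy \<eta> \<le> energy \<phi> + \<kappa>"
    using approx_minimizer[OF \<kappa>(1)] by metis
  have \<eta>t: "\<eta> \<in> test_functions D" by (rule pos_tests_test[OF \<eta>(1)])
  have \<eta>0: "0 \<le> \<eta> x" for x by (rule pos_tests_nonneg[OF \<eta>(1)])
  have \<eta>L: "\<eta> \<in> L2 D" "grad \<eta> \<in> L2 D" using test_function_L2[OF \<eta>t Dm] by auto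
  have s\<eta>: "smooth \<eta>" by (rule test_functions_smooth[OF \<eta>t])
  have \<zeta>L: "\<zeta> \<eta> \<in> L2 D" by (rule \<zeta>_L2[OF \<eta>L(1)])
  have en: "energy \<eta> \<le> h * (l2norm D (grad f))\<^sup>2 + e"
    using \<eta>(2)[OF f] \<kappa>(2) by (simp add: energy_f)
  have g\<eta>: "l2norm D (grad \<eta>) \<le> C0"
  proof -
    have "h * (l2norm D (grad \<eta>))\<^sup>2 \<le> energy \<eta>"
      unfolding energy_def using quad_integral_nonneg[of "\<lambda>x. f x - \<eta> x"] by simp
    also have "\<dots> \<le> h * ((l2norm D (grad f))\<^sup>2 + e / h)" using en h by (simp add: distrib_left)
    finally have "(l2norm D (grad \<eta>))\<^sup>2 \<le> (l2norm D (grad f))\<^sup>2 + e / h" using h by simp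
    then show ?thesis unfolding C0_def by (rule real_le_rsqrt)
  qed
  have vb: "0 \<le> (h * (\<integral>x. grad \<eta> x \<bullet> grad b x \<partial>lebesgue_on D) - (\<integral>x. \<zeta> \<eta> x * b x \<partial>lebesgue_on D)) + e1"
    using variation_le[OF \<eta> bt, of s e1] \<eta>0 pos_tests_nonneg[OF b] s(1) sQ[of "quad b"] Q0 \<kappa>(3) by simp
  obtain C where C: "compact C" "C \<subseteq> D" "\<And>x. x \<notin> C \<Longrightarrow> \<eta> x = 0"
    using test_functionsE[OF \<eta>t] by metis
  have Cm: "C \<in> sets lebesgue" using C(1) by (simp add: lmeasurable_compact fmeasurableD)
  \<comment> \<open>Chosen after \<eta>: the approximation of \<open>Z\<close> has to beat the norm
    of \<open>\<zeta> \<eta>\<close>, and its gradient is required on the support of \<eta>.\<close>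
  define t where "t = min 1 (e1 / (h * C0 + l2norm D (\<zeta> \<eta>) + 1))"
  have hC: "h * C0 \<ge> 0" using h C0 by simp
  then have den: "h * C0 + l2norm D (\<zeta> \<eta>) + 1 > 0" using l2norm_nonneg[of D "\<zeta> \<eta>"] by linarith
  have t: "t > 0" "t \<le> 1" using e1 den by (auto simp: t_def)
  have t2: "h * C0 * t + l2norm D (\<zeta> \<eta>) * t \<le> e1"
  proof -
    have "h * C0 * t + l2norm D (\<zeta> \<eta>) * t \<le> (h * C0 + l2norm D (\<zeta> \<eta>) + 1) * t" using t(1) by (simp add: algebra_simps)
    also have "\<dots> \<le> (h * C0 + l2norm D (\<zeta> \<eta>) + 1) * (e1 / (h * C0 + l2norm D (\<zeta> \<eta>) + 1))"
      using den by (intro mult_left_mono) (auto simp: t_def)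
    also have "\<dots> = e1" using den by simp
    finally show ?thesis .
  qed
  obtain v where v: "v \<in> test_functions UNIV" "\<And>x. 0 \<le> v x" "\<And>x. v x \<le> M"
      "l2norm D (\<lambda>x. v x - Z x) < t" "l2norm D (\<lambda>x. indicator C x *\<^sub>R (grad v x - GZ x)) < t"
  proof (rule H1_local_approx[OF D Z Z0 R C(1,2) t(1)])
    fix v assume a: "v \<in> test_functions UNIV" "\<And>x. 0 \<le> v x"
      "\<And>M x. 0 \<le> M \<Longrightarrow> (\<And>x. x \<in> D \<Longrightarrow> Z x \<le> M) \<Longrightarrow> v x \<le> M"
      "l2norm D (\<lambda>x. v x - Z x) < t" "l2norm D (\<lambda>x. indicator C x *\<^sub>R (grad v x - GZ x)) < t"
    have "v x \<le> M" for x using a(3)[OF less_imp_le[OF M] ZM] .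
    from a(1,2) this a(4,5) show thesis by (rule that)
  qed
  have sv: "smooth v" by (rule test_functions_smooth[OF v(1)])
  have vL: "v \<in> L2 D" "grad v \<in> L2 D" using test_function_L2[OF v(1) Dm] by auto
  define q where "q x = 1 - (\<epsilon> * \<epsilon>) / ((\<epsilon> + \<eta> x) * (\<epsilon> + \<eta> x))" for x
  define k where "k x = 2 * \<epsilon> * \<epsilon> / ((\<epsilon> + \<eta> x) * (\<epsilon> + \<eta> x) * (\<epsilon> + \<eta> x))" for x
  have pos: "\<epsilon> + \<eta> x > 0" for x using \<epsilon>(1) \<eta>0[of x] by linarith
  have nz: "\<epsilon> + \<eta> x \<noteq> 0" for x using pos[of x] by simp
  have sq: "smooth q" unfolding q_def[abs_def]
    using nz by (intro smooth_diff smooth_const smooth_divide smooth_mult smooth_add s\<eta>) auto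
  have gq: "grad q x = k x *\<^sub>R grad \<eta> x" for x
    unfolding q_def[abs_def]
  proof (rule grad_compose[OF s\<eta>, of "\<lambda>s. 1 - (\<epsilon> * \<epsilon>) / ((\<epsilon> + s) * (\<epsilon> + s))"])
    show "((\<lambda>s. 1 - (\<epsilon> * \<epsilon>) / ((\<epsilon> + s) * (\<epsilon> + s))) has_real_derivative k x) (at (\<eta> x))"
      using nz[of x] unfolding k_def by (auto intro!: derivative_eq_intros) (simp add: divide_simps)
  qed
  have q_ratio: "(\<epsilon> * \<epsilon>) / ((\<epsilon> + \<eta> x) * (\<epsilon> + \<eta> x)) = (\<epsilon> / (\<epsilon> + \<eta> x)) * (\<epsilon> / (\<epsilon> + \<eta> x))" for x by simp
  have r01: "0 \<le> \<epsilon> / (\<epsilon> + \<eta> x)" "\<epsilon> / (\<epsilon> + \<eta> x) \<le> 1" for x using \<epsilon>(1) \<eta>0[of x] pos[of x] by auto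
  have q01: "0 \<le> q x" "q x \<le> 1" for x
    using r01[of x] mult_le_one[OF r01(2)[of x] r01(1)[of x] r01(2)[of x]] unfolding q_def q_ratio by auto
  have q_lin: "q x \<le> 2 * \<eta> x / \<epsilon>" for x
  proof -
    let ?r = "\<epsilon> / (\<epsilon> + \<eta> x)"
    have "q x = (1 - ?r) * (1 + ?r)" unfolding q_def q_ratio by (simp add: algebra_simps)
    also have "\<dots> \<le> (1 - ?r) * 2" using r01[of x] by (intro mult_left_mono) auto
    also have "1 - ?r = \<eta> x / (\<epsilon> + \<eta> x)" using nz[of x] by (simp add: divide_simps)
    also have "\<dots> \<le> \<eta> x / \<epsilon>" using \<epsilon>(1) \<eta>0[of x] by (intro divide_left_mono) auto
    finally show ?thesis by (simp add: mult.commute)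
  qed
  have qC: "q x = 0" if "x \<notin> C" for x using C(3)[OF that] \<epsilon>(1) by (simp add: q_def)
  have k01: "0 \<le> k x" "k x \<le> 2 / \<epsilon>" for x
  proof -
    show "0 \<le> k x" unfolding k_def using \<epsilon>(1) pos[of x] by simp
    have "k x = (2 / \<epsilon>) * (\<epsilon> / (\<epsilon> + \<eta> x) * (\<epsilon> / (\<epsilon> + \<eta> x)) * (\<epsilon> / (\<epsilon> + \<eta> x)))"
      unfolding k_def using \<epsilon>(1) by simp
    also have "\<dots> \<le> (2 / \<epsilon>) * 1"
      using r01[of x] \<epsilon>(1) by (intro mult_left_mono mult_le_one) auto
    finally show "k x \<le> 2 / \<epsilon>" by simp
  qed
  define \<psi> where "\<psi> x = v x * q x" for x
  have \<psi>t: "\<psi> \<in> test_functions D" unfolding \<psi>_def[abs_def]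
    by (rule test_functionsI[OF smooth_mult[OF sv sq] C(1,2)]) (simp add: qC)
  have \<psi>L: "\<psi> \<in> L2 D" "grad \<psi> \<in> L2 D" using test_function_L2[OF \<psi>t Dm] by auto
  have g\<psi>: "grad \<psi> x = (v x * k x) *\<^sub>R grad \<eta> x + q x *\<^sub>R grad v x" for x
    unfolding \<psi>_def[abs_def] grad_mult[OF sv sq] gq by simp
  have qm: "q \<in> borel_measurable (lebesgue_on D)"
    by (intro continuous_imp_measurable_on_sets_lebesgue continuous_on_subset[OF smooth_continuous[OF sq]] Dm) simp
  have DL: "(\<lambda>x. indicator C x *\<^sub>R (grad v x - GZ x)) \<in> L2 D"
    by (rule L2_indicator_restrict[OF L2_diff[OF vL(2) ZL(2)] Cm Dm])
  have quad\<psi>: "quad \<psi> \<le> Q0"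
  proof -
    have "l2norm D v \<le> l2norm D Z + 1" using l2norm_le_diff[OF vL(1) ZL(1)] v(4) t(2) by linarith
    then have v2: "(l2norm D v)\<^sup>2 \<le> (l2norm D Z + 1)\<^sup>2" by (intro power_mono) auto
    have "(\<integral>x. (\<psi> x)\<^sup>2 / \<alpha> x \<partial>lebesgue_on D) \<le> (\<integral>x. (v x)\<^sup>2 / \<delta> \<partial>lebesgue_on D)"
    proof (rule integral_mono)
      show "integrable (lebesgue_on D) (\<lambda>x. (\<psi> x)\<^sup>2 / \<alpha> x)"
        using L2_mult_integrable[OF \<psi>L(1) L2_over_\<alpha>[OF \<psi>L(1)]] by (simp add: power2_eq_square)
      show "integrable (lebesgue_on D) (\<lambda>x. (v x)\<^sup>2 / \<delta>)" using L2_integrable_sq[OF vL(1)] by simp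
      show "(\<psi> x)\<^sup>2 / \<alpha> x \<le> (v x)\<^sup>2 / \<delta>" for x
      proof (rule frac_le)
        have "\<psi> x \<le> v x * 1" unfolding \<psi>_def by (intro mult_left_mono q01 v)
        then show "(\<psi> x)\<^sup>2 \<le> (v x)\<^sup>2" using v(2)[of x] q01[of x] by (intro power_mono) (auto simp: \<psi>_def)
      qed (use \<delta> \<alpha>\<delta> in auto)
    qed
    also have "\<dots> = (l2norm D v)\<^sup>2 / \<delta>" by (simp add: l2norm_sq)
    also have "\<dots> \<le> (l2norm D Z + 1)\<^sup>2 / \<delta>" using v2 \<delta> by (intro divide_right_mono) auto
    finally have 1: "(\<integral>x. (\<psi> x)\<^sup>2 / \<alpha> x \<partial>lebesgue_on D) \<le> (l2norm D Z + 1)\<^sup>2 / \<delta>" .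
    let ?n1 = "\<lambda>x. norm (indicator C x *\<^sub>R (grad v x - GZ x))" and ?n2 = "\<lambda>x. norm (GZ x)" and ?n3 = "\<lambda>x. (2 * M / \<epsilon>) *\<^sub>R norm (grad \<eta> x)"
    have nL: "?n1 \<in> L2 D" "?n2 \<in> L2 D" "?n3 \<in> L2 D"
      by (intro L2_norm DL) (intro L2_norm ZL, intro L2_scaleR L2_norm \<eta>L)
    have pw: "norm (grad \<psi> x) \<le> ?n1 x + ?n2 x + ?n3 x" for x
    proof -
      have "norm (grad \<psi> x) \<le> (v x * k x) * norm (grad \<eta> x) + q x * norm (grad v x)"
        unfolding g\<psi> using v(2)[of x] k01(1)[of x] q01(1)[of x] by (intro norm_triangle_le) simp
      moreover have "(v x * k x) * norm (grad \<eta> x) \<le> (M * (2 / \<epsilon>)) * norm (grad \<eta> x)"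
        using v(2,3)[of x] k01[of x] M by (intro mult_right_mono mult_mono) auto
      moreover have "q x * norm (grad v x) \<le> ?n1 x + ?n2 x"
      proof (cases "x \<in> C")
        case True
        have "q x * norm (grad v x) \<le> 1 * norm (grad v x)" by (intro mult_right_mono q01) simp
        also have "\<dots> \<le> norm (grad v x - GZ x) + norm (GZ x)" using norm_triangle_sub[of "grad v x" "GZ x"] by simp
        finally show ?thesis using True by simp
      qed (simp add: qC)
      ultimately show ?thesis by (simp add: mult.commute)
    qed
    have sL: "(\<lambda>x. ?n1 x + ?n2 x + ?n3 x) \<in> L2 D" by (rule L2_add[OF L2_add[OF nL(1,2)] nL(3)])
    have "l2norm D (grad \<psi>) \<le> l2norm D (\<lambda>x. ?n1 x + ?n2 x + ?n3 x)"
    proof (rule l2norm_mono[OF sL L2_measurable[OF \<psi>L(2)]], intro AE_I2)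
      fix x show "norm (grad \<psi> x) \<le> norm (?n1 x + ?n2 x + ?n3 x)" using pw[of x] by simp
    qed
    also have "\<dots> \<le> l2norm D ?n1 + l2norm D ?n2 + l2norm D ?n3"
      using l2norm_triangle[OF L2_add[OF nL(1,2)] nL(3)] l2norm_triangle[OF nL(1,2)] by linarith
    also have "\<dots> \<le> 1 + l2norm D GZ + (2 * M / \<epsilon>) * C0"
    proof -
      have "l2norm D ?n3 \<le> (2 * M / \<epsilon>) * C0"
        unfolding l2norm_scaleR l2norm_norm using M \<epsilon>(1) g\<eta> by (simp add: mult_left_mono divide_right_mono)
      then show ?thesis using v(5) t(2) unfolding l2norm_norm by linarith
    qed
    finally have "(l2norm D (grad \<psi>))\<^sup>2 \<le> (1 + l2norm D GZ + (2 * M / \<epsilon>) * C0)\<^sup>2" by (intro power_mono) auto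
    then show ?thesis unfolding quad_def Q0_def using 1 h by (intro add_mono mult_left_mono) auto
  qed
  have v\<psi>: "h * (\<integral>x. grad \<eta> x \<bullet> grad \<psi> x \<partial>lebesgue_on D) \<le> (\<integral>x. \<zeta> \<eta> x * \<psi> x \<partial>lebesgue_on D) + e1"
  proof -
    have "0 \<le> \<eta> x + (- s) * \<psi> x" for x
    proof -
      have "s * \<psi> x \<le> (\<epsilon> / (2 * M)) * (M * (2 * \<eta> x / \<epsilon>))"
        unfolding \<psi>_def using v(2,3)[of x] q01[of x] q_lin[of x] s M \<epsilon>(1) by (intro mult_mono) auto
      also have "\<dots> = \<eta> x" using M \<epsilon>(1) by simp
      finally show ?thesis by simp
    qed
    from variation_le[OF \<eta> \<psi>t this, of e1] show ?thesis
      using s(1) sQ[of "quad \<psi>"] quad\<psi> qb \<kappa>(3) by simp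
  qed
  have i_v: "integrable (lebesgue_on D) (\<lambda>x. q x * (grad \<eta> x \<bullet> grad v x))"
   and i_G: "integrable (lebesgue_on D) (\<lambda>x. q x * (grad \<eta> x \<bullet> GZ x))"
  proof -
    have "(\<lambda>x. q x *\<^sub>R grad \<eta> x) \<in> L2 D"
      by (rule L2_mult_bounded(1)[OF \<eta>L(2) qm, of 1]) (use q01 in auto)
    from L2_inner_integrable[OF this vL(2)] L2_inner_integrable[OF this ZL(2)]
    show "integrable (lebesgue_on D) (\<lambda>x. q x * (grad \<eta> x \<bullet> grad v x))"
      "integrable (lebesgue_on D) (\<lambda>x. q x * (grad \<eta> x \<bullet> GZ x))" by auto
  qed
  \<comment> \<open>The part of \<nabla>\<psi> in which \<open>q\<close> is differentiated
    contributes \<open>v * k\<close> times the square of \<nabla>\<eta>. It is nonnegative because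
    \<open>q\<close> increases with \<eta>, and is dropped.\<close>
  have I1: "(\<integral>x. q x * (grad \<eta> x \<bullet> grad v x) \<partial>lebesgue_on D) \<le> (\<integral>x. grad \<eta> x \<bullet> grad \<psi> x \<partial>lebesgue_on D)"
  proof (rule integral_mono[OF i_v L2_inner_integrable[OF \<eta>L(2) \<psi>L(2)]])
    fix x
    have "0 \<le> (v x * k x) * (grad \<eta> x \<bullet> grad \<eta> x)" using v(2)[of x] k01(1)[of x] by simp
    then show "q x * (grad \<eta> x \<bullet> grad v x) \<le> grad \<eta> x \<bullet> grad \<psi> x" unfolding g\<psi> by (simp add: inner_add_right)
  qed
  have I2: "(\<integral>x. q x * (grad \<eta> x \<bullet> GZ x) \<partial>lebesgue_on D) \<le> (\<integral>x. q x * (grad \<eta> x \<bullet> grad v x) \<partial>lebesgue_on D) + C0 * t"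
  proof -
    let ?X = "\<lambda>x. q x *\<^sub>R (indicator C x *\<^sub>R (grad v x - GZ x))"
    have XL: "?X \<in> L2 D" and Xn: "l2norm D ?X \<le> l2norm D (\<lambda>x. indicator C x *\<^sub>R (grad v x - GZ x))"
      using L2_mult_bounded[OF DL qm, of 1] q01 by auto
    have "grad \<eta> x \<bullet> ?X x = q x * (grad \<eta> x \<bullet> grad v x) - q x * (grad \<eta> x \<bullet> GZ x)" for x
      using qC[of x] by (cases "x \<in> C") (auto simp: inner_diff_right algebra_simps)
    then have "(\<integral>x. grad \<eta> x \<bullet> ?X x \<partial>lebesgue_on D) = (\<integral>x. q x * (grad \<eta> x \<bullet> grad v x) \<partial>lebesgue_on D) - (\<integral>x. q x * (grad \<eta> x \<bullet> GZ x) \<partial>lebesgue_on D)"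
      using i_v i_G by simp
    moreover have "\<bar>\<integral>x. grad \<eta> x \<bullet> ?X x \<partial>lebesgue_on D\<bar> \<le> C0 * t"
      using order_trans[OF L2_inner_le[OF \<eta>L(2) XL] mult_mono[OF g\<eta>, of "l2norm D ?X" t]] Xn v(5) C0 by simp
    ultimately show ?thesis by linarith
  qed
  have qZL: "(\<lambda>x. q x *\<^sub>R Z x) \<in> L2 D"
    by (rule L2_mult_bounded(1)[OF ZL(1) qm, of 1]) (use q01 in auto)
  have I3: "(\<integral>x. \<zeta> \<eta> x * \<psi> x \<partial>lebesgue_on D) \<le> (\<integral>x. \<zeta> \<eta> x * (q x * Z x) \<partial>lebesgue_on D) + l2norm D (\<zeta> \<eta>) * t"
  proof -
    let ?Y = "\<lambda>x. q x *\<^sub>R (v x - Z x)"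
    have YL: "?Y \<in> L2 D" and Yn: "l2norm D ?Y \<le> l2norm D (\<lambda>x. v x - Z x)"
      using L2_mult_bounded[OF L2_diff[OF vL(1) ZL(1)] qm, of 1] q01 by auto
    have "(\<integral>x. \<zeta> \<eta> x * ?Y x \<partial>lebesgue_on D) = (\<integral>x. \<zeta> \<eta> x * \<psi> x - \<zeta> \<eta> x * (q x * Z x) \<partial>lebesgue_on D)"
      by (intro Bochner_Integration.integral_cong) (auto simp: \<psi>_def algebra_simps)
    also have "\<dots> = (\<integral>x. \<zeta> \<eta> x * \<psi> x \<partial>lebesgue_on D) - (\<integral>x. \<zeta> \<eta> x * (q x * Z x) \<partial>lebesgue_on D)"
      using L2_mult_integrable[OF \<zeta>L \<psi>L(1)] L2_mult_integrable[OF \<zeta>L qZL] by simp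
    finally have "(\<integral>x. \<zeta> \<eta> x * ?Y x \<partial>lebesgue_on D) = (\<integral>x. \<zeta> \<eta> x * \<psi> x \<partial>lebesgue_on D) - (\<integral>x. \<zeta> \<eta> x * (q x * Z x) \<partial>lebesgue_on D)" .
    moreover have "\<bar>\<integral>x. \<zeta> \<eta> x * ?Y x \<partial>lebesgue_on D\<bar> \<le> l2norm D (\<zeta> \<eta>) * t"
      using order_trans[OF L2_mult_le[OF \<zeta>L YL] mult_left_mono[of "l2norm D ?Y" t "l2norm D (\<zeta> \<eta>)"]] Yn v(4) by simp
    ultimately show ?thesis by linarith
  qed
  \<comment> \<open>Where \<open>1 - q\<close> is not small, \<eta> is at most of order \<epsilon>.
    Nonnegativity of \<open>f\<close> gives \<open>- \<zeta> \<eta> \<le> \<eta> / \<alpha>\<close>,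
    and \<open>\<eta> * (1 - q) \<le> \<epsilon>\<close> bounds the loss.\<close>
  have I4: "(\<integral>x. \<zeta> \<eta> x * (q x * Z x) \<partial>lebesgue_on D) \<le> (\<integral>x. \<zeta> \<eta> x * Z x \<partial>lebesgue_on D) + \<epsilon> / \<delta> * IZ"
  proof -
    have "(\<integral>x. \<zeta> \<eta> x * (q x * Z x) \<partial>lebesgue_on D) \<le> (\<integral>x. \<zeta> \<eta> x * Z x + \<epsilon> / \<delta> * Z x \<partial>lebesgue_on D)"
    proof (rule integral_mono)
      show "integrable (lebesgue_on D) (\<lambda>x. \<zeta> \<eta> x * (q x * Z x))" using L2_mult_integrable[OF \<zeta>L qZL] by simp
      show "integrable (lebesgue_on D) (\<lambda>x. \<zeta> \<eta> x * Z x + \<epsilon> / \<delta> * Z x)"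
        using L2_mult_integrable[OF \<zeta>L ZL(1)] Zi by simp
      fix x assume "x \<in> space (lebesgue_on D)"
      then have z: "0 \<le> Z x" using Z0 by simp
      have a: "\<alpha> x > 0" using \<alpha>\<delta>[of x] \<delta> by linarith
      have "- \<zeta> \<eta> x \<le> \<eta> x / \<alpha> x" unfolding \<zeta>_def using a pos_tests_nonneg[OF f, of x] by (simp add: divide_simps)
      then have "(- \<zeta> \<eta> x) * ((1 - q x) * Z x) \<le> (\<eta> x / \<alpha> x) * ((1 - q x) * Z x)"
        using q01[of x] z by (intro mult_right_mono) auto
      also have "\<dots> = (\<eta> x * (1 - q x)) / \<alpha> x * Z x" by simp
      also have "\<dots> \<le> \<epsilon> / \<delta> * Z x"
      proof (intro mult_right_mono z frac_le \<alpha>\<delta> \<delta>)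
        have "\<eta> x * (1 - q x) = \<epsilon> * (\<eta> x / (\<epsilon> + \<eta> x) * (\<epsilon> / (\<epsilon> + \<eta> x)))" unfolding q_def by simp
        also have "\<dots> \<le> \<epsilon> * 1" using \<epsilon>(1) r01[of x] \<eta>0[of x] pos[of x] by (intro mult_left_mono mult_le_one) auto
        finally show "\<eta> x * (1 - q x) \<le> \<epsilon>" by simp
      qed (use \<epsilon> in auto)
      finally show "\<zeta> \<eta> x * (q x * Z x) \<le> \<zeta> \<eta> x * Z x + \<epsilon> / \<delta> * Z x" by (simp add: algebra_simps)
    qed
    also have "\<dots> = (\<integral>x. \<zeta> \<eta> x * Z x \<partial>lebesgue_on D) + \<epsilon> / \<delta> * IZ"
      using L2_mult_integrable[OF \<zeta>L ZL(1)] Zi by (simp add: IZ_def)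
    finally show ?thesis .
  qed
  have I5: "h * (\<integral>x. grad \<eta> x \<bullet> GZ x \<partial>lebesgue_on D) \<le> h * (\<integral>x. q x * (grad \<eta> x \<bullet> GZ x) \<partial>lebesgue_on D) + e1"
  proof -
    define L where "L x = \<epsilon> * \<eta> x / (\<epsilon> + \<eta> x)" for x
    have sL: "smooth L" unfolding L_def[abs_def]
      using nz by (intro smooth_divide smooth_mult smooth_add smooth_const s\<eta>) auto
    have Lt: "L \<in> test_functions D" by (rule test_functionsI[OF sL C(1,2)]) (simp add: L_def C(3))
    have gL: "grad L x = (1 - q x) *\<^sub>R grad \<eta> x" for x
      unfolding L_def[abs_def]
    proof (rule grad_compose[OF s\<eta>, of "\<lambda>s. \<epsilon> * s / (\<epsilon> + s)"])
      show "((\<lambda>s. \<epsilon> * s / (\<epsilon> + s)) has_real_derivative 1 - q x) (at (\<eta> x))"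
        using nz[of x] unfolding q_def by (auto intro!: derivative_eq_intros) (simp add: algebra_simps)
    qed
    have Lb: "\<bar>L x\<bar> \<le> \<epsilon>0" for x
    proof -
      have "L x = \<epsilon> * (\<eta> x / (\<epsilon> + \<eta> x))" by (simp add: L_def)
      also have "\<dots> \<le> \<epsilon> * 1" using \<epsilon>(1) \<eta>0[of x] by (intro mult_left_mono) auto
      finally show ?thesis using \<epsilon> \<eta>0[of x] pos[of x] by (simp add: L_def)
    qed
    have "l2norm D (grad L) \<le> l2norm D (grad \<eta>)"
    proof (rule l2norm_mono[OF \<eta>L(2) L2_measurable[OF test_function_L2(2)[OF Lt Dm]]], intro AE_I2)
      fix x show "norm (grad L x) \<le> norm (grad \<eta> x)" unfolding gL using q01[of x] by (simp add: mult_left_le_one_le)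
    qed
    then have "\<bar>\<integral>x. grad L x \<bullet> GZ x \<partial>lebesgue_on D\<bar> \<le> e1 / h" using \<epsilon>0(2)[OF Lt Lb] g\<eta> by linarith
    moreover have "(\<integral>x. grad L x \<bullet> GZ x \<partial>lebesgue_on D) = (\<integral>x. grad \<eta> x \<bullet> GZ x \<partial>lebesgue_on D) - (\<integral>x. q x * (grad \<eta> x \<bullet> GZ x) \<partial>lebesgue_on D)"
      unfolding gL using L2_inner_integrable[OF \<eta>L(2) ZL(2)] i_G by (simp add: left_diff_distrib)
    ultimately have "(\<integral>x. grad \<eta> x \<bullet> GZ x \<partial>lebesgue_on D) \<le> (\<integral>x. q x * (grad \<eta> x \<bullet> GZ x) \<partial>lebesgue_on D) + e1 / h" by linarith
    from mult_left_mono[OF this, of h] show ?thesis using h by (simp add: distrib_left)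
  qed
  have I12: "h * (\<integral>x. q x * (grad \<eta> x \<bullet> GZ x) \<partial>lebesgue_on D) \<le> h * (\<integral>x. grad \<eta> x \<bullet> grad \<psi> x \<partial>lebesgue_on D) + h * C0 * t"
  proof -
    have "(\<integral>x. q x * (grad \<eta> x \<bullet> GZ x) \<partial>lebesgue_on D) \<le> (\<integral>x. grad \<eta> x \<bullet> grad \<psi> x \<partial>lebesgue_on D) + C0 * t"
      using I1 I2 by linarith
    from mult_left_mono[OF this, of h] show ?thesis using h by (simp add: distrib_left mult.assoc)
  qed
  have Zfin: "h * (\<integral>x. grad \<eta> x \<bullet> GZ x \<partial>lebesgue_on D) \<le> (\<integral>x. \<zeta> \<eta> x * Z x \<partial>lebesgue_on D) + 4 * e1"
    using I5 I12 v\<psi> I3 I4 \<epsilon>IZ t2 by linarith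
  have s1: "(\<integral>x. \<zeta> \<eta> x * (b x - Z x) \<partial>lebesgue_on D) = (\<integral>x. \<zeta> \<eta> x * b x \<partial>lebesgue_on D) - (\<integral>x. \<zeta> \<eta> x * Z x \<partial>lebesgue_on D)"
    using L2_mult_integrable[OF \<zeta>L bL(1)] L2_mult_integrable[OF \<zeta>L ZL(1)] by (simp add: right_diff_distrib)
  have s2: "h * (\<integral>x. grad \<eta> x \<bullet> (grad b x - GZ x) \<partial>lebesgue_on D) = h * (\<integral>x. grad \<eta> x \<bullet> grad b x \<partial>lebesgue_on D) - h * (\<integral>x. grad \<eta> x \<bullet> GZ x \<partial>lebesgue_on D)"
    using L2_inner_integrable[OF \<eta>L(2) bL(2)] L2_inner_integrable[OF \<eta>L(2) ZL(2)] by (simp add: inner_diff_right right_diff_distrib)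
  have "(\<integral>x. \<zeta> \<eta> x * (b x - Z x) \<partial>lebesgue_on D) \<le> h * (\<integral>x. grad \<eta> x \<bullet> (grad b x - GZ x) \<partial>lebesgue_on D) + e"
    unfolding s1 s2 using vb Zfin e1 by (simp add: e1_def)
  with \<eta>(1) en show thesis by (rule that)
qed

end

text \<open>The nonnegative elements of \<open>H^1_0(D)\<close>, encoded as limits of nonnegative
  test functions so that the approximants are admissible upward variations of \<eta>.\<close>

definition pos_H10 :: "'a::euclidean_space set \<Rightarrow> ('a \<Rightarrow> real) \<Rightarrow> ('a \<Rightarrow> 'a) \<Rightarrow> bool" where
  "pos_H10 D P GP \<longleftrightarrow> P \<in> L2 D \<and> GP \<in> L2 D \<and>
     (\<forall>\<epsilon>>0. \<exists>b\<in>pos_tests D. l2norm D (\<lambda>x. b x - P x) < \<epsilon> \<and> l2norm D (\<lambda>x. grad b x - GP x) < \<epsilon>)"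

lemma l2norm_triangle_minus:
  assumes "f \<in> L2 \<Omega>" "g \<in> L2 \<Omega>"
  shows "l2norm \<Omega> (\<lambda>x. f x - g x) \<le> l2norm \<Omega> f + l2norm \<Omega> g"
proof -
  have "l2norm \<Omega> (\<lambda>x. - g x) = l2norm \<Omega> g" by (simp add: l2norm_def)
  then show ?thesis using l2norm_triangle[OF assms(1) L2_uminus[OF assms(2)]] by simp
qed

lemma l2norm_mult_le:
  assumes "f \<in> L2 \<Omega>" "a \<in> borel_measurable (lebesgue_on \<Omega>)" "\<And>x. \<bar>a x\<bar> \<le> c" "c \<ge> 0"
  shows "(\<lambda>x. a x *\<^sub>R f x) \<in> L2 \<Omega>" "l2norm \<Omega> (\<lambda>x. a x *\<^sub>R f x) \<le> c * l2norm \<Omega> f"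
  using L2_mult_bounded[OF assms(1,2), of c] assms(3,4) by (auto simp: l2norm_scaleR)

lemma l2norm_mult_vec_le:
  fixes f :: "'a::euclidean_space \<Rightarrow> real" and a :: "'a \<Rightarrow> 'b::euclidean_space"
  assumes f: "f \<in> L2 \<Omega>" and a: "a \<in> borel_measurable (lebesgue_on \<Omega>)" "\<And>x. norm (a x) \<le> c"
  shows "(\<lambda>x. f x *\<^sub>R a x) \<in> L2 \<Omega>" "l2norm \<Omega> (\<lambda>x. f x *\<^sub>R a x) \<le> c * l2norm \<Omega> f"
proof -
  have c: "c \<ge> 0" using norm_ge_zero order_trans a(2) by blast
  have m: "(\<lambda>x. f x *\<^sub>R a x) \<in> borel_measurable (lebesgue_on \<Omega>)" using L2_measurable[OF f] a(1) by measurable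
  have b: "AE x in lebesgue_on \<Omega>. norm (f x *\<^sub>R a x) \<le> norm (c *\<^sub>R f x)"
  proof (intro AE_I2)
    fix x show "norm (f x *\<^sub>R a x) \<le> norm (c *\<^sub>R f x)"
      using mult_left_mono[OF a(2)[of x], of "\<bar>f x\<bar>"] c by (simp add: mult.commute)
  qed
  show "(\<lambda>x. f x *\<^sub>R a x) \<in> L2 \<Omega>" by (rule L2_bound[OF L2_scaleR[OF f] m b])
  have "l2norm \<Omega> (\<lambda>x. f x *\<^sub>R a x) \<le> l2norm \<Omega> (\<lambda>x. c *\<^sub>R f x)" by (rule l2norm_mono[OF L2_scaleR[OF f] m b])
  then show "l2norm \<Omega> (\<lambda>x. f x *\<^sub>R a x) \<le> c * l2norm \<Omega> f" using c unfolding l2norm_scaleR by simp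
qed

lemma continuous_measurable_on:
  "continuous_on UNIV f \<Longrightarrow> D \<in> sets lebesgue \<Longrightarrow> f \<in> borel_measurable (lebesgue_on D)"
  for f :: "'a::euclidean_space \<Rightarrow> 'b::euclidean_space"
  by (rule continuous_imp_measurable_on_sets_lebesgue[OF continuous_on_subset[OF _ subset_UNIV]])

lemma pos_H10_mult:
  assumes D: "D \<in> sets lebesgue" and P: "pos_H10 D P GP" and \<xi>: "smooth \<xi>" "\<And>x. 0 \<le> \<xi> x" "\<And>x. \<xi> x \<le> 1" "\<And>x. norm (grad \<xi> x) \<le> c"
  shows "pos_H10 D (\<lambda>x. \<xi> x * P x) (\<lambda>x. \<xi> x *\<^sub>R GP x + P x *\<^sub>R grad \<xi> x)"
proof -
  have PL: "P \<in> L2 D" "GP \<in> L2 D" using P by (auto simp: pos_H10_def)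
  have c: "c \<ge> 0" using norm_ge_zero order_trans \<xi>(4) by blast
  have \<xi>m: "\<xi> \<in> borel_measurable (lebesgue_on D)" "grad \<xi> \<in> borel_measurable (lebesgue_on D)"
    using D by (auto intro: continuous_measurable_on smooth_continuous smooth_grad_continuous \<xi>(1))
  have ab: "\<bar>\<xi> x\<bar> \<le> 1" for x using \<xi>(2,3)[of x] by simp
  show ?thesis
    unfolding pos_H10_def
  proof (intro conjI allI impI)
    show "(\<lambda>x. \<xi> x * P x) \<in> L2 D" using l2norm_mult_le(1)[OF PL(1) \<xi>m(1) ab] by simp
    show "(\<lambda>x. \<xi> x *\<^sub>R GP x + P x *\<^sub>R grad \<xi> x) \<in> L2 D"
      by (rule L2_add[OF l2norm_mult_le(1)[OF PL(2) \<xi>m(1) ab] l2norm_mult_vec_le(1)[OF PL(1) \<xi>m(2) \<xi>(4)]]) simp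
    fix \<epsilon> :: real assume \<epsilon>: "\<epsilon> > 0"
    define t where "t = \<epsilon> / (c + 1)"
    have t: "t > 0" "t \<le> \<epsilon>" "t * (1 + c) = \<epsilon>" using \<epsilon> c by (auto simp: t_def field_simps)
    then have t3: "t + c * t = \<epsilon>" by (simp add: algebra_simps)
    obtain b where b: "b \<in> pos_tests D" "l2norm D (\<lambda>x. b x - P x) < t" "l2norm D (\<lambda>x. grad b x - GP x) < t"
      using P t(1) by (auto simp: pos_H10_def)
    have bt: "b \<in> test_functions D" by (rule pos_tests_test[OF b(1)])
    have bL: "b \<in> L2 D" "grad b \<in> L2 D" using test_function_L2[OF bt D] by auto
    have sb: "smooth b" by (rule test_functions_smooth[OF bt])
    show "\<exists>b\<in>pos_tests D. l2norm D (\<lambda>x. b x - \<xi> x * P x) < \<epsilon> \<and> l2norm D (\<lambda>x. grad b x - (\<xi> x *\<^sub>R GP x + P x *\<^sub>R grad \<xi> x)) < \<epsilon>"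
    proof (intro bexI conjI)
      show "(\<lambda>x. \<xi> x * b x) \<in> pos_tests D"
        unfolding pos_tests_def using test_function_mult[OF bt \<xi>(1)] \<xi>(2) pos_tests_nonneg[OF b(1)] by simp
      have "l2norm D (\<lambda>x. \<xi> x * b x - \<xi> x * P x) \<le> 1 * l2norm D (\<lambda>x. b x - P x)"
        using l2norm_mult_le(2)[OF L2_diff[OF bL(1) PL(1)] \<xi>m(1) ab] by (simp add: right_diff_distrib)
      then show "l2norm D (\<lambda>x. \<xi> x * b x - \<xi> x * P x) < \<epsilon>" using b(2) t(2) by simp
      have eq: "grad (\<lambda>x. \<xi> x * b x) x - (\<xi> x *\<^sub>R GP x + P x *\<^sub>R grad \<xi> x) = \<xi> x *\<^sub>R (grad b x - GP x) + (b x - P x) *\<^sub>R grad \<xi> x" for x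
        unfolding grad_mult[OF \<xi>(1) sb] by (simp add: algebra_simps)
      have "l2norm D (\<lambda>x. \<xi> x *\<^sub>R (grad b x - GP x) + (b x - P x) *\<^sub>R grad \<xi> x)
          \<le> l2norm D (\<lambda>x. \<xi> x *\<^sub>R (grad b x - GP x)) + l2norm D (\<lambda>x. (b x - P x) *\<^sub>R grad \<xi> x)"
        by (rule l2norm_triangle[OF l2norm_mult_le(1)[OF L2_diff[OF bL(2) PL(2)] \<xi>m(1) ab] l2norm_mult_vec_le(1)[OF L2_diff[OF bL(1) PL(1)] \<xi>m(2) \<xi>(4)]]) simp
      also have "\<dots> \<le> 1 * l2norm D (\<lambda>x. grad b x - GP x) + c * l2norm D (\<lambda>x. b x - P x)"
        by (rule add_mono[OF l2norm_mult_le(2)[OF L2_diff[OF bL(2) PL(2)] \<xi>m(1) ab] l2norm_mult_vec_le(2)[OF L2_diff[OF bL(1) PL(1)] \<xi>m(2) \<xi>(4)]]) simp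
      also have "\<dots> < t + c * t" using b(2,3) c by (intro add_less_le_mono mult_left_mono) auto
      finally show "l2norm D (\<lambda>x. grad (\<lambda>x. \<xi> x * b x) x - (\<xi> x *\<^sub>R GP x + P x *\<^sub>R grad \<xi> x)) < \<epsilon>"
        unfolding eq t3 .
    qed
  qed
qed

text \<open>The product rule is moved to the test side, where \<open>\<xi> \<phi>\<close> is again a
  test function.\<close>

lemma H1_gradient_mult:
  assumes D: "open D" and Z: "has_H1_gradient D Z GZ" and \<xi>: "smooth \<xi>" "\<And>x. \<bar>\<xi> x\<bar> \<le> 1" "\<And>x. norm (grad \<xi> x) \<le> c"
  shows "has_H1_gradient D (\<lambda>x. \<xi> x * Z x) (\<lambda>x. \<xi> x *\<^sub>R GZ x + Z x *\<^sub>R grad \<xi> x)"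
proof -
  have Dm: "D \<in> sets lebesgue" using D by simp
  have ZL: "Z \<in> L2 D" "GZ \<in> L2 D" using Z by (auto simp: has_H1_gradient_def)
  have \<xi>m: "\<xi> \<in> borel_measurable (lebesgue_on D)" "grad \<xi> \<in> borel_measurable (lebesgue_on D)"
    using Dm by (auto intro: continuous_measurable_on smooth_continuous smooth_grad_continuous \<xi>(1))
  have L1: "(\<lambda>x. \<xi> x * Z x) \<in> L2 D" using l2norm_mult_le(1)[OF ZL(1) \<xi>m(1) \<xi>(2)] by simp
  have L2': "(\<lambda>x. \<xi> x *\<^sub>R GZ x) \<in> L2 D" by (rule l2norm_mult_le(1)[OF ZL(2) \<xi>m(1) \<xi>(2)]) simp
  have L3: "(\<lambda>x. Z x *\<^sub>R grad \<xi> x) \<in> L2 D" by (rule l2norm_mult_vec_le(1)[OF ZL(1) \<xi>m(2) \<xi>(3)])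
  have "(\<integral>x. \<xi> x * Z x * (grad \<phi> x \<bullet> b) \<partial>lebesgue_on D) = - (\<integral>x. ((\<xi> x *\<^sub>R GZ x + Z x *\<^sub>R grad \<xi> x) \<bullet> b) * \<phi> x \<partial>lebesgue_on D)"
    if \<phi>: "\<phi> \<in> test_functions D" and b: "b \<in> Basis" for \<phi> b
  proof -
    have s\<phi>: "smooth \<phi>" by (rule test_functions_smooth[OF \<phi>])
    have t: "(\<lambda>x. \<xi> x * \<phi> x) \<in> test_functions D" by (rule test_function_mult[OF \<phi> \<xi>(1)])
    have \<phi>L: "\<phi> \<in> L2 D" "(\<lambda>x. grad \<phi> x \<bullet> b) \<in> L2 D" using test_function_L2[OF \<phi> Dm] L2_component by auto
    have "(\<integral>x. Z x * (grad (\<lambda>x. \<xi> x * \<phi> x) x \<bullet> b) \<partial>lebesgue_on D) = - (\<integral>x. (GZ x \<bullet> b) * (\<xi> x * \<phi> x) \<partial>lebesgue_on D)"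
      using Z t b interior_open[OF D] unfolding has_H1_gradient_def by auto
    moreover have "Z x * (grad (\<lambda>x. \<xi> x * \<phi> x) x \<bullet> b) = \<xi> x * Z x * (grad \<phi> x \<bullet> b) + (Z x *\<^sub>R grad \<xi> x \<bullet> b) * \<phi> x" for x
      unfolding grad_mult[OF \<xi>(1) s\<phi>] by (simp add: inner_add_left algebra_simps)
    moreover have "(\<integral>x. \<xi> x * Z x * (grad \<phi> x \<bullet> b) + (Z x *\<^sub>R grad \<xi> x \<bullet> b) * \<phi> x \<partial>lebesgue_on D)
        = (\<integral>x. \<xi> x * Z x * (grad \<phi> x \<bullet> b) \<partial>lebesgue_on D) + (\<integral>x. (Z x *\<^sub>R grad \<xi> x \<bullet> b) * \<phi> x \<partial>lebesgue_on D)"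
      by (rule Bochner_Integration.integral_add[OF L2_mult_integrable[OF L1 \<phi>L(2)] L2_mult_integrable[OF L2_component[OF L3] \<phi>L(1)]])
    moreover have "(\<integral>x. ((\<xi> x *\<^sub>R GZ x + Z x *\<^sub>R grad \<xi> x) \<bullet> b) * \<phi> x \<partial>lebesgue_on D)
        = (\<integral>x. (\<xi> x *\<^sub>R GZ x \<bullet> b) * \<phi> x \<partial>lebesgue_on D) + (\<integral>x. (Z x *\<^sub>R grad \<xi> x \<bullet> b) * \<phi> x \<partial>lebesgue_on D)"
      unfolding inner_add_left distrib_right
      by (rule Bochner_Integration.integral_add[OF L2_mult_integrable[OF L2_component[OF L2'] \<phi>L(1)] L2_mult_integrable[OF L2_component[OF L3] \<phi>L(1)]])
    moreover have "(GZ x \<bullet> b) * (\<xi> x * \<phi> x) = (\<xi> x *\<^sub>R GZ x \<bullet> b) * \<phi> x" for x by simp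
    ultimately show ?thesis by simp
  qed
  then show ?thesis
    using L1 L2_add[OF L2' L3] interior_open[OF D] by (auto simp: has_H1_gradient_def)
qed

context parabolic_step begin

text \<open>Extends the bounded case to unbounded \<open>Z\<close> and to limits \<open>P\<close> of
  the cone. The energy bounds the norms of \<nabla>\<eta> and \<open>\<zeta> \<eta>\<close> by
  quantities known before \<eta>, so \<open>P\<close> and \<open>Z\<close> can be replaced in
  advance by \<open>b\<close> and \<open>Z'\<close> that are close enough.\<close>

lemma minimizer_exists:
  assumes P: "pos_H10 D P GP" and Z: "has_H1_gradient D Z GZ" "\<And>x. x \<in> D \<Longrightarrow> 0 \<le> Z x"
    and R: "R > 0" "\<And>x. norm x \<ge> R \<Longrightarrow> Z x = 0" and e: "e > 0"
  obtains \<eta> where "\<eta> \<in> pos_tests D" "energy \<eta> \<le> h * (l2norm D (grad f))\<^sup>2 + e"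
    "(\<integral>x. \<zeta> \<eta> x * (P x - Z x) \<partial>lebesgue_on D) \<le> h * (\<integral>x. grad \<eta> x \<bullet> (GP x - GZ x) \<partial>lebesgue_on D) + e"
proof -
  define B where "B = h * (l2norm D (grad f))\<^sup>2 + e"
  have B: "B \<ge> 0" using h e by (simp add: B_def)
  \<comment> \<open>The two roots are the energy bounds for the norms of
    \<open>\<zeta> \<eta>\<close> and of \<nabla>\<eta>; the summand 1 keeps \<open>K\<close>
    positive.\<close>
  define K where "K = sqrt (B / \<delta>) + h * sqrt (B / h) + 1"
  have K: "K > 0" unfolding K_def using B \<delta> h by (intro add_nonneg_pos add_nonneg_nonneg mult_nonneg_nonneg) auto
  define t where "t = e / (4 * K)"
  have t: "t > 0" using e K by (simp add: t_def)
  obtain b where b: "b \<in> pos_tests D" "l2norm D (\<lambda>x. b x - P x) < t" "l2norm D (\<lambda>x. grad b x - GP x) < t"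
    using P t by (auto simp: pos_H10_def)
  obtain M Z' GZ' where Z': "M > 0" "has_H1_gradient D Z' GZ'" "\<And>x. x \<in> D \<Longrightarrow> 0 \<le> Z' x" "\<And>x. x \<in> D \<Longrightarrow> Z' x \<le> M"
    "\<And>x. norm x \<ge> R \<Longrightarrow> Z' x = 0" "l2norm D (\<lambda>x. Z' x - Z x) < t" "l2norm D (\<lambda>x. GZ' x - GZ x) < t"
  proof (rule H1_bounded_approx[OF D Z R t])
    fix M Z' GZ' assume "M > 0" "has_H1_gradient D Z' GZ'" "\<And>x. x \<in> D \<Longrightarrow> 0 \<le> Z' x" "\<And>x. x \<in> D \<Longrightarrow> Z' x \<le> M"
      "\<And>x. norm x \<ge> R \<Longrightarrow> Z' x = 0" "l2norm D (\<lambda>x. Z' x - Z x) < t" "l2norm D (\<lambda>x. GZ' x - GZ x) < t"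
    then show thesis by (rule that)
  qed
  have e2: "e / 2 > 0" using e by simp
  obtain \<eta> where \<eta>: "\<eta> \<in> pos_tests D" "energy \<eta> \<le> h * (l2norm D (grad f))\<^sup>2 + e / 2"
    "(\<integral>x. \<zeta> \<eta> x * (b x - Z' x) \<partial>lebesgue_on D) \<le> h * (\<integral>x. grad \<eta> x \<bullet> (grad b x - GZ' x) \<partial>lebesgue_on D) + e / 2"
  proof (rule minimizer_exists_bounded[OF b(1) Z'(2,3,4,1) R(1) Z'(5) e2])
    fix \<eta> assume "\<eta> \<in> pos_tests D" "energy \<eta> \<le> h * (l2norm D (grad f))\<^sup>2 + e / 2"
      "(\<integral>x. \<zeta> \<eta> x * (b x - Z' x) \<partial>lebesgue_on D) \<le> h * (\<integral>x. grad \<eta> x \<bullet> (grad b x - GZ' x) \<partial>lebesgue_on D) + e / 2"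
    then show thesis by (rule that)
  qed
  have \<eta>t: "\<eta> \<in> test_functions D" by (rule pos_tests_test[OF \<eta>(1)])
  have bt: "b \<in> test_functions D" by (rule pos_tests_test[OF b(1)])
  have L: "\<eta> \<in> L2 D" "grad \<eta> \<in> L2 D" "b \<in> L2 D" "grad b \<in> L2 D"
    using test_function_L2[OF \<eta>t Dm] test_function_L2[OF bt Dm] by auto
  have PL: "P \<in> L2 D" "GP \<in> L2 D" using P by (auto simp: pos_H10_def)
  have ZL: "Z \<in> L2 D" "GZ \<in> L2 D" "Z' \<in> L2 D" "GZ' \<in> L2 D" using Z(1) Z'(2) by (auto simp: has_H1_gradient_def)
  have \<zeta>L: "\<zeta> \<eta> \<in> L2 D" by (rule \<zeta>_L2[OF L(1)])
  have en: "energy \<eta> \<le> B" using \<eta>(2) e by (simp add: B_def)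
  have "h * (l2norm D (grad \<eta>))\<^sup>2 \<le> B"
    using en quad_integral_nonneg[of "\<lambda>x. f x - \<eta> x"] by (simp add: energy_def)
  then have "(l2norm D (grad \<eta>))\<^sup>2 \<le> B / h" using h by (simp add: pos_le_divide_eq mult.commute)
  then have n1: "l2norm D (grad \<eta>) \<le> sqrt (B / h)" by (rule real_le_rsqrt)
  have "0 \<le> h * (l2norm D (grad \<eta>))\<^sup>2" using h by simp
  then have "\<delta> * (l2norm D (\<zeta> \<eta>))\<^sup>2 \<le> B" using en \<zeta>_bound[OF L(1)] unfolding energy_def by linarith
  then have "(l2norm D (\<zeta> \<eta>))\<^sup>2 \<le> B / \<delta>" using \<delta> by (simp add: pos_le_divide_eq mult.commute)
  then have n2: "l2norm D (\<zeta> \<eta>) \<le> sqrt (B / \<delta>)" by (rule real_le_rsqrt)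
  let ?d = "\<lambda>x. (P x - Z x) - (b x - Z' x)" and ?g = "\<lambda>x. (grad b x - GZ' x) - (GP x - GZ x)"
  have dL: "?d \<in> L2 D" "?g \<in> L2 D" by (intro L2_diff PL ZL L)+
  have dn: "l2norm D ?d \<le> 2 * t"
  proof -
    have "l2norm D ?d = l2norm D (\<lambda>x. (Z' x - Z x) - (b x - P x))" by (simp add: algebra_simps)
    also have "\<dots> \<le> l2norm D (\<lambda>x. Z' x - Z x) + l2norm D (\<lambda>x. b x - P x)"
      by (rule l2norm_triangle_minus[OF L2_diff[OF ZL(3,1)] L2_diff[OF L(3) PL(1)]])
    finally show ?thesis using Z'(6) b(2) by linarith
  qed
  have gn: "l2norm D ?g \<le> 2 * t"
  proof -
    have "l2norm D ?g = l2norm D (\<lambda>x. (grad b x - GP x) - (GZ' x - GZ x))" by (simp add: algebra_simps)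
    also have "\<dots> \<le> l2norm D (\<lambda>x. grad b x - GP x) + l2norm D (\<lambda>x. GZ' x - GZ x)"
      by (rule l2norm_triangle_minus[OF L2_diff[OF L(4) PL(2)] L2_diff[OF ZL(4,2)]])
    finally show ?thesis using Z'(7) b(3) by linarith
  qed
  have 1: "(\<integral>x. \<zeta> \<eta> x * (P x - Z x) \<partial>lebesgue_on D) \<le> (\<integral>x. \<zeta> \<eta> x * (b x - Z' x) \<partial>lebesgue_on D) + sqrt (B / \<delta>) * (2 * t)"
  proof -
    have "(\<integral>x. \<zeta> \<eta> x * ?d x \<partial>lebesgue_on D) = (\<integral>x. \<zeta> \<eta> x * (P x - Z x) \<partial>lebesgue_on D) - (\<integral>x. \<zeta> \<eta> x * (b x - Z' x) \<partial>lebesgue_on D)"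
      by (subst right_diff_distrib, rule Bochner_Integration.integral_diff)
        (intro L2_mult_integrable \<zeta>L L2_diff PL ZL L)+
    moreover have "\<bar>\<integral>x. \<zeta> \<eta> x * ?d x \<partial>lebesgue_on D\<bar> \<le> sqrt (B / \<delta>) * (2 * t)"
      by (rule order_trans[OF L2_mult_le[OF \<zeta>L dL(1)] mult_mono[OF n2 dn]]) (use B \<delta> in auto)
    ultimately show ?thesis by linarith
  qed
  have 2: "h * (\<integral>x. grad \<eta> x \<bullet> (grad b x - GZ' x) \<partial>lebesgue_on D) \<le> h * (\<integral>x. grad \<eta> x \<bullet> (GP x - GZ x) \<partial>lebesgue_on D) + h * sqrt (B / h) * (2 * t)"
  proof -
    have "(\<integral>x. grad \<eta> x \<bullet> ?g x \<partial>lebesgue_on D) = (\<integral>x. grad \<eta> x \<bullet> (grad b x - GZ' x) \<partial>lebesgue_on D) - (\<integral>x. grad \<eta> x \<bullet> (GP x - GZ x) \<partial>lebesgue_on D)"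
      by (subst inner_diff_right, rule Bochner_Integration.integral_diff)
        (intro L2_inner_integrable L2_diff PL ZL L)+
    moreover have "\<bar>\<integral>x. grad \<eta> x \<bullet> ?g x \<partial>lebesgue_on D\<bar> \<le> sqrt (B / h) * (2 * t)"
      by (rule order_trans[OF L2_inner_le[OF L(2) dL(2)] mult_mono[OF n1 gn]]) (use B h in auto)
    ultimately have "(\<integral>x. grad \<eta> x \<bullet> (grad b x - GZ' x) \<partial>lebesgue_on D) \<le> (\<integral>x. grad \<eta> x \<bullet> (GP x - GZ x) \<partial>lebesgue_on D) + sqrt (B / h) * (2 * t)"
      by linarith
    from mult_left_mono[OF this, of h] show ?thesis using h by (simp add: distrib_left mult.assoc)
  qed
  have 3: "sqrt (B / \<delta>) * (2 * t) + h * sqrt (B / h) * (2 * t) \<le> e / 2"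
  proof -
    have "sqrt (B / \<delta>) * (2 * t) + h * sqrt (B / h) * (2 * t) = (K - 1) * (2 * t)" by (simp add: K_def algebra_simps)
    also have "\<dots> \<le> K * (2 * t)" using t by (intro mult_right_mono) auto
    also have "\<dots> = e / 2" using K by (simp add: t_def)
    finally show ?thesis .
  qed
  show thesis
  proof (rule that[OF \<eta>(1)])
    show "energy \<eta> \<le> h * (l2norm D (grad f))\<^sup>2 + e" using en by (simp add: B_def)
    show "(\<integral>x. \<zeta> \<eta> x * (P x - Z x) \<partial>lebesgue_on D) \<le> h * (\<integral>x. grad \<eta> x \<bullet> (GP x - GZ x) \<partial>lebesgue_on D) + e"
      using 1 2 3 \<eta>(3) by linarith
  qed
qed

end

text \<open>Finite dependent choice against the order of the indices: the terminal value sits at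
  \<open>Suc N\<close>, and step \<open>n\<close> takes \<open>\<eta> (Suc n)\<close> as its
  datum.\<close>

lemma backward_choice:
  assumes "\<And>n g. 1 \<le> n \<Longrightarrow> n \<le> N \<Longrightarrow> Q g \<Longrightarrow> \<exists>g'. Q g' \<and> S n g g'" "Q f"
  shows "\<exists>\<eta>::nat \<Rightarrow> 'b. \<eta> (Suc N) = f \<and> (\<forall>n\<in>{1..N}. Q (\<eta> n) \<and> S n (\<eta> (Suc n)) (\<eta> n))"
  using assms
proof (induction N arbitrary: f)
  case 0 then show ?case by (intro exI[of _ "\<lambda>_. f"]) auto
next
  case (Suc N)
  obtain g where g: "Q g" "S (Suc N) f g" using Suc.prems(1)[of "Suc N" f] Suc.prems(2) by auto
  obtain \<eta> where \<eta>: "\<eta> (Suc N) = g" "\<forall>n\<in>{1..N}. Q (\<eta> n) \<and> S n (\<eta> (Suc n)) (\<eta> n)"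
    using Suc.IH[OF Suc.prems(1) g(1)] by auto
  let ?\<eta> = "\<eta>(Suc (Suc N) := f)"
  have "Q (?\<eta> n) \<and> S n (?\<eta> (Suc n)) (?\<eta> n)" if "n \<in> {1..Suc N}" for n
    using that \<eta> g by (cases "n = Suc N") auto
  then show ?case by (intro exI[of _ ?\<eta>]) auto
qed

section \<open>The discrete duality estimate\<close>

text \<open>Applied with \<open>g n\<close> the scaled Dirichlet energy of \<open>\<eta> n\<close>
  and \<open>F n\<close> the dissipation of step \<open>n\<close>. Time runs from
  \<open>Suc N\<close> down to 1, so the right-hand sides refer to the terminal index.\<close>

lemma telescope_bound:
  fixes F g :: "nat \<Rightarrow> real"
  assumes "\<And>n. n \<in> {1..N} \<Longrightarrow> F n + g n \<le> g (Suc n) + \<kappa>" "\<And>n. n \<in> {1..N} \<Longrightarrow> 0 \<le> F n" "0 \<le> \<kappa>"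
  shows "(\<Sum>n=1..N. F n) + g 1 \<le> g (Suc N) + real N * \<kappa>"
    and "n \<in> {1..Suc N} \<Longrightarrow> g n \<le> g (Suc N) + real N * \<kappa>"
proof -
  show "(\<Sum>n=1..N. F n) + g 1 \<le> g (Suc N) + real N * \<kappa>"
    using assms(1)
  proof (induction N)
    case (Suc N)
    have "F (Suc N) + g (Suc N) \<le> g (Suc (Suc N)) + \<kappa>" using Suc.prems[of "Suc N"] by simp
    moreover have "(\<Sum>n=1..N. F n) + g 1 \<le> g (Suc N) + real N * \<kappa>" using Suc by simp
    ultimately show ?case by (simp add: algebra_simps)
  qed simp
  have "n \<le> Suc N \<Longrightarrow> 1 \<le> n \<Longrightarrow> g n \<le> g (Suc N) + real (Suc N - n) * \<kappa>" for n
  proof (induction n rule: inc_induct)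
    case (step n)
    have "g n \<le> g (Suc n) + \<kappa>" using assms(1,2)[of n] step by force
    also have "\<dots> \<le> g (Suc N) + real (Suc N - Suc n) * \<kappa> + \<kappa>" using step by simp
    also have "\<dots> = g (Suc N) + real (Suc N - n) * \<kappa>" using step(2) by (simp add: of_nat_diff algebra_simps)
    finally show ?case .
  qed simp
  moreover assume "n \<in> {1..Suc N}"
  ultimately have "g n \<le> g (Suc N) + real (Suc N - n) * \<kappa>" by simp
  also have "\<dots> \<le> g (Suc N) + real N * \<kappa>"
    using \<open>n \<in> _\<close> assms(3) by (intro add_left_mono mult_right_mono) auto
  finally show "g n \<le> g (Suc N) + real N * \<kappa>" .
qed

text \<open>\<open>X n k\<close> will pair the enthalpy at time \<open>n\<close> with the dual
  function of index \<open>k\<close>. Each step is split into a change of the enthalpy at a fixed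
  dual function and a change of the dual function at a fixed enthalpy.\<close>

lemma summation_by_parts:
  fixes X :: "nat \<Rightarrow> nat \<Rightarrow> real"
  shows "X N (Suc N) = X 0 1 + (\<Sum>n=1..N. (X n n - X (n - 1) n) + (X n (Suc n) - X n n))"
  by (induction N) (auto simp: algebra_simps)

lemma sum_le_sqrt:
  fixes a b :: "nat \<Rightarrow> real"
  assumes "\<And>n. n \<in> {1..N} \<Longrightarrow> (a n)\<^sup>2 \<le> C * b n" "(\<Sum>n=1..N. b n) \<le> B" "0 \<le> C"
  shows "(\<Sum>n=1..N. a n) \<le> sqrt (real N * (C * B))"
proof (rule real_le_rsqrt)
  have "(\<Sum>n=1..N. a n)\<^sup>2 \<le> (\<Sum>n=1..N. (a n)\<^sup>2) * real (card {1..N})"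
    by (rule sum_squared_le_sum_of_squares)
  also have "\<dots> \<le> (\<Sum>n=1..N. C * b n) * real N"
    using assms(1) by (auto intro!: mult_right_mono sum_mono)
  also have "\<dots> \<le> (C * B) * real N"
    using assms(2,3) by (auto simp: sum_distrib_left[symmetric] intro!: mult_right_mono mult_left_mono)
  finally show "(\<Sum>n=1..N. a n)\<^sup>2 \<le> real N * (C * B)" by (simp add: mult.commute)
qed

text \<open>The dissipation bounds the sum of the norms of \<open>\<theta> n\<close> by
  \<open>sqrt (N h A^2 / \<delta>)\<close>; it multiplies the averaging error \<omega> and the
  regularisation error \<open>\<delta> E\<close>, which gives the first term. The summand
  \<open>h\<close> collects the minimisation tolerances, and the terms with \<open>c\<close> are
  those in which the cutoff \<xi> is differentiated. A cutoff is present because \<open>m\<close> is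
  only bounded, so that \<open>w + m\<close> may fail to be in \<open>L2\<close>, and because the
  dual step asks for \<open>Z\<close> of bounded support.\<close>

lemma discrete_duality_estimate:
  fixes D :: "'a::euclidean_space set" and f \<xi> :: "'a \<Rightarrow> real" and w m P Z :: "nat \<Rightarrow> 'a \<Rightarrow> real" and GP GZ :: "nat \<Rightarrow> 'a \<Rightarrow> 'a"
    and c h \<delta> S \<omega> \<Gamma> :: real and N :: nat
  defines "A \<equiv> sqrt ((l2norm D (grad f))\<^sup>2 + 1)"
  assumes D: "open D" and f: "f \<in> pos_tests D"
    and \<xi>: "\<xi> \<in> test_functions UNIV" "\<And>x. 0 \<le> \<xi> x" "\<And>x. \<xi> x \<le> 1" "\<And>x. norm (grad \<xi> x) \<le> c" "\<And>x. \<xi> x * f x = f x"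
    and N: "N \<ge> 1" and h: "h > 0" and \<delta>: "0 < \<delta>" "\<delta> \<le> 1"
    and w: "\<And>n. n \<le> N \<Longrightarrow> w n \<in> L2 D" "\<And>n. n \<le> N \<Longrightarrow> l2norm D (w n) \<le> S"
    and m: "\<And>n. n \<le> N \<Longrightarrow> m n \<in> borel_measurable (lebesgue_on D)" "\<And>n. n \<le> N \<Longrightarrow> AE x in lebesgue_on D. \<bar>m n x\<bar> \<le> 2"
    and sgn: "\<And>n. n \<le> N \<Longrightarrow> AE x in lebesgue_on D. (0 < w n x \<longrightarrow> 0 \<le> m n x) \<and> (w n x < 0 \<longrightarrow> m n x \<le> 0)"
    and init: "AE x in lebesgue_on D. w 0 x + m 0 x \<le> 0"
    and P: "\<And>n. n \<in> {1..N} \<Longrightarrow> pos_H10 D (P n) (GP n)"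
    and Z: "\<And>n. n \<in> {1..N} \<Longrightarrow> has_H1_gradient D (Z n) (GZ n)" "\<And>n x. n \<in> {1..N} \<Longrightarrow> x \<in> D \<Longrightarrow> 0 \<le> Z n x"
    and ineq: "\<And>n \<phi>. n \<in> {1..N} \<Longrightarrow> \<phi> \<in> pos_tests D \<Longrightarrow>
        (\<integral>x. (w n x + m n x) * \<phi> x \<partial>lebesgue_on D) - (\<integral>x. (w (n - 1) x + m (n - 1) x) * \<phi> x \<partial>lebesgue_on D)
          + (\<integral>x. (GP n x - GZ n x) \<bullet> grad \<phi> x \<partial>lebesgue_on D) \<le> 0"
    and bw: "\<And>n. n \<in> {1..N} \<Longrightarrow> l2norm D (\<lambda>x. (P n x - Z n x) / h - w n x) \<le> \<omega>"
    and bG: "(\<Sum>n=1..N. l2norm D (\<lambda>x. GP n x - GZ n x)) \<le> \<Gamma>"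
  shows "(\<integral>x. (w N x + m N x) * f x \<partial>lebesgue_on D)
    \<le> (\<omega> + \<delta> * (S + 2 * l2norm D \<xi>)) * sqrt (real N * h * A\<^sup>2 / \<delta>) + h
       + c * (real N * h * (S + \<omega>) * A + (l2norm D f + sqrt (2 * (real N * h) * A\<^sup>2)) * \<Gamma>)"
proof -
  have Dm: "D \<in> sets lebesgue" using D by simp
  have A2: "A\<^sup>2 = (l2norm D (grad f))\<^sup>2 + 1" by (simp add: A_def)
  have A0: "A \<ge> 0" by (simp add: A_def)
  have c: "c \<ge> 0" using norm_ge_zero order_trans \<xi>(4) by blast
  have S0: "S \<ge> 0" using order_trans[OF l2norm_nonneg w(2)[of 0]] by simp
  have \<omega>0: "\<omega> \<ge> 0" using order_trans[OF l2norm_nonneg bw[of 1]] N by simp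
  have s\<xi>: "smooth \<xi>" by (rule test_functions_smooth[OF \<xi>(1)])
  have \<xi>L: "\<xi> \<in> L2 D" "grad \<xi> \<in> L2 D" using test_function_L2[OF \<xi>(1) Dm] by auto
  have \<xi>m: "\<xi> \<in> borel_measurable (lebesgue_on D)" "grad \<xi> \<in> borel_measurable (lebesgue_on D)"
    using \<xi>L L2_measurable by auto
  have \<xi>a: "\<bar>\<xi> x\<bar> \<le> 1" for x using \<xi>(2,3)[of x] by simp
  obtain R where R: "R > 0" "\<And>x. norm x \<ge> R \<Longrightarrow> \<xi> x = 0"
  proof -
    obtain C where C: "compact C" "\<And>x. x \<notin> C \<Longrightarrow> \<xi> x = 0" using test_functionsE[OF \<xi>(1)] by metis
    obtain R where R: "R > 0" "C \<subseteq> ball 0 R" using bounded_subset_ballD[OF compact_imp_bounded[OF C(1)], of 0] by blast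
    show thesis
    proof (rule that[OF R(1)])
      fix x :: 'a assume "norm x \<ge> R"
      then have "x \<notin> C" using R(2) by auto
      then show "\<xi> x = 0" by (rule C(2))
    qed
  qed
  \<comment> \<open>Where \<open>w + m = 0\<close> the quotient is 0 by convention, and the sign
    hypothesis gives \<open>w = 0\<close> there, so \<open>a (w + m) = w\<close> survives. Clipping
    to [0, 1] makes the bounds on \<alpha> hold everywhere instead of almost everywhere.\<close>
  define \<alpha> where "\<alpha> n x = max 0 (min 1 (w n x / (w n x + m n x))) + \<delta>" for n x
  have \<alpha>: "\<delta> \<le> \<alpha> n x" "\<alpha> n x \<le> 2" for n x using \<delta> by (auto simp: \<alpha>_def)
  have \<alpha>m: "\<alpha> n \<in> borel_measurable (lebesgue_on D)" if "n \<le> N" for n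
    unfolding \<alpha>_def using L2_measurable[OF w(1)[OF that]] m(1)[OF that] by measurable
  \<comment> \<open>The tolerance enters the energy balance \<open>N\<close> times and, divided by
    \<open>h\<close>, the duality sum \<open>N\<close> times; both totals must be at most
    \<open>h\<close>. The first total is absorbed by the summand 1 in \<open>A\<close>.\<close>
  define \<kappa> where "\<kappa> = min h (h\<^sup>2) / real N"
  have \<kappa>: "\<kappa> > 0" "real N * \<kappa> \<le> h" "real N * (\<kappa> / h) \<le> h"
  proof -
    show "\<kappa> > 0" using h N by (simp add: \<kappa>_def)
    have e: "real N * \<kappa> = min h (h\<^sup>2)" using N by (simp add: \<kappa>_def)
    then show "real N * \<kappa> \<le> h" by simp
    have "real N * (\<kappa> / h) = min h (h\<^sup>2) / h" using e by simp
    also have "\<dots> \<le> h\<^sup>2 / h" using h by (intro divide_right_mono) auto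
    also have "\<dots> = h" using h by (simp add: power2_eq_square)
    finally show "real N * (\<kappa> / h) \<le> h" .
  qed
  define W where "W n x = P n x - Z n x" for n x
  define GW where "GW n x = GP n x - GZ n x" for n x
  have PL: "P n \<in> L2 D" "GP n \<in> L2 D" "Z n \<in> L2 D" "GZ n \<in> L2 D" "W n \<in> L2 D" "GW n \<in> L2 D" if "n \<in> {1..N}" for n
  proof -
    show 1: "P n \<in> L2 D" "GP n \<in> L2 D" using P[OF that] by (auto simp: pos_H10_def)
    show 2: "Z n \<in> L2 D" "GZ n \<in> L2 D" using Z(1)[OF that] by (auto simp: has_H1_gradient_def)
    show "W n \<in> L2 D" "GW n \<in> L2 D" unfolding W_def GW_def by (rule L2_diff[OF 1(1) 2(1)] L2_diff[OF 1(2) 2(2)])+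
  qed
  \<comment> \<open>Both conclusions of the dual step for data localised by \<xi>: the energy drop,
    and the one-sided weak equation with the product rule already carried out on
    \<open>\<xi> W\<close>.\<close>
  define step where "step n g \<eta> \<longleftrightarrow>
      (\<integral>x. (g x - \<eta> x)\<^sup>2 / \<alpha> n x \<partial>lebesgue_on D) + h * (l2norm D (grad \<eta>))\<^sup>2 \<le> h * (l2norm D (grad g))\<^sup>2 + \<kappa> \<and>
      (\<integral>x. (g x - \<eta> x) / \<alpha> n x * (\<xi> x * W n x) \<partial>lebesgue_on D)
        \<le> h * (\<integral>x. grad \<eta> x \<bullet> (\<xi> x *\<^sub>R GW n x + W n x *\<^sub>R grad \<xi> x) \<partial>lebesgue_on D) + \<kappa>" for n g \<eta>
  have "\<exists>\<eta>::nat \<Rightarrow> 'a \<Rightarrow> real. \<eta> (Suc N) = f \<and> (\<forall>n\<in>{1..N}. \<eta> n \<in> pos_tests D \<and> step n (\<eta> (Suc n)) (\<eta> n))"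
  proof (rule backward_choice[where Q = "\<lambda>g. g \<in> pos_tests D" and S = step, OF _ f])
    fix n and g :: "'a \<Rightarrow> real" assume n: "1 \<le> n" "n \<le> N" and g: "g \<in> pos_tests D"
    then have nN: "n \<in> {1..N}" by simp
    interpret parabolic_step D "\<alpha> n" g \<delta> h
      by unfold_locales (use D \<alpha>m[OF n(2)] \<delta> \<alpha> h g in auto)
    show "\<exists>\<eta>. \<eta> \<in> pos_tests D \<and> step n g \<eta>"
    proof (rule minimizer_exists[OF pos_H10_mult[OF Dm P[OF nN] s\<xi> \<xi>(2,3,4)] H1_gradient_mult[OF D Z(1)[OF nN] s\<xi> \<xi>a \<xi>(4)] _ R(1) _ \<kappa>(1)])
      show "0 \<le> \<xi> x * Z n x" if "x \<in> D" for x using \<xi>(2)[of x] Z(2)[OF nN that] by simp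
      show "\<xi> x * Z n x = 0" if "norm x \<ge> R" for x using R(2)[OF that] by simp
      fix \<eta> assume \<eta>: "\<eta> \<in> pos_tests D" "energy \<eta> \<le> h * (l2norm D (grad g))\<^sup>2 + \<kappa>"
        "(\<integral>x. \<zeta> \<eta> x * (\<xi> x * P n x - \<xi> x * Z n x) \<partial>lebesgue_on D)
          \<le> h * (\<integral>x. grad \<eta> x \<bullet> ((\<xi> x *\<^sub>R GP n x + P n x *\<^sub>R grad \<xi> x) - (\<xi> x *\<^sub>R GZ n x + Z n x *\<^sub>R grad \<xi> x)) \<partial>lebesgue_on D) + \<kappa>"
      have "step n g \<eta>" unfolding step_def
      proof
        show "(\<integral>x. (g x - \<eta> x)\<^sup>2 / \<alpha> n x \<partial>lebesgue_on D) + h * (l2norm D (grad \<eta>))\<^sup>2 \<le> h * (l2norm D (grad g))\<^sup>2 + \<kappa>"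
          using \<eta>(2) by (simp add: energy_def)
        have "(\<xi> x *\<^sub>R GP n x + P n x *\<^sub>R grad \<xi> x) - (\<xi> x *\<^sub>R GZ n x + Z n x *\<^sub>R grad \<xi> x) = \<xi> x *\<^sub>R GW n x + W n x *\<^sub>R grad \<xi> x" for x
          by (simp add: GW_def W_def algebra_simps)
        moreover have "\<zeta> \<eta> x * (\<xi> x * P n x - \<xi> x * Z n x) = (g x - \<eta> x) / \<alpha> n x * (\<xi> x * W n x)" for x
          by (simp add: \<zeta>_def W_def right_diff_distrib)
        ultimately show "(\<integral>x. (g x - \<eta> x) / \<alpha> n x * (\<xi> x * W n x) \<partial>lebesgue_on D)
            \<le> h * (\<integral>x. grad \<eta> x \<bullet> (\<xi> x *\<^sub>R GW n x + W n x *\<^sub>R grad \<xi> x) \<partial>lebesgue_on D) + \<kappa>"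
          using \<eta>(3) by (simp only:)
      qed
      with \<eta>(1) show ?thesis by blast
    qed
  qed
  then obtain \<eta> where \<eta>f: "\<eta> (Suc N) = f" and \<eta>: "\<And>n. n \<in> {1..N} \<Longrightarrow> \<eta> n \<in> pos_tests D" "\<And>n. n \<in> {1..N} \<Longrightarrow> step n (\<eta> (Suc n)) (\<eta> n)"
    by blast
  have \<eta>p: "\<eta> n \<in> pos_tests D" if "n \<in> {1..Suc N}" for n
    using that \<eta>(1)[of n] \<eta>f f by (cases "n = Suc N") auto
  have \<eta>t: "\<eta> n \<in> test_functions D" if "n \<in> {1..Suc N}" for n by (rule pos_tests_test[OF \<eta>p[OF that]])
  have \<eta>L: "\<eta> n \<in> L2 D" "grad (\<eta> n) \<in> L2 D" if "n \<in> {1..Suc N}" for n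
    using test_function_L2[OF \<eta>t[OF that] Dm] by auto
  define \<theta> where "\<theta> n x = (\<eta> (Suc n) x - \<eta> n x) / \<alpha> n x" for n x
  define F where "F n = (\<integral>x. (\<eta> (Suc n) x - \<eta> n x)\<^sup>2 / \<alpha> n x \<partial>lebesgue_on D)" for n
  have dL: "(\<lambda>x. \<eta> (Suc n) x - \<eta> n x) \<in> L2 D" if "n \<in> {1..N}" for n
    using that by (intro L2_diff \<eta>L) auto
  have \<theta>L: "\<theta> n \<in> L2 D" and \<theta>n: "(l2norm D (\<theta> n))\<^sup>2 \<le> (1 / \<delta>) * F n" and dn: "(l2norm D (\<lambda>x. \<eta> (Suc n) x - \<eta> n x))\<^sup>2 \<le> 2 * F n"
    and F0: "0 \<le> F n" if n: "n \<in> {1..N}" for n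
  proof -
    interpret parabolic_step D "\<alpha> n" "\<eta> (Suc n)" \<delta> h
      by unfold_locales (use n D \<alpha>m[of n] \<delta> \<alpha> h \<eta>p[of "Suc n"] in auto)
    have z: "\<zeta> (\<eta> n) = \<theta> n"
      by (rule ext) (simp add: \<theta>_def \<zeta>_def)
    show "\<theta> n \<in> L2 D" using \<zeta>_L2[OF \<eta>L(1)[of n]] n unfolding z by simp
    have "\<delta> * (l2norm D (\<theta> n))\<^sup>2 \<le> F n" using \<zeta>_bound[OF \<eta>L(1)[of n]] n unfolding z F_def by simp
    then show "(l2norm D (\<theta> n))\<^sup>2 \<le> (1 / \<delta>) * F n" using \<delta>(1) by (simp add: pos_le_divide_eq mult.commute)
    show "0 \<le> F n" unfolding F_def by (rule quad_integral_nonneg)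
    have "(l2norm D (\<lambda>x. \<eta> (Suc n) x - \<eta> n x))\<^sup>2 = (\<integral>x. (\<eta> (Suc n) x - \<eta> n x)\<^sup>2 \<partial>lebesgue_on D)"
      by (simp add: l2norm_sq)
    also have "\<dots> \<le> (\<integral>x. 2 * ((\<eta> (Suc n) x - \<eta> n x)\<^sup>2 / \<alpha> n x) \<partial>lebesgue_on D)"
    proof (rule integral_mono)
      show "integrable (lebesgue_on D) (\<lambda>x. (\<eta> (Suc n) x - \<eta> n x)\<^sup>2)" using L2_integrable_sq[OF dL[OF n]] by simp
      have "integrable (lebesgue_on D) (\<lambda>x. (\<eta> (Suc n) x - \<eta> n x)\<^sup>2 / \<alpha> n x)"
        using L2_mult_integrable[OF dL[OF n] L2_over_\<alpha>[OF dL[OF n]]] by (simp add: power2_eq_square)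
      then show "integrable (lebesgue_on D) (\<lambda>x. 2 * ((\<eta> (Suc n) x - \<eta> n x)\<^sup>2 / \<alpha> n x))" by (rule integrable_mult_right)
      show "(\<eta> (Suc n) x - \<eta> n x)\<^sup>2 \<le> 2 * ((\<eta> (Suc n) x - \<eta> n x)\<^sup>2 / \<alpha> n x)" for x
      proof -
        have "\<alpha> n x > 0" using \<alpha>(1)[of n x] \<delta> by linarith
        then have "1 \<le> 2 / \<alpha> n x" using \<alpha>(2)[of n x] by simp
        from mult_right_mono[OF this, of "(\<eta> (Suc n) x - \<eta> n x)\<^sup>2"] show ?thesis by simp
      qed
    qed
    finally show "(l2norm D (\<lambda>x. \<eta> (Suc n) x - \<eta> n x))\<^sup>2 \<le> 2 * F n"
      unfolding F_def by (simp only: integral_mult_right_zero)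
  qed
  have Fstep: "F n + h * (l2norm D (grad (\<eta> n)))\<^sup>2 \<le> h * (l2norm D (grad (\<eta> (Suc n))))\<^sup>2 + \<kappa>" if "n \<in> {1..N}" for n
    using \<eta>(2)[OF that] by (simp add: step_def F_def)
  have hA: "h * (l2norm D (grad f))\<^sup>2 + real N * \<kappa> \<le> h * A\<^sup>2"
    using \<kappa>(2) by (simp add: A2 algebra_simps)
  have "(\<Sum>n=1..N. F n) + h * (l2norm D (grad (\<eta> 1)))\<^sup>2 \<le> h * (l2norm D (grad (\<eta> (Suc N))))\<^sup>2 + real N * \<kappa>"
    using telescope_bound(1)[of N F "\<lambda>n. h * (l2norm D (grad (\<eta> n)))\<^sup>2" \<kappa>] Fstep F0 \<kappa>(1) by simp
  moreover have "0 \<le> h * (l2norm D (grad (\<eta> 1)))\<^sup>2" using h by simp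
  ultimately have SF: "(\<Sum>n=1..N. F n) \<le> h * A\<^sup>2" using hA unfolding \<eta>f by linarith
  have gA: "l2norm D (grad (\<eta> n)) \<le> A" if "n \<in> {1..N}" for n
  proof -
    have "h * (l2norm D (grad (\<eta> n)))\<^sup>2 \<le> h * (l2norm D (grad (\<eta> (Suc N))))\<^sup>2 + real N * \<kappa>"
      using telescope_bound(2)[of N F "\<lambda>n. h * (l2norm D (grad (\<eta> n)))\<^sup>2" \<kappa> n] Fstep F0 \<kappa>(1) that by simp
    then have "h * (l2norm D (grad (\<eta> n)))\<^sup>2 \<le> h * A\<^sup>2" using hA unfolding \<eta>f by linarith
    then have "(l2norm D (grad (\<eta> n)))\<^sup>2 \<le> A\<^sup>2" using h by simp
    then show ?thesis using A0 by (rule power2_le_imp_le)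
  qed
  have S\<theta>: "(\<Sum>n=1..N. l2norm D (\<theta> n)) \<le> sqrt (real N * h * A\<^sup>2 / \<delta>)"
    using sum_le_sqrt[of N "\<lambda>n. l2norm D (\<theta> n)" "1 / \<delta>" F "h * A\<^sup>2"] \<theta>n SF \<delta>(1) by (simp add: mult.assoc)
  have Sd: "(\<Sum>n=1..N. l2norm D (\<lambda>x. \<eta> (Suc n) x - \<eta> n x)) \<le> sqrt (2 * (real N * h) * A\<^sup>2)"
    using sum_le_sqrt[of N "\<lambda>n. l2norm D (\<lambda>x. \<eta> (Suc n) x - \<eta> n x)" 2 F "h * A\<^sup>2"] dn SF by (simp add: mult_ac)
  \<comment> \<open>The \<open>L2\<close> norm of the dual functions grows only through the
    increments, whose sum is controlled by the dissipation and
    \<open>\<alpha> \<le> 2\<close>.\<close>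
  define B where "B = l2norm D f + sqrt (2 * (real N * h) * A\<^sup>2)"
  have B0: "B \<ge> 0" using h by (simp add: B_def)
  have \<eta>B: "l2norm D (\<eta> n) \<le> B" if n: "n \<in> {1..N}" for n
  proof -
    have "n \<le> Suc N \<Longrightarrow> 1 \<le> n \<Longrightarrow> l2norm D (\<eta> n) \<le> l2norm D f + (\<Sum>k\<in>{n..N}. l2norm D (\<lambda>x. \<eta> (Suc k) x - \<eta> k x))" for n
    proof (induction n rule: inc_induct)
      case base then show ?case by (simp add: \<eta>f)
    next
      case (step n)
      have "l2norm D (\<eta> n) \<le> l2norm D (\<lambda>x. \<eta> n x - \<eta> (Suc n) x) + l2norm D (\<eta> (Suc n))"
        using step by (intro l2norm_le_diff \<eta>L) auto
      also have "l2norm D (\<lambda>x. \<eta> n x - \<eta> (Suc n) x) = l2norm D (\<lambda>x. \<eta> (Suc n) x - \<eta> n x)" by (rule l2norm_minus_commute)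
      finally show ?case using step by (simp add: sum.atLeast_Suc_atMost)
    qed
    then have "l2norm D (\<eta> n) \<le> l2norm D f + (\<Sum>k\<in>{n..N}. l2norm D (\<lambda>x. \<eta> (Suc k) x - \<eta> k x))" using n by simp
    also have "(\<Sum>k\<in>{n..N}. l2norm D (\<lambda>x. \<eta> (Suc k) x - \<eta> k x)) \<le> (\<Sum>k=1..N. l2norm D (\<lambda>x. \<eta> (Suc k) x - \<eta> k x))"
      using n by (intro sum_mono2) auto
    finally show ?thesis using Sd by (simp add: B_def)
  qed
  define e where "e n x = \<xi> x * (w n x + m n x)" for n x
  define E where "E = S + 2 * l2norm D \<xi>"
  have E0: "E \<ge> 0" using S0 by (simp add: E_def)
  have \<xi>w: "(\<lambda>x. \<xi> x * w n x) \<in> L2 D" "l2norm D (\<lambda>x. \<xi> x * w n x) \<le> S" if "n \<le> N" for n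
    using l2norm_mult_le[OF w(1)[OF that] \<xi>m(1) \<xi>a] w(2)[OF that] by auto
  have eL: "e n \<in> L2 D" and eE: "l2norm D (e n) \<le> E" if n: "n \<le> N" for n
  proof -
    have "(\<lambda>x. m n x *\<^sub>R \<xi> x) \<in> L2 D" "l2norm D (\<lambda>x. m n x *\<^sub>R \<xi> x) \<le> l2norm D (\<lambda>x. 2 *\<^sub>R \<xi> x)"
      by (rule L2_mult_bounded[OF \<xi>L(1) m[OF n]])+
    then have mL: "(\<lambda>x. \<xi> x * m n x) \<in> L2 D" "l2norm D (\<lambda>x. \<xi> x * m n x) \<le> 2 * l2norm D \<xi>"
      unfolding l2norm_scaleR by (simp_all add: mult.commute)
    have ee: "e n = (\<lambda>x. \<xi> x * w n x + \<xi> x * m n x)" by (simp add: e_def[abs_def] distrib_left)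
    show "e n \<in> L2 D" unfolding ee by (rule L2_add[OF \<xi>w(1)[OF n] mL(1)])
    show "l2norm D (e n) \<le> E"
      unfolding ee E_def using l2norm_triangle[OF \<xi>w(1)[OF n] mL(1)] \<xi>w(2)[OF n] mL(2) by linarith
  qed
  define X where "X n k = (\<integral>x. e n x * \<eta> k x \<partial>lebesgue_on D)" for n k
  have X0: "X 0 1 \<le> 0"
  proof -
    have "(\<integral>x. - (e 0 x * \<eta> 1 x) \<partial>lebesgue_on D) \<ge> 0"
    proof (rule integral_nonneg_AE)
      show "AE x in lebesgue_on D. 0 \<le> - (e 0 x * \<eta> 1 x)"
        using init
      proof eventually_elim
        case (elim x)
        have "0 \<le> \<xi> x * \<eta> 1 x" using \<xi>(2)[of x] pos_tests_nonneg[OF \<eta>p[of 1], of x] N by simp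
        from mult_nonneg_nonpos[OF this elim] show ?case by (simp add: e_def mult_ac)
      qed
    qed
    then show ?thesis by (simp add: X_def)
  qed
  have XN: "X N (Suc N) = (\<integral>x. (w N x + m N x) * f x \<partial>lebesgue_on D)"
    unfolding X_def \<eta>f
  proof (rule Bochner_Integration.integral_cong)
    fix x show "e N x * f x = (w N x + m N x) * f x"
      using \<xi>(5)[of x] by (simp add: e_def mult_ac) (metis mult.left_commute mult.commute)
  qed simp
  \<comment> \<open>The enthalpy inequality tested with \<open>\<xi> \<eta>\<close> bounds the first
    bracket by \<open>- I1 - I2\<close>; the dual step bounds \<open>J / h\<close> by
    \<open>I1 + I3 + \<kappa> / h\<close>; and the second bracket is \<open>J / h\<close> up to the
    errors with \<omega> and \<delta>. The terms \<open>I1\<close> cancel, and only terms with a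
    derivative on \<xi> remain.\<close>
  have main: "(X n n - X (n - 1) n) + (X n (Suc n) - X n n)
      \<le> l2norm D (\<theta> n) * (\<omega> + \<delta> * E) + \<kappa> / h + c * (h * (S + \<omega>) * A + B * l2norm D (GW n))" if n: "n \<in> {1..N}" for n
  proof -
    have n1: "n \<le> N" "n \<in> {1..Suc N}" "Suc n \<in> {1..Suc N}" using n by auto
    have s\<eta>: "smooth (\<eta> n)" by (rule test_functions_smooth[OF \<eta>t[OF n1(2)]])
    note L = \<eta>L[OF n1(2)] \<eta>L(1)[OF n1(3)] \<theta>L[OF n] PL(5,6)[OF n]
    have xp: "(\<lambda>x. \<xi> x * \<eta> n x) \<in> pos_tests D"
      unfolding pos_tests_def using test_function_mult[OF \<eta>t[OF n1(2)] s\<xi>] \<xi>(2) pos_tests_nonneg[OF \<eta>p[OF n1(2)]] by simp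
    have xx: "(\<lambda>x. (w k x + m k x) * (\<xi> x * \<eta> n x)) = (\<lambda>x. e k x * \<eta> n x)" for k by (auto simp: e_def mult_ac)
    have \<xi>GW: "(\<lambda>x. \<xi> x *\<^sub>R GW n x) \<in> L2 D" using l2norm_mult_le(1)[OF L(6) \<xi>m(1) \<xi>a] by simp
    have \<xi>W: "(\<lambda>x. \<xi> x * W n x) \<in> L2 D" using l2norm_mult_le(1)[OF L(5) \<xi>m(1) \<xi>a] by simp
    have \<eta>\<xi>: "(\<lambda>x. \<eta> n x *\<^sub>R grad \<xi> x) \<in> L2 D" "l2norm D (\<lambda>x. \<eta> n x *\<^sub>R grad \<xi> x) \<le> c * l2norm D (\<eta> n)"
      by (rule l2norm_mult_vec_le[OF L(1) \<xi>m(2) \<xi>(4)])+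
    have W\<xi>: "(\<lambda>x. W n x *\<^sub>R grad \<xi> x) \<in> L2 D" "l2norm D (\<lambda>x. W n x *\<^sub>R grad \<xi> x) \<le> c * l2norm D (W n)"
      by (rule l2norm_mult_vec_le[OF L(5) \<xi>m(2) \<xi>(4)])+
    let ?I1 = "\<integral>x. grad (\<eta> n) x \<bullet> (\<xi> x *\<^sub>R GW n x) \<partial>lebesgue_on D"
    let ?I2 = "\<integral>x. GW n x \<bullet> (\<eta> n x *\<^sub>R grad \<xi> x) \<partial>lebesgue_on D"
    let ?I3 = "\<integral>x. grad (\<eta> n) x \<bullet> (W n x *\<^sub>R grad \<xi> x) \<partial>lebesgue_on D"
    let ?J = "\<integral>x. \<theta> n x * (\<xi> x * W n x) \<partial>lebesgue_on D"
    have "(\<integral>x. GW n x \<bullet> grad (\<lambda>x. \<xi> x * \<eta> n x) x \<partial>lebesgue_on D) = ?I1 + ?I2"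
    proof -
      have "GW n x \<bullet> grad (\<lambda>x. \<xi> x * \<eta> n x) x = grad (\<eta> n) x \<bullet> (\<xi> x *\<^sub>R GW n x) + GW n x \<bullet> (\<eta> n x *\<^sub>R grad \<xi> x)" for x
        unfolding grad_mult[OF s\<xi> s\<eta>] by (simp add: inner_add_right inner_commute)
      then show ?thesis
        using Bochner_Integration.integral_add[OF L2_inner_integrable[OF L(2) \<xi>GW] L2_inner_integrable[OF L(6) \<eta>\<xi>(1)]] by (simp only:)
    qed
    then have a: "X n n - X (n - 1) n + (?I1 + ?I2) \<le> 0"
      using ineq[OF n xp] unfolding xx X_def GW_def[symmetric] by (simp only:)
    have "(\<integral>x. grad (\<eta> n) x \<bullet> (\<xi> x *\<^sub>R GW n x + W n x *\<^sub>R grad \<xi> x) \<partial>lebesgue_on D) = ?I1 + ?I3"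
      unfolding inner_add_right
      by (rule Bochner_Integration.integral_add[OF L2_inner_integrable[OF L(2) \<xi>GW] L2_inner_integrable[OF L(2) W\<xi>(1)]])
    then have "?J \<le> h * (?I1 + ?I3) + \<kappa>"
      using \<eta>(2)[OF n] unfolding step_def \<theta>_def by simp
    then have "?J / h \<le> (h * (?I1 + ?I3) + \<kappa>) / h" using h by (intro divide_right_mono) auto
    also have "\<dots> = ?I1 + ?I3 + \<kappa> / h" using h by (simp add: add_divide_distrib)
    finally have b: "?J / h \<le> ?I1 + ?I3 + \<kappa> / h" .
    have i2: "\<bar>?I2\<bar> \<le> c * (B * l2norm D (GW n))"
    proof -
      have "\<bar>?I2\<bar> \<le> l2norm D (GW n) * (c * B)"
        by (rule order_trans[OF L2_inner_le[OF L(6) \<eta>\<xi>(1)] mult_left_mono[OF order_trans[OF \<eta>\<xi>(2) mult_left_mono[OF \<eta>B[OF n] c]]]]) simp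
      then show ?thesis by (simp add: mult_ac)
    qed
    have nW: "l2norm D (W n) \<le> h * (S + \<omega>)"
    proof -
      have q: "(\<lambda>x. W n x / h) \<in> L2 D" using L2_cmult[OF L(5), of "1 / h"] by simp
      have "l2norm D (\<lambda>x. W n x / h) \<le> \<omega> + S"
        using l2norm_le_diff[OF q w(1)[OF n1(1)]] bw[OF n] w(2)[OF n1(1)] by (simp add: W_def)
      moreover have "l2norm D (W n) = h * l2norm D (\<lambda>x. W n x / h)"
        using l2norm_scaleR[of D h "\<lambda>x. W n x / h"] h by simp
      ultimately show ?thesis using h by (simp add: add.commute)
    qed
    have i3: "\<bar>?I3\<bar> \<le> c * (h * (S + \<omega>) * A)"
    proof -
      have "\<bar>?I3\<bar> \<le> A * (c * (h * (S + \<omega>)))"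
        by (rule order_trans[OF L2_inner_le[OF L(2) W\<xi>(1)] mult_mono[OF gA[OF n] order_trans[OF W\<xi>(2) mult_left_mono[OF nW c]] A0]]) simp
      then show ?thesis by (simp add: mult_ac)
    qed
    \<comment> \<open>The increment of the dual function is \<open>\<alpha> \<theta>\<close>, and
      \<open>\<alpha> (w + m) = w + \<delta> (w + m)\<close>: the bounded but irregular
      \<open>m\<close> disappears except for the regularisation error.\<close>
    have dX: "X n (Suc n) - X n n = (\<integral>x. \<theta> n x * (\<xi> x * w n x) \<partial>lebesgue_on D) + \<delta> * (\<integral>x. \<theta> n x * e n x \<partial>lebesgue_on D)"
    proof -
      have "X n (Suc n) - X n n = (\<integral>x. e n x * \<eta> (Suc n) x - e n x * \<eta> n x \<partial>lebesgue_on D)"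
        unfolding X_def
        by (rule Bochner_Integration.integral_diff[OF L2_mult_integrable[OF eL[OF n1(1)] L(3)] L2_mult_integrable[OF eL[OF n1(1)] L(1)], symmetric])
      also have "\<dots> = (\<integral>x. \<theta> n x * (\<xi> x * w n x) + \<delta> * (\<theta> n x * e n x) \<partial>lebesgue_on D)"
      proof (rule integral_cong_AE)
        note [measurable] = L2_measurable[OF eL[OF n1(1)]] L2_measurable[OF L(1)] L2_measurable[OF L(3)] L2_measurable[OF L(4)]
          L2_measurable[OF w(1)[OF n1(1)]] \<xi>m(1)
        show "(\<lambda>x. e n x * \<eta> (Suc n) x - e n x * \<eta> n x) \<in> borel_measurable (lebesgue_on D)" by measurable
        show "(\<lambda>x. \<theta> n x * (\<xi> x * w n x) + \<delta> * (\<theta> n x * e n x)) \<in> borel_measurable (lebesgue_on D)" by measurable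
        show "AE x in lebesgue_on D. e n x * \<eta> (Suc n) x - e n x * \<eta> n x = \<theta> n x * (\<xi> x * w n x) + \<delta> * (\<theta> n x * e n x)"
          using sgn[OF n1(1)]
        proof eventually_elim
          case (elim x)
          have "max 0 (min 1 (w n x / (w n x + m n x))) * (w n x + m n x) = w n x"
          proof -
            consider "w n x = 0" | "w n x > 0" "m n x \<ge> 0" | "w n x < 0" "m n x \<le> 0" using elim by linarith
            then show ?thesis
            proof cases
              case 2
              then have "0 \<le> w n x / (w n x + m n x)" "w n x / (w n x + m n x) \<le> 1" by simp_all
              then show ?thesis using 2 by simp
            next
              case 3
              then have "0 \<le> w n x / (w n x + m n x)" "w n x / (w n x + m n x) \<le> 1"
                by (simp_all add: zero_le_divide_iff divide_le_eq)
              then show ?thesis using 3 by simp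
            qed simp
          qed
          then have wa: "\<alpha> n x * (w n x + m n x) = w n x + \<delta> * (w n x + m n x)" by (simp add: \<alpha>_def distrib_right)
          have "\<alpha> n x \<noteq> 0" using \<alpha>(1)[of n x] \<delta> by linarith
          then have "\<eta> (Suc n) x - \<eta> n x = \<alpha> n x * \<theta> n x" by (simp add: \<theta>_def)
          then have "e n x * (\<eta> (Suc n) x - \<eta> n x) = \<theta> n x * (\<xi> x * (\<alpha> n x * (w n x + m n x)))"
            by (simp only: e_def mult_ac)
          then have "e n x * \<eta> (Suc n) x - e n x * \<eta> n x = \<theta> n x * (\<xi> x * (\<alpha> n x * (w n x + m n x)))"
            by (simp only: right_diff_distrib)
          then show ?case unfolding wa by (simp add: e_def algebra_simps)
        qed
      qed
      also have "\<dots> = (\<integral>x. \<theta> n x * (\<xi> x * w n x) \<partial>lebesgue_on D) + (\<integral>x. \<delta> * (\<theta> n x * e n x) \<partial>lebesgue_on D)"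
        by (rule Bochner_Integration.integral_add[OF L2_mult_integrable[OF L(4) \<xi>w(1)[OF n1(1)]] integrable_mult_right[OF L2_mult_integrable[OF L(4) eL[OF n1(1)]]]])
      finally show ?thesis by simp
    qed
    have d1: "(\<integral>x. \<theta> n x * (\<xi> x * w n x) \<partial>lebesgue_on D) - ?J / h \<le> l2norm D (\<theta> n) * \<omega>"
    proof -
      let ?d = "\<lambda>x. \<xi> x *\<^sub>R (W n x / h - w n x)"
      have q: "(\<lambda>x. W n x / h) \<in> L2 D" using L2_cmult[OF L(5), of "1 / h"] by simp
      have q': "(\<lambda>x. W n x / h - w n x) \<in> L2 D" by (rule L2_diff[OF q w(1)[OF n1(1)]])
      have dl: "?d \<in> L2 D" "l2norm D ?d \<le> \<omega>"
        using l2norm_mult_le[OF q' \<xi>m(1) \<xi>a] bw[OF n] by (auto simp: W_def)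
      have "(\<integral>x. \<theta> n x * ?d x \<partial>lebesgue_on D) = (\<integral>x. (1 / h) * (\<theta> n x * (\<xi> x * W n x)) - \<theta> n x * (\<xi> x * w n x) \<partial>lebesgue_on D)"
        by (intro Bochner_Integration.integral_cong) (auto simp: algebra_simps)
      also have "\<dots> = (\<integral>x. (1 / h) * (\<theta> n x * (\<xi> x * W n x)) \<partial>lebesgue_on D) - (\<integral>x. \<theta> n x * (\<xi> x * w n x) \<partial>lebesgue_on D)"
        by (rule Bochner_Integration.integral_diff[OF integrable_mult_right[OF L2_mult_integrable[OF L(4) \<xi>W]] L2_mult_integrable[OF L(4) \<xi>w(1)[OF n1(1)]]])
      finally have "(\<integral>x. \<theta> n x * ?d x \<partial>lebesgue_on D) = ?J / h - (\<integral>x. \<theta> n x * (\<xi> x * w n x) \<partial>lebesgue_on D)" by simp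
      moreover have "\<bar>\<integral>x. \<theta> n x * ?d x \<partial>lebesgue_on D\<bar> \<le> l2norm D (\<theta> n) * \<omega>"
        by (rule order_trans[OF L2_mult_le[OF L(4) dl(1)] mult_left_mono[OF dl(2)]]) simp
      ultimately show ?thesis by linarith
    qed
    have d2: "\<delta> * (\<integral>x. \<theta> n x * e n x \<partial>lebesgue_on D) \<le> \<delta> * (l2norm D (\<theta> n) * E)"
    proof (rule mult_left_mono)
      have "\<bar>\<integral>x. \<theta> n x * e n x \<partial>lebesgue_on D\<bar> \<le> l2norm D (\<theta> n) * E"
        by (rule order_trans[OF L2_mult_le[OF L(4) eL[OF n1(1)]] mult_left_mono[OF eE[OF n1(1)]]]) simp
      then show "(\<integral>x. \<theta> n x * e n x \<partial>lebesgue_on D) \<le> l2norm D (\<theta> n) * E" by linarith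
    qed (use \<delta> in simp)
    have "(X n n - X (n - 1) n) + (X n (Suc n) - X n n)
        \<le> l2norm D (\<theta> n) * \<omega> + \<delta> * (l2norm D (\<theta> n) * E) + \<kappa> / h + (c * (h * (S + \<omega>) * A) + c * (B * l2norm D (GW n)))"
      using a b i2 i3 dX d1 d2 by linarith
    then show ?thesis by (simp add: algebra_simps)
  qed
  have "X N (Suc N) \<le> (\<Sum>n=1..N. l2norm D (\<theta> n) * (\<omega> + \<delta> * E) + \<kappa> / h + c * (h * (S + \<omega>) * A + B * l2norm D (GW n)))"
    unfolding summation_by_parts[of X N] using X0 sum_mono[OF main, of "{1..N}" "\<lambda>n. n"] by simp
  also have "\<dots> = (\<Sum>n=1..N. l2norm D (\<theta> n)) * (\<omega> + \<delta> * E) + real N * (\<kappa> / h)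
      + c * (real N * (h * (S + \<omega>) * A) + B * (\<Sum>n=1..N. l2norm D (GW n)))"
    by (simp add: sum.distrib sum_distrib_left sum_distrib_right distrib_left)
  also have "\<dots> \<le> sqrt (real N * h * A\<^sup>2 / \<delta>) * (\<omega> + \<delta> * E) + h
      + c * (real N * (h * (S + \<omega>) * A) + B * \<Gamma>)"
  proof -
    have "0 \<le> \<omega> + \<delta> * E" using \<omega>0 \<delta> E0 by simp
    from mult_right_mono[OF S\<theta> this]
    have u1: "(\<Sum>n=1..N. l2norm D (\<theta> n)) * (\<omega> + \<delta> * E) \<le> sqrt (real N * h * A\<^sup>2 / \<delta>) * (\<omega> + \<delta> * E)" .
    have "B * (\<Sum>n=1..N. l2norm D (GW n)) \<le> B * \<Gamma>"
      using bG B0 by (intro mult_left_mono) (simp_all add: GW_def[abs_def])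
    then have "c * (real N * (h * (S + \<omega>) * A) + B * (\<Sum>n=1..N. l2norm D (GW n))) \<le> c * (real N * (h * (S + \<omega>) * A) + B * \<Gamma>)"
      by (rule mult_left_mono[OF add_left_mono c])
    with u1 \<kappa>(3) show ?thesis by linarith
  qed
  finally show ?thesis unfolding XN B_def E_def by (simp add: mult_ac)
qed

section \<open>From the discrete estimate to the comparison inequality\<close>

lemma grad_cutoff_bound:
  obtains B where "B > 0" "\<And>R x. R > 0 \<Longrightarrow> norm (grad (cutoff R) (x :: 'a::euclidean_space)) \<le> B / R"
proof -
  obtain B where B: "B > 0" "\<And>x::'a. norm (grad (cutoff 1) x) \<le> B"
    using test_function_bounded[OF cutoff_test_function[of 1]] by (metis zero_less_one)
  have "norm (grad (cutoff R) x) \<le> B / R" if R: "R > 0" for R and x :: 'a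
  proof -
    have "grad (cutoff R) x = (1 / R) *\<^sub>R grad (cutoff 1) ((1 / R) *\<^sub>R x)"
    proof (rule grad_eqI)
      have "((\<lambda>x::'a. (1 / R) *\<^sub>R x) has_derivative (\<lambda>h. (1 / R) *\<^sub>R h)) (at x)"
        by (auto intro!: derivative_eq_intros)
      from has_derivative_compose[OF this smooth_grad[OF smooth_cutoff[of 1]]]
      have "((\<lambda>x. cutoff 1 ((1 / R) *\<^sub>R x)) has_derivative (\<lambda>h. (1 / R) *\<^sub>R grad (cutoff 1) ((1 / R) *\<^sub>R x) \<bullet> h)) (at x)"
        by simp
      moreover have "(\<lambda>x::'a. cutoff 1 ((1 / R) *\<^sub>R x)) = cutoff R"
        by (auto simp: cutoff_def power2_eq_square)
      ultimately show "(cutoff R has_derivative (\<lambda>h. (1 / R) *\<^sub>R grad (cutoff 1) ((1 / R) *\<^sub>R x) \<bullet> h)) (at x)" by simp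
    qed
    then have "norm (grad (cutoff R) x) = norm (grad (cutoff 1) ((1 / R) *\<^sub>R x)) / R" using R by simp
    then show ?thesis using B(2)[of "(1 / R) *\<^sub>R x"] R by (simp add: divide_right_mono)
  qed
  with B(1) show thesis by (rule that)
qed

text \<open>\<open>P - Z\<close> stands for the time integral of \<open>w\<close> over a step, so
  its mean is near \<open>w t\<close>; the last bound is additive in time, so its sum over all steps
  does not depend on their number. The parameters are chosen in the order that the discrete estimate
  forces: the cutoff radius, then \<delta>, which sees the \<open>L2\<close> norm of the cutoff,
  then \<omega>, then the step. Each of the four terms becomes at most a quarter of
  \<epsilon>.\<close>

lemma duality_comparison:
  fixes D :: "'a::euclidean_space set" and w m :: "real \<Rightarrow> 'a \<Rightarrow> real" and T S :: real and \<Gamma> :: "real \<Rightarrow> real"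
  assumes D: "open D" and T: "T > 0" and f: "f \<in> pos_tests D"
    and w: "\<And>t. t \<in> {0..T} \<Longrightarrow> w t \<in> L2 D" "\<And>t. t \<in> {0..T} \<Longrightarrow> l2norm D (w t) \<le> S"
    and wc: "\<And>\<epsilon>. \<epsilon> > 0 \<Longrightarrow> \<exists>d>0. \<forall>s\<in>{0..T}. \<forall>t\<in>{0..T}. \<bar>s - t\<bar> < d \<longrightarrow> l2norm D (\<lambda>x. w s x - w t x) \<le> \<epsilon>"
    and m: "\<And>t. t \<in> {0..T} \<Longrightarrow> m t \<in> borel_measurable (lebesgue_on D)" "\<And>t. t \<in> {0..T} \<Longrightarrow> AE x in lebesgue_on D. \<bar>m t x\<bar> \<le> 2"
    and sgn: "\<And>t. t \<in> {0..T} \<Longrightarrow> AE x in lebesgue_on D. (0 < w t x \<longrightarrow> 0 \<le> m t x) \<and> (w t x < 0 \<longrightarrow> m t x \<le> 0)"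
    and init: "AE x in lebesgue_on D. w 0 x + m 0 x \<le> 0"
    and data: "\<And>s t. 0 \<le> s \<Longrightarrow> s < t \<Longrightarrow> t \<le> T \<Longrightarrow> \<exists>P GP Z GZ. pos_H10 D P GP \<and> has_H1_gradient D Z GZ \<and> (\<forall>x\<in>D. 0 \<le> Z x) \<and>
      (\<forall>\<phi>\<in>pos_tests D. (\<integral>x. (w t x + m t x) * \<phi> x \<partial>lebesgue_on D) - (\<integral>x. (w s x + m s x) * \<phi> x \<partial>lebesgue_on D)
          + (\<integral>x. (GP x - GZ x) \<bullet> grad \<phi> x \<partial>lebesgue_on D) \<le> 0) \<and>
      (\<forall>\<epsilon>. (\<forall>r\<in>{s..t}. l2norm D (\<lambda>x. w r x - w t x) \<le> \<epsilon>) \<longrightarrow> l2norm D (\<lambda>x. (P x - Z x) / (t - s) - w t x) \<le> \<epsilon>) \<and>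
      l2norm D (\<lambda>x. GP x - GZ x) \<le> (t - s) + (\<Gamma> t - \<Gamma> s)"
  shows "(\<integral>x. (w T x + m T x) * f x \<partial>lebesgue_on D) \<le> 0"
proof -
  have Dm: "D \<in> sets lebesgue" using D by simp
  define I where "I = (\<integral>x. (w T x + m T x) * f x \<partial>lebesgue_on D)"
  have "I \<le> 0 + \<epsilon>" if \<epsilon>: "\<epsilon> > 0" for \<epsilon>
  proof -
    define A where "A = sqrt ((l2norm D (grad f))\<^sup>2 + 1)"
    have A: "A \<ge> 0" by (simp add: A_def)
    have S: "S \<ge> 0" using order_trans[OF l2norm_nonneg w(2)[of 0]] T by simp
    define G where "G = T + (\<Gamma> T - \<Gamma> 0)"
    have G: "G \<ge> 0"
    proof -
      obtain P GP Z GZ where "l2norm D (\<lambda>x. (GP x :: 'a) - GZ x) \<le> (T - 0) + (\<Gamma> T - \<Gamma> 0)"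
        using data[of 0 T] T by auto
      from order_trans[OF l2norm_nonneg this] show ?thesis by (simp add: G_def)
    qed
    define K where "K = T * (S + 1) * A + (l2norm D f + sqrt (2 * T * A\<^sup>2)) * G"
    have K: "K \<ge> 0" using T S A G by (simp add: K_def)
    obtain C where C: "compact C" "\<And>x. x \<notin> C \<Longrightarrow> f x = 0"
      using test_functionsE[OF pos_tests_test[OF f]] by metis
    obtain R0 where R0: "R0 > 0" "C \<subseteq> ball 0 R0" using bounded_subset_ballD[OF compact_imp_bounded[OF C(1)], of 0] by blast
    obtain B where B: "B > 0" "\<And>R x. R > 0 \<Longrightarrow> norm (grad (cutoff R) (x :: 'a)) \<le> B / R" by (rule grad_cutoff_bound) (rule that)
    \<comment> \<open>Makes \<open>c * K\<close> at most \<open>\<epsilon> / 4\<close>. This is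
      possible because \<open>K\<close> is free of the later parameters: it contains the bound 1 in
      place of \<omega>.\<close>
    define R where "R = max R0 (4 * B * (K + 1) / \<epsilon>)"
    have R: "R > 0" "R \<ge> R0" "R \<ge> 4 * B * (K + 1) / \<epsilon>" using R0 by (auto simp: R_def)
    define c where "c = B / R"
    have c0: "c \<ge> 0" using B R by (simp add: c_def)
    have cK: "c * K \<le> \<epsilon> / 4"
    proof -
      have "4 * B * (K + 1) \<le> R * \<epsilon>" using R(3) \<epsilon> by (simp add: pos_divide_le_eq)
      then have "B * (K + 1) \<le> \<epsilon> / 4 * R" by (simp add: algebra_simps)
      then have "B * (K + 1) / R \<le> \<epsilon> / 4" using R(1) by (simp only: pos_divide_le_eq)
      moreover have "c * K \<le> B * (K + 1) / R" unfolding c_def using B R(1) by (simp add: divide_right_mono)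
      ultimately show ?thesis by linarith
    qed
    define \<xi> :: "'a \<Rightarrow> real" where "\<xi> = cutoff R"
    have \<xi>: "\<xi> \<in> test_functions UNIV" "\<And>x. 0 \<le> \<xi> x" "\<And>x. \<xi> x \<le> 1" "\<And>x. norm (grad \<xi> x) \<le> c" "\<And>x. \<xi> x * f x = f x"
    proof -
      show "\<xi> \<in> test_functions UNIV" unfolding \<xi>_def by (rule cutoff_test_function[OF R(1)])
      show "0 \<le> \<xi> x" "\<xi> x \<le> 1" for x by (simp_all add: \<xi>_def cutoff_bounds)
      show "norm (grad \<xi> x) \<le> c" for x unfolding \<xi>_def c_def by (rule B(2)[OF R(1)])
      show "\<xi> x * f x = f x" for x
      proof (cases "x \<in> C")
        case True
        then have "norm x \<le> R" using R0(2) R(2) by auto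
        then show ?thesis using cutoff_eq_1[OF R(1), of x] by (simp add: \<xi>_def)
      qed (simp add: C(2))
    qed
    define E where "E = S + 2 * l2norm D \<xi>"
    have E: "E \<ge> 0" using S by (simp add: E_def)
    \<comment> \<open>The term to be made small has the square
      \<open>\<delta> * E^2 * T * A^2\<close>; the summand 1 excludes a zero denominator.\<close>
    define \<delta> where "\<delta> = min 1 ((\<epsilon> / 4)\<^sup>2 / (E\<^sup>2 * (T * A\<^sup>2) + 1))"
    have den: "E\<^sup>2 * (T * A\<^sup>2) + 1 > 0" using T by (intro add_nonneg_pos) auto
    have \<delta>: "\<delta> > 0" "\<delta> \<le> 1" using \<epsilon> den by (auto simp: \<delta>_def)
    have \<delta>E: "\<delta> * E * sqrt (T * A\<^sup>2 / \<delta>) \<le> \<epsilon> / 4"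
    proof (rule power2_le_imp_le)
      have "(\<delta> * E * sqrt (T * A\<^sup>2 / \<delta>))\<^sup>2 = \<delta>\<^sup>2 * E\<^sup>2 * (T * A\<^sup>2 / \<delta>)"
        using \<delta>(1) T by (simp add: power_mult_distrib)
      also have "\<dots> = \<delta> * (E\<^sup>2 * (T * A\<^sup>2))" using \<delta>(1) by (simp add: power2_eq_square)
      also have "\<dots> \<le> \<delta> * (E\<^sup>2 * (T * A\<^sup>2) + 1)" using \<delta>(1) by (intro mult_left_mono) auto
      also have "\<dots> \<le> ((\<epsilon> / 4)\<^sup>2 / (E\<^sup>2 * (T * A\<^sup>2) + 1)) * (E\<^sup>2 * (T * A\<^sup>2) + 1)"
        using den by (intro mult_right_mono) (auto simp: \<delta>_def)
      also have "\<dots> = (\<epsilon> / 4)\<^sup>2" using den by simp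
      finally show "(\<delta> * E * sqrt (T * A\<^sup>2 / \<delta>))\<^sup>2 \<le> (\<epsilon> / 4)\<^sup>2" .
    qed (use \<epsilon> in simp)
    define q where "q = sqrt (T * A\<^sup>2 / \<delta>)"
    have q: "q \<ge> 0" using T \<delta> by (simp add: q_def)
    define \<omega> where "\<omega> = min 1 (\<epsilon> / 4 / (q + 1))"
    have \<omega>: "\<omega> > 0" "\<omega> \<le> 1" using \<epsilon> q by (auto simp: \<omega>_def)
    have \<omega>q: "\<omega> * q \<le> \<epsilon> / 4"
    proof -
      have "\<omega> * q \<le> \<omega> * (q + 1)" using \<omega> by simp
      also have "\<dots> \<le> (\<epsilon> / 4 / (q + 1)) * (q + 1)" using q by (intro mult_right_mono) (auto simp: \<omega>_def)
      also have "\<dots> = \<epsilon> / 4"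
      proof -
        have "q + 1 \<noteq> 0" using q by linarith
        from iffD1[OF nonzero_eq_divide_eq[OF this] refl] show ?thesis .
      qed
      finally show ?thesis .
    qed
    obtain d where d: "d > 0" "\<forall>s\<in>{0..T}. \<forall>t\<in>{0..T}. \<bar>s - t\<bar> < d \<longrightarrow> l2norm D (\<lambda>x. w s x - w t x) \<le> \<omega>"
      using wc[OF \<omega>(1)] by blast
    define d' where "d' = min d (\<epsilon> / 4)"
    have d': "d' > 0" using d(1) \<epsilon> by (simp add: d'_def)
    obtain N :: nat where N: "T / d' < real N" using reals_Archimedean2 by blast
    have N1: "N \<ge> 1" "real N > 0"
    proof -
      have "0 < T / d'" using T d' by simp
      then show "real N > 0" using N by linarith
      then show "N \<ge> 1" by simp
    qed
    define h where "h = T / real N"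
    have h: "h > 0" "h < d'" "real N * h = T"
      using N1 N T d' by (auto simp: h_def field_simps)
    have in_T: "real n * h \<in> {0..T}" if "n \<le> N" for n
      using that h mult_right_mono[of "real n" "real N" h] by auto
    define Q where "Q n P GP Z GZ \<longleftrightarrow> pos_H10 D P GP \<and> has_H1_gradient D Z GZ \<and> (\<forall>x\<in>D. 0 \<le> Z x) \<and>
      (\<forall>\<phi>\<in>pos_tests D. (\<integral>x. (w (real n * h) x + m (real n * h) x) * \<phi> x \<partial>lebesgue_on D) - (\<integral>x. (w (real (n - 1) * h) x + m (real (n - 1) * h) x) * \<phi> x \<partial>lebesgue_on D)
          + (\<integral>x. (GP x - GZ x) \<bullet> grad \<phi> x \<partial>lebesgue_on D) \<le> 0) \<and>
      l2norm D (\<lambda>x. (P x - Z x) / h - w (real n * h) x) \<le> \<omega> \<and>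
      l2norm D (\<lambda>x. GP x - GZ x) \<le> h + (\<Gamma> (real n * h) - \<Gamma> (real (n - 1) * h))" for n P GP Z GZ
    have "\<exists>P GP Z GZ. Q n P GP Z GZ" if n: "n \<in> {1..N}" for n
    proof -
      have n1: "real n = real (n - 1) + 1" using n by (simp add: of_nat_diff)
      have th: "real n * h - real (n - 1) * h = h" by (subst n1) (simp only: distrib_right mult_1_left add_diff_cancel_left')
      have lt: "0 \<le> real (n - 1) * h" "real (n - 1) * h < real n * h" "real n * h \<le> T"
      proof -
        show "0 \<le> real (n - 1) * h" using h(1) by simp
        show "real (n - 1) * h < real n * h" using th h(1) by linarith
        show "real n * h \<le> T" using in_T[of n] n by simp
      qed
      obtain P GP Z GZ where PZ: "pos_H10 D P GP" "has_H1_gradient D Z GZ" "\<forall>x\<in>D. 0 \<le> Z x"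
        "\<forall>\<phi>\<in>pos_tests D. (\<integral>x. (w (real n * h) x + m (real n * h) x) * \<phi> x \<partial>lebesgue_on D) - (\<integral>x. (w (real (n - 1) * h) x + m (real (n - 1) * h) x) * \<phi> x \<partial>lebesgue_on D)
          + (\<integral>x. (GP x - GZ x) \<bullet> grad \<phi> x \<partial>lebesgue_on D) \<le> 0"
        "\<forall>\<epsilon>. (\<forall>r\<in>{real (n - 1) * h..real n * h}. l2norm D (\<lambda>x. w r x - w (real n * h) x) \<le> \<epsilon>) \<longrightarrow> l2norm D (\<lambda>x. (P x - Z x) / (real n * h - real (n - 1) * h) - w (real n * h) x) \<le> \<epsilon>"
        "l2norm D (\<lambda>x. GP x - GZ x) \<le> (real n * h - real (n - 1) * h) + (\<Gamma> (real n * h) - \<Gamma> (real (n - 1) * h))"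
        using data[OF lt] by (elim exE conjE) (rule that)
      have "l2norm D (\<lambda>x. w r x - w (real n * h) x) \<le> \<omega>" if r: "r \<in> {real (n - 1) * h..real n * h}" for r
      proof -
        have "r \<in> {0..T}" using r lt by auto
        moreover have "real n * h \<in> {0..T}" using in_T n by auto
        moreover have "\<bar>r - real n * h\<bar> < d"
        proof -
          have "real (n - 1) * h \<le> r" "r \<le> real n * h" "h < d" using r h(2) by (auto simp: d'_def)
          then show ?thesis using th by linarith
        qed
        ultimately show ?thesis using d(2) by blast
      qed
      then have close: "l2norm D (\<lambda>x. (P x - Z x) / h - w (real n * h) x) \<le> \<omega>"
        using PZ(5)[rule_format, of \<omega>] unfolding th by simp
      have "Q n P GP Z GZ" unfolding Q_def by (intro conjI PZ(1-4) close PZ(6)[unfolded th])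
      then show ?thesis by blast
    qed
    then have "\<forall>n\<in>{1..N}. \<exists>p. Q n (fst p) (fst (snd p)) (fst (snd (snd p))) (snd (snd (snd p)))"
      by (metis fst_conv snd_conv)
    from bchoice[OF this] obtain p where p: "\<forall>n\<in>{1..N}. Q n (fst (p n)) (fst (snd (p n))) (fst (snd (snd (p n)))) (snd (snd (snd (p n))))"
      by blast
    define P GP Z GZ where "P n = fst (p n)" and "GP n = fst (snd (p n))" and "Z n = fst (snd (snd (p n)))" and "GZ n = snd (snd (snd (p n)))" for n
    have PZ: "Q n (P n) (GP n) (Z n) (GZ n)" if "n \<in> {1..N}" for n
      using p that unfolding P_def GP_def Z_def GZ_def by blast
    note q = PZ[unfolded Q_def]
    note PZ' = q[THEN conjunct1] q[THEN conjunct2, THEN conjunct1] q[THEN conjunct2, THEN conjunct2, THEN conjunct1]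
      q[THEN conjunct2, THEN conjunct2, THEN conjunct2, THEN conjunct1]
      q[THEN conjunct2, THEN conjunct2, THEN conjunct2, THEN conjunct2, THEN conjunct1]
      q[THEN conjunct2, THEN conjunct2, THEN conjunct2, THEN conjunct2, THEN conjunct2]
    have "(\<Sum>n=1..M. h + (\<Gamma> (real n * h) - \<Gamma> (real (n - 1) * h))) = real M * h + (\<Gamma> (real M * h) - \<Gamma> 0)" for M
      by (induction M) (auto simp: algebra_simps)
    from this[of N] have "(\<Sum>n=1..N. h + (\<Gamma> (real n * h) - \<Gamma> (real (n - 1) * h))) = G"
      unfolding h(3) G_def .
    moreover have "(\<Sum>n=1..N. l2norm D (\<lambda>x. GP n x - GZ n x)) \<le> (\<Sum>n=1..N. h + (\<Gamma> (real n * h) - \<Gamma> (real (n - 1) * h)))"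
      by (intro sum_mono PZ'(6))
    ultimately have bG: "(\<Sum>n=1..N. l2norm D (\<lambda>x. GP n x - GZ n x)) \<le> G" by simp
    have "(\<integral>x. (w (real N * h) x + m (real N * h) x) * f x \<partial>lebesgue_on D)
      \<le> (\<omega> + \<delta> * (S + 2 * l2norm D \<xi>)) * sqrt (real N * h * (sqrt ((l2norm D (grad f))\<^sup>2 + 1))\<^sup>2 / \<delta>) + h
       + c * (real N * h * (S + \<omega>) * sqrt ((l2norm D (grad f))\<^sup>2 + 1) + (l2norm D f + sqrt (2 * (real N * h) * (sqrt ((l2norm D (grad f))\<^sup>2 + 1))\<^sup>2)) * G)"
    proof (rule discrete_duality_estimate[where w = "\<lambda>n. w (real n * h)" and m = "\<lambda>n. m (real n * h)" and P = P and Z = Z and GP = GP and GZ = GZ])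
      show "AE x in lebesgue_on D. w (real 0 * h) x + m (real 0 * h) x \<le> 0" using init by simp
      fix n assume n: "n \<le> N"
      show "w (real n * h) \<in> L2 D" "l2norm D (w (real n * h)) \<le> S" "m (real n * h) \<in> borel_measurable (lebesgue_on D)"
        "AE x in lebesgue_on D. \<bar>m (real n * h) x\<bar> \<le> 2"
        "AE x in lebesgue_on D. (0 < w (real n * h) x \<longrightarrow> 0 \<le> m (real n * h) x) \<and> (w (real n * h) x < 0 \<longrightarrow> m (real n * h) x \<le> 0)"
        using in_T[OF n] by (rule w m sgn)+
    next
      fix n assume n: "n \<in> {1..N}"
      show "pos_H10 D (P n) (GP n)" "has_H1_gradient D (Z n) (GZ n)" "l2norm D (\<lambda>x. (P n x - Z n x) / h - w (real n * h) x) \<le> \<omega>"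
        using n by (rule PZ')+
      show "0 \<le> Z n x" if "x \<in> D" for x using PZ'(3)[OF n] that by simp
      show "(\<integral>x. (w (real n * h) x + m (real n * h) x) * \<phi> x \<partial>lebesgue_on D) - (\<integral>x. (w (real (n - 1) * h) x + m (real (n - 1) * h) x) * \<phi> x \<partial>lebesgue_on D)
          + (\<integral>x. (GP n x - GZ n x) \<bullet> grad \<phi> x \<partial>lebesgue_on D) \<le> 0" if "\<phi> \<in> pos_tests D" for \<phi>
        using PZ'(4)[OF n] that by blast
    qed (use D f \<xi> N1 h(1) \<delta> bG in auto)
    then have "I \<le> (\<omega> + \<delta> * E) * q + h + c * (T * (S + \<omega>) * A + (l2norm D f + sqrt (2 * T * A\<^sup>2)) * G)"
      unfolding h(3) I_def A_def[symmetric] E_def q_def .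
    also have "\<dots> = \<omega> * q + \<delta> * E * q + h + c * (T * (S + \<omega>) * A + (l2norm D f + sqrt (2 * T * A\<^sup>2)) * G)"
      by (simp add: distrib_right)
    also have "\<dots> \<le> \<epsilon> / 4 + \<epsilon> / 4 + \<epsilon> / 4 + c * K"
    proof (intro add_mono \<omega>q)
      show "\<delta> * E * q \<le> \<epsilon> / 4" using \<delta>E by (simp add: q_def)
      show "h \<le> \<epsilon> / 4" using h(2) by (simp add: d'_def)
      have "T * (S + \<omega>) * A \<le> T * (S + 1) * A" using T S A \<omega> by (intro mult_right_mono mult_left_mono) auto
      then show "c * (T * (S + \<omega>) * A + (l2norm D f + sqrt (2 * T * A\<^sup>2)) * G) \<le> c * K"
        unfolding K_def by (rule mult_left_mono[OF add_right_mono c0])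
    qed
    finally show ?thesis using cK by linarith
  qed
  then have "I \<le> 0" by (rule field_le_epsilon)
  then show ?thesis by (simp add: I_def)
qed

text \<open>The ideal test function is a cutoff times the indicator of the set where
  \<open>g\<close> is positive; it is approximated in \<open>L2\<close> by nonnegative test
  functions. A second cutoff factor, attached to the approximants, turns \<open>g\<close> into the
  square integrable \<open>G\<close>, so the limit is the integral of the positive part of
  \<open>g\<close> with the squared cutoff as weight.\<close>

lemma AE_nonpos_if_tests_nonpos:
  fixes D :: "'a::euclidean_space set"
  assumes D: "open D" and g: "g \<in> borel_measurable (lebesgue_on D)"
    and gL: "\<And>\<xi>. \<xi> \<in> test_functions UNIV \<Longrightarrow> (\<lambda>x. \<xi> x * g x) \<in> L2 D"
    and tests: "\<And>f. f \<in> pos_tests D \<Longrightarrow> (\<integral>x. g x * f x \<partial>lebesgue_on D) \<le> 0"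
  shows "AE x in lebesgue_on D. g x \<le> 0"
proof -
  have Dm: "D \<in> sets lebesgue" using D by simp
  note [measurable] = g
  have "AE x in lebesgue_on D. norm x \<le> real n \<longrightarrow> g x \<le> 0" for n
  proof -
    define R where "R = real n + 1"
    have R: "R > 0" by (simp add: R_def)
    let ?\<xi> = "cutoff R :: 'a \<Rightarrow> real"
    define G where "G x = ?\<xi> x * g x" for x
    have GL: "G \<in> L2 D" unfolding G_def[abs_def] by (rule gL[OF cutoff_test_function[OF R]])
    note [measurable] = L2_measurable[OF GL]
    define a where "a x = (if G x > 0 then ?\<xi> x else 0)" for x
    have xm[measurable]: "?\<xi> \<in> borel_measurable (lebesgue_on D)"
      by (rule continuous_measurable_on[OF smooth_continuous[OF smooth_cutoff] Dm])
    have am: "a \<in> borel_measurable (lebesgue_on D)" unfolding a_def by measurable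
    have aL: "a \<in> L2 D"
    proof (rule L2_bound[OF test_function_L2(1)[OF cutoff_test_function[OF R] Dm] am])
      show "AE x in lebesgue_on D. norm (a x) \<le> norm (?\<xi> x)" by (intro AE_I2) (simp add: a_def)
    qed
    have a0: "0 \<le> a x" for x by (simp add: a_def cutoff_bounds)
    have "(\<integral>x. G x * a x \<partial>lebesgue_on D) \<le> 0 + e" if e: "e > 0" for e
    proof -
      define d where "d = e / (l2norm D G + 1)"
      have lg: "l2norm D G + 1 > 0" by (intro add_nonneg_pos) auto
      have d: "d > 0" using e lg by (simp add: d_def)
      obtain \<psi> where \<psi>: "\<psi> \<in> test_functions D" "l2norm D (\<lambda>x. a x - \<psi> x) < d" "\<And>x. 0 \<le> \<psi> x"
        using L2_test_functions_dense[OF D aL d] a0 by metis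
      have \<psi>L: "\<psi> \<in> L2 D" by (rule test_function_L2(1)[OF \<psi>(1) Dm])
      have "(\<lambda>x. ?\<xi> x * \<psi> x) \<in> pos_tests D"
        unfolding pos_tests_def using test_function_mult[OF \<psi>(1) smooth_cutoff] \<psi>(3)
        by (auto intro: mult_nonneg_nonneg cutoff_bounds(1))
      from tests[OF this] have 1: "(\<integral>x. G x * \<psi> x \<partial>lebesgue_on D) \<le> 0" by (simp add: G_def mult_ac)
      have "(\<integral>x. G x * a x \<partial>lebesgue_on D) - (\<integral>x. G x * \<psi> x \<partial>lebesgue_on D) = (\<integral>x. G x * (a x - \<psi> x) \<partial>lebesgue_on D)"
        using L2_mult_integrable[OF GL aL] L2_mult_integrable[OF GL \<psi>L] by (simp add: right_diff_distrib)
      also have "\<dots> \<le> l2norm D G * l2norm D (\<lambda>x. a x - \<psi> x)" using L2_mult_le[OF GL L2_diff[OF aL \<psi>L]] by linarith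
      also have "\<dots> \<le> (l2norm D G + 1) * d" using \<psi>(2) by (intro mult_mono) auto
      also have "\<dots> = e" using lg by (simp add: d_def)
      finally show ?thesis using 1 by linarith
    qed
    then have le0: "(\<integral>x. G x * a x \<partial>lebesgue_on D) \<le> 0" by (rule field_le_epsilon)
    have nn: "0 \<le> G x * a x" for x using cutoff_bounds[of R x] by (simp add: a_def)
    have "(\<integral>x. G x * a x \<partial>lebesgue_on D) = 0"
    proof (rule antisym[OF le0])
      show "0 \<le> (\<integral>x. G x * a x \<partial>lebesgue_on D)" by (rule integral_nonneg_AE) (simp add: nn)
    qed
    then have "AE x in lebesgue_on D. G x * a x = 0"
      using integral_nonneg_eq_0_iff_AE[OF L2_mult_integrable[OF GL aL]] nn by auto
    then show ?thesis
    proof eventually_elim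
      case (elim x)
      show ?case
      proof
        assume "norm x \<le> real n"
        then have "?\<xi> x = 1" by (intro cutoff_eq_1[OF R]) (simp add: R_def)
        then show "g x \<le> 0" using elim by (auto simp: a_def G_def split: if_splits)
      qed
    qed
  qed
  then have "AE x in lebesgue_on D. \<forall>n. norm x \<le> real n \<longrightarrow> g x \<le> 0"
    unfolding AE_all_countable by blast
  then show ?thesis by eventually_elim (use real_arch_simple in blast)
qed

section \<open>Integration in time\<close>

text \<open>Completeness of Lebesgue measure: measurability of \<open>f\<close> is a conclusion,
  which is convenient for iterated integrals that are identified only almost everywhere.\<close>

lemma lebesgue_measurable_cong_AE:
  fixes f g :: "'a::euclidean_space \<Rightarrow> real"
  assumes g: "g \<in> borel_measurable lebesgue" and ae: "AE x in lebesgue. f x = g x"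
  shows "f \<in> borel_measurable lebesgue"
proof (rule measurableI)
  fix A :: "real set" assume A: "A \<in> sets borel"
  have "g -` A \<inter> space lebesgue \<in> sets lebesgue" using g A by (rule measurable_sets)
  moreover have "AE x in lebesgue. x \<in> g -` A \<longleftrightarrow> x \<in> f -` A" using ae by eventually_elim auto
  ultimately show "f -` A \<inter> space lebesgue \<in> sets lebesgue"
    using completion.in_sets_AE[where A = "g -` A" and B = "f -` A"] by simp
qed simp

lemma lebesgue_AE_borel:
  fixes f g :: "'a::euclidean_space \<Rightarrow> real"
  assumes g: "g \<in> borel_measurable borel" and ae: "AE x in lebesgue. f x = g x"
  shows "f \<in> borel_measurable lebesgue" "integrable lebesgue f \<longleftrightarrow> integrable lborel g"
    "(\<integral>x. f x \<partial>lebesgue) = (\<integral>x. g x \<partial>lborel)"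
proof -
  have gm: "g \<in> borel_measurable lebesgue" using g by (intro measurable_completion) simp
  show fm: "f \<in> borel_measurable lebesgue" by (rule lebesgue_measurable_cong_AE[OF gm ae])
  have "integrable lebesgue f \<longleftrightarrow> integrable lebesgue g" by (rule integrable_cong_AE[OF fm gm ae])
  then show "integrable lebesgue f \<longleftrightarrow> integrable lborel g" using g by (simp add: integrable_completion)
  have "(\<integral>x. f x \<partial>lebesgue) = (\<integral>x. g x \<partial>lebesgue)" by (rule integral_cong_AE[OF fm gm ae])
  then show "(\<integral>x. f x \<partial>lebesgue) = (\<integral>x. g x \<partial>lborel)" using g by (simp add: integral_completion)
qed

lemma lebesgue_borel_representative:
  fixes f :: "'a::euclidean_space \<Rightarrow> real"
  assumes "f \<in> borel_measurable lebesgue"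
  obtains g where "g \<in> borel_measurable borel" "AE x in lebesgue. f x = g x"
  using completion_ex_borel_measurable_real[OF assms] AE_completion by auto

text \<open>A Lebesgue null set is covered by a Borel null set, to which Fubini on the product of
  the Borel measures applies; the slices of the original set are then contained in null
  sets.\<close>

lemma AE_lebesgue_slices:
  fixes P :: "'a::euclidean_space \<times> 'b::euclidean_space \<Rightarrow> bool"
  assumes "AE z in lebesgue. P z"
  shows "AE x in lebesgue. AE t in lebesgue. P (x, t)" "AE t in lebesgue. AE x in lebesgue. P (x, t)"
proof -
  have "AE z in lborel. P z" using assms by (simp add: AE_completion_iff)
  then obtain N where N: "N \<in> null_sets (lborel :: ('a \<times> 'b) measure)" "{z. \<not> P z} \<subseteq> N"
    unfolding eventually_ae_filter by auto
  have "AE z in lborel. z \<notin> N" using N(1) by (rule AE_not_in)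
  then have "AE z in lborel \<Otimes>\<^sub>M lborel. z \<notin> N" by (simp only: lborel_prod)
  then have 1: "AE x in lborel. AE t in lborel. (x, t) \<notin> N" by (rule lborel_pair.AE_pair)
  have meas: "{z \<in> space (lborel \<Otimes>\<^sub>M lborel). (fst z, snd z) \<notin> N} \<in> sets (lborel \<Otimes>\<^sub>M (lborel :: 'b measure))"
  proof -
    have "{z \<in> space (lborel \<Otimes>\<^sub>M lborel). (fst z, snd z) \<notin> N} = - N" by (auto simp: space_pair_measure)
    moreover have "- N \<in> sets (lborel :: ('a \<times> 'b) measure)"
      using N(1) by (auto simp: null_sets_def borel_comp)
    ultimately show ?thesis by (simp only: lborel_prod)
  qed
  have 2: "AE t in lborel. AE x in lborel. (x, t) \<notin> N"
    using 1 lborel_pair.AE_commute[OF meas] by simp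
  show "AE x in lebesgue. AE t in lebesgue. P (x, t)"
    unfolding AE_completion_iff using 1
  proof eventually_elim
    case (elim x) then show ?case by eventually_elim (use N(2) in auto)
  qed
  show "AE t in lebesgue. AE x in lebesgue. P (x, t)"
    unfolding AE_completion_iff using 2
  proof eventually_elim
    case (elim x) then show ?case by eventually_elim (use N(2) in auto)
  qed
qed

lemma AE_lebesgue_fst:
  fixes P :: "'a::euclidean_space \<Rightarrow> bool"
  assumes "AE x in lebesgue. P x"
  shows "AE z in (lebesgue :: ('a \<times> 'b::euclidean_space) measure). P (fst z)"
proof -
  have "AE x in lborel. P x" using assms by (simp add: AE_completion_iff)
  then obtain N where N: "N \<in> null_sets (lborel :: 'a measure)" "{z. \<not> P z} \<subseteq> N"
    unfolding eventually_ae_filter by auto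
  have [measurable]: "N \<in> sets borel" using N(1) by auto
  have "AE z in (lborel \<Otimes>\<^sub>M (lborel :: 'b measure)). fst z \<notin> N"
  proof (rule lborel_pair.AE_pair_measure)
    show "{z \<in> space (lborel \<Otimes>\<^sub>M (lborel :: 'b measure)). fst z \<notin> N} \<in> sets (lborel \<Otimes>\<^sub>M (lborel :: 'b measure))"
      by measurable
    have "AE x in lborel. x \<notin> N" using N(1) by (rule AE_not_in)
    then show "AE x in lborel. AE y in (lborel :: 'b measure). fst (x, y) \<notin> N" by eventually_elim simp
  qed
  then have "AE z in (lborel :: ('a \<times> 'b) measure). fst z \<notin> N" by (simp only: lborel_prod)
  then show ?thesis unfolding AE_completion_iff by eventually_elim (use N(2) in auto)
qed

lemma borel_measurable_fst_snd:
  shows "fst \<in> borel_measurable (borel :: ('a::euclidean_space \<times> 'b::euclidean_space) measure)"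
    and "snd \<in> borel_measurable (borel :: ('a \<times> 'b) measure)"
  by (intro borel_measurable_continuous_onI continuous_intros)+

lemma lebesgue_measurable_fst:
  fixes f :: "'a::euclidean_space \<Rightarrow> real"
  assumes "f \<in> borel_measurable lebesgue"
  shows "(\<lambda>z. f (fst z)) \<in> borel_measurable (lebesgue :: ('a \<times> 'b::euclidean_space) measure)"
proof -
  obtain g where g: "g \<in> borel_measurable borel" "AE x in lebesgue. f x = g x"
    by (rule lebesgue_borel_representative[OF assms])
  have "(\<lambda>z::'a \<times> 'b. g (fst z)) \<in> borel_measurable borel" by (rule measurable_compose[OF borel_measurable_fst_snd(1) g(1)])
  from lebesgue_AE_borel(1)[OF this AE_lebesgue_fst[OF g(2)]] show ?thesis .
qed

text \<open>Fubini is used only for a Borel representative; for almost every parameter its slice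
  agrees almost everywhere with that of \<open>F\<close>, so the inner integrals coincide.\<close>

lemma fubini_lebesgue:
  fixes F :: "'a::euclidean_space \<times> 'b::euclidean_space \<Rightarrow> real"
  assumes F: "integrable lebesgue F"
  shows "integrable lebesgue (\<lambda>t. \<integral>x. F (x, t) \<partial>lebesgue)"
    "(\<integral>t. (\<integral>x. F (x, t) \<partial>lebesgue) \<partial>lebesgue) = (\<integral>z. F z \<partial>lebesgue)"
    "(\<integral>x. (\<integral>t. F (x, t) \<partial>lebesgue) \<partial>lebesgue) = (\<integral>z. F z \<partial>lebesgue)"
proof -
  obtain g where g[measurable]: "g \<in> borel_measurable borel" and Fg: "AE z in lebesgue. F z = g z"
    by (rule lebesgue_borel_representative[OF borel_measurable_integrable[OF F]])
  have gi: "integrable (lborel \<Otimes>\<^sub>M lborel) (case_prod (\<lambda>x t. g (x, t)))"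
    using F lebesgue_AE_borel(2)[OF g Fg] by (simp add: lborel_prod)
  have gint: "(\<integral>z. F z \<partial>lebesgue) = integral\<^sup>L (lborel \<Otimes>\<^sub>M lborel) (case_prod (\<lambda>x t. g (x, t)))"
    using lebesgue_AE_borel(3)[OF g Fg] by (simp add: lborel_prod)
  have m1: "(\<lambda>t. \<integral>x. g (x, t) \<partial>lborel) \<in> borel_measurable borel"
    "(\<lambda>x. \<integral>t. g (x, t) \<partial>lborel) \<in> borel_measurable borel"
    using borel_measurable_integrable[OF lborel_pair.integrable_snd[OF gi]] borel_measurable_integrable[OF lborel_pair.integrable_fst[OF gi]] by simp_all
  have s1: "AE t in lebesgue. (\<integral>x. F (x, t) \<partial>lebesgue) = (\<integral>x. g (x, t) \<partial>lborel)"
    using AE_lebesgue_slices(2)[OF Fg]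
  proof eventually_elim
    case (elim t)
    have "(\<lambda>x. g (x, t)) \<in> borel_measurable borel" by measurable
    from lebesgue_AE_borel(3)[OF this elim] show ?case .
  qed
  have s2: "AE x in lebesgue. (\<integral>t. F (x, t) \<partial>lebesgue) = (\<integral>t. g (x, t) \<partial>lborel)"
    using AE_lebesgue_slices(1)[OF Fg]
  proof eventually_elim
    case (elim x)
    have "(\<lambda>t. g (x, t)) \<in> borel_measurable borel" by measurable
    from lebesgue_AE_borel(3)[OF this elim] show ?case .
  qed
  show "integrable lebesgue (\<lambda>t. \<integral>x. F (x, t) \<partial>lebesgue)"
    using lebesgue_AE_borel(2)[OF m1(1) s1] lborel_pair.integrable_snd[OF gi] by simp
  show "(\<integral>t. (\<integral>x. F (x, t) \<partial>lebesgue) \<partial>lebesgue) = (\<integral>z. F z \<partial>lebesgue)"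
    unfolding gint lebesgue_AE_borel(3)[OF m1(1) s1] by (rule lborel_pair.integral_snd[OF gi])
  show "(\<integral>x. (\<integral>t. F (x, t) \<partial>lebesgue) \<partial>lebesgue) = (\<integral>z. F z \<partial>lebesgue)"
    unfolding gint lebesgue_AE_borel(3)[OF m1(2) s2] using lborel_pair.integral_fst[OF gi] by simp
qed

section \<open>Integrals over space-time slabs\<close>

lemma slab_lebesgue: "open D \<Longrightarrow> D \<times> {s..<t::real} \<in> sets lebesgue" for D :: "'a::euclidean_space set"
  by (intro sets_completionI_sets) (auto intro!: borel_Times)

lemma slab_integral:
  fixes n :: "'a::euclidean_space \<Rightarrow> real"
  assumes n: "integrable lebesgue n" and st: "s \<le> t"
  shows "integrable lebesgue (\<lambda>z. n (fst z) * indicator {s..<t::real} (snd z))"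
    "(\<integral>z. n (fst z) * indicator {s..<t} (snd z) \<partial>lebesgue) = (t - s) * (\<integral>x. n x \<partial>lebesgue)"
proof -
  obtain g where g[measurable]: "g \<in> borel_measurable borel" and ng: "AE x in lebesgue. n x = g x"
    by (rule lebesgue_borel_representative[OF borel_measurable_integrable[OF n]])
  have gi: "integrable lborel g" using n lebesgue_AE_borel(2)[OF g ng] by simp
  let ?G = "\<lambda>z. g (fst z) * indicator {s..<t} (snd z)"
  have Gm: "?G \<in> borel_measurable borel"
    by (intro borel_measurable_times measurable_compose[OF borel_measurable_fst_snd(1) g]
        measurable_compose[OF borel_measurable_fst_snd(2) borel_measurable_indicator]) simp
  have ae: "AE z in lebesgue. n (fst z) * indicator {s..<t} (snd z) = ?G z"
    using AE_lebesgue_fst[OF ng] by eventually_elim simp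
  have ind: "integrable lborel (\<lambda>y. indicator {s..<t} y :: real)" "(\<integral>y. indicator {s..<t} y \<partial>lborel) = t - s"
    using st by (auto simp: )
  have Gi: "integrable (lborel \<Otimes>\<^sub>M lborel) ?G"
  proof (rule lborel_pair.Fubini_integrable)
    show "?G \<in> borel_measurable (lborel \<Otimes>\<^sub>M lborel)" using Gm by (simp add: lborel_prod)
    show "integrable lborel (\<lambda>x. \<integral>y. norm (?G (x, y)) \<partial>lborel)"
      using gi ind by (simp add: abs_mult)
    show "AE x in lborel. integrable lborel (\<lambda>y. ?G (x, y))" using ind by simp
  qed
  show "integrable lebesgue (\<lambda>z. n (fst z) * indicator {s..<t::real} (snd z))"
    using lebesgue_AE_borel(2)[OF Gm ae] Gi by (simp add: lborel_prod)
  have "(\<integral>z. n (fst z) * indicator {s..<t} (snd z) \<partial>lebesgue) = (\<integral>x. (\<integral>y. n x * indicator {s..<t} y \<partial>lebesgue) \<partial>lebesgue)"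
    using fubini_lebesgue(3)[OF \<open>integrable lebesgue (\<lambda>z. n (fst z) * indicator {s..<t::real} (snd z))\<close>] by simp
  also have "\<dots> = (t - s) * (\<integral>x. n x \<partial>lebesgue)"
    using st by (simp add: mult.commute)
  finally show "(\<integral>z. n (fst z) * indicator {s..<t} (snd z) \<partial>lebesgue) = (t - s) * (\<integral>x. n x \<partial>lebesgue)" .
qed

lemma measurable_lebesgue_on_iff:
  fixes f :: "'a::euclidean_space \<Rightarrow> real"
  assumes "S \<in> sets lebesgue"
  shows "f \<in> borel_measurable (lebesgue_on S) \<longleftrightarrow> (\<lambda>x. indicator S x * f x) \<in> borel_measurable lebesgue"
  using assms borel_measurable_restrict_space_iff[of S lebesgue f] by simp

lemma measurable_lebesgue_on_components:
  fixes f :: "'a::euclidean_space \<Rightarrow> 'b::euclidean_space"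
  shows "f \<in> borel_measurable (lebesgue_on S) \<longleftrightarrow> (\<forall>b\<in>Basis. (\<lambda>x. f x \<bullet> b) \<in> borel_measurable (lebesgue_on S))"
  by (rule borel_measurable_euclidean_space)

lemma fst_L2:
  fixes \<Phi> :: "'a::euclidean_space \<Rightarrow> 'b::euclidean_space"
  assumes D: "open D" and \<Phi>: "\<Phi> \<in> L2 D" and st: "s \<le> t"
  shows "(\<lambda>z. \<Phi> (fst z)) \<in> L2 (D \<times> {s..<t::real})" "(l2norm (D \<times> {s..<t}) (\<lambda>z. \<Phi> (fst z)))\<^sup>2 = (t - s) * (l2norm D \<Phi>)\<^sup>2"
proof -
  have Dm: "D \<in> sets lebesgue" using D by simp
  note Qm = slab_lebesgue[OF D, of s t]
  have m: "(\<lambda>z. \<Phi> (fst z)) \<in> borel_measurable (lebesgue_on (D \<times> {s..<t}))"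
  proof (rule measurable_lebesgue_on_components[THEN iffD2], rule ballI)
    fix b :: 'b assume "b \<in> Basis"
    have "(\<lambda>x. indicator D x * (\<Phi> x \<bullet> b)) \<in> borel_measurable lebesgue"
      using L2_measurable[OF L2_component[OF \<Phi>]] by (simp add: measurable_lebesgue_on_iff[OF Dm])
    from lebesgue_measurable_fst[OF this]
    have "(\<lambda>z. indicator D (fst z) * (\<Phi> (fst z) \<bullet> b)) \<in> borel_measurable (lebesgue :: ('a \<times> real) measure)" .
    then have "(\<lambda>z. indicator D (fst z) * (\<Phi> (fst z) \<bullet> b)) \<in> borel_measurable (lebesgue_on (D \<times> {s..<t}))"
      by (rule measurable_restrict_space1)
    then show "(\<lambda>z. \<Phi> (fst z) \<bullet> b) \<in> borel_measurable (lebesgue_on (D \<times> {s..<t}))"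
      by (rule measurable_cong[THEN iffD1, rotated]) auto
  qed
  have "integrable lebesgue (\<lambda>x. indicator D x *\<^sub>R (norm (\<Phi> x))\<^sup>2)"
    using L2_integrable_sq[OF \<Phi>] Dm by (simp add: integrable_restrict_space)
  note sl = slab_integral[OF this st]
  have eq: "(indicator D (fst z) *\<^sub>R (norm (\<Phi> (fst z)))\<^sup>2) * indicator {s..<t} (snd z) = indicator (D \<times> {s..<t}) z *\<^sub>R (norm (\<Phi> (fst z)))\<^sup>2" for z
    by (cases z) (auto simp: indicator_def)
  show "(\<lambda>z. \<Phi> (fst z)) \<in> L2 (D \<times> {s..<t})"
    unfolding L2_def mem_Collect_eq using m sl(1) Qm unfolding eq by (simp add: integrable_restrict_space)
  show "(l2norm (D \<times> {s..<t}) (\<lambda>z. \<Phi> (fst z)))\<^sup>2 = (t - s) * (l2norm D \<Phi>)\<^sup>2"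
    unfolding l2norm_sq using sl(2) Qm Dm unfolding eq by (simp add: integral_restrict_space)
qed

text \<open>The slab is half-open, as in \<open>cyl\<close>, while the outer integral runs over the
  closed interval, as in \<open>enthalpy_flux\<close>; the end point is a null set of times.\<close>

lemma slab_iterated_integral:
  fixes f :: "'a::euclidean_space \<times> real \<Rightarrow> real"
  assumes D: "open D" and f: "integrable (lebesgue_on (D \<times> {s..<t})) f"
  shows "integrable (lebesgue_on {s..t}) (\<lambda>\<tau>. \<integral>x. f (x, \<tau>) \<partial>lebesgue_on D)"
    "(\<integral>\<tau>. (\<integral>x. f (x, \<tau>) \<partial>lebesgue_on D) \<partial>lebesgue_on {s..t}) = (\<integral>z. f z \<partial>lebesgue_on (D \<times> {s..<t}))"
proof -
  have Dm: "D \<in> sets lebesgue" using D by simp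
  note Qm = slab_lebesgue[OF D, of s t]
  let ?F = "\<lambda>z. indicator (D \<times> {s..<t}) z *\<^sub>R f z"
  have F: "integrable lebesgue ?F" using f Qm by (simp add: integrable_restrict_space)
  have sl: "(\<integral>x. ?F (x, \<tau>) \<partial>lebesgue) = indicator {s..<t} \<tau> *\<^sub>R (\<integral>x. f (x, \<tau>) \<partial>lebesgue_on D)" for \<tau>
    using Dm by (cases "\<tau> \<in> {s..<t}") (auto simp: integral_restrict_space indicator_times)
  have ae: "AE \<tau> in lebesgue. indicator {s..t} \<tau> *\<^sub>R (\<integral>x. f (x, \<tau>) \<partial>lebesgue_on D) = (\<integral>x. ?F (x, \<tau>) \<partial>lebesgue)"
  proof -
    have "AE \<tau> in lebesgue. \<tau> \<noteq> t" by (intro AE_completion AE_lborel_singleton)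
    then show ?thesis unfolding sl by eventually_elim (auto simp: indicator_def)
  qed
  note fb = fubini_lebesgue(1,2)[OF F]
  have m: "(\<lambda>\<tau>. indicator {s..t} \<tau> *\<^sub>R (\<integral>x. f (x, \<tau>) \<partial>lebesgue_on D)) \<in> borel_measurable lebesgue"
    by (rule lebesgue_measurable_cong_AE[OF borel_measurable_integrable[OF fb(1)] ae])
  show "integrable (lebesgue_on {s..t}) (\<lambda>\<tau>. \<integral>x. f (x, \<tau>) \<partial>lebesgue_on D)"
    using integrable_cong_AE[OF m borel_measurable_integrable[OF fb(1)] ae] fb(1) by (simp add: integrable_restrict_space)
  have "(\<integral>\<tau>. (\<integral>x. f (x, \<tau>) \<partial>lebesgue_on D) \<partial>lebesgue_on {s..t}) = (\<integral>\<tau>. (\<integral>x. ?F (x, \<tau>) \<partial>lebesgue) \<partial>lebesgue)"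
    using integral_cong_AE[OF m borel_measurable_integrable[OF fb(1)] ae] by (simp add: integral_restrict_space)
  also have "\<dots> = (\<integral>z. f z \<partial>lebesgue_on (D \<times> {s..<t}))"
    using fb(2) Qm by (simp add: integral_restrict_space)
  finally show "(\<integral>\<tau>. (\<integral>x. f (x, \<tau>) \<partial>lebesgue_on D) \<partial>lebesgue_on {s..t}) = (\<integral>z. f z \<partial>lebesgue_on (D \<times> {s..<t}))" .
qed

text \<open>\<open>F\<close> is the integral of \<open>f\<close> over the times from
  \<open>s\<close> to \<open>t\<close> as an element of \<open>L2 D\<close>. It is given by duality,
  which avoids statements about individual slices and determines \<open>F\<close> up to null
  sets.\<close>

definition time_int :: "'a::euclidean_space set \<Rightarrow> real \<Rightarrow> real \<Rightarrow> ('a \<times> real \<Rightarrow> 'b::euclidean_space) \<Rightarrow> ('a \<Rightarrow> 'b) \<Rightarrow> bool" where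
  "time_int D s t f F \<longleftrightarrow> F \<in> L2 D \<and>
     (\<forall>\<Phi>\<in>L2 D. (\<integral>x. F x \<bullet> \<Phi> x \<partial>lebesgue_on D) = (\<integral>z. f z \<bullet> \<Phi> (fst z) \<partial>lebesgue_on (D \<times> {s..<t})))"

lemma square_integral_le:
  fixes g :: "real \<Rightarrow> real"
  assumes g: "g \<in> borel_measurable lborel" "integrable lborel (\<lambda>y. (g y)\<^sup>2)" "\<And>y. y \<notin> {s..<t} \<Longrightarrow> g y = 0" and st: "s < t"
  shows "(\<integral>y. g y \<partial>lborel)\<^sup>2 \<le> (t - s) * (\<integral>y. (g y)\<^sup>2 \<partial>lborel)"
proof -
  let ?I = "\<lambda>y. indicator {s..<t} y :: real"
  have i1: "integrable lborel ?I" "(\<integral>y. ?I y \<partial>lborel) = t - s" using st by auto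
  have i2: "integrable lborel g"
  proof (rule Bochner_Integration.integrable_bound[OF Bochner_Integration.integrable_add[OF i1(1) g(2)] g(1)], intro AE_I2)
    fix y
    have "\<bar>g y\<bar> \<le> 1 + (g y)\<^sup>2" using sum_squares_bound[of "\<bar>g y\<bar>" 1] by simp
    then show "norm (g y) \<le> norm (?I y + (g y)\<^sup>2)" using g(3)[of y] by (cases "y \<in> {s..<t}") auto
  qed
  define c where "c = (\<integral>y. g y \<partial>lborel) / (t - s)"
  have "0 \<le> (\<integral>y. (g y - c * ?I y)\<^sup>2 \<partial>lborel)" by (intro integral_nonneg_AE) simp
  also have "(\<lambda>y. (g y - c * ?I y)\<^sup>2) = (\<lambda>y. (g y)\<^sup>2 - 2 * c * g y + c\<^sup>2 * ?I y)"
  proof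
    fix y show "(g y - c * ?I y)\<^sup>2 = (g y)\<^sup>2 - 2 * c * g y + c\<^sup>2 * ?I y"
      using g(3)[of y] by (cases "y \<in> {s..<t}") (auto simp: power2_diff)
  qed
  also have "(\<integral>y. (g y)\<^sup>2 - 2 * c * g y + c\<^sup>2 * ?I y \<partial>lborel) = (\<integral>y. (g y)\<^sup>2 \<partial>lborel) - 2 * c * (\<integral>y. g y \<partial>lborel) + c\<^sup>2 * (t - s)"
    using g(2) i2 i1 by simp
  also have "\<dots> = (\<integral>y. (g y)\<^sup>2 \<partial>lborel) - (\<integral>y. g y \<partial>lborel)\<^sup>2 / (t - s)"
    using st by (simp add: c_def power2_eq_square)
  finally have "(\<integral>y. g y \<partial>lborel)\<^sup>2 / (t - s) \<le> (\<integral>y. (g y)\<^sup>2 \<partial>lborel)" by simp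
  then show ?thesis using st by (simp add: pos_divide_le_eq mult.commute)
qed

text \<open>Integrating the slices of a Borel representative gives a measurable function of
  \<open>x\<close>; Cauchy-Schwarz in time puts it in \<open>L2\<close>, and Fubini yields the
  duality.\<close>

lemma time_int_exists_real:
  fixes f :: "'a::euclidean_space \<times> real \<Rightarrow> real"
  assumes D: "open D" and st: "s < t" and f: "f \<in> L2 (D \<times> {s..<t})"
  obtains F where "time_int D s t f F"
proof -
  have Dm: "D \<in> sets lebesgue" using D by simp
  note Qm = slab_lebesgue[OF D, of s t]
  define F0 where "F0 z = indicator (D \<times> {s..<t}) z * f z" for z
  have F0m: "F0 \<in> borel_measurable lebesgue"
    using L2_measurable[OF f] unfolding F0_def measurable_lebesgue_on_iff[OF Qm] .
  obtain g0 where g0[measurable]: "g0 \<in> borel_measurable borel" and Fg0: "AE z in lebesgue. F0 z = g0 z"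
    by (rule lebesgue_borel_representative[OF F0m])
  \<comment> \<open>The factor in time makes every slice, not only almost every one, vanish outside
    the time interval, as \<open>square_integral_le\<close> asks.\<close>
  define g where "g z = g0 z * indicator {s..<t} (snd z)" for z
  have g[measurable]: "g \<in> borel_measurable borel" unfolding g_def
    by (intro borel_measurable_times g0 measurable_compose[OF borel_measurable_fst_snd(2) borel_measurable_indicator]) simp
  have Fg: "AE z in lebesgue. F0 z = g z"
    using Fg0
  proof eventually_elim
    case (elim z)
    have "F0 z = 0" if "snd z \<notin> {s..<t}" using that by (cases z) (auto simp: F0_def)
    then show ?case using elim by (cases "snd z \<in> {s..<t}") (simp_all add: g_def)
  qed
  have F02: "integrable lebesgue (\<lambda>z. (F0 z)\<^sup>2)"
  proof -
    have "integrable lebesgue (\<lambda>z. indicator (D \<times> {s..<t}) z *\<^sub>R (norm (f z))\<^sup>2)"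
      using L2_integrable_sq[OF f] Qm by (simp add: integrable_restrict_space)
    moreover have "(\<lambda>z. indicator (D \<times> {s..<t}) z *\<^sub>R (norm (f z))\<^sup>2) = (\<lambda>z. (F0 z)\<^sup>2)"
      by (auto simp: F0_def indicator_def)
    ultimately show ?thesis by simp
  qed
  have g2m: "(\<lambda>z. (g z)\<^sup>2) \<in> borel_measurable borel" by measurable
  have ae2: "AE z in lebesgue. (F0 z)\<^sup>2 = (g z)\<^sup>2" using Fg by eventually_elim simp
  have g2: "integrable (lborel \<Otimes>\<^sub>M lborel) (\<lambda>z. (g z)\<^sup>2)"
    using F02 lebesgue_AE_borel(2)[OF g2m ae2] by (simp add: lborel_prod)
  define W where "W x = (\<integral>y. g (x, y) \<partial>lborel)" for x
  have Wm: "W \<in> borel_measurable borel" unfolding W_def by measurable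
  have W_bound: "AE x in lborel. (W x)\<^sup>2 \<le> (t - s) * (\<integral>y. (g (x, y))\<^sup>2 \<partial>lborel)"
    using lborel_pair.AE_integrable_fst'[OF g2]
  proof eventually_elim
    case (elim x)
    then show ?case unfolding W_def
      by (intro square_integral_le[OF _ _ _ st]) (auto simp: g_def)
  qed
  have W2: "integrable lborel (\<lambda>x. (W x)\<^sup>2)"
  proof (rule Bochner_Integration.integrable_bound[OF integrable_mult_right[OF lborel_pair.integrable_fst'[OF g2], of "t - s"]])
    show "(\<lambda>x. (W x)\<^sup>2) \<in> borel_measurable lborel" using Wm by measurable
    show "AE x in lborel. norm ((W x)\<^sup>2) \<le> norm ((t - s) * (\<integral>y. (g (x, y))\<^sup>2 \<partial>lborel))"
      using W_bound by eventually_elim simp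
  qed
  have WL: "W \<in> L2 UNIV" unfolding L2_UNIV_iff
    using W2 Wm by (auto simp: integrable_completion intro: measurable_completion)
  have WD: "W \<in> L2 D" by (rule L2_subset(1)[OF WL subset_UNIV _ Dm]) simp
  have "time_int D s t f W"
    unfolding time_int_def
  proof (intro conjI ballI WD)
    fix \<Phi> :: "'a \<Rightarrow> real" assume \<Phi>: "\<Phi> \<in> L2 D"
    have \<Phi>f: "(\<lambda>z. \<Phi> (fst z)) \<in> L2 (D \<times> {s..<t})" by (rule fst_L2(1)[OF D \<Phi>]) (use st in simp)
    let ?H = "\<lambda>z. indicator (D \<times> {s..<t}) z *\<^sub>R (f z \<bullet> \<Phi> (fst z))"
    have H: "integrable lebesgue ?H"
      using L2_inner_integrable[OF f \<Phi>f] Qm by (simp add: integrable_restrict_space)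
    have ind: "AE x in lebesgue. (\<integral>y. ?H (x, y) \<partial>lebesgue) = indicator D x *\<^sub>R (W x \<bullet> \<Phi> x)"
      using AE_lebesgue_slices(1)[OF Fg]
    proof eventually_elim
      case (elim x)
      have "(\<lambda>y. g (x, y)) \<in> borel_measurable borel" by measurable
      from lebesgue_AE_borel(3)[OF this elim] have e: "(\<integral>y. F0 (x, y) \<partial>lebesgue) = W x" by (simp add: W_def)
      have "?H (x, y) = (indicator D x * \<Phi> x) * F0 (x, y)" for y
        by (cases "x \<in> D") (simp_all add: F0_def indicator_times)
      then have "(\<integral>y. ?H (x, y) \<partial>lebesgue) = (\<integral>y. (indicator D x * \<Phi> x) * F0 (x, y) \<partial>lebesgue)"
        by (simp only:)
      also have "\<dots> = (indicator D x * \<Phi> x) * W x" by (simp only: integral_mult_right_zero e)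
      finally show ?case by (simp add: mult_ac)
    qed
    have m1: "(\<lambda>x. indicator D x *\<^sub>R (W x \<bullet> \<Phi> x)) \<in> borel_measurable lebesgue"
      using borel_measurable_integrable[OF L2_inner_integrable[OF WD \<Phi>]] by (simp add: measurable_lebesgue_on_iff[OF Dm])
    have "(\<integral>z. f z \<bullet> \<Phi> (fst z) \<partial>lebesgue_on (D \<times> {s..<t})) = (\<integral>z. ?H z \<partial>lebesgue)"
      using Qm by (simp add: integral_restrict_space)
    also have "\<dots> = (\<integral>x. (\<integral>y. ?H (x, y) \<partial>lebesgue) \<partial>lebesgue)" by (rule fubini_lebesgue(3)[OF H, symmetric])
    also have "\<dots> = (\<integral>x. indicator D x *\<^sub>R (W x \<bullet> \<Phi> x) \<partial>lebesgue)"
      by (rule integral_cong_AE[OF lebesgue_measurable_cong_AE[OF m1 ind] m1 ind])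
    also have "\<dots> = (\<integral>x. W x \<bullet> \<Phi> x \<partial>lebesgue_on D)" using Dm by (simp add: integral_restrict_space)
    finally show "(\<integral>x. W x \<bullet> \<Phi> x \<partial>lebesgue_on D) = (\<integral>z. f z \<bullet> \<Phi> (fst z) \<partial>lebesgue_on (D \<times> {s..<t}))" by simp
  qed
  then show thesis by (rule that)
qed

lemma time_int_L2: "time_int D s t f F \<Longrightarrow> F \<in> L2 D"
  and time_int_eq: "time_int D s t f F \<Longrightarrow> \<Phi> \<in> L2 D \<Longrightarrow>
    (\<integral>x. F x \<bullet> \<Phi> x \<partial>lebesgue_on D) = (\<integral>z. f z \<bullet> \<Phi> (fst z) \<partial>lebesgue_on (D \<times> {s..<t}))"
  by (simp_all add: time_int_def)

lemma slab_inner_integrable: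
  assumes D: "open D" and st: "s \<le> t" and f: "f \<in> L2 (D \<times> {s..<t::real})" and \<Phi>: "\<Phi> \<in> L2 D"
  shows "integrable (lebesgue_on (D \<times> {s..<t})) (\<lambda>z. f z \<bullet> \<Phi> (fst z))"
  by (rule L2_inner_integrable[OF f fst_L2(1)[OF D \<Phi> st]])

lemma time_int_diff:
  fixes f g :: "'a::euclidean_space \<times> real \<Rightarrow> 'b::euclidean_space"
  assumes D: "open D" and st: "s \<le> t" and f: "f \<in> L2 (D \<times> {s..<t})" "time_int D s t f F"
    and g: "g \<in> L2 (D \<times> {s..<t})" "time_int D s t g G"
  shows "time_int D s t (\<lambda>z. f z - g z) (\<lambda>x. F x - G x)"
  unfolding time_int_def
proof (intro conjI ballI)
  show "(\<lambda>x. F x - G x) \<in> L2 D" by (rule L2_diff[OF time_int_L2[OF f(2)] time_int_L2[OF g(2)]])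
  fix \<Phi> :: "'a \<Rightarrow> 'b" assume \<Phi>: "\<Phi> \<in> L2 D"
  show "(\<integral>x. (F x - G x) \<bullet> \<Phi> x \<partial>lebesgue_on D) = (\<integral>z. (f z - g z) \<bullet> \<Phi> (fst z) \<partial>lebesgue_on (D \<times> {s..<t}))"
    using L2_inner_integrable[OF time_int_L2[OF f(2)] \<Phi>] L2_inner_integrable[OF time_int_L2[OF g(2)] \<Phi>]
      slab_inner_integrable[OF D st f(1) \<Phi>] slab_inner_integrable[OF D st g(1) \<Phi>]
      time_int_eq[OF f(2) \<Phi>] time_int_eq[OF g(2) \<Phi>]
    by (simp add: inner_diff_left)
qed

lemma time_int_componentwise:
  fixes f :: "'a::euclidean_space \<times> real \<Rightarrow> 'b::euclidean_space"
  assumes D: "open D" and st: "s \<le> t" and f: "f \<in> L2 (D \<times> {s..<t})" and F: "F \<in> L2 D"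
    and c: "\<And>b. b \<in> Basis \<Longrightarrow> time_int D s t (\<lambda>z. f z \<bullet> b) (\<lambda>x. F x \<bullet> b)"
  shows "time_int D s t f F"
  unfolding time_int_def
proof (intro conjI ballI F)
  fix \<Phi> :: "'a \<Rightarrow> 'b" assume \<Phi>: "\<Phi> \<in> L2 D"
  have \<Phi>f: "(\<lambda>z. \<Phi> (fst z)) \<in> L2 (D \<times> {s..<t})" by (rule fst_L2(1)[OF D \<Phi> st])
  have "(\<integral>x. F x \<bullet> \<Phi> x \<partial>lebesgue_on D) = (\<integral>x. (\<Sum>b\<in>Basis. (F x \<bullet> b) * (\<Phi> x \<bullet> b)) \<partial>lebesgue_on D)"
    by (simp add: euclidean_inner[symmetric])
  also have "\<dots> = (\<Sum>b\<in>Basis. \<integral>x. (F x \<bullet> b) * (\<Phi> x \<bullet> b) \<partial>lebesgue_on D)"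
    by (rule Bochner_Integration.integral_sum) (rule L2_component_integrable[OF F \<Phi>])
  also have "\<dots> = (\<Sum>b\<in>Basis. \<integral>z. (f z \<bullet> b) * (\<Phi> (fst z) \<bullet> b) \<partial>lebesgue_on (D \<times> {s..<t}))"
    using time_int_eq[OF c L2_component[OF \<Phi>]] by (intro sum.cong) simp_all
  also have "\<dots> = (\<integral>z. (\<Sum>b\<in>Basis. (f z \<bullet> b) * (\<Phi> (fst z) \<bullet> b)) \<partial>lebesgue_on (D \<times> {s..<t}))"
    by (rule Bochner_Integration.integral_sum[symmetric]) (rule L2_component_integrable[OF f \<Phi>f])
  finally show "(\<integral>x. F x \<bullet> \<Phi> x \<partial>lebesgue_on D) = (\<integral>z. f z \<bullet> \<Phi> (fst z) \<partial>lebesgue_on (D \<times> {s..<t}))"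
    by (simp add: euclidean_inner[symmetric])
qed

lemma time_int_exists:
  fixes f :: "'a::euclidean_space \<times> real \<Rightarrow> 'b::euclidean_space"
  assumes D: "open D" and st: "s < t" and f: "f \<in> L2 (D \<times> {s..<t})"
  obtains F where "time_int D s t f F"
proof -
  have "\<exists>F. time_int D s t (\<lambda>z. f z \<bullet> b) F" for b
    using time_int_exists_real[OF D st L2_component[OF f]] by metis
  then obtain W where W: "\<And>b. time_int D s t (\<lambda>z. f z \<bullet> b) (W b)" by metis
  define F where "F x = (\<Sum>b\<in>Basis. W b x *\<^sub>R b)" for x
  have "(\<lambda>x. \<Sum>b\<in>Basis. W b x *\<^sub>R b) \<in> L2 D"
  proof (rule conjunct1[OF l2norm_sum])
    show "(\<lambda>x. W b x *\<^sub>R b) \<in> L2 D" for b :: 'b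
      by (rule l2norm_mult_vec_le(1)[OF time_int_L2[OF W], where c = "norm b"]) auto
  qed simp
  then have F: "F \<in> L2 D" by (simp add: F_def[abs_def])
  have "time_int D s t f F"
  proof (rule time_int_componentwise[OF D less_imp_le[OF st] f F])
    fix b :: 'b assume b: "b \<in> Basis"
    have "(\<lambda>x. F x \<bullet> b) = W b"
      using b by (auto simp: F_def inner_sum_left inner_Basis if_distrib[where f = "\<lambda>t. _ * t"] cong: if_cong)
    then show "time_int D s t (\<lambda>z. f z \<bullet> b) (\<lambda>x. F x \<bullet> b)" using W[of b] by simp
  qed
  then show thesis by (rule that)
qed

text \<open>Test the defining identity with \<open>F\<close> itself; extending \<open>F\<close>
  constantly in time is what brings in the factor \<open>sqrt (t - s)\<close>.\<close>

lemma time_int_norm: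
  assumes D: "open D" and st: "s \<le> t" and f: "f \<in> L2 (D \<times> {s..<t})" "time_int D s t f F"
  shows "l2norm D F \<le> sqrt (t - s) * l2norm (D \<times> {s..<t}) f"
proof (cases "l2norm D F = 0")
  case False
  then have pos: "l2norm D F > 0" by (simp add: less_le)
  have FL: "F \<in> L2 D" by (rule time_int_L2[OF f(2)])
  have "l2norm D F * l2norm D F = (\<integral>x. F x \<bullet> F x \<partial>lebesgue_on D)"
    using l2norm_sq[of D F] unfolding power2_norm_eq_inner by (simp add: power2_eq_square)
  also have "\<dots> = (\<integral>z. f z \<bullet> F (fst z) \<partial>lebesgue_on (D \<times> {s..<t}))" by (rule time_int_eq[OF f(2) FL])
  also have "\<dots> \<le> l2norm (D \<times> {s..<t}) f * l2norm (D \<times> {s..<t}) (\<lambda>z. F (fst z))"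
    using L2_inner_le[OF f(1) fst_L2(1)[OF D FL st]] by linarith
  also have "l2norm (D \<times> {s..<t}) (\<lambda>z. F (fst z)) = sqrt ((t - s) * (l2norm D F)\<^sup>2)"
    using fst_L2(2)[OF D FL st] by (simp add: real_sqrt_unique)
  also have "\<dots> = sqrt (t - s) * l2norm D F" by (simp add: real_sqrt_mult)
  finally have "l2norm D F * l2norm D F \<le> (sqrt (t - s) * l2norm (D \<times> {s..<t}) f) * l2norm D F" by (simp add: mult_ac)
  then show ?thesis using pos by (simp only: mult_le_cancel_right_pos)
qed (use st in simp)

text \<open>Testing with the negative part of \<open>F\<close> gives minus its squared norm on one
  side and a nonnegative number on the other.\<close>

lemma time_int_nonneg:
  fixes f :: "'a::euclidean_space \<times> real \<Rightarrow> real"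
  assumes D: "open D" and F: "time_int D s t f F" and f: "\<And>z. 0 \<le> f z"
  shows "AE x in lebesgue_on D. 0 \<le> F x"
proof -
  have FL: "F \<in> L2 D" by (rule time_int_L2[OF F])
  note [measurable] = L2_measurable[OF FL]
  define \<Phi> where "\<Phi> x = max 0 (- F x)" for x
  have \<Phi>: "\<Phi> \<in> L2 D"
  proof (rule L2_bound[OF FL])
    show "\<Phi> \<in> borel_measurable (lebesgue_on D)" unfolding \<Phi>_def by measurable
  qed (auto simp: \<Phi>_def)
  have "0 \<le> (\<integral>z. f z \<bullet> \<Phi> (fst z) \<partial>lebesgue_on (D \<times> {s..<t}))"
    by (intro integral_nonneg_AE AE_I2) (simp add: \<Phi>_def f)
  also have "\<dots> = (\<integral>x. F x \<bullet> \<Phi> x \<partial>lebesgue_on D)" by (rule time_int_eq[OF F \<Phi>, symmetric])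
  also have "\<dots> = (\<integral>x. - ((norm (\<Phi> x))\<^sup>2) \<partial>lebesgue_on D)"
    by (intro Bochner_Integration.integral_cong) (auto simp: \<Phi>_def max_def power2_eq_square)
  also have "\<dots> = - (l2norm D \<Phi>)\<^sup>2" by (simp add: l2norm_sq)
  finally have "l2norm D \<Phi> = 0" by simp
  from l2norm_eq_0[OF \<Phi> this] show ?thesis by eventually_elim (auto simp: \<Phi>_def max_def split: if_splits)
qed

text \<open>Fubini reduces the weak identity to time slices, where it holds for almost every time;
  the vector-valued test function \<open>\<phi> b\<close> picks out one component of the
  gradient.\<close>

lemma time_int_H1_gradient:
  fixes f :: "'a::euclidean_space \<times> real \<Rightarrow> real"
  assumes D: "open D" and st: "s \<le> t"
    and f: "f \<in> L2 (D \<times> {s..<t})" "time_int D s t f W" and G: "G \<in> L2 (D \<times> {s..<t})" "time_int D s t G GW"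
    and H: "AE \<tau> in lebesgue_on {s..t}. has_H1_gradient D (\<lambda>x. f (x, \<tau>)) (\<lambda>x. G (x, \<tau>))"
  shows "has_H1_gradient D W GW"
proof -
  have Dm: "D \<in> sets lebesgue" using D by simp
  have "(\<integral>x. W x * (grad \<phi> x \<bullet> b) \<partial>lebesgue_on D) = - (\<integral>x. (GW x \<bullet> b) * \<phi> x \<partial>lebesgue_on D)"
    if \<phi>: "\<phi> \<in> test_functions D" and b: "b \<in> Basis" for \<phi> b
  proof -
    have L: "\<phi> \<in> L2 D" "(\<lambda>x. grad \<phi> x \<bullet> b) \<in> L2 D" using test_function_L2[OF \<phi> Dm] L2_component by auto
    have pb: "(\<lambda>x. \<phi> x *\<^sub>R b) \<in> L2 D" by (rule l2norm_mult_vec_le(1)[OF L(1), where c = "norm b"]) auto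
    note i1 = slab_iterated_integral[OF D slab_inner_integrable[OF D st f(1) L(2)]]
    note i2 = slab_iterated_integral[OF D slab_inner_integrable[OF D st G(1) pb]]
    have "(\<integral>x. W x * (grad \<phi> x \<bullet> b) \<partial>lebesgue_on D) = (\<integral>\<tau>. (\<integral>x. f (x, \<tau>) * (grad \<phi> x \<bullet> b) \<partial>lebesgue_on D) \<partial>lebesgue_on {s..t})"
      using time_int_eq[OF f(2) L(2)] i1(2) by simp
    also have "\<dots> = (\<integral>\<tau>. - (\<integral>x. G (x, \<tau>) \<bullet> (\<phi> x *\<^sub>R b) \<partial>lebesgue_on D) \<partial>lebesgue_on {s..t})"
    proof (rule integral_cong_AE)
      show "(\<lambda>\<tau>. \<integral>x. f (x, \<tau>) * (grad \<phi> x \<bullet> b) \<partial>lebesgue_on D) \<in> borel_measurable (lebesgue_on {s..t})"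
        using borel_measurable_integrable[OF i1(1)] by simp
      show "(\<lambda>\<tau>. - (\<integral>x. G (x, \<tau>) \<bullet> (\<phi> x *\<^sub>R b) \<partial>lebesgue_on D)) \<in> borel_measurable (lebesgue_on {s..t})"
        using borel_measurable_integrable[OF i2(1)] by simp
      show "AE \<tau> in lebesgue_on {s..t}. (\<integral>x. f (x, \<tau>) * (grad \<phi> x \<bullet> b) \<partial>lebesgue_on D) = - (\<integral>x. G (x, \<tau>) \<bullet> (\<phi> x *\<^sub>R b) \<partial>lebesgue_on D)"
        using H
      proof eventually_elim
        case (elim \<tau>)
        then have "(\<integral>x. f (x, \<tau>) * (grad \<phi> x \<bullet> b) \<partial>lebesgue_on D) = - (\<integral>x. (G (x, \<tau>) \<bullet> b) * \<phi> x \<partial>lebesgue_on D)"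
          using \<phi> b interior_open[OF D] unfolding has_H1_gradient_def by auto
        then show ?case by (simp add: mult.commute)
      qed
    qed
    also have "\<dots> = - (\<integral>x. GW x \<bullet> (\<phi> x *\<^sub>R b) \<partial>lebesgue_on D)"
      using i2(2) time_int_eq[OF G(2) pb] by simp
    finally show ?thesis by (simp add: mult.commute)
  qed
  then show ?thesis
    using time_int_L2[OF f(2)] time_int_L2[OF G(2)] interior_open[OF D] by (auto simp: has_H1_gradient_def)
qed

text \<open>Testing with the error \<open>V\<close> itself reduces the claim to single time slices
  and so takes the place of Minkowski's integral inequality.\<close>

lemma time_int_average_close:
  fixes f :: "'a::euclidean_space \<times> real \<Rightarrow> real"
  assumes D: "open D" and st: "s < t" and f: "f \<in> L2 (D \<times> {s..<t})" "time_int D s t f W"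
    and sl: "\<And>r. r \<in> {s..t} \<Longrightarrow> (\<lambda>x. f (x, r)) \<in> L2 D"
    and g: "g \<in> L2 D"
    and e: "\<And>r. r \<in> {s..t} \<Longrightarrow> l2norm D (\<lambda>x. f (x, r) - g x) \<le> e"
  shows "l2norm D (\<lambda>x. W x / (t - s) - g x) \<le> e"
proof -
  define V where "V x = W x / (t - s) - g x" for x
  have WL: "(\<lambda>x. W x / (t - s)) \<in> L2 D"
    using L2_cmult[OF time_int_L2[OF f(2)], of "1 / (t - s)"] by simp
  have V: "V \<in> L2 D" unfolding V_def by (rule L2_diff[OF WL g])
  have e0: "e \<ge> 0" using order_trans[OF l2norm_nonneg e[of s]] st by simp
  note it = slab_iterated_integral[OF D slab_inner_integrable[OF D less_imp_le[OF st] f(1) V]]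
  have fin: "finite_measure (lebesgue_on {s..t})" by (intro finite_measure_lebesgue_on) simp
  let ?c = "(\<integral>x. g x * V x \<partial>lebesgue_on D) + e * l2norm D V"
  have "(\<integral>x. W x * V x \<partial>lebesgue_on D) = (\<integral>\<tau>. (\<integral>x. f (x, \<tau>) * V x \<partial>lebesgue_on D) \<partial>lebesgue_on {s..t})"
    using time_int_eq[OF f(2) V] it(2) by simp
  also have "\<dots> \<le> (\<integral>\<tau>. ?c \<partial>lebesgue_on {s..t})"
  proof (rule integral_mono)
    show "integrable (lebesgue_on {s..t}) (\<lambda>\<tau>. \<integral>x. f (x, \<tau>) * V x \<partial>lebesgue_on D)" using it(1) by simp
    show "integrable (lebesgue_on {s..t}) (\<lambda>\<tau>. ?c)" by (rule finite_measure.integrable_const[OF fin])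
    fix \<tau> assume "\<tau> \<in> space (lebesgue_on {s..t})"
    then have \<tau>: "\<tau> \<in> {s..t}" by simp
    have "(\<integral>x. f (x, \<tau>) * V x \<partial>lebesgue_on D) - (\<integral>x. g x * V x \<partial>lebesgue_on D) = (\<integral>x. (f (x, \<tau>) - g x) * V x \<partial>lebesgue_on D)"
      using L2_mult_integrable[OF sl[OF \<tau>] V] L2_mult_integrable[OF g V] by (simp add: left_diff_distrib)
    also have "\<dots> \<le> l2norm D (\<lambda>x. f (x, \<tau>) - g x) * l2norm D V"
      using L2_mult_le[OF L2_diff[OF sl[OF \<tau>] g] V] by linarith
    also have "\<dots> \<le> e * l2norm D V" by (intro mult_right_mono e \<tau>) simp
    finally show "(\<integral>x. f (x, \<tau>) * V x \<partial>lebesgue_on D) \<le> ?c" by simp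
  qed
  also have "\<dots> = (t - s) * ?c" using st by (simp add: measure_restrict_space)
  finally have "(\<integral>x. W x * V x \<partial>lebesgue_on D) \<le> (t - s) * ?c" .
  then have 1: "(\<integral>x. W x * V x \<partial>lebesgue_on D) / (t - s) \<le> ?c" using st by (simp add: pos_divide_le_eq mult.commute)
  have "l2norm D V * l2norm D V = (\<integral>x. V x * V x \<partial>lebesgue_on D)"
    using l2norm_sq[of D V] by (simp add: power2_eq_square)
  also have "\<dots> = (\<integral>x. (W x / (t - s)) * V x - g x * V x \<partial>lebesgue_on D)"
    by (intro Bochner_Integration.integral_cong) (auto simp: V_def left_diff_distrib)
  also have "\<dots> = (\<integral>x. (W x / (t - s)) * V x \<partial>lebesgue_on D) - (\<integral>x. g x * V x \<partial>lebesgue_on D)"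
    by (rule Bochner_Integration.integral_diff[OF L2_mult_integrable[OF WL V] L2_mult_integrable[OF g V]])
  also have "\<dots> \<le> e * l2norm D V" using 1 by simp
  finally have "l2norm D V * l2norm D V \<le> e * l2norm D V" .
  then show ?thesis unfolding V_def[symmetric, abs_def] using e0
    by (cases "l2norm D V = 0") (auto simp: less_le)
qed

text \<open>The sharp indicator in time does no harm: \<open>b\<close> depends on \<open>x\<close>
  alone and is a parametric integral with the indicator as density, hence smooth. Its gradient comes
  from the spatial component \<open>fst\<close> of the space-time gradient.\<close>

lemma slab_test_function_time_int:
  fixes \<phi> :: "'a::euclidean_space \<times> real \<Rightarrow> real"
  assumes D: "open D" and st: "s \<le> t" and \<phi>: "\<phi> \<in> test_functions (D \<times> UNIV)"
  defines "b \<equiv> \<lambda>x. \<integral>y. \<phi> (x, y) * indicator {s..<t} y \<partial>lebesgue"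
  shows "b \<in> test_functions D" "time_int D s t \<phi> b" "time_int D s t (\<lambda>z. fst (grad \<phi> z)) (grad b)"
proof -
  have Dm: "D \<in> sets lebesgue" using D by simp
  note Qm = slab_lebesgue[OF D, of s t]
  have ind: "integrable lebesgue (\<lambda>y. indicator {s..<t} y :: real)"
    using st by (subst integrable_completion) auto
  have gen: "(\<lambda>x. \<integral>y. \<psi> (x, y) * indicator {s..<t} y \<partial>lebesgue) \<in> test_functions D \<and>
      time_int D s t \<psi> (\<lambda>x. \<integral>y. \<psi> (x, y) * indicator {s..<t} y \<partial>lebesgue)" if \<psi>: "\<psi> \<in> test_functions (D \<times> UNIV)" for \<psi> :: "'a \<times> real \<Rightarrow> real"
  proof -
    let ?b = "\<lambda>x. \<integral>y. \<psi> (x, y) * indicator {s..<t} y \<partial>lebesgue"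
    have \<psi>U: "\<psi> \<in> test_functions UNIV" by (rule test_functions_mono[OF \<psi>]) simp
    obtain C where C: "compact C" "C \<subseteq> D \<times> UNIV" "\<And>z. z \<notin> C \<Longrightarrow> \<psi> z = 0" using test_functionsE[OF \<psi>] by metis
    have bt: "?b \<in> test_functions D"
    proof (rule test_functionsI[of _ "fst ` C"])
      show "smooth ?b" by (rule parametric_integral_test_function(1)[OF \<psi>U ind])
      show "compact (fst ` C)" by (intro compact_continuous_image continuous_intros C)
      show "fst ` C \<subseteq> D" using C(2) by auto
      show "?b x = 0" if "x \<notin> fst ` C" for x
      proof -
        have "\<psi> (x, y) = 0" for y using that by (intro C(3)) force
        then show ?thesis by simp
      qed
    qed
    moreover have "time_int D s t \<psi> ?b"
      unfolding time_int_def
    proof (intro conjI ballI)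
      show "?b \<in> L2 D" by (rule test_function_L2(1)[OF bt Dm])
      fix \<Phi> :: "'a \<Rightarrow> real" assume \<Phi>: "\<Phi> \<in> L2 D"
      have \<psi>L: "\<psi> \<in> L2 (D \<times> {s..<t})" by (rule test_function_L2(1)[OF \<psi> Qm])
      let ?H = "\<lambda>z. indicator (D \<times> {s..<t}) z *\<^sub>R (\<psi> z \<bullet> \<Phi> (fst z))"
      have H: "integrable lebesgue ?H"
        using slab_inner_integrable[OF D st \<psi>L \<Phi>] Qm by (simp add: integrable_restrict_space)
      have "(\<integral>y. ?H (x, y) \<partial>lebesgue) = indicator D x *\<^sub>R (?b x \<bullet> \<Phi> x)" for x
      proof -
        have "?H (x, y) = (indicator D x * \<Phi> x) * (\<psi> (x, y) * indicator {s..<t} y)" for y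
          by (simp add: indicator_times)
        then have "(\<integral>y. ?H (x, y) \<partial>lebesgue) = (\<integral>y. (indicator D x * \<Phi> x) * (\<psi> (x, y) * indicator {s..<t} y) \<partial>lebesgue)"
          by (simp only:)
        also have "\<dots> = (indicator D x * \<Phi> x) * ?b x" by (simp only: integral_mult_right_zero)
        finally show ?thesis by (simp add: mult_ac)
      qed
      then show "(\<integral>x. ?b x \<bullet> \<Phi> x \<partial>lebesgue_on D) = (\<integral>z. \<psi> z \<bullet> \<Phi> (fst z) \<partial>lebesgue_on (D \<times> {s..<t}))"
        using fubini_lebesgue(3)[OF H] Qm Dm by (simp add: integral_restrict_space)
    qed
    ultimately show ?thesis by blast
  qed
  show bt: "b \<in> test_functions D" and "time_int D s t \<phi> b" using gen[OF \<phi>] by (auto simp: b_def)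
  have \<phi>U: "\<phi> \<in> test_functions UNIV" by (rule test_functions_mono[OF \<phi>]) simp
  show "time_int D s t (\<lambda>z. fst (grad \<phi> z)) (grad b)"
  proof (rule time_int_componentwise[OF D st])
    have gL: "grad \<phi> \<in> L2 (D \<times> {s..<t})" by (rule test_function_L2(2)[OF \<phi> Qm])
    have gc: "continuous_on UNIV (grad \<phi>)" by (rule smooth_grad_continuous[OF test_functions_smooth[OF \<phi>]])
    show "(\<lambda>z. fst (grad \<phi> z)) \<in> L2 (D \<times> {s..<t})"
    proof (rule L2_bound[OF gL])
      show "(\<lambda>z. fst (grad \<phi> z)) \<in> borel_measurable (lebesgue_on (D \<times> {s..<t}))"
        by (rule continuous_measurable_on[OF continuous_on_fst[OF gc] Qm])
      show "AE z in lebesgue_on (D \<times> {s..<t}). norm (fst (grad \<phi> z)) \<le> norm (grad \<phi> z)"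
        by (intro AE_I2) (metis norm_fst_le prod.collapse)
    qed
    show "grad b \<in> L2 D" by (rule test_function_L2(2)[OF bt Dm])
    fix c :: 'a assume c: "c \<in> Basis"
    have c0: "(c, 0::real) \<in> Basis" using c by (auto simp: Basis_prod_def)
    have "(\<lambda>z. fst (grad \<phi> z) \<bullet> c) = (\<lambda>z. grad \<phi> z \<bullet> (c, 0))" by (simp add: inner_prod_def)
    moreover have "(\<lambda>x. grad b x \<bullet> c) = (\<lambda>x. \<integral>y. (grad \<phi> (x, y) \<bullet> (c, 0)) * indicator {s..<t} y \<partial>lebesgue)"
      unfolding b_def by (rule ext) (rule parametric_integral_test_function(2)[OF \<phi>U ind c])
    ultimately show "time_int D s t (\<lambda>z. fst (grad \<phi> z) \<bullet> c) (\<lambda>x. grad b x \<bullet> c)"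
      using gen[OF grad_test_function_inner[OF \<phi> c0]] by simp
  qed
qed

text \<open>For positive \<open>y\<close> this is \<open>y * exp (- s / y)\<close>, a smooth
  positive part. It stays within \<open>s\<close> of \<open>max y 0\<close>, and its slope is at
  most 1 in modulus, so composing with it does not increase gradients.\<close>

definition smooth_pos :: "real \<Rightarrow> real \<Rightarrow> real" where
  "smooth_pos s y = y * flat_exp (y / s)"

lemma smooth_pos_properties:
  assumes s: "s > 0"
  shows "smooth (smooth_pos s)" "0 \<le> smooth_pos s y" "\<bar>smooth_pos s y - max y 0\<bar> \<le> s" "smooth_pos s 0 = 0"
    "\<exists>d. (smooth_pos s has_real_derivative d) (at y) \<and> \<bar>d\<bar> \<le> 1"
proof -
  have "smooth (\<lambda>y::real. (1 / s) * y)" by (rule smooth_mult[OF smooth_const smooth_id])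
  from smooth_mult[OF smooth_id smooth_compose[OF smooth_flat_exp this]]
  show "smooth (smooth_pos s)" by (simp add: smooth_pos_def[abs_def])
  show "smooth_pos s 0 = 0" by (simp add: smooth_pos_def)
  have "0 \<le> smooth_pos s y \<and> \<bar>smooth_pos s y - max y 0\<bar> \<le> s"
  proof (cases "y > 0")
    case True
    have e: "flat_exp (y / s) = exp (- (s / y))" using True s by (simp add: flat_exp_def)
    have "1 + (- (s / y)) \<le> exp (- (s / y))" by (rule exp_ge_add_one_self)
    then have "y * (1 + (- (s / y))) \<le> y * exp (- (s / y))" using True by (intro mult_left_mono) auto
    moreover have "y * (1 + (- (s / y))) = y - s" using True by (simp add: field_simps)
    moreover have "y * exp (- (s / y)) \<le> y * 1" using True s by (intro mult_left_mono) auto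
    ultimately have "y * exp (- (s / y)) \<le> y" "y - y * exp (- (s / y)) \<le> s" by linarith+
    then show ?thesis using True s by (auto simp: smooth_pos_def e)
  next
    case False
    then have "flat_exp (y / s) = 0" using s by (intro flat_exp_zero) (simp add: divide_le_0_iff)
    then show ?thesis using False s by (simp add: smooth_pos_def)
  qed
  then show "0 \<le> smooth_pos s y" "\<bar>smooth_pos s y - max y 0\<bar> \<le> s" by auto
  define D where "D = (if 0 < y / s then poly ((1 - pderiv 1) * [:0, 0, 1:]) (1 / (y / s)) * exp (- 1 / (y / s)) else 0)"
  have D_pos: "D = (s / y)\<^sup>2 * exp (- (s / y))" if "y > 0"
    using that s by (simp add: D_def power2_eq_square)
  have "(\<lambda>x. if 0 < x then poly 1 (1 / x) * exp (- 1 / x) else 0) = flat_exp" by (simp add: fun_eq_iff flat_exp_def)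
  then have "(flat_exp has_real_derivative D) (at (y / s))"
    using poly_flat_exp_deriv[of 1 "y / s"] unfolding D_def by metis
  then have "((\<lambda>y. flat_exp (y / s)) has_real_derivative D * (1 / s)) (at y)"
    by (rule DERIV_chain2) (use s in \<open>auto intro!: derivative_eq_intros\<close>)
  then have "((\<lambda>y. y * flat_exp (y / s)) has_real_derivative 1 * flat_exp (y / s) + D * (1 / s) * y) (at y)"
    by (rule DERIV_mult[OF DERIV_ident])
  moreover have "\<bar>1 * flat_exp (y / s) + D * (1 / s) * y\<bar> \<le> 1"
  proof (cases "y > 0")
    case True
    \<comment> \<open>The derivative at positive \<open>y\<close> is
      \<open>exp (- x) * (1 + x)\<close> with \<open>x = s / y\<close>, so this inequality is
      exactly the bound by 1.\<close>
    have "1 + s / y \<le> exp (s / y)" by (rule exp_ge_add_one_self)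
    then have "exp (- (s / y)) * (1 + s / y) \<le> exp (- (s / y)) * exp (s / y)" by (intro mult_left_mono) auto
    then have "exp (- (s / y)) * (1 + s / y) \<le> 1" by (simp add: exp_minus)
    moreover have "1 * flat_exp (y / s) + D * (1 / s) * y = exp (- (s / y)) * (1 + s / y)"
      using True s by (simp add: flat_exp_def D_pos power2_eq_square field_simps)
    moreover have "0 \<le> exp (- (s / y)) * (1 + s / y)" using True s by simp
    ultimately show ?thesis by simp
  next
    case False
    then have "y / s \<le> 0" using s by (simp add: divide_le_0_iff)
    then show ?thesis by (simp add: flat_exp_zero D_def)
  qed
  ultimately show "\<exists>d. (smooth_pos s has_real_derivative d) (at y) \<and> \<bar>d\<bar> \<le> 1"
    unfolding smooth_pos_def[abs_def] by blast
qed

text \<open>\<Lambda> is the Laplacian of \<psi>. It lets pairings with \<nabla>\<psi> be estimated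
  through the \<open>L2\<close> distance of the functions instead of their gradients.\<close>

lemma integral_grad_grad:
  fixes f \<psi> :: "'a::euclidean_space \<Rightarrow> real"
  assumes D: "open D" and \<psi>: "\<psi> \<in> test_functions D"
  obtains \<Lambda> where "\<Lambda> \<in> L2 D"
    "\<And>f. f \<in> test_functions D \<Longrightarrow> (\<integral>x. grad f x \<bullet> grad \<psi> x \<partial>lebesgue_on D) = - (\<integral>x. f x * \<Lambda> x \<partial>lebesgue_on D)"
proof
  have Dm: "D \<in> sets lebesgue" using D by simp
  let ?t = "\<lambda>b x. grad (\<lambda>x. grad \<psi> x \<bullet> b) x \<bullet> b"
  have t: "?t b \<in> test_functions D" if "b \<in> Basis" for b
    by (intro grad_test_function_inner \<psi> that)
  have tL: "?t b \<in> L2 D" if "b \<in> Basis" for b by (rule test_function_L2(1)[OF t[OF that] Dm])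
  show "(\<lambda>x. \<Sum>b\<in>Basis. ?t b x) \<in> L2 D" using l2norm_sum[OF finite_Basis, of ?t D] tL by blast
  fix f assume f: "f \<in> test_functions D"
  note fL = test_function_L2[OF f Dm]
  have "(\<integral>x. grad f x \<bullet> grad \<psi> x \<partial>lebesgue_on D) = (\<integral>x. (\<Sum>b\<in>Basis. (grad f x \<bullet> b) * (grad \<psi> x \<bullet> b)) \<partial>lebesgue_on D)"
    by (simp add: euclidean_inner[symmetric])
  also have "\<dots> = (\<Sum>b\<in>Basis. \<integral>x. (grad f x \<bullet> b) * (grad \<psi> x \<bullet> b) \<partial>lebesgue_on D)"
    by (rule Bochner_Integration.integral_sum) (rule L2_component_integrable[OF fL(2) test_function_L2(2)[OF \<psi> Dm]])
  also have "\<dots> = (\<Sum>b\<in>Basis. - (\<integral>x. f x * ?t b x \<partial>lebesgue_on D))"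
  proof (rule sum.cong[OF refl])
    fix b :: 'a assume b: "b \<in> Basis"
    show "(\<integral>x. (grad f x \<bullet> b) * (grad \<psi> x \<bullet> b) \<partial>lebesgue_on D) = - (\<integral>x. f x * ?t b x \<partial>lebesgue_on D)"
      using smooth_integration_by_parts[OF Dm grad_test_function_inner[OF \<psi> b] test_functions_smooth[OF f] b] by linarith
  qed
  also have "\<dots> = - (\<integral>x. (\<Sum>b\<in>Basis. f x * ?t b x) \<partial>lebesgue_on D)"
    using Bochner_Integration.integral_sum[of Basis "lebesgue_on D" "\<lambda>b x. f x * ?t b x"] L2_mult_integrable[OF fL(1) tL]
    by (simp add: sum_negf)
  finally show "(\<integral>x. grad f x \<bullet> grad \<psi> x \<partial>lebesgue_on D) = - (\<integral>x. f x * (\<Sum>b\<in>Basis. ?t b x) \<partial>lebesgue_on D)"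
    by (simp add: sum_distrib_left)
qed

text \<open>The approximants may change sign, so \<open>b\<close> is replaced by its smoothed
  positive part \<open>f\<close>. The gradient norm of \<open>f\<close> is at most that of
  \<open>b\<close>, which is close to that of \<open>GP\<close>; and \<nabla>f is weakly close to
  \<open>GP\<close>, which is seen by pairing with \<nabla>\<psi> for one fixed good approximant
  \<psi>. Norm bound and weak closeness give strong closeness by expanding the square of
  \<open>V\<close>. This bypasses strong continuity of the positive part in
  \<open>H^1\<close>.\<close>

lemma pos_H10_if_test_limit:
  fixes D :: "'a::euclidean_space set"
  assumes D: "open D" and P: "P \<in> L2 D" "GP \<in> L2 D" and P0: "AE x in lebesgue_on D. 0 \<le> P x"
    and lim: "\<And>\<epsilon>. \<epsilon> > 0 \<Longrightarrow> \<exists>b\<in>test_functions D. l2norm D (\<lambda>x. b x - P x) < \<epsilon> \<and> l2norm D (\<lambda>x. grad b x - GP x) < \<epsilon>"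
  shows "pos_H10 D P GP"
  unfolding pos_H10_def
proof (intro conjI allI impI P)
  fix \<epsilon> :: real assume \<epsilon>: "\<epsilon> > 0"
  have Dm: "D \<in> sets lebesgue" using D by simp
  define K where "K = 2 * l2norm D GP + 1"
  have K: "K > 0" unfolding K_def by (simp add: add_nonneg_pos)
  \<comment> \<open>\<psi> is fixed with accuracy \<delta> before \<open>b\<close>, because the
    tolerance \<open>t\<close> for \<open>b\<close> depends on \<psi> and \<Lambda>. In the squared
    norm of \<open>V\<close>, \<delta> accounts for \<epsilon>^2 / 2 and \<open>t\<close> for
    \<epsilon>^2 / 4.\<close>
  define \<delta> where "\<delta> = \<epsilon>\<^sup>2 / (4 * K)"
  have \<delta>: "\<delta> > 0" using \<epsilon> K by (simp add: \<delta>_def)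
  obtain \<psi> where \<psi>: "\<psi> \<in> test_functions D" "l2norm D (\<lambda>x. grad \<psi> x - GP x) < \<delta>" using lim[OF \<delta>] by blast
  obtain \<Lambda> where \<Lambda>: "\<Lambda> \<in> L2 D"
    "\<And>f. f \<in> test_functions D \<Longrightarrow> (\<integral>x. grad f x \<bullet> grad \<psi> x \<partial>lebesgue_on D) = - (\<integral>x. f x * \<Lambda> x \<partial>lebesgue_on D)"
    using integral_grad_grad[OF D \<psi>(1)] by metis
  note \<psi>L = test_function_L2[OF \<psi>(1) Dm]
  define M where "M = K + 6 * l2norm D \<Lambda> + 2 * l2norm D (grad \<psi>)"
  have M: "M > 0" unfolding M_def using K by (intro add_pos_nonneg) auto
  define t where "t = Min {1, \<epsilon> / 2, \<epsilon>\<^sup>2 / (4 * M)}"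
  have t: "t > 0" "t \<le> 1" "t \<le> \<epsilon> / 2" "t \<le> \<epsilon>\<^sup>2 / (4 * M)" using \<epsilon> M by (auto simp: t_def)
  obtain b where b: "b \<in> test_functions D" "l2norm D (\<lambda>x. b x - P x) < t" "l2norm D (\<lambda>x. grad b x - GP x) < t"
    using lim[OF t(1)] by blast
  note bL = test_function_L2[OF b(1) Dm]
  obtain C where C: "compact C" "C \<subseteq> D" "\<And>x. x \<notin> C \<Longrightarrow> b x = 0" using test_functionsE[OF b(1)] by metis
  obtain R where R: "R > 0" "\<And>x. x \<in> C \<Longrightarrow> norm x \<le> R"
    using compact_imp_bounded[OF C(1)] bounded_pos by metis
  have cL: "cutoff R \<in> L2 D" by (rule test_function_L2(1)[OF cutoff_test_function[OF R(1)] Dm])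
  \<comment> \<open>The smoothing error is at most \<open>s\<close> on the support of
    \<open>b\<close> and 0 elsewhere, so \<open>s\<close> times the norm of a cutoff equal to 1 on
    that support bounds it.\<close>
  define s where "s = t / (l2norm D (cutoff R) + 1)"
  have cn: "l2norm D (cutoff R) + 1 > 0" by (simp add: add_nonneg_pos)
  have s: "s > 0" using t(1) cn by (simp add: s_def)
  have "s * (l2norm D (cutoff R) + 1) = t" using cn by (simp add: s_def)
  then have st: "s * l2norm D (cutoff R) \<le> t" using s by (simp add: distrib_left)
  note sp = smooth_pos_properties[OF s]
  define f where "f x = smooth_pos s (b x)" for x
  have f: "f \<in> test_functions D"
  proof (rule test_functionsI[OF _ C(1,2)])
    show "smooth f" unfolding f_def[abs_def] by (rule smooth_compose[OF sp(1) test_functions_smooth[OF b(1)]])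
    show "f x = 0" if "x \<notin> C" for x using C(3)[OF that] sp(4) by (simp add: f_def)
  qed
  note fL = test_function_L2[OF f Dm]
  have fg: "norm (grad f x) \<le> norm (grad b x)" for x
  proof -
    obtain d where d: "(smooth_pos s has_real_derivative d) (at (b x))" "\<bar>d\<bar> \<le> 1" using sp(5) by blast
    have "grad f x = d *\<^sub>R grad b x"
      unfolding f_def[abs_def] by (rule grad_compose[OF test_functions_smooth[OF b(1)] d(1)])
    then show ?thesis using d(2) by (simp add: mult_left_le_one_le)
  qed
  have mx: "(\<lambda>x. max (b x) 0) \<in> L2 D" by (rule L2_bound[OF bL(1)]) (use L2_measurable[OF bL(1)] in auto)
  have m1: "l2norm D (\<lambda>x. max (b x) 0 - P x) \<le> l2norm D (\<lambda>x. b x - P x)"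
  proof (rule l2norm_mono)
    show "(\<lambda>x. b x - P x) \<in> L2 D" by (rule L2_diff[OF bL(1) P(1)])
    show "(\<lambda>x. max (b x) 0 - P x) \<in> borel_measurable (lebesgue_on D)" by (rule L2_measurable[OF L2_diff[OF mx P(1)]])
    show "AE x in lebesgue_on D. norm (max (b x) 0 - P x) \<le> norm (b x - P x)" using P0 by eventually_elim auto
  qed
  have m2: "l2norm D (\<lambda>x. f x - max (b x) 0) \<le> l2norm D (\<lambda>x. s *\<^sub>R cutoff R x)"
  proof (rule l2norm_mono)
    show "(\<lambda>x. s *\<^sub>R cutoff R x) \<in> L2 D" by (rule L2_scaleR[OF cL])
    show "(\<lambda>x. f x - max (b x) 0) \<in> borel_measurable (lebesgue_on D)" by (rule L2_measurable[OF L2_diff[OF fL(1) mx]])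
    show "AE x in lebesgue_on D. norm (f x - max (b x) 0) \<le> norm (s *\<^sub>R cutoff R x)"
    proof (intro AE_I2)
      fix x show "norm (f x - max (b x) 0) \<le> norm (s *\<^sub>R cutoff R x)"
        using sp(3)[of "b x"] sp(4) s C(3)[of x] cutoff_eq_1[OF R(1) R(2)[of x]] by (cases "x \<in> C") (auto simp: f_def)
    qed
  qed
  have fP: "l2norm D (\<lambda>x. f x - P x) < 2 * t"
    using l2norm_triangle_diff[OF fL(1) mx P(1)] m1 m2 b(2) st s by (simp add: l2norm_scaleR del: real_scaleR_def)
  have fb: "l2norm D (\<lambda>x. f x - b x) \<le> 3 * t"
    using l2norm_triangle_diff[OF fL(1) P(1) bL(1)] fP b(2) l2norm_minus_commute[of D P b] by simp
  define V where "V x = grad f x - GP x" for x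
  have V: "V \<in> L2 D" unfolding V_def by (rule L2_diff[OF fL(2) P(2)])
  have gf: "l2norm D (grad f) \<le> l2norm D (grad b)"
    by (rule l2norm_mono[OF bL(2) L2_measurable[OF fL(2)]]) (simp add: fg)
  have gb: "l2norm D (grad b) \<le> l2norm D GP + t" using l2norm_le_diff[OF bL(2) P(2)] b(3) by simp
  have VK: "l2norm D V \<le> K" unfolding V_def K_def using l2norm_triangle_minus[OF fL(2) P(2)] gf gb t by simp
  have e1: "(\<integral>x. V x \<bullet> grad \<psi> x \<partial>lebesgue_on D) = - (\<integral>x. (f x - b x) * \<Lambda> x \<partial>lebesgue_on D) + (\<integral>x. (grad b x - GP x) \<bullet> grad \<psi> x \<partial>lebesgue_on D)"
    using L2_inner_integrable[OF fL(2) \<psi>L(2)] L2_inner_integrable[OF bL(2) \<psi>L(2)] L2_inner_integrable[OF P(2) \<psi>L(2)]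
      L2_mult_integrable[OF fL(1) \<Lambda>(1)] L2_mult_integrable[OF bL(1) \<Lambda>(1)] \<Lambda>(2)[OF f] \<Lambda>(2)[OF b(1)]
    by (simp add: V_def inner_diff_left left_diff_distrib)
  have "\<bar>\<integral>x. (f x - b x) * \<Lambda> x \<partial>lebesgue_on D\<bar> \<le> 3 * t * l2norm D \<Lambda>"
    using L2_mult_le[OF L2_diff[OF fL(1) bL(1)] \<Lambda>(1)] mult_right_mono[OF fb l2norm_nonneg[of D \<Lambda>]] by linarith
  moreover have "\<bar>\<integral>x. (grad b x - GP x) \<bullet> grad \<psi> x \<partial>lebesgue_on D\<bar> \<le> t * l2norm D (grad \<psi>)"
    using L2_inner_le[OF L2_diff[OF bL(2) P(2)] \<psi>L(2)] mult_right_mono[OF less_imp_le[OF b(3)] l2norm_nonneg[of D "grad \<psi>"]] by linarith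
  moreover have "\<bar>\<integral>x. V x \<bullet> (grad \<psi> x - GP x) \<partial>lebesgue_on D\<bar> \<le> K * \<delta>"
    using L2_inner_le[OF V L2_diff[OF \<psi>L(2) P(2)]] mult_mono[OF VK less_imp_le[OF \<psi>(2)] less_imp_le[OF K] l2norm_nonneg] by linarith
  moreover have "(\<integral>x. V x \<bullet> (grad \<psi> x - GP x) \<partial>lebesgue_on D) = (\<integral>x. V x \<bullet> grad \<psi> x \<partial>lebesgue_on D) - (\<integral>x. V x \<bullet> GP x \<partial>lebesgue_on D)"
    using L2_inner_integrable[OF V \<psi>L(2)] L2_inner_integrable[OF V P(2)] by (simp add: inner_diff_right)
  ultimately have VG: "- (\<integral>x. V x \<bullet> GP x \<partial>lebesgue_on D) \<le> 3 * t * l2norm D \<Lambda> + t * l2norm D (grad \<psi>) + K * \<delta>"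
    using e1 by linarith
  have "(norm (V x))\<^sup>2 = (norm (grad f x))\<^sup>2 - (norm (GP x))\<^sup>2 - 2 * (V x \<bullet> GP x)" for x
    by (simp add: V_def power2_norm_eq_inner inner_diff_left inner_diff_right inner_commute)
  then have "(l2norm D V)\<^sup>2 = (l2norm D (grad f))\<^sup>2 - (l2norm D GP)\<^sup>2 - 2 * (\<integral>x. V x \<bullet> GP x \<partial>lebesgue_on D)"
    unfolding l2norm_sq using L2_integrable_sq[OF fL(2)] L2_integrable_sq[OF P(2)] L2_inner_integrable[OF V P(2)] by simp
  moreover have "(l2norm D (grad f))\<^sup>2 - (l2norm D GP)\<^sup>2 \<le> t * K"
  proof -
    have "(l2norm D (grad f))\<^sup>2 \<le> (l2norm D GP + t)\<^sup>2" using gf gb by (intro power_mono) auto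
    also have "\<dots> = (l2norm D GP)\<^sup>2 + t * (2 * l2norm D GP + t)" by (simp add: power2_eq_square algebra_simps)
    also have "\<dots> \<le> (l2norm D GP)\<^sup>2 + t * K" unfolding K_def using t by (intro add_left_mono mult_left_mono) auto
    finally show ?thesis by simp
  qed
  ultimately have "(l2norm D V)\<^sup>2 \<le> t * M + 2 * K * \<delta>" using VG by (simp add: M_def algebra_simps)
  also have "\<dots> \<le> \<epsilon>\<^sup>2 / 4 + \<epsilon>\<^sup>2 / 2"
  proof (rule add_mono)
    show "t * M \<le> \<epsilon>\<^sup>2 / 4" using t(4) M by (simp add: pos_le_divide_eq mult_ac)
    show "2 * K * \<delta> \<le> \<epsilon>\<^sup>2 / 2" using K by (simp add: \<delta>_def)
  qed
  also have "\<dots> < \<epsilon>\<^sup>2" using \<epsilon> by (simp add: field_simps)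
  finally have "l2norm D V < \<epsilon>" using \<epsilon> by (simp add: power_less_imp_less_base)
  moreover have "f \<in> pos_tests D" using f sp(2) by (simp add: pos_tests_def f_def)
  ultimately show "\<exists>b\<in>pos_tests D. l2norm D (\<lambda>x. b x - P x) < \<epsilon> \<and> l2norm D (\<lambda>x. grad b x - GP x) < \<epsilon>"
    using fP t(3) unfolding V_def by (intro bexI[of _ f] conjI) auto
qed

text \<open>Integration in time turns space-time test functions into test functions on
  \<open>D\<close>, and \<open>time_int_norm\<close> converts slab errors into errors on
  \<open>D\<close>; this is the origin of the division by \<open>sqrt (t - s)\<close>.\<close>

lemma time_int_pos_H10:
  fixes p :: "'a::euclidean_space \<times> real \<Rightarrow> real"
  assumes D: "open D" and st: "s < t"
    and p: "p \<in> L2 (D \<times> {s..<t})" "time_int D s t p P" "\<And>z. 0 \<le> p z"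
    and g: "g \<in> L2 (D \<times> {s..<t})" "time_int D s t g GP"
    and approx: "\<And>\<epsilon>. \<epsilon> > 0 \<Longrightarrow> \<exists>\<phi>\<in>test_functions (D \<times> UNIV).
      l2norm (D \<times> {s..<t}) (\<lambda>z. \<phi> z - p z) < \<epsilon> \<and> l2norm (D \<times> {s..<t}) (\<lambda>z. fst (grad \<phi> z) - g z) < \<epsilon>"
  shows "pos_H10 D P GP"
proof (rule pos_H10_if_test_limit[OF D time_int_L2[OF p(2)] time_int_L2[OF g(2)] time_int_nonneg[OF D p(2,3)]])
  fix \<epsilon> :: real assume \<epsilon>: "\<epsilon> > 0"
  note Qm = slab_lebesgue[OF D, of s t]
  have q: "sqrt (t - s) > 0" using st by simp
  obtain \<phi> where \<phi>: "\<phi> \<in> test_functions (D \<times> UNIV)" "l2norm (D \<times> {s..<t}) (\<lambda>z. \<phi> z - p z) < \<epsilon> / sqrt (t - s)"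
    "l2norm (D \<times> {s..<t}) (\<lambda>z. fst (grad \<phi> z) - g z) < \<epsilon> / sqrt (t - s)"
    using approx[of "\<epsilon> / sqrt (t - s)"] \<epsilon> q by auto
  note b = slab_test_function_time_int[OF D less_imp_le[OF st] \<phi>(1)]
  let ?b = "\<lambda>x. \<integral>y. \<phi> (x, y) * indicator {s..<t} y \<partial>lebesgue"
  have fL: "\<phi> \<in> L2 (D \<times> {s..<t})" by (rule test_function_L2(1)[OF \<phi>(1) Qm])
  have gL: "(\<lambda>z. fst (grad \<phi> z)) \<in> L2 (D \<times> {s..<t})"
  proof (rule L2_bound[OF test_function_L2(2)[OF \<phi>(1) Qm]])
    show "(\<lambda>z. fst (grad \<phi> z)) \<in> borel_measurable (lebesgue_on (D \<times> {s..<t}))"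
      by (rule continuous_measurable_on[OF continuous_on_fst[OF smooth_grad_continuous[OF test_functions_smooth[OF \<phi>(1)]]] Qm])
    show "AE z in lebesgue_on (D \<times> {s..<t}). norm (fst (grad \<phi> z)) \<le> norm (grad \<phi> z)"
      by (intro AE_I2) (metis norm_fst_le prod.collapse)
  qed
  have "l2norm D (\<lambda>x. ?b x - P x) \<le> sqrt (t - s) * l2norm (D \<times> {s..<t}) (\<lambda>z. \<phi> z - p z)"
    by (rule time_int_norm[OF D less_imp_le[OF st] L2_diff[OF fL p(1)] time_int_diff[OF D less_imp_le[OF st] fL b(2) p(1,2)]])
  also have "\<dots> < \<epsilon>" using \<phi>(2) q by (simp add: pos_less_divide_eq mult.commute)
  finally have 1: "l2norm D (\<lambda>x. ?b x - P x) < \<epsilon>" .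
  have "l2norm D (\<lambda>x. grad ?b x - GP x) \<le> sqrt (t - s) * l2norm (D \<times> {s..<t}) (\<lambda>z. fst (grad \<phi> z) - g z)"
    by (rule time_int_norm[OF D less_imp_le[OF st] L2_diff[OF gL g(1)] time_int_diff[OF D less_imp_le[OF st] gL b(3) g(1,2)]])
  also have "\<dots> < \<epsilon>" using \<phi>(3) q by (simp add: pos_less_divide_eq mult.commute)
  finally show "\<exists>b\<in>test_functions D. l2norm D (\<lambda>x. b x - P x) < \<epsilon> \<and> l2norm D (\<lambda>x. grad b x - GP x) < \<epsilon>"
    using 1 b(1) by (intro bexI[of _ ?b] conjI)
qed

text \<open>A test function \<open>\<phi>\<close> supported in positive times satisfies
  \<open>\<integral>\<^sub>0\<^sup>\<tau> \<phi>(x,t) dt = \<integral>\<^sub>0\<^sup>\<tau> (\<tau> - t) \<partial>\<^sub>t\<phi>(x,t) dt\<close>, and the weight \<open>\<tau> - t\<close> gains a factor \<open>\<tau>\<close>.\<close>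

lemma time_int_integration_by_parts:
  fixes \<phi> :: "'a::euclidean_space \<times> real \<Rightarrow> real"
  assumes \<phi>: "\<phi> \<in> test_functions (D \<times> {0<..})" and \<tau>: "\<tau> > 0"
  shows "(\<integral>y. (\<tau> - y) * (grad \<phi> (x, y) \<bullet> (0, 1)) * indicator {0..<\<tau>} y \<partial>lebesgue) = (\<integral>y. \<phi> (x, y) * indicator {0..<\<tau>} y \<partial>lebesgue)"
proof -
  have sm: "smooth \<phi>" by (rule test_functions_smooth[OF \<phi>])
  have der: "((\<lambda>y. \<phi> (x, y)) has_real_derivative (grad \<phi> (x, y) \<bullet> (0, 1))) (at y)" for y
  proof -
    have "((\<lambda>y. (x, y)) has_derivative (\<lambda>h. (0, h))) (at y)" by (auto intro!: derivative_eq_intros)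
    from has_derivative_compose[OF this grad_has_derivative[OF smooth_differentiable[OF sm]]]
    have "((\<lambda>y. \<phi> (x, y)) has_derivative (\<lambda>h. grad \<phi> (x, y) \<bullet> (0, h))) (at y)" .
    then show ?thesis by (simp add: has_field_derivative_def inner_prod_def)
  qed
  have pc: "continuous_on UNIV (\<lambda>y. (x, y))" by (intro continuous_intros)
  have c1: "continuous_on UNIV (\<lambda>y. \<phi> (x, y))"
    by (rule continuous_on_compose2[OF smooth_continuous[OF sm] pc]) simp
  have c2: "continuous_on UNIV (\<lambda>y. grad \<phi> (x, y))"
    by (rule continuous_on_compose2[OF smooth_grad_continuous[OF sm] pc]) simp
  have c3: "continuous_on UNIV (\<lambda>y. (\<tau> - y) * (grad \<phi> (x, y) \<bullet> (0, 1)))" by (intro continuous_intros c2)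
  have tr: "(\<integral>y. f y * indicator {0..<\<tau>} y \<partial>lebesgue) = (\<integral>y. indicator {0..\<tau>} y *\<^sub>R f y \<partial>lborel)"
    if f: "continuous_on UNIV f" for f :: "real \<Rightarrow> real"
  proof -
    have fb[measurable]: "f \<in> borel_measurable borel" by (rule borel_measurable_continuous_onI[OF f])
    have "(\<integral>y. f y * indicator {0..<\<tau>} y \<partial>lebesgue) = (\<integral>y. f y * indicator {0..<\<tau>} y \<partial>lborel)"
      by (rule integral_completion) measurable
    also have "\<dots> = (\<integral>y. indicator {0..\<tau>} y *\<^sub>R f y \<partial>lborel)"
    proof (rule integral_cong_AE)
      show "AE y in lborel. f y * indicator {0..<\<tau>} y = indicator {0..\<tau>} y *\<^sub>R f y"
        using AE_lborel_singleton[of \<tau>] by eventually_elim (auto simp: indicator_def)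
    qed measurable
    finally show ?thesis .
  qed
  have int: "integrable lborel (\<lambda>y. indicator {0..\<tau>} y *\<^sub>R f y)" if f: "continuous_on UNIV f" for f :: "real \<Rightarrow> real"
    using borel_integrable_atLeastAtMost'[OF continuous_on_subset[OF f subset_UNIV]] by (simp add: set_integrable_def)
  have "(\<integral>y. indicator {0..\<tau>} y *\<^sub>R ((\<tau> - y) * (grad \<phi> (x, y) \<bullet> (0, 1)) - \<phi> (x, y)) \<partial>lborel) = (\<tau> - \<tau>) * \<phi> (x, \<tau>) - (\<tau> - 0) * \<phi> (x, 0)"
  proof (rule integral_FTC_atLeastAtMost)
    show "0 \<le> \<tau>" using \<tau> by simp
    show "continuous_on {0..\<tau>} (\<lambda>y. (\<tau> - y) * (grad \<phi> (x, y) \<bullet> (0, 1)) - \<phi> (x, y))"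
      by (rule continuous_on_subset[OF continuous_on_diff[OF c3 c1] subset_UNIV])
    fix y
    have "((\<lambda>y. \<tau> - y) has_real_derivative - 1) (at y)" by (auto intro!: derivative_eq_intros)
    from DERIV_mult[OF this der]
    have "((\<lambda>y. (\<tau> - y) * \<phi> (x, y)) has_real_derivative (\<tau> - y) * (grad \<phi> (x, y) \<bullet> (0, 1)) - \<phi> (x, y)) (at y)"
      by (simp add: algebra_simps)
    then show "((\<lambda>y. (\<tau> - y) * \<phi> (x, y)) has_vector_derivative (\<tau> - y) * (grad \<phi> (x, y) \<bullet> (0, 1)) - \<phi> (x, y)) (at y within {0..\<tau>})"
      by (simp add: has_real_derivative_iff_has_vector_derivative has_vector_derivative_at_within)
  qed
  moreover have "\<phi> (x, 0) = 0" by (rule test_function_outside(1)[OF \<phi>]) simp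
  ultimately have "(\<integral>y. indicator {0..\<tau>} y *\<^sub>R ((\<tau> - y) * (grad \<phi> (x, y) \<bullet> (0, 1))) \<partial>lborel) = (\<integral>y. indicator {0..\<tau>} y *\<^sub>R \<phi> (x, y) \<partial>lborel)"
    using int[OF c3] int[OF c1] by (simp add: right_diff_distrib)
  then show ?thesis using tr[OF c3] tr[OF c1] by simp
qed

text \<open>The approximants vanish near time 0, so the integral of \<open>p\<close> over the times
  from 0 to \<tau> has norm at most \<open>\<tau> * sqrt \<tau>\<close> times that of the time
  derivative \<open>g\<close>, and the mean is of order \<open>sqrt \<tau>\<close>. By continuity in
  time the means tend to \<open>p (x, 0)\<close>.\<close>

lemma initial_trace_zero:
  fixes p :: "'a::euclidean_space \<times> real \<Rightarrow> real"
  assumes D: "open D" and a: "a > 0"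
    and p: "p \<in> L2 (D \<times> {0..<a})" "\<And>r. r \<in> {0..a} \<Longrightarrow> (\<lambda>x. p (x, r)) \<in> L2 D"
    and g: "g \<in> L2 (D \<times> {0..<a})"
    and cont: "\<And>\<epsilon>. \<epsilon> > 0 \<Longrightarrow> \<exists>d>0. \<forall>r\<in>{0..a}. r < d \<longrightarrow> l2norm D (\<lambda>x. p (x, r) - p (x, 0)) \<le> \<epsilon>"
    and approx: "\<And>\<epsilon>. \<epsilon> > 0 \<Longrightarrow> \<exists>\<phi>\<in>test_functions (D \<times> {0<..}).
      l2norm (D \<times> {0..<a}) (\<lambda>z. \<phi> z - p z) < \<epsilon> \<and> l2norm (D \<times> {0..<a}) (\<lambda>z. grad \<phi> z \<bullet> (0, 1) - g z) < \<epsilon>"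
  shows "AE x in lebesgue_on D. p (x, 0) = 0"
proof -
  let ?C = "l2norm (D \<times> {0..<a}) g"
  have p0: "(\<lambda>x. p (x, 0)) \<in> L2 D" using a by (intro p) auto
  have bound: "l2norm D P \<le> sqrt \<tau> * (\<tau> * ?C)" if \<tau>: "0 < \<tau>" "\<tau> \<le> a" and P: "time_int D 0 \<tau> p P" for \<tau> P
  proof (rule field_le_epsilon)
    fix \<epsilon> :: real assume \<epsilon>: "\<epsilon> > 0"
    let ?Q = "D \<times> {0..<\<tau>}"
    note Qm = slab_lebesgue[OF D, of 0 \<tau>] and Qa = slab_lebesgue[OF D, of 0 a]
    have sub: "?Q \<subseteq> D \<times> {0..<a}" using \<tau> by auto
    have q: "sqrt \<tau> * (\<tau> + 1) > 0" using \<tau> by simp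
    define \<delta> where "\<delta> = \<epsilon> / (sqrt \<tau> * (\<tau> + 1))"
    have \<delta>: "\<delta> > 0" unfolding \<delta>_def using \<epsilon> q by simp
    have \<delta>e: "sqrt \<tau> * (\<tau> + 1) * \<delta> = \<epsilon>"
      unfolding \<delta>_def times_divide_eq_right by (rule nonzero_mult_div_cancel_left[OF less_imp_neq[OF q, symmetric]])
    obtain \<phi> where \<phi>: "\<phi> \<in> test_functions (D \<times> {0<..})" "l2norm (D \<times> {0..<a}) (\<lambda>z. \<phi> z - p z) < \<delta>"
      "l2norm (D \<times> {0..<a}) (\<lambda>z. grad \<phi> z \<bullet> (0, 1) - g z) < \<delta>" using approx[OF \<delta>] by blast
    have \<phi>U: "\<phi> \<in> test_functions (D \<times> UNIV)" by (rule test_functions_mono[OF \<phi>(1)]) auto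
    have e01: "(0::'a, 1::real) \<in> Basis" by (simp add: Basis_prod_def)
    let ?\<psi> = "\<lambda>z::'a \<times> real. (\<tau> - snd z) * (grad \<phi> z \<bullet> (0, 1))"
    have dt: "(\<lambda>z. grad \<phi> z \<bullet> (0, 1)) \<in> test_functions (D \<times> UNIV)" by (rule grad_test_function_inner[OF \<phi>U e01])
    have "smooth (\<lambda>z::'a \<times> real. \<tau> - snd z)"
      by (rule smooth_diff[OF smooth_const smooth_linear[OF bounded_linear_snd]])
    from test_function_mult[OF dt this] have \<psi>: "?\<psi> \<in> test_functions (D \<times> UNIV)" .
    define b where "b x = (\<integral>y. \<phi> (x, y) * indicator {0..<\<tau>} y \<partial>lebesgue)" for x
    have b1: "time_int D 0 \<tau> \<phi> b" unfolding b_def using slab_test_function_time_int(2)[OF D _ \<phi>U, of 0 \<tau>] \<tau> by simp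
    \<comment> \<open>The same \<open>b\<close> is the time integral of two functions: through
      \<phi> it is close to \<open>P\<close>, and through the weighted time derivative it is
      small.\<close>
    have b2: "time_int D 0 \<tau> ?\<psi> b"
      using slab_test_function_time_int(2)[OF D _ \<psi>, of 0 \<tau>] \<tau>(1) time_int_integration_by_parts[OF \<phi>(1) \<tau>(1)]
      unfolding b_def by simp
    have \<tau>0: "0 \<le> \<tau>" using \<tau> by simp
    have pL: "p \<in> L2 ?Q" by (rule L2_subset(1)[OF p(1) sub Qa Qm])
    have \<phi>L: "\<phi> \<in> L2 ?Q" "\<phi> \<in> L2 (D \<times> {0..<a})" by (auto intro: test_function_L2(1)[OF \<phi>(1)] Qm Qa)
    have dL: "(\<lambda>z. grad \<phi> z \<bullet> (0, 1)) \<in> L2 ?Q" "(\<lambda>z. grad \<phi> z \<bullet> (0, 1)) \<in> L2 (D \<times> {0..<a})"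
      by (auto intro: test_function_L2(1)[OF dt] Qm Qa)
    have \<psi>L: "?\<psi> \<in> L2 ?Q" by (rule test_function_L2(1)[OF \<psi> Qm])
    have "l2norm D (\<lambda>x. P x - b x) \<le> sqrt \<tau> * l2norm ?Q (\<lambda>z. p z - \<phi> z)"
      using time_int_norm[OF D \<tau>0 L2_diff[OF pL \<phi>L(1)] time_int_diff[OF D \<tau>0 pL P \<phi>L(1) b1]] by simp
    also have "l2norm ?Q (\<lambda>z. p z - \<phi> z) \<le> l2norm (D \<times> {0..<a}) (\<lambda>z. p z - \<phi> z)"
      by (rule L2_subset(2)[OF L2_diff[OF p(1) \<phi>L(2)] sub Qa Qm])
    also have "l2norm (D \<times> {0..<a}) (\<lambda>z. p z - \<phi> z) \<le> \<delta>" using \<phi>(2) l2norm_minus_commute[of _ p \<phi>] by simp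
    finally have 1: "l2norm D (\<lambda>x. P x - b x) \<le> sqrt \<tau> * \<delta>" using \<tau> by (simp add: mult_left_mono)
    have "l2norm D b \<le> sqrt \<tau> * l2norm ?Q ?\<psi>" using time_int_norm[OF D \<tau>0 \<psi>L b2] by simp
    also have "l2norm ?Q ?\<psi> \<le> l2norm ?Q (\<lambda>z. \<tau> *\<^sub>R (grad \<phi> z \<bullet> (0, 1)))"
    proof (rule l2norm_mono[OF L2_scaleR[OF dL(1)] L2_measurable[OF \<psi>L]])
      have "\<bar>\<tau> - snd z\<bar> * \<bar>grad \<phi> z \<bullet> (0, 1)\<bar> \<le> \<tau> * \<bar>grad \<phi> z \<bullet> (0, 1)\<bar>" if "z \<in> ?Q" for z
        using that by (intro mult_right_mono) auto
      then show "AE z in lebesgue_on ?Q. norm (?\<psi> z) \<le> norm (\<tau> *\<^sub>R (grad \<phi> z \<bullet> (0, 1)))"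
        using \<tau> by (intro AE_I2) (simp add: abs_mult)
    qed
    also have "\<dots> = \<tau> * l2norm ?Q (\<lambda>z. grad \<phi> z \<bullet> (0, 1))" using \<tau> by (simp add: l2norm_scaleR del: real_scaleR_def)
    also have "l2norm ?Q (\<lambda>z. grad \<phi> z \<bullet> (0, 1)) \<le> l2norm (D \<times> {0..<a}) (\<lambda>z. grad \<phi> z \<bullet> (0, 1))"
      by (rule L2_subset(2)[OF dL(2) sub Qa Qm])
    also have "\<dots> \<le> \<delta> + ?C" using l2norm_le_diff[OF dL(2) g] \<phi>(3) by simp
    finally have 2: "l2norm D b \<le> sqrt \<tau> * (\<tau> * (\<delta> + ?C))" using \<tau> by (simp add: mult_left_mono)
    have "l2norm D P \<le> l2norm D (\<lambda>x. P x - b x) + l2norm D b"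
      by (rule l2norm_le_diff[OF time_int_L2[OF P] time_int_L2[OF b1]])
    also have "\<dots> \<le> sqrt \<tau> * \<delta> + sqrt \<tau> * (\<tau> * (\<delta> + ?C))" using 1 2 by simp
    also have "\<dots> = sqrt \<tau> * (\<tau> * ?C) + sqrt \<tau> * (\<tau> + 1) * \<delta>" by (simp add: algebra_simps)
    finally show "l2norm D P \<le> sqrt \<tau> * (\<tau> * ?C) + \<epsilon>" using \<delta>e by simp
  qed
  have "l2norm D (\<lambda>x. p (x, 0)) \<le> 0 + \<epsilon>" if \<epsilon>: "\<epsilon> > 0" for \<epsilon>
  proof -
    obtain d where d: "d > 0" "\<forall>r\<in>{0..a}. r < d \<longrightarrow> l2norm D (\<lambda>x. p (x, r) - p (x, 0)) \<le> \<epsilon> / 2"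
      using cont[of "\<epsilon> / 2"] \<epsilon> by auto
    have C1: "?C + 1 > 0" by (simp add: add_nonneg_pos)
    define \<tau> where "\<tau> = Min {a, d / 2, (\<epsilon> / (2 * (?C + 1)))\<^sup>2}"
    have e2: "\<epsilon> / (2 * (?C + 1)) > 0" using \<epsilon> C1 by simp
    have \<tau>: "\<tau> > 0" "\<tau> \<le> a" "\<tau> \<le> d / 2" "\<tau> \<le> (\<epsilon> / (2 * (?C + 1)))\<^sup>2" using a d(1) e2 by (auto simp: \<tau>_def)
    have "sqrt \<tau> \<le> \<epsilon> / (2 * (?C + 1))" using real_le_lsqrt[OF _ \<tau>(4)] e2 \<tau>(1) by simp
    then have "sqrt \<tau> * (2 * (?C + 1)) \<le> \<epsilon>" using C1 by (simp add: pos_le_divide_eq)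
    moreover have "sqrt \<tau> * (2 * (?C + 1)) = 2 * (sqrt \<tau> * ?C) + 2 * sqrt \<tau>" by (simp add: algebra_simps)
    moreover have "sqrt \<tau> \<ge> 0" using \<tau> by simp
    ultimately have sq: "sqrt \<tau> * ?C \<le> \<epsilon> / 2" by linarith
    have "D \<times> {0..<\<tau>} \<subseteq> D \<times> {0..<a}" using \<tau> by auto
    then have pL: "p \<in> L2 (D \<times> {0..<\<tau>})"
      by (rule L2_subset(1)[OF p(1) _ slab_lebesgue[OF D] slab_lebesgue[OF D]])
    obtain P where P: "time_int D 0 \<tau> p P" by (rule time_int_exists_real[OF D \<tau>(1) pL])
    have near: "l2norm D (\<lambda>x. P x / (\<tau> - 0) - p (x, 0)) \<le> \<epsilon> / 2"
      by (rule time_int_average_close[OF D \<tau>(1) pL P _ p0]) (use \<tau> d p(2) in auto)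
    have PL: "(\<lambda>x. (1 / \<tau>) *\<^sub>R P x) \<in> L2 D" by (rule L2_scaleR[OF time_int_L2[OF P]])
    have "l2norm D (\<lambda>x. (1 / \<tau>) *\<^sub>R P x) = l2norm D P / \<tau>" using \<tau>(1) by (simp only: l2norm_scaleR) simp
    also have "\<dots> \<le> sqrt \<tau> * ?C" using bound[OF \<tau>(1,2) P] \<tau>(1) by (simp add: pos_divide_le_eq mult_ac)
    finally have Pn: "l2norm D (\<lambda>x. (1 / \<tau>) *\<^sub>R P x) \<le> \<epsilon> / 2" using sq by linarith
    have "l2norm D (\<lambda>x. p (x, 0)) \<le> l2norm D (\<lambda>x. p (x, 0) - (1 / \<tau>) *\<^sub>R P x) + l2norm D (\<lambda>x. (1 / \<tau>) *\<^sub>R P x)"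
      by (rule l2norm_le_diff[OF p0 PL])
    also have "l2norm D (\<lambda>x. p (x, 0) - (1 / \<tau>) *\<^sub>R P x) \<le> \<epsilon> / 2"
      using near l2norm_minus_commute[of D "\<lambda>x. p (x, 0)" "\<lambda>x. (1 / \<tau>) *\<^sub>R P x"] by simp
    finally show ?thesis using Pn by simp
  qed
  then have "l2norm D (\<lambda>x. p (x, 0)) \<le> 0" by (rule field_le_epsilon)
  then show ?thesis using l2norm_nonneg[of D "\<lambda>x. p (x, 0)"] by (intro l2norm_eq_0[OF p0]) linarith
qed

text \<open>A Lebesgue number of the cover by balls of pointwise continuity puts any two close
  points into one ball, whose centre \<open>r\<close> is the intermediate point in the triangle
  inequality; this is why \<open>tri\<close> compares both points with \<open>r\<close>.\<close>

lemma compact_uniformly_continuous_pseudometric: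
  fixes N :: "'a::metric_space \<Rightarrow> 'a \<Rightarrow> real"
  assumes K: "compact K" and tri: "\<And>r s t. r \<in> K \<Longrightarrow> s \<in> K \<Longrightarrow> t \<in> K \<Longrightarrow> N s t \<le> N s r + N t r"
    and pt: "\<And>t \<epsilon>. t \<in> K \<Longrightarrow> \<epsilon> > 0 \<Longrightarrow> \<exists>d>0. \<forall>s\<in>K. dist s t < d \<longrightarrow> N s t \<le> \<epsilon>"
    and \<epsilon>: "\<epsilon> > 0"
  shows "\<exists>d>0. \<forall>s\<in>K. \<forall>t\<in>K. dist s t < d \<longrightarrow> N s t \<le> \<epsilon>"
proof -
  have "\<forall>t\<in>K. \<exists>d>0. \<forall>s\<in>K. dist s t < d \<longrightarrow> N s t \<le> \<epsilon> / 2" using pt[of _ "\<epsilon> / 2"] \<epsilon> by simp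
  then obtain d where d: "\<And>t. t \<in> K \<Longrightarrow> d t > 0" "\<And>s t. t \<in> K \<Longrightarrow> s \<in> K \<Longrightarrow> dist s t < d t \<Longrightarrow> N s t \<le> \<epsilon> / 2"
    by metis
  have cov: "K \<subseteq> \<Union>((\<lambda>t. ball t (d t)) ` K)" using d(1) by force
  obtain e where e: "e > 0" "\<And>x. x \<in> K \<Longrightarrow> \<exists>G\<in>(\<lambda>t. ball t (d t)) ` K. ball x e \<subseteq> G"
    by (rule Heine_Borel_lemma[OF K cov]) auto
  have "N s t \<le> \<epsilon>" if st: "s \<in> K" "t \<in> K" "dist s t < e" for s t
  proof -
    obtain r where r: "r \<in> K" "ball s e \<subseteq> ball r (d r)" using e(2)[OF st(1)] by auto
    have "s \<in> ball r (d r)" "t \<in> ball r (d r)" by (rule subsetD[OF r(2)]; use e(1) st(3) in simp)+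
    then have "dist s r < d r" "dist t r < d r" by (simp_all add: dist_commute)
    from d(2)[OF r(1) st(1) this(1)] d(2)[OF r(1) st(2) this(2)] tri[OF r(1) st(1,2)] show ?thesis by linarith
  qed
  with e(1) show ?thesis by blast
qed

section \<open>The enthalpy inequality\<close>

text \<open>A spatial test function times a cutoff in time that equals 1 around [s, t]. Its time
  derivative vanishes there, so \<open>u + \<mu>\<close> drops out of the flux. The identities hold
  for all \<open>u\<close> and \<mu>, so one \<eta> serves subsolution and supersolution
  alike.\<close>

lemma enthalpy_stationary_test:
  fixes \<phi> :: "'a::euclidean_space \<Rightarrow> real"
  assumes D: "open D" and st: "0 \<le> s" "s < t" and \<phi>: "\<phi> \<in> pos_tests D"
  obtains \<eta> where "\<eta> \<in> test_functions (D \<times> UNIV)" "\<And>z. 0 \<le> \<eta> z"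
    "\<And>u \<mu>. enthalpy_increment D u \<mu> \<eta> s t
      = (\<integral>x. (u (x, t) + \<mu> (x, t)) * \<phi> x \<partial>lebesgue_on D) - (\<integral>x. (u (x, s) + \<mu> (x, s)) * \<phi> x \<partial>lebesgue_on D)"
    "\<And>F u \<mu> G. F \<in> L2 D \<Longrightarrow> G \<in> L2 (D \<times> {s..<t}) \<Longrightarrow> enthalpy_flux D F u \<mu> G \<eta> s t
      = - (\<integral>z. G z \<bullet> grad \<phi> (fst z) \<partial>lebesgue_on (D \<times> {s..<t})) - (\<integral>z. F (fst z) \<bullet> grad \<phi> (fst z) \<partial>lebesgue_on (D \<times> {s..<t}))"
proof -
  have Dm: "D \<in> sets lebesgue" using D by simp
  note \<phi>t = pos_tests_test[OF \<phi>]
  have R: "t + 1 > 0" using st by simp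
  define \<eta> where "\<eta> z = \<phi> (fst z) * cutoff (t + 1) (snd z)" for z :: "'a \<times> real"
  have one: "cutoff (t + 1) r = 1" if "\<bar>r\<bar> < t + 1" for r :: real
    by (rule cutoff_eq_1[OF R]) (use that in simp)
  have sl: "(\<lambda>y. \<eta> (y, r)) = \<phi>" if "\<bar>r\<bar> < t + 1" for r using one[OF that] by (simp add: \<eta>_def)
  \<comment> \<open>The radius \<open>t + 1\<close> makes the cutoff constant on an open interval
    containing [s, t], so \<open>deriv\<close> is 0 at the end points as well.\<close>
  have dv: "deriv (\<lambda>r. \<eta> (x, r)) \<tau> = 0" if \<tau>: "\<tau> \<in> {s..t}" for x \<tau>
  proof (rule DERIV_imp_deriv)
    have "((\<lambda>r. \<phi> x) has_real_derivative 0) (at \<tau>)" by simp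
    then show "((\<lambda>r. \<eta> (x, r)) has_real_derivative 0) (at \<tau>)"
    proof (rule has_field_derivative_transform_within_open)
      show "open {- (t + 1)<..<t + 1}" by simp
      show "\<tau> \<in> {- (t + 1)<..<t + 1}" using \<tau> st by auto
      show "\<phi> x = \<eta> (x, r)" if "r \<in> {- (t + 1)<..<t + 1}" for r
      proof -
        have "\<bar>r\<bar> < t + 1" using that by (auto simp: abs_less_iff)
        from one[OF this] show ?thesis by (simp add: \<eta>_def)
      qed
    qed
  qed
  show thesis
  proof
    obtain C where C: "compact C" "C \<subseteq> D" "\<And>x. x \<notin> C \<Longrightarrow> \<phi> x = 0" using test_functionsE[OF \<phi>t] by metis
    show "\<eta> \<in> test_functions (D \<times> UNIV)"
    proof (rule test_functionsI[of _ "C \<times> {- 2 * (t + 1)..2 * (t + 1)}"])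
      have "smooth (\<lambda>z::'a \<times> real. \<phi> (fst z))"
        by (rule smooth_inner_compose[OF _ test_functions_smooth[OF \<phi>t]]) (rule has_derivative_fst[OF has_derivative_ident])
      moreover have "smooth (\<lambda>z::'a \<times> real. cutoff (t + 1) (snd z))"
        by (rule smooth_inner_compose[OF _ smooth_cutoff]) (rule has_derivative_snd[OF has_derivative_ident])
      ultimately show "smooth \<eta>" unfolding \<eta>_def[abs_def] by (rule smooth_mult)
      show "compact (C \<times> {- 2 * (t + 1)..2 * (t + 1)})" by (intro compact_Times C compact_Icc)
      show "C \<times> {- 2 * (t + 1)..2 * (t + 1)} \<subseteq> D \<times> UNIV" using C(2) by auto
      fix z :: "'a \<times> real" assume z: "z \<notin> C \<times> {- 2 * (t + 1)..2 * (t + 1)}"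
      show "\<eta> z = 0"
      proof (cases "fst z \<in> C")
        case True
        then have "2 * (t + 1) \<le> norm (snd z)" using z by (cases z) auto
        from cutoff_eq_0[OF R this] show ?thesis by (simp add: \<eta>_def)
      qed (simp add: \<eta>_def C(3))
    qed
    show "0 \<le> \<eta> z" for z unfolding \<eta>_def by (intro mult_nonneg_nonneg pos_tests_nonneg[OF \<phi>] cutoff_bounds(1))
    show "enthalpy_increment D u \<mu> \<eta> s t
      = (\<integral>x. (u (x, t) + \<mu> (x, t)) * \<phi> x \<partial>lebesgue_on D) - (\<integral>x. (u (x, s) + \<mu> (x, s)) * \<phi> x \<partial>lebesgue_on D)" for u \<mu>
      using one[of s] one[of t] st by (simp add: enthalpy_increment_def \<eta>_def)
    show "enthalpy_flux D F u \<mu> G \<eta> s t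
      = - (\<integral>z. G z \<bullet> grad \<phi> (fst z) \<partial>lebesgue_on (D \<times> {s..<t})) - (\<integral>z. F (fst z) \<bullet> grad \<phi> (fst z) \<partial>lebesgue_on (D \<times> {s..<t}))"
      if F: "F \<in> L2 D" and G: "G \<in> L2 (D \<times> {s..<t})" for F u \<mu> G
    proof -
      note gL = test_function_L2(2)[OF \<phi>t Dm]
      note i1 = slab_inner_integrable[OF D less_imp_le[OF st(2)] G gL]
      note i2 = slab_inner_integrable[OF D less_imp_le[OF st(2)] fst_L2(1)[OF D F less_imp_le[OF st(2)]] gL]
      have i: "integrable (lebesgue_on (D \<times> {s..<t})) (\<lambda>z. - (G z \<bullet> grad \<phi> (fst z)) - F (fst z) \<bullet> grad \<phi> (fst z))"
        by (intro Bochner_Integration.integrable_diff Bochner_Integration.integrable_minus i1 i2)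
      have "enthalpy_flux D F u \<mu> G \<eta> s t
        = (\<integral>\<tau>. (\<integral>x. - (G (x, \<tau>) \<bullet> grad \<phi> x) - F x \<bullet> grad \<phi> x \<partial>lebesgue_on D) \<partial>lebesgue_on {s..t})"
        unfolding enthalpy_flux_def
      proof (rule Bochner_Integration.integral_cong[OF refl])
        fix \<tau> assume "\<tau> \<in> space (lebesgue_on {s..t})"
        then have \<tau>: "\<tau> \<in> {s..t}" by simp
        then have "\<bar>\<tau>\<bar> < t + 1" using st by auto
        then show "(\<integral>x. (u (x, \<tau>) + \<mu> (x, \<tau>)) * deriv (\<lambda>s. \<eta> (x, s)) \<tau> - G (x, \<tau>) \<bullet> grad (\<lambda>y. \<eta> (y, \<tau>)) x
            - F x \<bullet> grad (\<lambda>y. \<eta> (y, \<tau>)) x \<partial>lebesgue_on D)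
          = (\<integral>x. - (G (x, \<tau>) \<bullet> grad \<phi> x) - F x \<bullet> grad \<phi> x \<partial>lebesgue_on D)"
          by (simp add: sl dv[OF \<tau>])
      qed
      also have "\<dots> = (\<integral>z. - (G z \<bullet> grad \<phi> (fst z)) - F (fst z) \<bullet> grad \<phi> (fst z) \<partial>lebesgue_on (D \<times> {s..<t}))"
        using slab_iterated_integral(2)[OF D i] by simp
      also have "\<dots> = - (\<integral>z. G z \<bullet> grad \<phi> (fst z) \<partial>lebesgue_on (D \<times> {s..<t})) - (\<integral>z. F (fst z) \<bullet> grad \<phi> (fst z) \<partial>lebesgue_on (D \<times> {s..<t}))"
        using i1 i2 by simp
      finally show ?thesis .
    qed
  qed
qed

section \<open>Rules for weak gradients\<close>

lemma has_H1_gradientD: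
  assumes "open D" "has_H1_gradient D f g" "\<phi> \<in> test_functions D" "b \<in> Basis"
  shows "(\<integral>x. f x * (grad \<phi> x \<bullet> b) \<partial>lebesgue_on D) = - (\<integral>x. (g x \<bullet> b) * \<phi> x \<partial>lebesgue_on D)"
  using assms by (simp add: has_H1_gradient_def interior_open)

lemma has_H1_gradient_L2: "has_H1_gradient D f g \<Longrightarrow> f \<in> L2 D" "has_H1_gradient D f g \<Longrightarrow> g \<in> L2 D"
  by (simp_all add: has_H1_gradient_def)

lemma has_H1_gradientI:
  assumes "open D" "f \<in> L2 D" "g \<in> L2 D"
    "\<And>\<phi> b. \<phi> \<in> test_functions D \<Longrightarrow> b \<in> Basis \<Longrightarrow>
      (\<integral>x. f x * (grad \<phi> x \<bullet> b) \<partial>lebesgue_on D) = - (\<integral>x. (g x \<bullet> b) * \<phi> x \<partial>lebesgue_on D)"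
  shows "has_H1_gradient D f g"
  unfolding has_H1_gradient_def interior_open[OF assms(1)] by (intro conjI ballI assms)

lemma pos_H10_H1_gradient:
  fixes D :: "'a::euclidean_space set"
  assumes D: "open D" and P: "pos_H10 D P GP"
  shows "has_H1_gradient D P GP"
proof -
  have Dm: "D \<in> sets lebesgue" using D by simp
  have PL: "P \<in> L2 D" "GP \<in> L2 D" using P by (simp_all add: pos_H10_def)
  have ibp: "(\<integral>x. P x * (grad \<phi> x \<bullet> c) \<partial>lebesgue_on D) = - (\<integral>x. (GP x \<bullet> c) * \<phi> x \<partial>lebesgue_on D)"
    if \<phi>: "\<phi> \<in> test_functions D" and c: "c \<in> Basis" for \<phi> c
  proof -
    note gL = test_function_L2(1)[OF grad_test_function_inner[OF \<phi> c] Dm] and \<phi>L = test_function_L2(1)[OF \<phi> Dm]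
    let ?X = "(\<integral>x. P x * (grad \<phi> x \<bullet> c) \<partial>lebesgue_on D) + (\<integral>x. (GP x \<bullet> c) * \<phi> x \<partial>lebesgue_on D)"
    let ?K = "l2norm D (\<lambda>x. grad \<phi> x \<bullet> c) + l2norm D \<phi> + 1"
    have K: "?K > 0" by (simp add: add_nonneg_pos)
    have "\<bar>?X\<bar> \<le> 0 + \<epsilon>" if \<epsilon>: "\<epsilon> > 0" for \<epsilon>
    proof -
      obtain b where b: "b \<in> pos_tests D" "l2norm D (\<lambda>x. b x - P x) < \<epsilon> / ?K" "l2norm D (\<lambda>x. grad b x - GP x) < \<epsilon> / ?K"
        using P \<epsilon> K unfolding pos_H10_def by (meson divide_pos_pos)
      note bt = pos_tests_test[OF b(1)]
      note bL = test_function_L2[OF bt Dm]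
      note gd = L2_diff[OF bL(2) PL(2)]
      have gc: "l2norm D (\<lambda>x. grad b x \<bullet> c - GP x \<bullet> c) \<le> \<epsilon> / ?K"
        using l2norm_component_le[OF gd c] b(3) by (simp add: inner_diff_left)
      have "(\<integral>x. b x * (grad \<phi> x \<bullet> c) \<partial>lebesgue_on D) + (\<integral>x. (grad b x \<bullet> c) * \<phi> x \<partial>lebesgue_on D) = 0"
        using smooth_integration_by_parts[OF Dm \<phi> test_functions_smooth[OF bt] c] by simp
      then have "?X = - (\<integral>x. (b x - P x) * (grad \<phi> x \<bullet> c) \<partial>lebesgue_on D) - (\<integral>x. (grad b x \<bullet> c - GP x \<bullet> c) * \<phi> x \<partial>lebesgue_on D)"
        using L2_mult_integrable[OF bL(1) gL] L2_mult_integrable[OF PL(1) gL]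
          L2_mult_integrable[OF L2_component[OF bL(2)] \<phi>L] L2_mult_integrable[OF L2_component[OF PL(2)] \<phi>L]
        by (simp add: left_diff_distrib)
      moreover have "\<bar>\<integral>x. (b x - P x) * (grad \<phi> x \<bullet> c) \<partial>lebesgue_on D\<bar> \<le> \<epsilon> / ?K * l2norm D (\<lambda>x. grad \<phi> x \<bullet> c)"
        by (rule order_trans[OF L2_mult_le[OF L2_diff[OF bL(1) PL(1)] gL] mult_right_mono[OF less_imp_le[OF b(2)] l2norm_nonneg]])
      moreover have "\<bar>\<integral>x. (grad b x \<bullet> c - GP x \<bullet> c) * \<phi> x \<partial>lebesgue_on D\<bar> \<le> \<epsilon> / ?K * l2norm D \<phi>"
        by (rule order_trans[OF L2_mult_le[OF L2_diff[OF L2_component[OF bL(2)] L2_component[OF PL(2)]] \<phi>L] mult_right_mono[OF gc l2norm_nonneg]])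
      ultimately have "\<bar>?X\<bar> \<le> \<epsilon> / ?K * l2norm D (\<lambda>x. grad \<phi> x \<bullet> c) + \<epsilon> / ?K * l2norm D \<phi>" by linarith
      also have "\<dots> \<le> \<epsilon> / ?K * ?K"
        unfolding distrib_left[symmetric] using \<epsilon> K by (intro mult_left_mono) auto
      also have "\<epsilon> / ?K * ?K = \<epsilon>" using K by simp
      finally show ?thesis by simp
    qed
    then have "\<bar>?X\<bar> \<le> 0" by (rule field_le_epsilon)
    then show ?thesis by linarith
  qed
  show ?thesis by (rule has_H1_gradientI[OF D PL ibp])
qed

lemma has_H1_gradient_diff:
  fixes D :: "'a::euclidean_space set"
  assumes D: "open D" and f: "has_H1_gradient D f gf" and h: "has_H1_gradient D h gh"
  shows "has_H1_gradient D (\<lambda>x. f x - h x) (\<lambda>x. gf x - gh x)"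
proof -
  have Dm: "D \<in> sets lebesgue" using D by simp
  have L: "f \<in> L2 D" "gf \<in> L2 D" "h \<in> L2 D" "gh \<in> L2 D" by (rule has_H1_gradient_L2[OF f] has_H1_gradient_L2[OF h])+
  have ibp: "(\<integral>x. (f x - h x) * (grad \<phi> x \<bullet> b) \<partial>lebesgue_on D) = - (\<integral>x. ((gf x - gh x) \<bullet> b) * \<phi> x \<partial>lebesgue_on D)"
    if \<phi>: "\<phi> \<in> test_functions D" and b: "b \<in> Basis" for \<phi> b
  proof -
    note gL = test_function_L2(1)[OF grad_test_function_inner[OF \<phi> b] Dm] and \<phi>L = test_function_L2(1)[OF \<phi> Dm]
    have "(\<integral>x. f x * (grad \<phi> x \<bullet> b) \<partial>lebesgue_on D) = - (\<integral>x. (gf x \<bullet> b) * \<phi> x \<partial>lebesgue_on D)"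
      "(\<integral>x. h x * (grad \<phi> x \<bullet> b) \<partial>lebesgue_on D) = - (\<integral>x. (gh x \<bullet> b) * \<phi> x \<partial>lebesgue_on D)"
      by (rule has_H1_gradientD[OF D f \<phi> b], rule has_H1_gradientD[OF D h \<phi> b])
    then show ?thesis
      using L2_mult_integrable[OF L(1) gL] L2_mult_integrable[OF L(3) gL]
        L2_mult_integrable[OF L2_component[OF L(2)] \<phi>L] L2_mult_integrable[OF L2_component[OF L(4)] \<phi>L]
      by (simp add: left_diff_distrib inner_diff_left)
  qed
  show ?thesis by (rule has_H1_gradientI[OF D L2_diff[OF L(1,3)] L2_diff[OF L(2,4)] ibp])
qed

text \<open>Permits the passage to a representative that is nonnegative at every point of
  \<open>D\<close>, as the dual step asks, when nonnegativity is known only almost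
  everywhere.\<close>

lemma has_H1_gradient_cong_AE:
  fixes D :: "'a::euclidean_space set"
  assumes D: "open D" and f: "has_H1_gradient D f g" and h: "h \<in> borel_measurable (lebesgue_on D)"
    and eq: "AE x in lebesgue_on D. h x = f x"
  shows "has_H1_gradient D h g"
proof -
  have Dm: "D \<in> sets lebesgue" using D by simp
  have L: "f \<in> L2 D" "g \<in> L2 D" by (rule has_H1_gradient_L2[OF f])+
  have hL: "h \<in> L2 D" by (rule L2_bound[OF L(1) h]) (use eq in \<open>eventually_elim, simp\<close>)
  have same: "(\<integral>x. h x * (grad \<phi> x \<bullet> b) \<partial>lebesgue_on D) = (\<integral>x. f x * (grad \<phi> x \<bullet> b) \<partial>lebesgue_on D)"
    if \<phi>: "\<phi> \<in> test_functions D" and b: "b \<in> Basis" for \<phi> b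
  proof (rule integral_cong_AE)
    note gL = test_function_L2(1)[OF grad_test_function_inner[OF \<phi> b] Dm]
    show "(\<lambda>x. h x * (grad \<phi> x \<bullet> b)) \<in> borel_measurable (lebesgue_on D)" "(\<lambda>x. f x * (grad \<phi> x \<bullet> b)) \<in> borel_measurable (lebesgue_on D)"
      by (intro borel_measurable_times h L2_measurable[OF gL] L2_measurable[OF L(1)])+
    show "AE x in lebesgue_on D. h x * (grad \<phi> x \<bullet> b) = f x * (grad \<phi> x \<bullet> b)" using eq by eventually_elim simp
  qed
  show ?thesis by (rule has_H1_gradientI[OF D hL L(2)]) (simp only: same has_H1_gradientD[OF D f])
qed

lemma L2_continuousD:
  assumes "L2_continuous D T u" "t \<in> time_interval T" "\<epsilon> > 0"
  shows "\<exists>d>0. \<forall>s\<in>time_interval T. dist s t < d \<longrightarrow> l2norm D (\<lambda>x. u (x, s) - u (x, t)) \<le> \<epsilon>"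
proof -
  have "((\<lambda>s. \<integral>x. (u (x, s) - u (x, t))\<^sup>2 \<partial>lebesgue_on D) \<longlongrightarrow> 0) (at t within time_interval T)"
    using assms(1,2) by (simp add: L2_continuous_def)
  then have "\<forall>\<^sub>F s in at t within time_interval T. dist (\<integral>x. (u (x, s) - u (x, t))\<^sup>2 \<partial>lebesgue_on D) 0 < \<epsilon>\<^sup>2"
    by (rule tendstoD) (use assms(3) in simp)
  then obtain d where d: "d > 0" "\<forall>s\<in>time_interval T. s \<noteq> t \<and> dist s t < d \<longrightarrow> dist (\<integral>x. (u (x, s) - u (x, t))\<^sup>2 \<partial>lebesgue_on D) 0 < \<epsilon>\<^sup>2"
    unfolding eventually_at by blast
  have "l2norm D (\<lambda>x. u (x, s) - u (x, t)) \<le> \<epsilon>" if s: "s \<in> time_interval T" "dist s t < d" for s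
  proof (cases "s = t")
    case True then show ?thesis using assms(3) by (simp add: l2norm_def)
  next
    case False
    then have "(l2norm D (\<lambda>x. u (x, s) - u (x, t)))\<^sup>2 < \<epsilon>\<^sup>2" using d(2) s by (simp add: l2norm_sq dist_real_def)
    then show ?thesis using assms(3) by (meson less_imp_le power_less_imp_less_base)
  qed
  with d(1) show ?thesis by blast
qed

lemma slab_sq_additive:
  fixes f :: "'a::euclidean_space \<times> real \<Rightarrow> 'b::euclidean_space"
  assumes D: "open D" and st: "0 \<le> s" "s \<le> t" and f: "f \<in> L2 (D \<times> {0..<t})"
  shows "(l2norm (D \<times> {s..<t}) f)\<^sup>2 = (l2norm (D \<times> {0..<t}) f)\<^sup>2 - (l2norm (D \<times> {0..<s}) f)\<^sup>2"
proof -
  have m: "D \<times> {r..<q::real} \<inter> space lebesgue \<in> sets lebesgue" for r q using slab_lebesgue[OF D] by simp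
  have i: "integrable lebesgue (\<lambda>z. indicator (D \<times> {r..<q}) z *\<^sub>R (norm (f z))\<^sup>2)" if "0 \<le> r" "q \<le> t" for r q
  proof -
    have "D \<times> {r..<q} \<subseteq> D \<times> {0..<t}" using that by auto
    from L2_integrable_sq[OF L2_subset(1)[OF f this slab_lebesgue[OF D] slab_lebesgue[OF D]]]
    show ?thesis unfolding integrable_restrict_space[OF m] .
  qed
  have "indicator (D \<times> {s..<t}) z *\<^sub>R (norm (f z))\<^sup>2 = indicator (D \<times> {0..<t}) z *\<^sub>R (norm (f z))\<^sup>2 - indicator (D \<times> {0..<s}) z *\<^sub>R (norm (f z))\<^sup>2" for z
    using st by (cases z) (auto simp: indicator_def)
  then show ?thesis unfolding l2norm_sq integral_restrict_space[OF m] using i[of 0 t] i[of 0 s] st by simp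
qed

text \<open>Fixes the gradients \<open>G1\<close>, \<open>G2\<close> and the space-time gradient
  \<open>g\<close>, which the definitions only assert to exist, together with one time
  \<open>T\<close> below \<open>Tstar\<close>.\<close>

locale enthalpy_comparison =
  fixes D :: "'a::euclidean_space set" and Tstar :: ereal and uM :: "'a \<Rightarrow> real" and F :: "'a \<Rightarrow> 'a"
    and u1 \<mu>1 u2 \<mu>2 :: "'a \<times> real \<Rightarrow> real" and G1 G2 :: "'a \<times> real \<Rightarrow> 'a" and g :: "'a \<times> real \<Rightarrow> 'a \<times> real" and T :: real
  assumes D: "open D" and T: "0 < T" "ereal T < Tstar" and F: "F \<in> L2 D"
    and pair1: "enthalpy_pair D Tstar uM u1 \<mu>1 G1" and pair2: "enthalpy_pair D Tstar uM u2 \<mu>2 G2"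
    and sub: "\<And>t1 t2 \<eta>. 0 \<le> t1 \<Longrightarrow> t1 \<le> t2 \<Longrightarrow> ereal t2 < Tstar \<Longrightarrow> \<eta> \<in> test_functions (D \<times> UNIV) \<Longrightarrow> (\<And>z. 0 \<le> \<eta> z) \<Longrightarrow>
      enthalpy_increment D u1 \<mu>1 \<eta> t1 t2 \<le> enthalpy_flux D F u1 \<mu>1 G1 \<eta> t1 t2"
    and super: "\<And>t1 t2 \<eta>. 0 \<le> t1 \<Longrightarrow> t1 \<le> t2 \<Longrightarrow> ereal t2 < Tstar \<Longrightarrow> \<eta> \<in> test_functions (D \<times> UNIV) \<Longrightarrow> (\<And>z. 0 \<le> \<eta> z) \<Longrightarrow>
      enthalpy_increment D u2 \<mu>2 \<eta> t1 t2 \<ge> enthalpy_flux D F u2 \<mu>2 G2 \<eta> t1 t2"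
    and g: "has_H1_gradient (cyl D Tstar) (\<lambda>z. min (u2 z - u1 z) 0) g"
    and g_approx: "\<And>\<epsilon>. \<epsilon> > 0 \<Longrightarrow> \<exists>\<phi>\<in>test_functions (D \<times> {0<..}).
        (\<integral>z. (min (u2 z - u1 z) 0 - \<phi> z)\<^sup>2 \<partial>lebesgue_on (cyl D Tstar))
        + (\<integral>z. (norm (g z - grad \<phi> z))\<^sup>2 \<partial>lebesgue_on (cyl D Tstar)) < \<epsilon>\<^sup>2"
    and init: "AE x in lebesgue_on D. \<mu>1 (x, 0) \<le> \<mu>2 (x, 0)"
begin

definition w :: "'a \<times> real \<Rightarrow> real" where "w z = u1 z - u2 z"
definition m :: "'a \<times> real \<Rightarrow> real" where "m z = \<mu>1 z - \<mu>2 z"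
text \<open>This is minus the function of the boundary hypothesis, so its space-time gradient is
  \<open>- g\<close>: the spatial part is \<open>fst (- g z)\<close>, the time derivative
  \<open>- g z \<bullet> (0, 1)\<close>.\<close>

definition p :: "'a \<times> real \<Rightarrow> real" where "p z = max (w z) 0"
definition G :: "'a \<times> real \<Rightarrow> 'a" where "G z = G1 z - G2 z"

lemma Dm: "D \<in> sets lebesgue" using D by simp

lemma time_intervalI: "t \<in> {0..T} \<Longrightarrow> t \<in> time_interval Tstar"
  using le_less_trans[of "ereal t" "ereal T" Tstar] T(2) by (simp add: time_interval_def)

lemma slab_subset_cyl: "0 \<le> s \<Longrightarrow> t \<le> T \<Longrightarrow> D \<times> {s..<t} \<subseteq> cyl D Tstar"
  unfolding cyl_def by (intro Sigma_mono subset_refl) (auto intro: time_intervalI)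

lemma slab_subset: "0 \<le> s \<Longrightarrow> t \<le> T \<Longrightarrow> D \<times> {s..<t} \<subseteq> D \<times> {0..<T}"
  by (intro Sigma_mono subset_refl) auto

lemma cyl_lebesgue: "cyl D Tstar \<in> sets lebesgue"
proof -
  have "time_interval Tstar = {0..} \<inter> ereal -` {..<Tstar}" by (auto simp: time_interval_def)
  then have "time_interval Tstar \<in> sets borel" by simp
  then show ?thesis unfolding cyl_def using D by (intro sets_completionI_sets) (auto intro!: borel_Times)
qed

lemma pair_L2:
  assumes "enthalpy_pair D Tstar uM u \<mu> H"
  shows "u \<in> L2 (D \<times> {0..<T})" "H \<in> L2 (D \<times> {0..<T})"
proof -
  have TI: "T \<in> time_interval Tstar" using T by (intro time_intervalI) simp
  have "cyl D (ereal T) = D \<times> {0..<T}" by (auto simp: cyl_def time_interval_def)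
  with assms TI show "u \<in> L2 (D \<times> {0..<T})" "H \<in> L2 (D \<times> {0..<T})"
    by (auto simp: enthalpy_pair_def has_L2loc_H1_gradient_def L2loc_L2_def)
qed

lemma pair_slices:
  assumes P: "enthalpy_pair D Tstar uM u \<mu> H" and t: "t \<in> {0..T}"
  shows "(\<lambda>x. u (x, t)) \<in> L2 D" "(\<lambda>x. \<mu> (x, t)) \<in> borel_measurable (lebesgue_on D)" "AE x in lebesgue_on D. \<bar>\<mu> (x, t)\<bar> \<le> 1"
    "AE x in lebesgue_on D. (u (x, t) > uM x \<longrightarrow> \<mu> (x, t) = 1) \<and> (u (x, t) < uM x \<longrightarrow> \<mu> (x, t) = - 1)"
proof -
  note tI = time_intervalI[OF t]
  show "(\<lambda>x. u (x, t)) \<in> L2 D" using P tI by (simp add: enthalpy_pair_def L2_continuous_def)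
  show "(\<lambda>x. \<mu> (x, t)) \<in> borel_measurable (lebesgue_on D)"
    using P tI by (simp add: enthalpy_pair_def Linf_weak_star_continuous_def Linf_def)
  have "AE x in lebesgue_on D. \<bar>\<mu> (x, t)\<bar> \<le> 1 \<and> (u (x, t) > uM x \<longrightarrow> \<mu> (x, t) = 1) \<and> (u (x, t) < uM x \<longrightarrow> \<mu> (x, t) = - 1)"
    using P tI by (simp add: enthalpy_pair_def)
  then show "AE x in lebesgue_on D. \<bar>\<mu> (x, t)\<bar> \<le> 1"
    "AE x in lebesgue_on D. (u (x, t) > uM x \<longrightarrow> \<mu> (x, t) = 1) \<and> (u (x, t) < uM x \<longrightarrow> \<mu> (x, t) = - 1)"
    by (eventually_elim, simp)+
qed

lemma pair_test_integrable:
  assumes P: "enthalpy_pair D Tstar uM u \<mu> H" and t: "t \<in> {0..T}" and \<phi>: "\<phi> \<in> test_functions D"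
  shows "integrable (lebesgue_on D) (\<lambda>x. (u (x, t) + \<mu> (x, t)) * \<phi> x)"
proof -
  note sl = pair_slices[OF P t] and \<phi>L = test_function_L2(1)[OF \<phi> Dm]
  have "integrable lebesgue (\<lambda>x. indicator D x *\<^sub>R \<phi> x)"
    using Dm by (intro integrable_mult_indicator test_function_integrable[OF \<phi>]) simp
  then have \<phi>i: "integrable (lebesgue_on D) \<phi>" using Dm by (simp add: integrable_restrict_space)
  have "integrable (lebesgue_on D) (\<lambda>x. \<mu> (x, t) * \<phi> x)"
  proof (rule Bochner_Integration.integrable_bound[OF \<phi>i])
    show "(\<lambda>x. \<mu> (x, t) * \<phi> x) \<in> borel_measurable (lebesgue_on D)"
      by (intro borel_measurable_times sl(2) L2_measurable[OF \<phi>L])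
    show "AE x in lebesgue_on D. norm (\<mu> (x, t) * \<phi> x) \<le> norm (\<phi> x)"
      using sl(3) by eventually_elim (simp add: abs_mult mult_left_le_one_le)
  qed
  then show ?thesis using L2_mult_integrable[OF sl(1) \<phi>L] by (simp add: distrib_right)
qed

lemma w_slab: "0 \<le> s \<Longrightarrow> t \<le> T \<Longrightarrow> w \<in> L2 (D \<times> {s..<t})"
  and G_slab: "0 \<le> s \<Longrightarrow> t \<le> T \<Longrightarrow> G \<in> L2 (D \<times> {s..<t})"
proof -
  assume st: "0 \<le> s" "t \<le> T"
  have "w \<in> L2 (D \<times> {0..<T})" "G \<in> L2 (D \<times> {0..<T})"
    unfolding w_def[abs_def] G_def[abs_def] by (intro L2_diff pair_L2[OF pair1] pair_L2[OF pair2])+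
  then show "w \<in> L2 (D \<times> {s..<t})" "G \<in> L2 (D \<times> {s..<t})"
    using L2_subset(1)[OF _ slab_subset[OF st] slab_lebesgue[OF D] slab_lebesgue[OF D]] by blast+
qed

lemma p_slab: "p \<in> L2 (D \<times> {s..<t})" if st: "0 \<le> s" "t \<le> T"
proof (rule L2_bound[OF w_slab[OF st]])
  show "p \<in> borel_measurable (lebesgue_on (D \<times> {s..<t}))"
    unfolding p_def[abs_def] by (intro borel_measurable_max L2_measurable[OF w_slab[OF st]] borel_measurable_const)
qed (simp add: p_def)

lemma g_slab: "g \<in> L2 (D \<times> {s..<t})" if st: "0 \<le> s" "t \<le> T"
  by (rule L2_subset(1)[OF has_H1_gradient_L2(2)[OF g] slab_subset_cyl[OF st] cyl_lebesgue slab_lebesgue[OF D]])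

lemma w_slice: "t \<in> {0..T} \<Longrightarrow> (\<lambda>x. w (x, t)) \<in> L2 D"
  unfolding w_def by (intro L2_diff pair_slices(1)[OF pair1] pair_slices(1)[OF pair2])

lemma p_slice: "(\<lambda>x. p (x, t)) \<in> L2 D" if t: "t \<in> {0..T}"
proof (rule L2_bound[OF w_slice[OF t]])
  show "(\<lambda>x. p (x, t)) \<in> borel_measurable (lebesgue_on D)"
    unfolding p_def by (intro borel_measurable_max L2_measurable[OF w_slice[OF t]] borel_measurable_const)
qed (simp add: p_def)

text \<open>The boundary hypothesis concerns \<open>- p\<close>, so the approximants change sign;
  restricting from the whole cylinder to a slab only decreases the norms.\<close>

lemma slab_approx:
  assumes st: "0 \<le> s" "t \<le> T" and \<epsilon>: "\<epsilon> > 0"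
  obtains \<phi> where "\<phi> \<in> test_functions (D \<times> {0<..})" "l2norm (D \<times> {s..<t}) (\<lambda>z. \<phi> z - p z) < \<epsilon>"
    "l2norm (D \<times> {s..<t}) (\<lambda>z. grad \<phi> z - (- g z)) < \<epsilon>"
proof -
  let ?Q = "D \<times> {s..<t}" and ?C = "cyl D Tstar" and ?v = "\<lambda>z. min (u2 z - u1 z) 0"
  obtain \<phi> where \<phi>: "\<phi> \<in> test_functions (D \<times> {0<..})"
    "(\<integral>z. (?v z - \<phi> z)\<^sup>2 \<partial>lebesgue_on ?C) + (\<integral>z. (norm (g z - grad \<phi> z))\<^sup>2 \<partial>lebesgue_on ?C) < \<epsilon>\<^sup>2"
    using g_approx[OF \<epsilon>] by blast
  have "(l2norm ?C (\<lambda>z. ?v z - \<phi> z))\<^sup>2 + (l2norm ?C (\<lambda>z. g z - grad \<phi> z))\<^sup>2 < \<epsilon>\<^sup>2"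
    using \<phi>(2) by (simp add: l2norm_sq)
  then have "(l2norm ?C (\<lambda>z. ?v z - \<phi> z))\<^sup>2 < \<epsilon>\<^sup>2" "(l2norm ?C (\<lambda>z. g z - grad \<phi> z))\<^sup>2 < \<epsilon>\<^sup>2"
    using zero_le_power2[of "l2norm ?C (\<lambda>z. ?v z - \<phi> z)"] zero_le_power2[of "l2norm ?C (\<lambda>z. g z - grad \<phi> z)"] by linarith+
  then have n: "l2norm ?C (\<lambda>z. ?v z - \<phi> z) < \<epsilon>" "l2norm ?C (\<lambda>z. g z - grad \<phi> z) < \<epsilon>"
    using \<epsilon> by (meson less_imp_le power_less_imp_less_base)+
  note \<phi>L = test_function_L2[OF \<phi>(1) cyl_lebesgue]
  note sb = slab_subset_cyl[OF st] cyl_lebesgue slab_lebesgue[OF D]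
  show thesis
  proof
    show "(\<lambda>z. - 1 * \<phi> z) \<in> test_functions (D \<times> {0<..})" by (rule test_function_mult[OF \<phi>(1) smooth_const])
    have "p z = - ?v z" for z by (simp add: p_def w_def)
    then have "(\<lambda>z. - 1 * \<phi> z - p z) = (\<lambda>z. ?v z - \<phi> z)" by (simp add: fun_eq_iff)
    then show "l2norm ?Q (\<lambda>z. - 1 * \<phi> z - p z) < \<epsilon>"
      using L2_subset(2)[OF L2_diff[OF has_H1_gradient_L2(1)[OF g] \<phi>L(1)] sb] n(1) by simp
    have "(\<lambda>z. grad (\<lambda>z. - 1 * \<phi> z) z - (- g z)) = (\<lambda>z. g z - grad \<phi> z)"
      unfolding grad_cmult[OF test_functions_smooth[OF \<phi>(1)]] by (simp add: fun_eq_iff)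
    then show "l2norm ?Q (\<lambda>z. grad (\<lambda>z. - 1 * \<phi> z) z - (- g z)) < \<epsilon>"
      using L2_subset(2)[OF L2_diff[OF has_H1_gradient_L2(2)[OF g] \<phi>L(2)] sb] n(2) by simp
  qed
qed

lemma w_continuous:
  assumes \<epsilon>: "\<epsilon> > 0"
  shows "\<exists>d>0. \<forall>s\<in>{0..T}. \<forall>t\<in>{0..T}. \<bar>s - t\<bar> < d \<longrightarrow> l2norm D (\<lambda>x. w (x, s) - w (x, t)) \<le> \<epsilon>"
proof -
  have "\<exists>d>0. \<forall>s\<in>{0..T}. \<forall>t\<in>{0..T}. dist s t < d \<longrightarrow> l2norm D (\<lambda>x. w (x, s) - w (x, t)) \<le> \<epsilon>"
  proof (rule compact_uniformly_continuous_pseudometric[OF compact_Icc _ _ \<epsilon>])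
    show "l2norm D (\<lambda>x. w (x, s) - w (x, t)) \<le> l2norm D (\<lambda>x. w (x, s) - w (x, r)) + l2norm D (\<lambda>x. w (x, t) - w (x, r))"
      if "r \<in> {0..T}" "s \<in> {0..T}" "t \<in> {0..T}" for r s t
      using l2norm_triangle_diff[OF w_slice[OF that(2)] w_slice[OF that(1)] w_slice[OF that(3)]]
        l2norm_minus_commute[of D "\<lambda>x. w (x, t)" "\<lambda>x. w (x, r)"] by simp
  next
    fix t e :: real assume t: "t \<in> {0..T}" and e: "e > 0"
    have c: "L2_continuous D Tstar u1" "L2_continuous D Tstar u2" using pair1 pair2 by (simp_all add: enthalpy_pair_def)
    obtain d1 where d1: "d1 > 0" "\<forall>s\<in>time_interval Tstar. dist s t < d1 \<longrightarrow> l2norm D (\<lambda>x. u1 (x, s) - u1 (x, t)) \<le> e / 2"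
      using L2_continuousD[OF c(1) time_intervalI[OF t], of "e / 2"] e by auto
    obtain d2 where d2: "d2 > 0" "\<forall>s\<in>time_interval Tstar. dist s t < d2 \<longrightarrow> l2norm D (\<lambda>x. u2 (x, s) - u2 (x, t)) \<le> e / 2"
      using L2_continuousD[OF c(2) time_intervalI[OF t], of "e / 2"] e by auto
    have "l2norm D (\<lambda>x. w (x, s) - w (x, t)) \<le> e" if s: "s \<in> {0..T}" "dist s t < min d1 d2" for s
    proof -
      have "(\<lambda>x. w (x, s) - w (x, t)) = (\<lambda>x. (u1 (x, s) - u1 (x, t)) - (u2 (x, s) - u2 (x, t)))" by (simp add: w_def fun_eq_iff)
      moreover have "l2norm D (\<lambda>x. u1 (x, s) - u1 (x, t)) \<le> e / 2" "l2norm D (\<lambda>x. u2 (x, s) - u2 (x, t)) \<le> e / 2"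
        using d1(2) d2(2) s time_intervalI[OF s(1)] by auto
      ultimately show ?thesis
        using l2norm_triangle_minus[OF L2_diff[OF pair_slices(1)[OF pair1 s(1)] pair_slices(1)[OF pair1 t]]
            L2_diff[OF pair_slices(1)[OF pair2 s(1)] pair_slices(1)[OF pair2 t]]] by simp
    qed
    then show "\<exists>d>0. \<forall>s\<in>{0..T}. dist s t < d \<longrightarrow> l2norm D (\<lambda>x. w (x, s) - w (x, t)) \<le> e"
      using d1(1) d2(1) by (intro exI[of _ "min d1 d2"]) auto
  qed
  then show ?thesis by (simp add: dist_real_def)
qed

lemma w_bounded: obtains S where "\<And>t. t \<in> {0..T} \<Longrightarrow> l2norm D (\<lambda>x. w (x, t)) \<le> S"
proof -
  have "continuous_on {0..T} (\<lambda>t. l2norm D (\<lambda>x. w (x, t)))"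
    unfolding continuous_on_iff
  proof (intro ballI allI impI)
    fix t e :: real assume t: "t \<in> {0..T}" and e: "e > 0"
    obtain d where d: "d > 0" "\<forall>s\<in>{0..T}. \<forall>t\<in>{0..T}. \<bar>s - t\<bar> < d \<longrightarrow> l2norm D (\<lambda>x. w (x, s) - w (x, t)) \<le> e / 2"
      using w_continuous[of "e / 2"] e by auto
    have "dist (l2norm D (\<lambda>x. w (x, s))) (l2norm D (\<lambda>x. w (x, t))) < e" if s: "s \<in> {0..T}" "dist s t < d" for s
    proof -
      have "l2norm D (\<lambda>x. w (x, s) - w (x, t)) \<le> e / 2" using d(2) s t by (auto simp: dist_real_def)
      then show ?thesis
        using l2norm_le_diff[OF w_slice[OF s(1)] w_slice[OF t]] l2norm_le_diff[OF w_slice[OF t] w_slice[OF s(1)]]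
          l2norm_minus_commute[of D "\<lambda>x. w (x, s)" "\<lambda>x. w (x, t)"] e by (simp add: dist_real_def abs_less_iff)
    qed
    with d(1) show "\<exists>d>0. \<forall>s\<in>{0..T}. dist s t < d \<longrightarrow> dist (l2norm D (\<lambda>x. w (x, s))) (l2norm D (\<lambda>x. w (x, t))) < e" by blast
  qed
  then have "bounded ((\<lambda>t. l2norm D (\<lambda>x. w (x, t))) ` {0..T})"
    by (intro compact_imp_bounded compact_continuous_image compact_Icc)
  then obtain S where "\<forall>y\<in>(\<lambda>t. l2norm D (\<lambda>x. w (x, t))) ` {0..T}. norm y \<le> S" unfolding bounded_iff by blast
  then show thesis by (intro that[of S]) auto
qed

text \<open>Here the bottom part of the parabolic boundary condition is used: it yields
  \<open>w \<le> 0\<close> at time 0, the initial ordering of \<open>u1\<close> and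
  \<open>u2\<close>.\<close>

lemma p_initial: "AE x in lebesgue_on D. p (x, 0) = 0"
proof (rule initial_trace_zero[OF D T(1) p_slab p_slice, of "\<lambda>z. - g z \<bullet> (0, 1)"])
  have T0: "0 \<in> {0..T}" using T by simp
  have gL: "(\<lambda>z. - g z) \<in> L2 (D \<times> {0..<T})" by (rule L2_uminus[OF g_slab]) auto
  show "(\<lambda>z. - g z \<bullet> (0, 1)) \<in> L2 (D \<times> {0..<T})" by (rule L2_component[OF gL])
  show "\<exists>d>0. \<forall>r\<in>{0..T}. r < d \<longrightarrow> l2norm D (\<lambda>x. p (x, r) - p (x, 0)) \<le> \<epsilon>" if \<epsilon>: "\<epsilon> > 0" for \<epsilon>
  proof -
    obtain d where d: "d > 0" "\<forall>s\<in>{0..T}. \<forall>t\<in>{0..T}. \<bar>s - t\<bar> < d \<longrightarrow> l2norm D (\<lambda>x. w (x, s) - w (x, t)) \<le> \<epsilon>"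
      using w_continuous[OF \<epsilon>] by blast
    have "l2norm D (\<lambda>x. p (x, r) - p (x, 0)) \<le> \<epsilon>" if r: "r \<in> {0..T}" "r < d" for r
    proof -
      have "l2norm D (\<lambda>x. p (x, r) - p (x, 0)) \<le> l2norm D (\<lambda>x. w (x, r) - w (x, 0))"
        by (rule l2norm_mono[OF L2_diff[OF w_slice[OF r(1)] w_slice[OF T0]] L2_measurable[OF L2_diff[OF p_slice[OF r(1)] p_slice[OF T0]]]])
          (auto simp: p_def)
      also have "\<dots> \<le> \<epsilon>" using d(2) r T0 by auto
      finally show ?thesis .
    qed
    with d(1) show ?thesis by blast
  qed
  show "\<exists>\<phi>\<in>test_functions (D \<times> {0<..}). l2norm (D \<times> {0..<T}) (\<lambda>z. \<phi> z - p z) < \<epsilon> \<and>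
      l2norm (D \<times> {0..<T}) (\<lambda>z. grad \<phi> z \<bullet> (0, 1) - - g z \<bullet> (0, 1)) < \<epsilon>" if \<epsilon>: "\<epsilon> > 0" for \<epsilon>
  proof -
    obtain \<phi> where \<phi>: "\<phi> \<in> test_functions (D \<times> {0<..})" "l2norm (D \<times> {0..<T}) (\<lambda>z. \<phi> z - p z) < \<epsilon>"
      "l2norm (D \<times> {0..<T}) (\<lambda>z. grad \<phi> z - (- g z)) < \<epsilon>" by (rule slab_approx[of 0 T, OF _ _ \<epsilon>]) auto
    have e: "(0::'a, 1::real) \<in> Basis" by (simp add: Basis_prod_def)
    have "l2norm (D \<times> {0..<T}) (\<lambda>z. (grad \<phi> z - (- g z)) \<bullet> (0, 1)) < \<epsilon>"
      by (rule le_less_trans[OF l2norm_component_le[OF L2_diff[OF test_function_L2(2)[OF \<phi>(1) slab_lebesgue[OF D]] gL] e] \<phi>(3)])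
    then show ?thesis using \<phi>(1,2) by (intro bexI[of _ \<phi>] conjI) (simp_all add: inner_diff_left inner_add_left)
  qed
qed auto

lemma fst_g_slab: "(\<lambda>z. fst (- g z)) \<in> L2 (D \<times> {s..<t})" if st: "0 \<le> s" "t \<le> T"
proof -
  note gL = L2_uminus[OF g_slab[OF st]]
  show ?thesis
  proof (rule L2_bound[OF gL])
    show "(\<lambda>z. fst (- g z)) \<in> borel_measurable (lebesgue_on (D \<times> {s..<t}))"
      by (rule measurable_compose[OF L2_measurable[OF gL] borel_measurable_fst_snd(1)])
    show "AE z in lebesgue_on (D \<times> {s..<t}). norm (fst (- g z)) \<le> norm (- g z)"
      by (intro AE_I2) (metis norm_fst_le prod.collapse)
  qed
qed

text \<open>Here the lateral part of the parabolic boundary condition is used; approximants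
  supported inside the domain survive integration over any time interval.\<close>

lemma time_int_p_pos_H10:
  assumes st: "0 \<le> s" "s < t" "t \<le> T" and P: "time_int D s t p P" and GP: "time_int D s t (\<lambda>z. fst (- g z)) GP"
  shows "pos_H10 D P GP"
proof (rule time_int_pos_H10[OF D st(2) p_slab[OF st(1,3)] P _ fst_g_slab[OF st(1,3)] GP])
  show "0 \<le> p z" for z by (simp add: p_def)
  note gL = L2_uminus[OF g_slab[OF st(1,3)]]
  fix \<epsilon> :: real assume \<epsilon>: "\<epsilon> > 0"
  obtain \<phi> where \<phi>: "\<phi> \<in> test_functions (D \<times> {0<..})" "l2norm (D \<times> {s..<t}) (\<lambda>z. \<phi> z - p z) < \<epsilon>"
    "l2norm (D \<times> {s..<t}) (\<lambda>z. grad \<phi> z - (- g z)) < \<epsilon>" by (rule slab_approx[OF st(1,3) \<epsilon>]) auto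
  note dL = L2_diff[OF test_function_L2(2)[OF \<phi>(1) slab_lebesgue[OF D]] gL]
  have "l2norm (D \<times> {s..<t}) (\<lambda>z. fst (grad \<phi> z - (- g z))) \<le> l2norm (D \<times> {s..<t}) (\<lambda>z. grad \<phi> z - (- g z))"
  proof (rule l2norm_mono[OF dL])
    show "(\<lambda>z. fst (grad \<phi> z - (- g z))) \<in> borel_measurable (lebesgue_on (D \<times> {s..<t}))"
      by (rule measurable_compose[OF L2_measurable[OF dL] borel_measurable_fst_snd(1)])
    show "AE z in lebesgue_on (D \<times> {s..<t}). norm (fst (grad \<phi> z - (- g z))) \<le> norm (grad \<phi> z - (- g z))"
      by (intro AE_I2) (metis norm_fst_le prod.collapse)
  qed
  also note \<phi>(3)
  finally have "l2norm (D \<times> {s..<t}) (\<lambda>z. fst (grad \<phi> z) - fst (- g z)) < \<epsilon>" by simp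
  moreover have "\<phi> \<in> test_functions (D \<times> UNIV)" by (rule test_functions_mono[OF \<phi>(1)]) auto
  ultimately show "\<exists>\<phi>\<in>test_functions (D \<times> UNIV). l2norm (D \<times> {s..<t}) (\<lambda>z. \<phi> z - p z) < \<epsilon> \<and>
      l2norm (D \<times> {s..<t}) (\<lambda>z. fst (grad \<phi> z) - fst (- g z)) < \<epsilon>"
    using \<phi>(2) by (intro bexI[of _ \<phi>] conjI)
qed

lemma time_int_w_H1_gradient:
  assumes st: "0 \<le> s" "s < t" "t \<le> T" and W: "time_int D s t w W" and GW: "time_int D s t G GW"
  shows "has_H1_gradient D W GW"
proof (rule time_int_H1_gradient[OF D less_imp_le[OF st(2)] w_slab[OF st(1,3)] W G_slab[OF st(1,3)] GW])
  have "AE \<tau> in lebesgue_on {s..t}. has_H1_gradient D (\<lambda>x. u (x, \<tau>)) (\<lambda>x. H (x, \<tau>))"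
    if "enthalpy_pair D Tstar uM u \<mu> H" for u \<mu> H
  proof -
    have "AE \<tau> in lebesgue_on (time_interval Tstar). has_H1_gradient D (\<lambda>x. u (x, \<tau>)) (\<lambda>x. H (x, \<tau>))"
      using that by (simp add: enthalpy_pair_def has_L2loc_H1_gradient_def)
    moreover have "time_interval Tstar \<inter> space lebesgue \<in> sets lebesgue"
    proof -
      have "time_interval Tstar = {0..} \<inter> ereal -` {..<Tstar}" by (auto simp: time_interval_def)
      then have "time_interval Tstar \<in> sets borel" by simp
      then show ?thesis by (simp add: sets_completionI_sets)
    qed
    ultimately have "AE \<tau> in lebesgue. \<tau> \<in> time_interval Tstar \<longrightarrow> has_H1_gradient D (\<lambda>x. u (x, \<tau>)) (\<lambda>x. H (x, \<tau>))"
      by (simp add: AE_restrict_space_iff)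
    then have "AE \<tau> in lebesgue. \<tau> \<in> {s..t} \<longrightarrow> has_H1_gradient D (\<lambda>x. u (x, \<tau>)) (\<lambda>x. H (x, \<tau>))"
    proof eventually_elim
      case (elim \<tau>) then show ?case using time_intervalI[of \<tau>] st by auto
    qed
    then show ?thesis by (simp add: AE_restrict_space_iff)
  qed
  from this[OF pair1] this[OF pair2]
  show "AE \<tau> in lebesgue_on {s..t}. has_H1_gradient D (\<lambda>x. w (x, \<tau>)) (\<lambda>x. G (x, \<tau>))"
  proof eventually_elim
    case (elim \<tau>) then show ?case unfolding w_def G_def by (rule has_H1_gradient_diff[OF D])
  qed
qed

lemma increment_le:
  assumes st: "0 \<le> s" "s < t" "t \<le> T" and \<phi>: "\<phi> \<in> pos_tests D" and GW: "time_int D s t G GW"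
  shows "(\<integral>x. (w (x, t) + m (x, t)) * \<phi> x \<partial>lebesgue_on D) - (\<integral>x. (w (x, s) + m (x, s)) * \<phi> x \<partial>lebesgue_on D)
    + (\<integral>x. GW x \<bullet> grad \<phi> x \<partial>lebesgue_on D) \<le> 0"
proof -
  note \<phi>t = pos_tests_test[OF \<phi>]
  note gL = test_function_L2(2)[OF \<phi>t Dm]
  have tT: "t \<in> {0..T}" "s \<in> {0..T}" using st by auto
  have tle: "ereal t < Tstar" using time_intervalI[OF tT(1)] by (simp add: time_interval_def)
  obtain \<eta> where \<eta>: "\<eta> \<in> test_functions (D \<times> UNIV)" "\<And>z. 0 \<le> \<eta> z"
    and inc: "\<And>u \<mu>. enthalpy_increment D u \<mu> \<eta> s t
      = (\<integral>x. (u (x, t) + \<mu> (x, t)) * \<phi> x \<partial>lebesgue_on D) - (\<integral>x. (u (x, s) + \<mu> (x, s)) * \<phi> x \<partial>lebesgue_on D)"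
    and flux: "\<And>F u \<mu> H. F \<in> L2 D \<Longrightarrow> H \<in> L2 (D \<times> {s..<t}) \<Longrightarrow> enthalpy_flux D F u \<mu> H \<eta> s t
      = - (\<integral>z. H z \<bullet> grad \<phi> (fst z) \<partial>lebesgue_on (D \<times> {s..<t})) - (\<integral>z. F (fst z) \<bullet> grad \<phi> (fst z) \<partial>lebesgue_on (D \<times> {s..<t}))"
    by (rule enthalpy_stationary_test[OF D st(1,2) \<phi>]) blast
  have GL: "G1 \<in> L2 (D \<times> {s..<t})" "G2 \<in> L2 (D \<times> {s..<t})"
    by (rule L2_subset(1)[OF _ slab_subset[OF st(1,3)] slab_lebesgue[OF D] slab_lebesgue[OF D]],
        rule pair_L2(2)[OF pair1] pair_L2(2)[OF pair2])+
  note i = slab_inner_integrable[OF D less_imp_le[OF st(2)] _ gL]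
  have "(\<integral>z. G z \<bullet> grad \<phi> (fst z) \<partial>lebesgue_on (D \<times> {s..<t}))
    = (\<integral>z. G1 z \<bullet> grad \<phi> (fst z) \<partial>lebesgue_on (D \<times> {s..<t})) - (\<integral>z. G2 z \<bullet> grad \<phi> (fst z) \<partial>lebesgue_on (D \<times> {s..<t}))"
    using i[OF GL(1)] i[OF GL(2)] by (simp add: G_def inner_diff_left)
  then have GWe: "(\<integral>x. GW x \<bullet> grad \<phi> x \<partial>lebesgue_on D)
    = (\<integral>z. G1 z \<bullet> grad \<phi> (fst z) \<partial>lebesgue_on (D \<times> {s..<t})) - (\<integral>z. G2 z \<bullet> grad \<phi> (fst z) \<partial>lebesgue_on (D \<times> {s..<t}))"
    using time_int_eq[OF GW gL] by simp
  have split: "(\<integral>x. (w (x, r) + m (x, r)) * \<phi> x \<partial>lebesgue_on D)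
    = (\<integral>x. (u1 (x, r) + \<mu>1 (x, r)) * \<phi> x \<partial>lebesgue_on D) - (\<integral>x. (u2 (x, r) + \<mu>2 (x, r)) * \<phi> x \<partial>lebesgue_on D)" if r: "r \<in> {0..T}" for r
  proof -
    have "(w (x, r) + m (x, r)) * \<phi> x = (u1 (x, r) + \<mu>1 (x, r)) * \<phi> x - (u2 (x, r) + \<mu>2 (x, r)) * \<phi> x" for x
      by (simp add: w_def m_def algebra_simps)
    then show ?thesis
      using Bochner_Integration.integral_diff[OF pair_test_integrable[OF pair1 r \<phi>t] pair_test_integrable[OF pair2 r \<phi>t]] by simp
  qed
  have 1: "enthalpy_increment D u1 \<mu>1 \<eta> s t \<le> enthalpy_flux D F u1 \<mu>1 G1 \<eta> s t"
    by (rule sub[OF st(1) less_imp_le[OF st(2)] tle \<eta>])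
  have 2: "enthalpy_flux D F u2 \<mu>2 G2 \<eta> s t \<le> enthalpy_increment D u2 \<mu>2 \<eta> s t"
    by (rule super[OF st(1) less_imp_le[OF st(2)] tle \<eta>])
  show ?thesis
    using 1 2 unfolding inc flux[OF F GL(1)] flux[OF F GL(2)] split[OF tT(1)] split[OF tT(2)] GWe by linarith
qed

text \<open>The squared norm is additive over adjacent time intervals, the norm is not. The estimate
  of a time integral by \<open>sqrt (t - s)\<close> times the slab norm is therefore weakened to
  \<open>(t - s)\<close> plus the increment of \<Gamma>.\<close>

definition \<Gamma> :: "real \<Rightarrow> real" where "\<Gamma> t = (l2norm (D \<times> {0..<t}) G)\<^sup>2"

text \<open>The time integral of \<open>w\<close> is split into those of its positive and negative part. The average of \<open>w\<^sup>+\<close>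
  belongs to \<open>H\<^sup>1\<^sub>0(D)\<close> even though \<open>w\<close> itself has no boundary values.\<close>

lemma comparison_data:
  assumes st: "0 \<le> s" "s < t" "t \<le> T"
  shows "\<exists>P GP Z GZ. pos_H10 D P GP \<and> has_H1_gradient D Z GZ \<and> (\<forall>x\<in>D. 0 \<le> Z x) \<and>
      (\<forall>\<phi>\<in>pos_tests D. (\<integral>x. (w (x, t) + m (x, t)) * \<phi> x \<partial>lebesgue_on D) - (\<integral>x. (w (x, s) + m (x, s)) * \<phi> x \<partial>lebesgue_on D)
          + (\<integral>x. (GP x - GZ x) \<bullet> grad \<phi> x \<partial>lebesgue_on D) \<le> 0) \<and>
      (\<forall>\<epsilon>. (\<forall>r\<in>{s..t}. l2norm D (\<lambda>x. w (x, r) - w (x, t)) \<le> \<epsilon>) \<longrightarrow> l2norm D (\<lambda>x. (P x - Z x) / (t - s) - w (x, t)) \<le> \<epsilon>) \<and>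
      l2norm D (\<lambda>x. GP x - GZ x) \<le> (t - s) + (\<Gamma> t - \<Gamma> s)"
proof -
  note wL = w_slab[OF st(1,3)] and pL = p_slab[OF st(1,3)] and GL = G_slab[OF st(1,3)] and gL = fst_g_slab[OF st(1,3)]
  have tT: "t \<in> {0..T}" using st by auto
  obtain P where P: "time_int D s t p P" by (rule time_int_exists[OF D st(2) pL])
  obtain W where W: "time_int D s t w W" by (rule time_int_exists[OF D st(2) wL])
  obtain GP where GP: "time_int D s t (\<lambda>z. fst (- g z)) GP" by (rule time_int_exists[OF D st(2) gL])
  obtain GW where GW: "time_int D s t G GW" by (rule time_int_exists[OF D st(2) GL])
  note PH = time_int_p_pos_H10[OF st P GP]
  note Z0 = has_H1_gradient_diff[OF D pos_H10_H1_gradient[OF D PH] time_int_w_H1_gradient[OF st W GW]]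
  have "AE x in lebesgue_on D. 0 \<le> P x - W x"
    by (rule time_int_nonneg[OF D time_int_diff[OF D less_imp_le[OF st(2)] pL P wL W]]) (simp add: p_def)
  then have ae: "AE x in lebesgue_on D. max (P x - W x) 0 = P x - W x" by eventually_elim simp
  \<comment> \<open>The difference \<open>P - W\<close> is nonnegative only almost everywhere; its
    positive part is the representative that is nonnegative on all of \<open>D\<close>.\<close>
  have Zm: "(\<lambda>x. max (P x - W x) 0) \<in> borel_measurable (lebesgue_on D)"
    by (intro borel_measurable_max L2_measurable[OF has_H1_gradient_L2(1)[OF Z0]] borel_measurable_const)
  note Z = has_H1_gradient_cong_AE[OF D Z0 Zm ae]
  have GE: "GP x - (GP x - GW x) = GW x" for x by simp
  have avg: "l2norm D (\<lambda>x. (P x - max (P x - W x) 0) / (t - s) - w (x, t)) \<le> \<epsilon>"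
    if e: "\<forall>r\<in>{s..t}. l2norm D (\<lambda>x. w (x, r) - w (x, t)) \<le> \<epsilon>" for \<epsilon>
  proof -
    have sl: "(\<lambda>x. w (x, r)) \<in> L2 D" if "r \<in> {s..t}" for r using that st by (intro w_slice) auto
    have close: "l2norm D (\<lambda>x. W x / (t - s) - w (x, t)) \<le> \<epsilon>"
      by (rule time_int_average_close[OF D st(2) wL W sl w_slice[OF tT]]) (use e in auto)
    have L: "(\<lambda>x. W x / (t - s) - w (x, t)) \<in> L2 D"
      using L2_diff[OF L2_cmult[OF time_int_L2[OF W], of "1 / (t - s)"] w_slice[OF tT]] by simp
    have "l2norm D (\<lambda>x. (P x - max (P x - W x) 0) / (t - s) - w (x, t)) \<le> l2norm D (\<lambda>x. W x / (t - s) - w (x, t))"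
    proof (rule l2norm_mono[OF L])
      show "(\<lambda>x. (P x - max (P x - W x) 0) / (t - s) - w (x, t)) \<in> borel_measurable (lebesgue_on D)"
        by (intro borel_measurable_diff borel_measurable_divide borel_measurable_const
            L2_measurable[OF time_int_L2[OF P]] Zm L2_measurable[OF w_slice[OF tT]])
      show "AE x in lebesgue_on D. norm ((P x - max (P x - W x) 0) / (t - s) - w (x, t)) \<le> norm (W x / (t - s) - w (x, t))"
        using ae by eventually_elim simp
    qed
    with close show ?thesis by linarith
  qed
  have "l2norm D GW \<le> sqrt (t - s) * l2norm (D \<times> {s..<t}) G"
    by (rule time_int_norm[OF D less_imp_le[OF st(2)] GL GW])
  also have "\<dots> \<le> (sqrt (t - s))\<^sup>2 + (l2norm (D \<times> {s..<t}) G)\<^sup>2"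
  proof -
    have "0 \<le> (sqrt (t - s) - l2norm (D \<times> {s..<t}) G)\<^sup>2" "0 \<le> sqrt (t - s) * l2norm (D \<times> {s..<t}) G"
      using st by (auto intro!: mult_nonneg_nonneg)
    then show ?thesis by (simp add: power2_diff)
  qed
  also have "(sqrt (t - s))\<^sup>2 = t - s" using st by simp
  also have "(l2norm (D \<times> {s..<t}) G)\<^sup>2 = \<Gamma> t - \<Gamma> s"
    unfolding \<Gamma>_def by (rule slab_sq_additive[OF D st(1) less_imp_le[OF st(2)] G_slab]) (use st in auto)
  finally have bd: "l2norm D GW \<le> (t - s) + (\<Gamma> t - \<Gamma> s)" .
  show ?thesis
    by (intro exI[of _ P] exI[of _ GP] exI[of _ "\<lambda>x. max (P x - W x) 0"] exI[of _ "\<lambda>x. GP x - GW x"] conjI PH Z)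
      (use increment_le[OF st _ GW] avg bd in \<open>simp_all only: GE, auto\<close>)
qed

text \<open>The sign relation is the monotonicity of the enthalpy graph: if \<open>u1 > u2\<close>,
  then \<open>u1 > uM\<close>, so that \<mu>1 is the maximal value 1, or \<open>u2 < uM\<close>, so
  that \<mu>2 is the minimal value -1; the case \<open>u1 < u2\<close> is symmetric.\<close>

lemma m_slice:
  assumes t: "t \<in> {0..T}"
  shows "(\<lambda>x. m (x, t)) \<in> borel_measurable (lebesgue_on D)" "AE x in lebesgue_on D. \<bar>m (x, t)\<bar> \<le> 2"
    "AE x in lebesgue_on D. (0 < w (x, t) \<longrightarrow> 0 \<le> m (x, t)) \<and> (w (x, t) < 0 \<longrightarrow> m (x, t) \<le> 0)"
proof -
  note s1 = pair_slices[OF pair1 t] and s2 = pair_slices[OF pair2 t]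
  show "(\<lambda>x. m (x, t)) \<in> borel_measurable (lebesgue_on D)"
    unfolding m_def by (intro borel_measurable_diff s1(2) s2(2))
  show "AE x in lebesgue_on D. \<bar>m (x, t)\<bar> \<le> 2" using s1(3) s2(3) by eventually_elim (auto simp: m_def)
  show "AE x in lebesgue_on D. (0 < w (x, t) \<longrightarrow> 0 \<le> m (x, t)) \<and> (w (x, t) < 0 \<longrightarrow> m (x, t) \<le> 0)"
    using s1(3,4) s2(3,4)
  proof eventually_elim
    case (elim x)
    consider "u1 (x, t) > uM x" | "u1 (x, t) < uM x" | "u1 (x, t) = uM x" by linarith
    then show ?case
      using elim by cases (auto simp: w_def m_def abs_le_iff not_less)
  qed
qed

lemma test_integral_nonpos:
  assumes f: "f \<in> pos_tests D"
  shows "(\<integral>x. (w (x, T) + m (x, T)) * f x \<partial>lebesgue_on D) \<le> 0"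
proof -
  obtain S where S: "\<And>t. t \<in> {0..T} \<Longrightarrow> l2norm D (\<lambda>x. w (x, t)) \<le> S" using w_bounded by blast
  \<comment> \<open>The ordering of \<open>u1\<close> and \<open>u2\<close> at time 0 comes from the
    boundary condition, that of \<mu>1 and \<mu>2 is assumed.\<close>
  have "AE x in lebesgue_on D. w (x, 0) + m (x, 0) \<le> 0"
    using p_initial init by eventually_elim (auto simp: p_def m_def max_def split: if_splits)
  from duality_comparison[OF D T(1) f, of "\<lambda>t x. w (x, t)" S "\<lambda>t x. m (x, t)" \<Gamma>,
      OF w_slice S w_continuous m_slice this comparison_data]
  show ?thesis by simp
qed

lemma comparison_at_T: "AE x in lebesgue_on D. u1 (x, T) \<le> u2 (x, T) \<and> \<mu>1 (x, T) \<le> \<mu>2 (x, T)"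
proof -
  have TT: "T \<in> {0..T}" using T by simp
  have "AE x in lebesgue_on D. w (x, T) + m (x, T) \<le> 0"
  proof (rule AE_nonpos_if_tests_nonpos[OF D _ _ test_integral_nonpos])
    show "(\<lambda>x. w (x, T) + m (x, T)) \<in> borel_measurable (lebesgue_on D)"
      by (intro borel_measurable_add L2_measurable[OF w_slice[OF TT]] m_slice(1)[OF TT])
    fix \<xi> :: "'a \<Rightarrow> real" assume \<xi>: "\<xi> \<in> test_functions UNIV"
    obtain B where B: "B > 0" "\<And>x. \<bar>\<xi> x\<bar> \<le> B" using test_function_bounded[OF \<xi>] by metis
    note \<xi>L = test_function_L2(1)[OF \<xi> Dm]
    have "(\<lambda>x. \<xi> x *\<^sub>R w (x, T)) \<in> L2 D"
      by (rule l2norm_mult_le(1)[OF w_slice[OF TT] L2_measurable[OF \<xi>L] B(2) less_imp_le[OF B(1)]])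
    moreover have "(\<lambda>x. m (x, T) *\<^sub>R \<xi> x) \<in> L2 D"
      by (rule L2_mult_bounded(1)[OF \<xi>L m_slice(1,2)[OF TT]])
    ultimately show "(\<lambda>x. \<xi> x * (w (x, T) + m (x, T))) \<in> L2 D"
      using L2_add by (fastforce simp: distrib_left mult.commute)
  qed
  with m_slice(3)[OF TT] show ?thesis
  proof eventually_elim
    \<comment> \<open>If \<open>w > 0\<close> then \<open>m \<ge> 0\<close>, which contradicts
      \<open>w + m \<le> 0\<close>; if \<open>w < 0\<close> then \<open>m \<le> 0\<close> by the
      sign relation; if \<open>w = 0\<close> the sum is \<open>m\<close>.\<close>
    case (elim x) then show ?case by (cases "w (x, T)" "0 :: real" rule: linorder_cases) (auto simp: w_def m_def)
  qed
qed

end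

theorem theorem1p14:
  fixes D :: "(real ^ 'd) set" and Tstar :: ereal
    and uM :: "real ^ 'd \<Rightarrow> real" and F :: "real ^ 'd \<Rightarrow> real ^ 'd"
    and u1 \<mu>1 u2 \<mu>2 :: "(real ^ 'd) \<times> real \<Rightarrow> real"
  assumes "0 < Tstar" and "open D"
    and "uM \<in> borel_measurable (lebesgue_on D)"
    and "F \<in> L2 D"
    and "dirichlet_enthalpy_subsolution D Tstar uM F u1 \<mu>1"
    and "dirichlet_enthalpy_supersolution D Tstar uM F u2 \<mu>2"
    and "(\<lambda>z. min (u2 z - u1 z) 0) \<in> H1_0P D Tstar"
    and "AE x in lebesgue_on D. \<mu>1 (x, 0) \<le> \<mu>2 (x, 0)"
  shows "\<forall>T. 0 < T \<and> ereal T < Tstar \<longrightarrow>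
    (AE x in lebesgue_on D. u1 (x, T) \<le> u2 (x, T) \<and> \<mu>1 (x, T) \<le> \<mu>2 (x, T))"
proof (intro allI impI)
  fix T :: real assume T: "0 < T \<and> ereal T < Tstar"
  obtain G1 where G1: "enthalpy_pair D Tstar uM u1 \<mu>1 G1"
    "\<And>t1 t2 \<eta>. 0 \<le> t1 \<and> t1 \<le> t2 \<and> ereal t2 < Tstar \<and> \<eta> \<in> test_functions (D \<times> UNIV) \<and> (\<forall>z. 0 \<le> \<eta> z) \<Longrightarrow>
      enthalpy_increment D u1 \<mu>1 \<eta> t1 t2 \<le> enthalpy_flux D F u1 \<mu>1 G1 \<eta> t1 t2"
    using assms(5) unfolding dirichlet_enthalpy_subsolution_def by blast
  obtain G2 where G2: "enthalpy_pair D Tstar uM u2 \<mu>2 G2"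
    "\<And>t1 t2 \<eta>. 0 \<le> t1 \<and> t1 \<le> t2 \<and> ereal t2 < Tstar \<and> \<eta> \<in> test_functions (D \<times> UNIV) \<and> (\<forall>z. 0 \<le> \<eta> z) \<Longrightarrow>
      enthalpy_increment D u2 \<mu>2 \<eta> t1 t2 \<ge> enthalpy_flux D F u2 \<mu>2 G2 \<eta> t1 t2"
    using assms(6) unfolding dirichlet_enthalpy_supersolution_def by blast
  obtain g where g: "has_H1_gradient (cyl D Tstar) (\<lambda>z. min (u2 z - u1 z) 0) g"
    "\<And>\<epsilon>. \<epsilon> > 0 \<Longrightarrow> \<exists>\<phi>\<in>test_functions (D \<times> {0<..}).
        (\<integral>z. (min (u2 z - u1 z) 0 - \<phi> z)\<^sup>2 \<partial>lebesgue_on (cyl D Tstar))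
        + (\<integral>z. (norm (g z - grad \<phi> z))\<^sup>2 \<partial>lebesgue_on (cyl D Tstar)) < \<epsilon>\<^sup>2"
    using assms(7) unfolding H1_0P_def by blast
  interpret enthalpy_comparison D Tstar uM F u1 \<mu>1 u2 \<mu>2 G1 G2 g T
    by unfold_locales (use assms(2,4,8) T G1 G2 g in \<open>auto\<close>)
  show "AE x in lebesgue_on D. u1 (x, T) \<le> u2 (x, T) \<and> \<mu>1 (x, T) \<le> \<mu>2 (x, T)" by (rule comparison_at_T)
qed

end
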